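(* Let $N\ge 2$, let $\Omega\subset\mathbb{R}^N$ be a bounded domain with boundary $\partial\Omega$ of class $C^{1,1}$, and let $A(x)$ be a symmetric $N\times N$ matrix of functions satisfying assumptions (a), (b) of the context. Let $f\in C(\partial\Omega)$ be non-negative and not identically zero, and set $$\mathcal{S}=\{x\in\partial\Omega: f(x)>0\}.$$ Let $u=u(x,t)$ be the solution of $$u_t-\operatorname{tr}[A(x)\nabla^2u]=0\ \text{ in }\Omega\times(0,\infty),\quad u=0\ \text{ on }\Omega\times\{0\},\quad u=f\ \text{ on }\partial\Omega\times(0,\infty),$$ and, for each $\varepsilon>0$, let $U_\varepsilon$ be the solution of $$\varepsilon^2\operatorname{tr}[A(x)\nabla^2U_\varepsilon]-U_\varepsilon=0\ \text{ in }\Omega,\quad U_\varepsilon=f\ \text{ on }\partial\Omega.$$ Then, for every $x\in\Omega\cup\mathcal{S}$, $$\lim_{t\to0^+}\bigl[-4t\log u(x,t)\bigr]=d_{\mathcal{S}}(x)^2\qquad\text{and}\qquad \lim_{\varepsilon\to0^+}\bigl[-\varepsilon\log U_\varepsilon(x)\bigr]=d_{\mathcal{S}}(x).$$ Moreover, both limits hold uniformly on compact subsets of $\Omega\cup\mathcal{S}$.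
   Context: Assumptions on $A$: (a) $A$ is differentiable and locally Lipschitz continuous in $\mathbb{R}^N$ and, for every compact set $K$, there is a constant $L_K>0$ with $|A(x)|,|\nabla A(x)|\le L_K$ for $x\in K$; (b) there is $\lambda>0$ such that $\langle A(x)\xi,\xi\rangle\ge\lambda|\xi|^2$ for all $x,\xi\in\mathbb{R}^N$. Solutions are bounded classical solutions attaining the data continuously (for the parabolic problem, continuously on $\overline{\Omega}\times[0,\infty)$ except on $\partial\Omega\times\{0\}$). $\nabla^2$ denotes the Hessian matrix and $\operatorname{tr}$ the trace. Distance $d_{\mathcal{S}}$: for a path $\gamma$ and $w\in\mathbb{R}^N$ let $|w|_A=\sqrt{\langle A^{-1}(\gamma(t))w,w\rangle}$ at the point $\gamma(t)$. For $x\in\overline{\Omega}$ and $\gamma\in H^1_{loc}([0,\infty);\mathbb{R}^N)$ with $\gamma(0)=x$, let $T_x=\inf\{\tau>0:\gamma(\tau)\in\mathbb{R}^N\setminus\Omega\}$ ($+\infty$ if the set is empty). For $\mathcal{S}\subseteq\partial\Omega$, $$d_{\mathcal{S}}(x)=\inf\Bigl\{\int_0^{T_x}|\gamma'(t)|_A\,dt:\ \gamma(0)=x,\ T_x<\infty,\ \gamma(T_x)\in\mathcal{S}\Bigr\}.$$ *)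

theory Defs
  imports "HOL-Analysis.Analysis"
begin

definition coefficients_locally_bounded :: "(real^'n \<Rightarrow> real^'n^'n) \<Rightarrow> bool" where
  "coefficients_locally_bounded A \<longleftrightarrow>
     (\<forall>x. A differentiable (at x)) \<and>
     (\<forall>x. \<exists>r>0. \<exists>L. L-lipschitz_on (ball x r) A) \<and>
     (\<forall>K. compact K \<longrightarrow> (\<exists>L>0. \<forall>x\<in>K.
        norm (A x) \<le> L \<and> onorm (frechet_derivative A (at x)) \<le> L))"

definition uniformly_elliptic :: "(real^'n \<Rightarrow> real^'n^'n) \<Rightarrow> bool" where
  "uniformly_elliptic A \<longleftrightarrow>
     (\<exists>c>0. \<forall>x \<xi>. (A x *v \<xi>) \<bullet> \<xi> \<ge> c * (norm \<xi>)\<^sup>2)"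

definition bounded_domain :: "(real^'n) set \<Rightarrow> bool" where
  "bounded_domain \<Omega> \<longleftrightarrow> open \<Omega> \<and> connected \<Omega> \<and> \<Omega> \<noteq> {} \<and> bounded \<Omega>"

definition C11_function :: "(real^'n \<Rightarrow> real) \<Rightarrow> bool" where
  "C11_function g \<longleftrightarrow>
     (\<exists>g'. (\<forall>y. GDERIV g y :> g' y) \<and> (\<exists>L. L-lipschitz_on UNIV g'))"

text \<open>
  Near each boundary point, the set lies on one side of the graph of a \<open>C\<^sup>1\<^sup>,\<^sup>1\<close> function of
  \<open>N - 1\<close> variables, in some orthonormal coordinate system. The unit vector \<open>e\<close> is the last
  coordinate direction. The function \<open>g\<close> is evaluated only at projections onto the hyperplane
  orthogonal to \<open>e\<close>; functions on that hyperplane extend to the whole space by composing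
  with the projection, so having \<open>g\<close> defined everywhere is no restriction.
\<close>

definition C11_boundary :: "(real^'n) set \<Rightarrow> bool" where
  "C11_boundary \<Omega> \<longleftrightarrow>
     (\<forall>p \<in> frontier \<Omega>. \<exists>r>0. \<exists>e g. norm e = 1 \<and> C11_function g \<and>
        \<Omega> \<inter> ball p r = {y \<in> ball p r. y \<bullet> e > g (y - (y \<bullet> e) *\<^sub>R e)})"

definition gradient :: "(real^'n \<Rightarrow> real) \<Rightarrow> real^'n \<Rightarrow> real^'n" where
  "gradient v x = (\<chi> i. frechet_derivative v (at x) (axis i 1))"

definition hessian :: "(real^'n \<Rightarrow> real) \<Rightarrow> real^'n \<Rightarrow> real^'n^'n" where
  "hessian v x = matrix (frechet_derivative (gradient v) (at x))"

definition twice_differentiable_on :: "(real^'n \<Rightarrow> real) \<Rightarrow> (real^'n) set \<Rightarrow> bool" where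
  "twice_differentiable_on v \<Omega> \<longleftrightarrow>
     (\<forall>x\<in>\<Omega>. v differentiable (at x) \<and> gradient v differentiable (at x))"

definition C2_on :: "(real^'n \<Rightarrow> real) \<Rightarrow> (real^'n) set \<Rightarrow> bool" where
  "C2_on v \<Omega> \<longleftrightarrow> twice_differentiable_on v \<Omega> \<and> continuous_on \<Omega> (hessian v)"

definition C21_on :: "(real^'n \<Rightarrow> real \<Rightarrow> real) \<Rightarrow> (real^'n) set \<Rightarrow> real set \<Rightarrow> bool" where
  "C21_on u \<Omega> I \<longleftrightarrow>
     (\<forall>t\<in>I. twice_differentiable_on (\<lambda>x. u x t) \<Omega>) \<and>
     (\<forall>x\<in>\<Omega>. \<forall>t\<in>I. u x differentiable (at t)) \<and>
     continuous_on (\<Omega> \<times> I) (\<lambda>(x, t). u x t) \<and>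
     continuous_on (\<Omega> \<times> I) (\<lambda>(x, t). gradient (\<lambda>y. u y t) x) \<and>
     continuous_on (\<Omega> \<times> I) (\<lambda>(x, t). hessian (\<lambda>y. u y t) x) \<and>
     continuous_on (\<Omega> \<times> I) (\<lambda>(x, t). deriv (u x) t)"

definition parabolic_solution ::
  "(real^'n \<Rightarrow> real^'n^'n) \<Rightarrow> (real^'n) set \<Rightarrow> (real^'n \<Rightarrow> real) \<Rightarrow> (real^'n \<Rightarrow> real \<Rightarrow> real) \<Rightarrow> bool"
  where
  "parabolic_solution A \<Omega> f u \<longleftrightarrow>
     C21_on u \<Omega> {0<..} \<and>
     continuous_on (closure \<Omega> \<times> {0..} - frontier \<Omega> \<times> {0}) (\<lambda>(x, t). u x t) \<and>
     bounded ((\<lambda>(x, t). u x t) ` (closure \<Omega> \<times> {0..} - frontier \<Omega> \<times> {0})) \<and>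
     (\<forall>x\<in>\<Omega>. \<forall>t>0. deriv (u x) t - trace (A x ** hessian (\<lambda>y. u y t) x) = 0) \<and>
     (\<forall>x\<in>\<Omega>. u x 0 = 0) \<and>
     (\<forall>x\<in>frontier \<Omega>. \<forall>t>0. u x t = f x)"

definition elliptic_solution ::
  "(real^'n \<Rightarrow> real^'n^'n) \<Rightarrow> (real^'n) set \<Rightarrow> (real^'n \<Rightarrow> real) \<Rightarrow> real \<Rightarrow> (real^'n \<Rightarrow> real) \<Rightarrow> bool"
  where
  "elliptic_solution A \<Omega> f \<epsilon> U \<longleftrightarrow>
     C2_on U \<Omega> \<and>
     continuous_on (closure \<Omega>) U \<and>
     bounded (U ` closure \<Omega>) \<and>
     (\<forall>x\<in>\<Omega>. \<epsilon>\<^sup>2 * trace (A x ** hessian U x) - U x = 0) \<and>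
     (\<forall>x\<in>frontier \<Omega>. U x = f x)"

text \<open>Compactly supported \<open>C\<^sup>1\<close> functions on \<open>(0, \<infinity>)\<close>, extended by zero to the real line.\<close>

definition test_function :: "(real \<Rightarrow> real) \<Rightarrow> bool" where
  "test_function \<phi> \<longleftrightarrow>
     (\<forall>t. \<phi> differentiable (at t)) \<and> continuous_on UNIV (deriv \<phi>) \<and>
     (\<exists>a b. 0 < a \<and> (\<forall>t. \<phi> t \<noteq> 0 \<longrightarrow> t \<in> {a..b}))"

text \<open>
  \<open>\<gamma>\<close> is the continuous representative of an element of \<open>H\<^sup>1\<^sub>l\<^sub>o\<^sub>c([0, \<infinity>); \<real>\<^sup>N)\<close> and
  \<open>\<gamma>'\<close> is its weak derivative. Local square integrability of \<open>\<gamma>\<close> itself follows from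
  continuity; only the values on \<open>[0, \<infinity>)\<close> matter.
\<close>

definition H1_loc_path :: "(real \<Rightarrow> real^'n) \<Rightarrow> (real \<Rightarrow> real^'n) \<Rightarrow> bool" where
  "H1_loc_path \<gamma> \<gamma>' \<longleftrightarrow>
     continuous_on {0..} \<gamma> \<and>
     set_borel_measurable lborel {0..} \<gamma>' \<and>
     (\<forall>T>0. set_integrable lborel {0..T} (\<lambda>t. (norm (\<gamma>' t))\<^sup>2)) \<and>
     (\<forall>\<phi>. test_function \<phi> \<longrightarrow>
        (LINT t:{0<..}|lborel. deriv \<phi> t *\<^sub>R \<gamma> t) = - (LINT t:{0<..}|lborel. \<phi> t *\<^sub>R \<gamma>' t))"

definition norm_A :: "(real^'n \<Rightarrow> real^'n^'n) \<Rightarrow> real^'n \<Rightarrow> real^'n \<Rightarrow> real" where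
  "norm_A A y w = sqrt ((matrix_inv (A y) *v w) \<bullet> w)"

definition exit_time :: "(real^'n) set \<Rightarrow> (real \<Rightarrow> real^'n) \<Rightarrow> ereal" where
  "exit_time \<Omega> \<gamma> = Inf (ereal ` {\<tau>. \<tau> > 0 \<and> \<gamma> \<tau> \<notin> \<Omega>})"

text \<open>
  The real variable \<open>T\<close> with \<open>ereal T = exit_time \<Omega> \<gamma>\<close> expresses that the exit time is finite.
  The infimum is a real one, so it is meaningful only at points from which an admissible path
  exists. When \<open>\<Omega>\<close> is a bounded domain with \<open>C\<^sup>1\<^sup>,\<^sup>1\<close> boundary and \<open>S\<close> is a nonempty subset of
  its boundary, this is the case at every point of the closure of \<open>\<Omega>\<close>.
\<close>

definition dist_S ::
  "(real^'n \<Rightarrow> real^'n^'n) \<Rightarrow> (real^'n) set \<Rightarrow> (real^'n) set \<Rightarrow> real^'n \<Rightarrow> real" where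
  "dist_S A \<Omega> S x = Inf {LINT t:{0..T}|lborel. norm_A A (\<gamma> t) (\<gamma>' t) | \<gamma> \<gamma>' T.
     H1_loc_path \<gamma> \<gamma>' \<and> \<gamma> 0 = x \<and> ereal T = exit_time \<Omega> \<gamma> \<and> \<gamma> T \<in> S}"

end

theory Submission
  imports Defs
begin

text \<open>
  Let \<open>\<phi>\<close> be the distance from \<open>x\<close> in the metric frozen at \<open>x\<close>. For small \<open>\<epsilon>\<close> the functions
  \<open>exp ((1 - \<delta>) \<phi> / \<epsilon>)\<close> and \<open>exp (- (1 + \<delta>) \<phi> / \<epsilon>)\<close>, smoothed at \<open>x\<close>, are an upper
  and a lower barrier for the elliptic equation on a small ball. The upper barrier gives decay by
  the factor \<open>exp (- (1 - \<delta>) r / \<epsilon>)\<close> per step of length \<open>r\<close>; as many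
  steps are available as are needed to reach \<open>S\<close> by a chain in the closed domain, and chains are
  turned into admissible paths by a vector field pointing into the domain. The lower barrier
  propagates lower bounds for \<open>U\<close> along any admissible path. Together they give the elliptic
  limit, locally uniformly.

  The parabolic limit follows from comparing \<open>u\<close> with the solutions \<open>exp (t / \<epsilon>\<^sup>2) U \<epsilon> x\<close> of the
  same equation: the bound \<open>u \<le> exp (t / \<epsilon>\<^sup>2) U \<epsilon>\<close> is optimal at \<open>\<epsilon> = 2 t / d x\<close>, and a
  combination of three of these solutions with parameters close to \<open>2 t / d x\<close> bounds \<open>u\<close> from below.
\<close>

section \<open>Positive semidefinite forms\<close>

text \<open>Freezing the metric makes the barriers explicit, so no regularity of the distance has to
  be known in advance; its continuity in the interior comes out of the estimates, because an upper
  and a lower rate of the same solution can be compared (\<open>d_le_lower_rate\<close>). Two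
  mismatches shape the elliptic part. The decay estimate sees only values on the closed domain and
  hence measures jumps between points of the closure, whereas the distance admits only paths that
  stay inside until they exit: the inward field bridges this gap. Conversely, an admissible path is
  only weakly differentiable, and its increments must be recovered from test functions before the
  metric can be frozen along it. In the parabolic part \<open>\<epsilon> = 2 t / d x\<close>
  minimises \<open>t / \<epsilon>\<^sup>2 - d x / \<epsilon>\<close>, with minimum
  \<open>- (d x)\<^sup>2 / (4 t)\<close>. This choice degenerates where the distance is small, and
  compact sets that touch \<open>S\<close> contain such points; they are treated with a fixed ratio
  of \<open>t\<close> to \<open>\<epsilon>\<close>. The comparison itself has to cope with parabolic
  data that jump at the corner of the space-time cylinder.\<close>

lemma psd_form_decomposition:
  fixes a :: "'i \<Rightarrow> 'i \<Rightarrow> real"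
  assumes "finite I"
    and "\<And>i j. \<lbrakk>i \<in> I; j \<in> I\<rbrakk> \<Longrightarrow> a i j = a j i"
    and "\<And>c. (\<Sum>i\<in>I. \<Sum>j\<in>I. a i j * c i * c j) \<ge> 0"
  shows "\<exists>b :: 'i \<Rightarrow> 'i \<Rightarrow> real. \<forall>i\<in>I. \<forall>j\<in>I. a i j = (\<Sum>k\<in>I. b k i * b k j)"
  using assms
proof (induction I arbitrary: a rule: finite_induct)
  case empty
  then show ?case by simp
next
  case (insert p I)
  define \<alpha> where "\<alpha> = a p p"
  have sym: "a i p = a p i" if "i \<in> I" for i using insert.prems(1) that by auto
  have expand: "(\<Sum>i\<in>insert p I. \<Sum>j\<in>insert p I. a i j * c i * c j)
      = \<alpha> * (c p)\<^sup>2 + 2 * c p * (\<Sum>i\<in>I. a p i * c i) + (\<Sum>i\<in>I. \<Sum>j\<in>I. a i j * c i * c j)" for c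
  proof -
    have "(\<Sum>i\<in>I. a i p * c i * c p) = c p * (\<Sum>i\<in>I. a p i * c i)"
      unfolding sum_distrib_left by (rule sum.cong) (auto simp: sym)
    moreover have "(\<Sum>i\<in>I. a p i * c p * c i) = c p * (\<Sum>i\<in>I. a p i * c i)"
      unfolding sum_distrib_left by (rule sum.cong) auto
    ultimately show ?thesis
      using insert.hyps by (simp add: sum.distrib \<alpha>_def power2_eq_square algebra_simps)
  qed
  have \<alpha>0: "\<alpha> \<ge> 0"
  proof -
    have "(\<Sum>i\<in>I. a p i * (if i = p then 1 else 0)) = 0"
      using insert.hyps by (intro sum.neutral) auto
    moreover have "(\<Sum>i\<in>I. \<Sum>j\<in>I. a i j * (if i = p then 1 else 0) * (if j = p then 1 else 0)) = 0"
      using insert.hyps by (intro sum.neutral) auto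
    ultimately show ?thesis
      using insert.prems(2)[of "\<lambda>i. if i = p then 1 else 0"] expand[of "\<lambda>i. if i = p then 1 else 0"] by simp
  qed
  \<comment> \<open>A vanishing pivot forces its row to vanish: with coordinate \<open>t\<close> at
    \<open>p\<close> and \<open>1\<close> at \<open>q\<close> the form is affine in
    \<open>t\<close>, and this \<open>t\<close> gives it the value \<open>-1\<close>.\<close>
  have zero: "a p q = 0" if "\<alpha> = 0" "q \<in> I" for q
  proof (rule ccontr)
    assume nz: "a p q \<noteq> 0"
    define t where "t = - (a q q + 1) / (2 * a p q)"
    define c where "c = (\<lambda>i. if i = p then t else if i = q then 1 else 0)"
    have pq: "p \<noteq> q" using insert.hyps that by auto
    have 1: "(\<Sum>i\<in>I. a p i * c i) = a p q"
    proof -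
      have "(\<Sum>i\<in>I. a p i * c i) = (\<Sum>i\<in>I. if i = q then a p q else 0)"
        using insert.hyps by (intro sum.cong) (auto simp: c_def)
      then show ?thesis using that insert.hyps by simp
    qed
    have 2: "(\<Sum>i\<in>I. \<Sum>j\<in>I. a i j * c i * c j) = a q q"
    proof -
      have "(\<Sum>j\<in>I. a i j * c i * c j) = (if i = q then a q q else 0)" if "i \<in> I" for i
      proof -
        have "(\<Sum>j\<in>I. a i j * c i * c j) = (\<Sum>j\<in>I. if j = q then (if i = q then a q q else 0) else 0)"
          using insert.hyps that by (intro sum.cong) (auto simp: c_def)
        then show ?thesis using \<open>q \<in> I\<close> insert.hyps by simp
      qed
      then show ?thesis using \<open>q \<in> I\<close> insert.hyps by simp
    qed
    have "2 * t * a p q + a q q \<ge> 0"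
      using insert.prems(2)[of c] unfolding expand 1 2 using that pq by (simp add: c_def)
    moreover have "2 * t * a p q = - (a q q + 1)" using nz by (simp add: t_def)
    ultimately show False by simp
  qed
  \<comment> \<open>Schur complement of the pivot. For \<open>\<alpha> = 0\<close> the division
    yields \<open>0\<close>, which agrees with \<open>zero\<close>, so no case distinction is needed
    here.\<close>
  define a' where "a' = (\<lambda>i j. a i j - a p i * a p j / \<alpha>)"
  have "\<exists>b. \<forall>i\<in>I. \<forall>j\<in>I. a' i j = (\<Sum>k\<in>I. b k i * b k j)"
  proof (rule insert.IH)
    show "a' i j = a' j i" if "i \<in> I" "j \<in> I" for i j
      using insert.prems(1) that by (auto simp: a'_def)
    fix c :: "'i \<Rightarrow> real"
    define \<sigma> where "\<sigma> = (\<Sum>i\<in>I. a p i * c i)"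
    \<comment> \<open>Completing the square: this coordinate at \<open>p\<close> minimises the form
      of \<open>a\<close> with the others held fixed, and the minimum is the form of
      \<open>a'\<close> at \<open>c\<close>.\<close>
    define d where "d = c(p := - \<sigma> / \<alpha>)"
    have d1: "(\<Sum>i\<in>I. a p i * d i) = \<sigma>"
      unfolding \<sigma>_def using insert.hyps by (intro sum.cong) (auto simp: d_def)
    have d2: "(\<Sum>i\<in>I. \<Sum>j\<in>I. a i j * d i * d j) = (\<Sum>i\<in>I. \<Sum>j\<in>I. a i j * c i * c j)"
      using insert.hyps by (intro sum.cong) (auto simp: d_def)
    have "0 \<le> \<alpha> * (\<sigma> / \<alpha>)\<^sup>2 - 2 * (\<sigma> / \<alpha>) * \<sigma> + (\<Sum>i\<in>I. \<Sum>j\<in>I. a i j * c i * c j)"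
      using insert.prems(2)[of d] unfolding expand d1 d2 by (simp add: d_def)
    also have "\<dots> = (\<Sum>i\<in>I. \<Sum>j\<in>I. a i j * c i * c j) - (\<sigma> * \<sigma>) / \<alpha>"
      by (cases "\<alpha> = 0") (auto simp: field_simps power2_eq_square)
    also have "\<dots> = (\<Sum>i\<in>I. \<Sum>j\<in>I. a i j * c i * c j - (a p i * c i) * (a p j * c j) / \<alpha>)"
      by (simp only: \<sigma>_def sum_product sum_divide_distrib sum_subtractf)
    also have "\<dots> = (\<Sum>i\<in>I. \<Sum>j\<in>I. a' i j * c i * c j)"
      by (intro sum.cong refl) (simp add: a'_def right_diff_distrib mult_ac)
    finally show "0 \<le> (\<Sum>i\<in>I. \<Sum>j\<in>I. a' i j * c i * c j)" .
  qed
  then obtain b where b: "\<And>i j. i \<in> I \<Longrightarrow> j \<in> I \<Longrightarrow> a' i j = (\<Sum>k\<in>I. b k i * b k j)" by blast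
  \<comment> \<open>One new square, the pivot row divided by the root of the pivot, and the squares
    of the Schur complement extended by zero.\<close>
  define b' where "b' = (\<lambda>k i. if k = p then a p i / sqrt \<alpha> else if i = p then 0 else b k i)"
  have s: "sqrt \<alpha> * sqrt \<alpha> = \<alpha>" using \<alpha>0 by simp
  have "a i j = (\<Sum>k\<in>insert p I. b' k i * b' k j)" if ij: "i \<in> insert p I" "j \<in> insert p I" for i j
  proof -
    have "(\<Sum>k\<in>insert p I. b' k i * b' k j) = a p i * a p j / \<alpha> + (\<Sum>k\<in>I. b' k i * b' k j)"
      using insert.hyps s by (simp add: b'_def)
    also have "\<dots> = a i j"
    proof (cases "i = p \<or> j = p")
      case True
      then have "(\<Sum>k\<in>I. b' k i * b' k j) = 0"
        using insert.hyps by (intro sum.neutral) (auto simp: b'_def)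
      moreover have "a p i * a p j / \<alpha> = a i j"
      proof (cases "i = p")
        case True
        have "a p j = 0" if "\<alpha> = 0" using that zero[of j] ij(2) \<alpha>_def by (cases "j = p") auto
        then show ?thesis using True \<alpha>_def by auto
      next
        case False
        then have "j = p" "i \<in> I" using \<open>i = p \<or> j = p\<close> ij by auto
        moreover have "a p i = 0" if "\<alpha> = 0" using that zero[of i] \<open>i \<in> I\<close> by blast
        ultimately show ?thesis using sym[of i] \<alpha>_def by auto
      qed
      ultimately show ?thesis by simp
    next
      case False
      then have "(\<Sum>k\<in>I. b' k i * b' k j) = (\<Sum>k\<in>I. b k i * b k j)"
        using insert.hyps by (intro sum.cong) (auto simp: b'_def)
      moreover have "i \<in> I" "j \<in> I" using False ij by auto
      ultimately show ?thesis using b[of i j] by (simp add: a'_def)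
    qed
    finally show ?thesis by simp
  qed
  then show ?case by blast
qed

lemma inner_matrix_vector_sum:
  fixes A :: "real^'n^'n"
  shows "(A *v v) \<bullet> w = (\<Sum>i\<in>UNIV. \<Sum>j\<in>UNIV. A $ i $ j * v $ j * w $ i)"
  by (simp add: inner_vec_def matrix_vector_mult_def sum_distrib_right)

text \<open>Writing the coefficient matrix as a sum of rank-one matrices turns
  \<open>trace (A ** H)\<close> into a sum of pure second derivatives along the vectors
  \<open>b k\<close>. Second-order conditions at extrema thereby reduce to functions of one real
  variable.\<close>

lemma symmetric_psd_decomposition:
  fixes A :: "real^'n^'n"
  assumes "transpose A = A" and psd: "\<And>\<xi>. (A *v \<xi>) \<bullet> \<xi> \<ge> 0"
  obtains b :: "'n \<Rightarrow> real^'n" where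
    "\<And>i j. A $ i $ j = (\<Sum>k\<in>UNIV. b k $ i * b k $ j)"
proof -
  have sym: "A $ i $ j = A $ j $ i" for i j
    using assms(1) by (metis transpose_def vec_lambda_beta)
  have "(\<Sum>i\<in>UNIV. \<Sum>j\<in>UNIV. A $ i $ j * c i * c j) \<ge> 0" for c
    using psd[of "\<chi> i. c i"] by (simp add: inner_matrix_vector_sum mult_ac)
  from psd_form_decomposition[of UNIV "\<lambda>i j. A $ i $ j", OF finite sym this]
  obtain b :: "'n \<Rightarrow> 'n \<Rightarrow> real" where b: "\<And>i j. A $ i $ j = (\<Sum>k\<in>UNIV. b k i * b k j)" by auto
  show thesis by (rule that[of "\<lambda>k. \<chi> i. b k i"]) (simp add: b)
qed

lemma trace_mult_decomposition:
  fixes A H :: "real^'n^'n"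
  assumes "\<And>i j. A $ i $ j = (\<Sum>k\<in>UNIV. b k $ i * b k $ j)"
  shows "trace (A ** H) = (\<Sum>k\<in>UNIV. (H *v b k) \<bullet> b k)"
proof -
  have "trace (A ** H) = (\<Sum>i\<in>UNIV. \<Sum>j\<in>UNIV. \<Sum>k\<in>UNIV. H $ j $ i * b k $ i * b k $ j)"
    by (simp add: trace_def matrix_matrix_mult_def assms sum_distrib_right sum_distrib_left mult_ac)
  also have "\<dots> = (\<Sum>j\<in>UNIV. \<Sum>i\<in>UNIV. \<Sum>k\<in>UNIV. H $ j $ i * b k $ i * b k $ j)"
    by (rule sum.swap)
  also have "\<dots> = (\<Sum>j\<in>UNIV. \<Sum>k\<in>UNIV. \<Sum>i\<in>UNIV. H $ j $ i * b k $ i * b k $ j)"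
    by (intro sum.cong refl sum.swap)
  also have "\<dots> = (\<Sum>k\<in>UNIV. \<Sum>j\<in>UNIV. \<Sum>i\<in>UNIV. H $ j $ i * b k $ i * b k $ j)"
    by (rule sum.swap)
  finally show ?thesis by (simp add: inner_matrix_vector_sum)
qed

lemma quadratic_form_decomposition:
  fixes A :: "real^'n^'n"
  assumes "\<And>i j. A $ i $ j = (\<Sum>k\<in>UNIV. b k $ i * b k $ j)"
  shows "(A *v p) \<bullet> p = (\<Sum>k\<in>UNIV. (b k \<bullet> p)\<^sup>2)"
proof -
  have "(A *v p) \<bullet> p = (\<Sum>i\<in>UNIV. \<Sum>j\<in>UNIV. \<Sum>k\<in>UNIV. b k $ i * b k $ j * p $ j * p $ i)"
    by (simp add: inner_matrix_vector_sum assms sum_distrib_right)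
  also have "\<dots> = (\<Sum>i\<in>UNIV. \<Sum>k\<in>UNIV. \<Sum>j\<in>UNIV. b k $ i * b k $ j * p $ j * p $ i)"
    by (intro sum.cong refl sum.swap)
  also have "\<dots> = (\<Sum>k\<in>UNIV. \<Sum>i\<in>UNIV. \<Sum>j\<in>UNIV. b k $ i * b k $ j * p $ j * p $ i)"
    by (rule sum.swap)
  also have "\<dots> = (\<Sum>k\<in>UNIV. (b k \<bullet> p)\<^sup>2)"
    by (simp add: power2_eq_square inner_vec_def sum_product mult_ac)
  finally show ?thesis .
qed

lemma trace_decomposition:
  fixes A :: "real^'n^'n"
  assumes "\<And>i j. A $ i $ j = (\<Sum>k\<in>UNIV. b k $ i * b k $ j)"
  shows "trace A = (\<Sum>k\<in>UNIV. (norm (b k))\<^sup>2)"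
  using trace_mult_decomposition[of A b "mat 1", OF assms]
  by (simp add: power2_norm_eq_inner)

lemma psd_form_Cauchy_Schwarz:
  fixes A :: "real^'n^'n"
  assumes "transpose A = A" and psd: "\<And>\<xi>. (A *v \<xi>) \<bullet> \<xi> \<ge> 0"
  shows "((A *v p) \<bullet> w)\<^sup>2 \<le> ((A *v p) \<bullet> p) * ((A *v w) \<bullet> w)"
proof -
  obtain b :: "'n \<Rightarrow> real^'n" where b: "\<And>i j. A $ i $ j = (\<Sum>k\<in>UNIV. b k $ i * b k $ j)"
    using symmetric_psd_decomposition[OF assms] by metis
  have polar: "(A *v p) \<bullet> w = (\<Sum>k\<in>UNIV. (b k \<bullet> p) * (b k \<bullet> w))"
  proof -
    have sw: "(A *v w) \<bullet> p = (A *v p) \<bullet> w"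
      by (metis assms(1) dot_lmul_matrix inner_commute transpose_matrix_vector)
    have "4 * ((A *v p) \<bullet> w) = (A *v (p + w)) \<bullet> (p + w) - (A *v (p - w)) \<bullet> (p - w)"
      using sw by (simp add: matrix_vector_right_distrib matrix_vector_mult_diff_distrib inner_simps)
    also have "\<dots> = (\<Sum>k\<in>UNIV. 4 * ((b k \<bullet> p) * (b k \<bullet> w)))"
      unfolding quadratic_form_decomposition[of A b, OF b] sum_subtractf[symmetric]
      by (intro sum.cong refl) (simp add: inner_simps power2_eq_square algebra_simps)
    finally show ?thesis by (simp add: sum_distrib_left[symmetric])
  qed
  show ?thesis
    unfolding polar quadratic_form_decomposition[of A b, OF b]
    by (rule Cauchy_Schwarz_ineq_sum)
qed

lemma norm_matrix_vector_mult_le: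
  fixes A :: "real^'n^'m"
  shows "norm (A *v x) \<le> norm A * norm x"
proof -
  have "norm (A *v x) \<le> L2_set (\<lambda>i. norm x * norm (A $ i)) UNIV"
    unfolding norm_vec_def[of "A *v x"]
    by (rule L2_set_mono)
       (auto simp: matrix_mult_dot Cauchy_Schwarz_ineq2 mult.commute[of "norm x"])
  also have "\<dots> = norm x * norm A"
    by (simp add: L2_set_right_distrib[symmetric] norm_vec_def[of A])
  finally show ?thesis by (simp add: mult.commute)
qed

lemma trace_mult_add:
  fixes A H K :: "real^'n^'n"
  shows "trace (A ** (H + K)) = trace (A ** H) + trace (A ** K)"
  by (simp add: matrix_add_ldistrib trace_add)

lemma trace_mult_scaleR:
  fixes A H :: "real^'n^'n"
  shows "trace (A ** (k *\<^sub>R H)) = k * trace (A ** H)"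
  by (simp add: trace_def matrix_matrix_mult_def sum_distrib_left mult_ac)

lemma scaleR_matrix_vector_mult:
  fixes H :: "real^'n^'n"
  shows "(k *\<^sub>R H) *v v = k *\<^sub>R (H *v v)"
  by (simp add: matrix_vector_mult_def vec_eq_iff sum_distrib_left mult_ac)

section \<open>Second order conditions and barriers\<close>

text \<open>At the minimum \<open>g'\<close> vanishes. With a negative derivative there it would be
  negative just to the right, and the mean value theorem would make \<open>g\<close> decrease.
  Differentiability of \<open>g'\<close> at the single point \<open>0\<close> is enough, which
  matches \<open>twice_differentiable_on\<close>.\<close>

lemma second_derivative_nonneg_at_local_min:
  fixes g g' :: "real \<Rightarrow> real"
  assumes "d > 0"
    and g: "\<And>s. \<bar>s\<bar> < d \<Longrightarrow> (g has_real_derivative g' s) (at s)"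
    and g': "(g' has_real_derivative c) (at 0)"
    and min: "\<And>s. \<bar>s\<bar> < d \<Longrightarrow> g 0 \<le> g s"
  shows "c \<ge> 0"
proof (rule ccontr)
  assume "\<not> c \<ge> 0"
  have "g' 0 = 0"
    using DERIV_local_min[of g "g' 0" 0 d] assms by simp
  obtain e where e: "e > 0" "\<And>h. 0 < h \<Longrightarrow> h < e \<Longrightarrow> g' h < 0"
    using DERIV_neg_dec_right[OF g'] \<open>\<not> c \<ge> 0\<close> \<open>g' 0 = 0\<close> by auto
  define h where "h = min d e / 2"
  have h: "0 < h" "h < d" "h < e" using \<open>d > 0\<close> e(1) by (auto simp: h_def min_def)
  obtain z where "0 < z" "z < h" "g h - g 0 = (h - 0) * g' z"
    using MVT2[of 0 h g g'] h g by auto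
  moreover have "g' z < 0" using e(2)[of z] h \<open>0 < z\<close> \<open>z < h\<close> by simp
  ultimately have "g h < g 0" using h(1) mult_pos_neg[of h "g' z"] by simp
  with min[of h] h show False by simp
qed

lemma frechet_derivative_eq_gradient:
  assumes "v differentiable (at y)"
  shows "frechet_derivative v (at y) \<xi> = gradient v y \<bullet> \<xi>"
proof -
  let ?D = "frechet_derivative v (at y)"
  have lin: "linear ?D" using assms linear_frechet_derivative by blast
  have "?D \<xi> = ?D (\<Sum>i\<in>UNIV. (\<xi> $ i) *s axis i 1)" by (simp only: basis_expansion)
  also have "\<dots> = (\<Sum>i\<in>UNIV. \<xi> $ i * ?D (axis i 1))"
    by (simp add: linear_sum[OF lin] linear_scale[OF lin] scalar_mult_eq_scaleR)
  also have "\<dots> = gradient v y \<bullet> \<xi>"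
    by (simp add: gradient_def inner_vec_def mult.commute)
  finally show ?thesis .
qed

lemma has_derivative_gradient:
  assumes "v differentiable (at y)"
  shows "(v has_derivative (\<lambda>\<xi>. gradient v y \<bullet> \<xi>)) (at y)"
proof -
  have "(\<lambda>\<xi>. gradient v y \<bullet> \<xi>) = frechet_derivative v (at y)"
    using frechet_derivative_eq_gradient[OF assms] by auto
  then show ?thesis using assms frechet_derivative_works by metis
qed

lemma has_derivative_hessian:
  assumes "gradient v differentiable (at y)"
  shows "(gradient v has_derivative (\<lambda>\<xi>. hessian v y *v \<xi>)) (at y)"
proof -
  have "linear (frechet_derivative (gradient v) (at y))"
    using assms linear_frechet_derivative by blast
  then have "(\<lambda>\<xi>. hessian v y *v \<xi>) = frechet_derivative (gradient v) (at y)"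
    by (auto simp: hessian_def matrix_works linear_matrix_vector_mul_eq)
  then show ?thesis using assms frechet_derivative_works by metis
qed

lemma line_derivative:
  assumes "v differentiable (at (x + s *\<^sub>R \<xi>))"
  shows "((\<lambda>s. v (x + s *\<^sub>R \<xi>)) has_real_derivative gradient v (x + s *\<^sub>R \<xi>) \<bullet> \<xi>) (at s)"
proof -
  have "((\<lambda>s. x + s *\<^sub>R \<xi>) has_derivative (\<lambda>h. h *\<^sub>R \<xi>)) (at s)"
    by (auto intro!: derivative_eq_intros)
  from has_derivative_compose[OF this has_derivative_gradient[OF assms]]
  show ?thesis
    unfolding has_field_derivative_def by (rule has_derivative_eq_rhs) (auto simp: fun_eq_iff)
qed

lemma line_derivative2:
  assumes "gradient v differentiable (at (x + s *\<^sub>R \<xi>))"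
  shows "((\<lambda>s. gradient v (x + s *\<^sub>R \<xi>) \<bullet> \<xi>) has_real_derivative
           (hessian v (x + s *\<^sub>R \<xi>) *v \<xi>) \<bullet> \<xi>) (at s)"
proof -
  have "((\<lambda>s. x + s *\<^sub>R \<xi>) has_derivative (\<lambda>h. h *\<^sub>R \<xi>)) (at s)"
    by (auto intro!: derivative_eq_intros)
  from has_derivative_inner_left[OF has_derivative_compose[OF this has_derivative_hessian[OF assms]], of \<xi>]
  show ?thesis
    unfolding has_field_derivative_def
    by (rule has_derivative_eq_rhs) (auto simp: fun_eq_iff matrix_vector_mult_scaleR)
qed

lemma open_line_segment:
  fixes x \<xi> :: "'a::real_normed_vector"
  assumes "open \<Omega>" "x \<in> \<Omega>"
  obtains d where "d > 0" "\<And>s. \<bar>s\<bar> < d \<Longrightarrow> x + s *\<^sub>R \<xi> \<in> \<Omega>"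
proof -
  obtain r where r: "r > 0" "ball x r \<subseteq> \<Omega>" using assms open_contains_ball by metis
  show thesis
  proof (rule that[of "r / (norm \<xi> + 1)"])
    have n: "norm \<xi> + 1 > 0" by (simp add: add_nonneg_pos)
    show "0 < r / (norm \<xi> + 1)" using r n by simp
    fix s assume s: "\<bar>s\<bar> < r / (norm \<xi> + 1)"
    have "\<bar>s\<bar> * norm \<xi> \<le> \<bar>s\<bar> * (norm \<xi> + 1)" by (simp add: mult_left_mono)
    also have "\<dots> < r" using s n by (simp add: pos_less_divide_eq)
    finally have "x + s *\<^sub>R \<xi> \<in> ball x r" by (simp add: dist_norm)
    then show "x + s *\<^sub>R \<xi> \<in> \<Omega>" using r by blast
  qed
qed

text \<open>The comparison function enters only through its restrictions \<open>\<beta> k\<close> to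
  the lines through \<open>x\<close> in the directions \<open>b k\<close>, so its Hessian is never
  computed. The factor \<open>a\<close> allows maxima as well as minima of \<open>v\<close> minus a
  comparison function.\<close>

lemma trace_hessian_ge_at_local_min:
  fixes A :: "real^'n^'n"
  assumes A: "\<And>i j. A $ i $ j = (\<Sum>k\<in>UNIV. b k $ i * b k $ j)"
    and "open \<Omega>" "twice_differentiable_on v \<Omega>" "x \<in> \<Omega>"
    and \<beta>: "\<And>k. \<exists>d>0. (\<forall>s. \<bar>s\<bar> < d \<longrightarrow> (\<beta> k has_real_derivative \<beta>' k s) (at s)
              \<and> a * v x - \<beta> k 0 \<le> a * v (x + s *\<^sub>R b k) - \<beta> k s)
              \<and> (\<beta>' k has_real_derivative c k) (at 0)"
  shows "a * trace (A ** hessian v x) \<ge> (\<Sum>k\<in>UNIV. c k)"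
proof -
  have "c k \<le> a * ((hessian v x *v b k) \<bullet> b k)" for k
  proof -
    obtain d where d: "d > 0"
      "\<And>s. \<bar>s\<bar> < d \<Longrightarrow> (\<beta> k has_real_derivative \<beta>' k s) (at s)"
      "\<And>s. \<bar>s\<bar> < d \<Longrightarrow> a * v x - \<beta> k 0 \<le> a * v (x + s *\<^sub>R b k) - \<beta> k s"
      "(\<beta>' k has_real_derivative c k) (at 0)" using \<beta>[of k] by blast
    obtain d' where d': "d' > 0" "\<And>s. \<bar>s\<bar> < d' \<Longrightarrow> x + s *\<^sub>R b k \<in> \<Omega>"
      using open_line_segment assms(2,4) by blast
    have "a * ((hessian v x *v b k) \<bullet> b k) - c k \<ge> 0"
    proof (rule second_derivative_nonneg_at_local_min[where d = "min d d'"
          and g = "\<lambda>s. a * v (x + s *\<^sub>R b k) - \<beta> k s"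
          and g' = "\<lambda>s. a * (gradient v (x + s *\<^sub>R b k) \<bullet> b k) - \<beta>' k s"])
      show "((\<lambda>s. a * v (x + s *\<^sub>R b k) - \<beta> k s) has_real_derivative
              a * (gradient v (x + s *\<^sub>R b k) \<bullet> b k) - \<beta>' k s) (at s)" if "\<bar>s\<bar> < min d d'" for s
        using that d(2) d'(2) assms(3) unfolding twice_differentiable_on_def
        by (intro DERIV_diff DERIV_cmult line_derivative) auto
      have "gradient v differentiable (at (x + 0 *\<^sub>R b k))"
        using assms(3,4) by (simp add: twice_differentiable_on_def)
      from line_derivative2[OF this]
      show "((\<lambda>s. a * (gradient v (x + s *\<^sub>R b k) \<bullet> b k) - \<beta>' k s) has_real_derivative
          a * ((hessian v x *v b k) \<bullet> b k) - c k) (at 0)"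
        by (intro DERIV_diff DERIV_cmult d(4)) simp
    qed (use d d' in auto)
    then show ?thesis by simp
  qed
  then have "(\<Sum>k\<in>UNIV. c k) \<le> (\<Sum>k\<in>UNIV. a * ((hessian v x *v b k) \<bullet> b k))"
    by (rule sum_mono)
  also have "\<dots> = a * trace (A ** hessian v x)"
    by (simp add: trace_mult_decomposition[of A b, OF A] sum_distrib_left)
  finally show ?thesis .
qed

text \<open>Along a line the expression under the root of a barrier is a quadratic polynomial in
  \<open>s\<close>; these are the first two derivatives of the barrier restricted to that
  line.\<close>

lemma exp_sqrt_quadratic_derivatives:
  fixes q l m \<sigma> :: real
  assumes "q > 0"
  defines "\<phi> \<equiv> (\<lambda>s. sqrt (q + 2 * s * l + s\<^sup>2 * m))"
  shows "\<exists>d>0. (\<forall>s. \<bar>s\<bar> < d \<longrightarrow> ((\<lambda>s. exp (\<sigma> * \<phi> s)) has_real_derivative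
            exp (\<sigma> * \<phi> s) * (\<sigma> * ((l + s * m) / \<phi> s))) (at s))
        \<and> ((\<lambda>s. exp (\<sigma> * \<phi> s) * (\<sigma> * ((l + s * m) / \<phi> s))) has_real_derivative
            exp (\<sigma> * sqrt q) * (\<sigma> * (m / sqrt q - l\<^sup>2 / sqrt q ^ 3) + \<sigma>\<^sup>2 * (l\<^sup>2 / q))) (at 0)"
proof -
  let ?w = "\<lambda>s. q + 2 * s * l + s\<^sup>2 * m"
  have "open {s. 0 < ?w s}" by (intro open_Collect_less continuous_intros)
  moreover have "0 \<in> {s. 0 < ?w s}" using assms by simp
  ultimately obtain d where "d > 0" "ball 0 d \<subseteq> {s. 0 < ?w s}" using open_contains_ball by blast
  then have d: "d > 0" "\<And>s. \<bar>s\<bar> < d \<Longrightarrow> ?w s > 0" by (auto simp: subset_iff)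
  have D: "(\<phi> has_real_derivative (l + s * m) / \<phi> s) (at s)" if "\<bar>s\<bar> < d" for s
    unfolding \<phi>_def using d(2)[OF that]
    by (auto intro!: derivative_eq_intros simp: field_simps)
  have \<phi>0: "\<phi> 0 = sqrt q" by (simp add: \<phi>_def)
  have q: "sqrt q > 0" "sqrt q * sqrt q = q" using assms by auto
  have D1: "((\<lambda>s. exp (\<sigma> * \<phi> s)) has_real_derivative exp (\<sigma> * \<phi> s) * (\<sigma> * ((l + s * m) / \<phi> s))) (at s)"
    if "\<bar>s\<bar> < d" for s
    by (rule DERIV_fun_exp[OF DERIV_cmult[OF D[OF that], of \<sigma>]])
  have "((\<lambda>s. l + s * m) has_real_derivative m) (at 0)"
    by (auto intro!: derivative_eq_intros)
  note quot = DERIV_divide[OF this D[of 0]]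
  have "(m * r - (l + 0 * m) * ((l + 0 * m) / r)) / (r * r) = m / r - l\<^sup>2 / r ^ 3" if "r \<noteq> 0" for r
    using that by (simp add: field_simps power2_eq_square power3_eq_cube)
  from this[of "\<phi> 0"] quot
  have "((\<lambda>s. (l + s * m) / \<phi> s) has_real_derivative (m / sqrt q - l\<^sup>2 / sqrt q ^ 3)) (at 0)"
    using d(1) \<phi>0 q(1) by simp
  from DERIV_mult[OF D1[of 0] DERIV_cmult[OF this, of \<sigma>]]
  have D2: "((\<lambda>s. exp (\<sigma> * \<phi> s) * (\<sigma> * ((l + s * m) / \<phi> s))) has_real_derivative
      exp (\<sigma> * sqrt q) * (\<sigma> * (l / sqrt q)) * (\<sigma> * (l / sqrt q)) +
      (\<sigma> * (m / sqrt q - l\<^sup>2 / sqrt q ^ 3)) * exp (\<sigma> * sqrt q)) (at 0)"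
    using d(1) by (simp add: \<phi>0 algebra_simps)
  have "exp (\<sigma> * sqrt q) * (\<sigma> * (l / sqrt q)) * (\<sigma> * (l / sqrt q)) +
      (\<sigma> * (m / sqrt q - l\<^sup>2 / sqrt q ^ 3)) * exp (\<sigma> * sqrt q)
     = exp (\<sigma> * sqrt q) * (\<sigma> * (m / sqrt q - l\<^sup>2 / sqrt q ^ 3) + \<sigma>\<^sup>2 * (l\<^sup>2 / (sqrt q * sqrt q)))"
    by (simp add: power2_eq_square algebra_simps)
  with D2 have "((\<lambda>s. exp (\<sigma> * \<phi> s) * (\<sigma> * ((l + s * m) / \<phi> s))) has_real_derivative
            exp (\<sigma> * sqrt q) * (\<sigma> * (m / sqrt q - l\<^sup>2 / sqrt q ^ 3) + \<sigma>\<^sup>2 * (l\<^sup>2 / q))) (at 0)"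
    unfolding q(2) by simp
  with D1 d(1) show ?thesis by blast
qed

lemma quadratic_form_line:
  fixes B :: "real^'n^'n"
  assumes "transpose B = B"
  shows "(B *v (h + s *\<^sub>R w)) \<bullet> (h + s *\<^sub>R w) = (B *v h) \<bullet> h + 2 * s * ((B *v h) \<bullet> w) + s\<^sup>2 * ((B *v w) \<bullet> w)"
proof -
  have "(B *v w) \<bullet> h = (B *v h) \<bullet> w"
    by (metis assms dot_lmul_matrix inner_commute transpose_matrix_vector)
  then show ?thesis
    by (simp add: matrix_vector_right_distrib matrix_vector_mult_scaleR inner_simps power2_eq_square algebra_simps)
qed

text \<open>Here \<open>B\<close> stands for the inverse matrix frozen at the centre
  \<open>x0\<close>, while \<open>A\<close> is the coefficient matrix at the touching point. Since
  \<open>\<sigma>\<close> is later of order \<open>1 / \<epsilon>\<close>, the term with the square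
  of \<open>\<sigma>\<close> dominates, and \<open>P\<close> is close to the square of
  \<open>\<phi>\<close> when the two coefficient matrices are close; the term linear in
  \<open>\<sigma>\<close> is the curvature error. The constant \<open>\<kappa>\<close> smooths the
  root at the centre.\<close>

lemma trace_hessian_ge_barrier:
  fixes A B :: "real^'n^'n"
  assumes A: "transpose A = A" "\<And>\<xi>. (A *v \<xi>) \<bullet> \<xi> \<ge> 0" and B: "transpose B = B"
    and "open \<Omega>" "twice_differentiable_on v \<Omega>" "x \<in> \<Omega>"
    and pos: "(B *v (x - x0)) \<bullet> (x - x0) + \<kappa> > 0"
    and min: "\<forall>\<^sub>F y in nhds x. a * v x - C * exp (\<sigma> * sqrt ((B *v (x - x0)) \<bullet> (x - x0) + \<kappa>))
                 \<le> a * v y - C * exp (\<sigma> * sqrt ((B *v (y - x0)) \<bullet> (y - x0) + \<kappa>))"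
  defines "\<phi> \<equiv> sqrt ((B *v (x - x0)) \<bullet> (x - x0) + \<kappa>)"
    and "P \<equiv> (A *v (B *v (x - x0))) \<bullet> (B *v (x - x0))"
  shows "a * trace (A ** hessian v x) \<ge>
     C * exp (\<sigma> * \<phi>) * (\<sigma> * (trace (A ** B) / \<phi> - P / \<phi> ^ 3) + \<sigma>\<^sup>2 * (P / \<phi>\<^sup>2))"
proof -
  obtain b :: "'n \<Rightarrow> real^'n" where b: "\<And>i j. A $ i $ j = (\<Sum>k\<in>UNIV. b k $ i * b k $ j)"
    using symmetric_psd_decomposition[OF A] by metis
  define h where "h = x - x0"
  define q where "q = (B *v h) \<bullet> h + \<kappa>"
  define l where "l = (\<lambda>k. (B *v h) \<bullet> b k)"
  define m where "m = (\<lambda>k. (B *v b k) \<bullet> b k)"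
  have q: "q > 0" using pos by (simp add: q_def h_def)
  have \<phi>: "\<phi> = sqrt q" by (simp add: \<phi>_def q_def h_def)
  define \<psi> where "\<psi> = (\<lambda>k s. sqrt (q + 2 * s * l k + s\<^sup>2 * m k))"
  define c where "c = (\<lambda>k. exp (\<sigma> * sqrt q) * (\<sigma> * (m k / sqrt q - (l k)\<^sup>2 / sqrt q ^ 3) + \<sigma>\<^sup>2 * ((l k)\<^sup>2 / q)))"
  have line: "sqrt ((B *v (x + s *\<^sub>R b k - x0)) \<bullet> (x + s *\<^sub>R b k - x0) + \<kappa>) = \<psi> k s" for k s
  proof -
    have "x + s *\<^sub>R b k - x0 = h + s *\<^sub>R b k" by (simp add: h_def)
    then show ?thesis
      using quadratic_form_line[OF B, of h s "b k"] by (simp add: \<psi>_def q_def l_def m_def algebra_simps)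
  qed
  have "(\<Sum>k\<in>UNIV. C * c k) \<le> a * trace (A ** hessian v x)"
  proof (rule trace_hessian_ge_at_local_min[where b = b and \<Omega> = \<Omega>
        and \<beta> = "\<lambda>k s. C * exp (\<sigma> * \<psi> k s)"
        and \<beta>' = "\<lambda>k s. C * (exp (\<sigma> * \<psi> k s) * (\<sigma> * ((l k + s * m k) / \<psi> k s)))"])
    fix k
    obtain d1 where d1: "d1 > 0"
      "\<And>s. \<bar>s\<bar> < d1 \<Longrightarrow> ((\<lambda>s. exp (\<sigma> * \<psi> k s)) has_real_derivative
            exp (\<sigma> * \<psi> k s) * (\<sigma> * ((l k + s * m k) / \<psi> k s))) (at s)"
      "((\<lambda>s. exp (\<sigma> * \<psi> k s) * (\<sigma> * ((l k + s * m k) / \<psi> k s))) has_real_derivative c k) (at 0)"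
      using exp_sqrt_quadratic_derivatives[OF q, of \<sigma> "l k" "m k"] unfolding \<psi>_def c_def by blast
    obtain S where S: "open S" "x \<in> S"
      "\<And>y. y \<in> S \<Longrightarrow> a * v x - C * exp (\<sigma> * sqrt ((B *v (x - x0)) \<bullet> (x - x0) + \<kappa>))
                 \<le> a * v y - C * exp (\<sigma> * sqrt ((B *v (y - x0)) \<bullet> (y - x0) + \<kappa>))"
      using min unfolding eventually_nhds by blast
    obtain d2 where d2: "d2 > 0" "\<And>s. \<bar>s\<bar> < d2 \<Longrightarrow> x + s *\<^sub>R b k \<in> S"
      using open_line_segment S by blast
    have "a * v x - C * exp (\<sigma> * \<psi> k 0) \<le> a * v (x + s *\<^sub>R b k) - C * exp (\<sigma> * \<psi> k s)"
      if "\<bar>s\<bar> < d2" for s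
      using S(3)[OF d2(2)[OF that]] line[of s k] line[of 0 k] by simp
    then show "\<exists>d>0. (\<forall>s. \<bar>s\<bar> < d \<longrightarrow> ((\<lambda>s. C * exp (\<sigma> * \<psi> k s)) has_real_derivative
              C * (exp (\<sigma> * \<psi> k s) * (\<sigma> * ((l k + s * m k) / \<psi> k s)))) (at s) \<and>
            a * v x - C * exp (\<sigma> * \<psi> k 0) \<le> a * v (x + s *\<^sub>R b k) - C * exp (\<sigma> * \<psi> k s)) \<and>
          ((\<lambda>s. C * (exp (\<sigma> * \<psi> k s) * (\<sigma> * ((l k + s * m k) / \<psi> k s)))) has_real_derivative C * c k) (at 0)"
      using d1(1) d2(1)
      by (intro exI[of _ "min d1 d2"] conjI allI impI DERIV_cmult d1(2,3)) simp_all
  qed (use assms b in auto)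
  also have "(\<Sum>k\<in>UNIV. C * c k) = C * exp (\<sigma> * \<phi>) * (\<sigma> * ((\<Sum>k\<in>UNIV. m k) / \<phi> - (\<Sum>k\<in>UNIV. (l k)\<^sup>2) / \<phi> ^ 3) + \<sigma>\<^sup>2 * ((\<Sum>k\<in>UNIV. (l k)\<^sup>2) / q))"
    unfolding c_def \<phi>
    by (simp add: sum_distrib_left sum_divide_distrib sum.distrib sum_subtractf right_diff_distrib distrib_left mult.assoc)
  also have "(\<Sum>k\<in>UNIV. m k) = trace (A ** B)"
    unfolding m_def by (rule trace_mult_decomposition[of A b, OF b, symmetric])
  also have "(\<Sum>k\<in>UNIV. (l k)\<^sup>2) = P"
    unfolding l_def P_def quadratic_form_decomposition[of A b, OF b] h_def by (simp add: inner_commute)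
  also have "q = \<phi>\<^sup>2" using q \<phi> by simp
  finally show ?thesis .
qed

section \<open>The metric and the resolvent equation\<close>

text \<open>The closure lies in an open ball, which leaves room for barrier centres slightly outside
  the domain. The bound \<open>\<Lambda>\<close> and the uniform continuity of \<open>A\<close>
  refer to the closed ball, so they cover those centres too.\<close>

locale elliptic_setting =
  fixes \<Omega> :: "(real^'n) set" and A :: "real^'n \<Rightarrow> real^'n^'n" and c \<Lambda> R :: real
  assumes open_domain: "open \<Omega>"
    and domain_subset: "closure \<Omega> \<subseteq> ball 0 R"
    and symmetric: "transpose (A x) = A x"
    and continuous: "continuous_on UNIV A"
    and c_pos: "c > 0"
    and elliptic: "(A x *v \<xi>) \<bullet> \<xi> \<ge> c * (norm \<xi>)\<^sup>2"
    and \<Lambda>_pos: "\<Lambda> > 0"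
    and bound: "x \<in> cball 0 R \<Longrightarrow> norm (A x) \<le> \<Lambda>"
begin

abbreviation N :: "real^'n \<Rightarrow> real^'n \<Rightarrow> real" where "N \<equiv> norm_A A"

abbreviation B :: "real^'n \<Rightarrow> real^'n^'n" where "B x \<equiv> matrix_inv (A x)"

lemma A_psd: "(A x *v \<xi>) \<bullet> \<xi> \<ge> 0"
  using elliptic[of \<xi> x] c_pos by (meson mult_nonneg_nonneg less_imp_le order_trans zero_le_power2)

lemma
  shows A_B: "A x *v (B x *v w) = w" and B_A: "B x *v (A x *v w) = w"
proof -
  have "inj ((*v) (A x))"
  proof (rule injI)
    fix v w assume "A x *v v = A x *v w"
    then have "A x *v (v - w) = 0" by (simp add: matrix_vector_mult_diff_distrib)
    then have "c * (norm (v - w))\<^sup>2 \<le> 0" using elliptic[of "v - w" x] by simp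
    then show "v = w" using c_pos by (simp add: mult_le_0_iff)
  qed
  then have "invertible (A x)"
    by (metis matrix_left_invertible_injective invertible_left_inverse)
  then have "A x ** B x = mat 1 \<and> B x ** A x = mat 1"
    unfolding invertible_def matrix_inv_def by (rule someI_ex)
  then show "A x *v (B x *v w) = w" "B x *v (A x *v w) = w"
    by (simp_all add: matrix_vector_mul_assoc)
qed

lemma inner_A_commute: "(A x *v v) \<bullet> w = v \<bullet> (A x *v w)"
  by (metis symmetric dot_lmul_matrix transpose_matrix_vector inner_commute)

lemma inner_B_commute: "(B x *v v) \<bullet> w = v \<bullet> (B x *v w)"
  using inner_A_commute[of x "B x *v v" "B x *v w"] by (simp add: A_B)

lemma symmetric_B: "transpose (B x) = B x"
proof -
  have "v \<bullet> (transpose (B x) *v w) = v \<bullet> (B x *v w)" for v w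
    by (metis dot_lmul_matrix inner_B_commute transpose_matrix_vector inner_commute transpose_transpose)
  then have "transpose (B x) *v w = B x *v w" for w by (metis vector_eq_rdot inner_commute)
  then show ?thesis by (simp add: matrix_eq)
qed

lemma B_form: "(B x *v w) \<bullet> w = (A x *v (B x *v w)) \<bullet> (B x *v w)"
  by (simp add: A_B inner_commute)

lemma B_psd: "(B x *v w) \<bullet> w \<ge> 0"
  using A_psd B_form by metis

lemma N_nonneg: "N x w \<ge> 0"
  by (simp add: norm_A_def B_psd)

lemma N_square: "(N x w)\<^sup>2 = (B x *v w) \<bullet> w"
  by (simp add: norm_A_def B_psd)

lemma N_scale: "N x (a *\<^sub>R w) = \<bar>a\<bar> * N x w"
  by (simp add: norm_A_def matrix_vector_mult_scaleR real_sqrt_mult power2_eq_square[symmetric] mult.assoc[symmetric])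

lemma N_zero [simp]: "N x 0 = 0"
  by (simp add: norm_A_def)

lemma N_minus: "N x (- w) = N x w"
  using N_scale[of x "-1" w] by simp

lemma inner_B_le: "(B x *v v) \<bullet> w \<le> N x v * N x w"
proof -
  have "((B x *v v) \<bullet> w)\<^sup>2 \<le> (N x v * N x w)\<^sup>2"
    using psd_form_Cauchy_Schwarz[of "B x" v w, OF symmetric_B B_psd]
    by (simp add: power_mult_distrib N_square)
  then show ?thesis
    by (meson N_nonneg abs_le_square_iff abs_ge_self mult_nonneg_nonneg order_trans power2_le_imp_le)
qed

lemma N_triangle: "N x (v + w) \<le> N x v + N x w"
proof (rule power2_le_imp_le)
  have "(N x (v + w))\<^sup>2 = (N x v)\<^sup>2 + 2 * ((B x *v v) \<bullet> w) + (N x w)\<^sup>2"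
    unfolding N_square using quadratic_form_line[OF symmetric_B, of x v 1 w] by simp
  also have "\<dots> \<le> (N x v)\<^sup>2 + 2 * (N x v * N x w) + (N x w)\<^sup>2"
    using inner_B_le[of x v w] by simp
  finally show "(N x (v + w))\<^sup>2 \<le> (N x v + N x w)\<^sup>2" by (simp add: power2_sum)
qed (simp add: N_nonneg)

text \<open>Ellipticity is tested at \<open>p = B x *v w\<close>, where the form of
  \<open>A x\<close> equals the squared metric norm of \<open>w\<close>. Together with the
  Cauchy-Schwarz inequality for \<open>p\<close> and \<open>w\<close> this avoids an operator norm
  of the inverse.\<close>

lemma N_square_le: "(N x w)\<^sup>2 \<le> (norm w)\<^sup>2 / c"
proof -
  define n where "n = (N x w)\<^sup>2"
  have n: "n \<ge> 0" by (simp add: n_def)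
  have "c * (norm (B x *v w))\<^sup>2 \<le> n"
    using elliptic[of "B x *v w" x] by (simp add: n_def N_square A_B inner_commute)
  moreover have "n\<^sup>2 \<le> (norm (B x *v w))\<^sup>2 * (norm w)\<^sup>2"
  proof -
    have "n \<le> norm (B x *v w) * norm w"
      unfolding n_def N_square by (rule norm_cauchy_schwarz)
    then show ?thesis using n by (metis power_mono power_mult_distrib)
  qed
  ultimately have "n\<^sup>2 * c \<le> n * (norm w)\<^sup>2"
    using less_imp_le[OF c_pos] mult_right_mono[of "c * (norm (B x *v w))\<^sup>2" n "(norm w)\<^sup>2"]
      mult_right_mono[of "n\<^sup>2" "(norm (B x *v w))\<^sup>2 * (norm w)\<^sup>2" c]
    by (simp add: mult_ac)
  then have "n * (n * c - (norm w)\<^sup>2) \<le> 0" by (simp add: power2_eq_square algebra_simps)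
  then have "n * c \<le> (norm w)\<^sup>2"
    using n c_pos by (cases "n = 0") (auto simp: mult_le_0_iff)
  then show ?thesis using c_pos by (simp add: n_def pos_le_divide_eq)
qed

lemma N_le: "N x w \<le> norm w / sqrt c"
  by (rule power2_le_imp_le) (use N_square_le[of x w] c_pos in \<open>auto simp: power_divide\<close>)

lemma A_form_le:
  assumes "x \<in> cball 0 R"
  shows "(A x *v w) \<bullet> w \<le> \<Lambda> * (norm w)\<^sup>2"
proof -
  have "(A x *v w) \<bullet> w \<le> norm (A x *v w) * norm w" by (rule norm_cauchy_schwarz)
  also have "\<dots> \<le> (norm (A x) * norm w) * norm w"
    by (intro mult_right_mono norm_matrix_vector_mult_le norm_ge_zero)
  also have "\<dots> \<le> (\<Lambda> * norm w) * norm w"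
    by (intro mult_right_mono bound assms norm_ge_zero)
  finally show ?thesis by (simp add: power2_eq_square)
qed

text \<open>Dual to the previous estimate: the squared Euclidean norm of \<open>w\<close> is the
  form of \<open>A x\<close> paired between \<open>B x *v w\<close> and \<open>w\<close>, and the
  Cauchy-Schwarz inequality of that form separates the two.\<close>

lemma norm_le_N:
  assumes "x \<in> cball 0 R"
  shows "norm w \<le> sqrt \<Lambda> * N x w"
proof (rule power2_le_imp_le)
  have "((norm w)\<^sup>2)\<^sup>2 \<le> ((A x *v (B x *v w)) \<bullet> (B x *v w)) * ((A x *v w) \<bullet> w)"
    using psd_form_Cauchy_Schwarz[OF symmetric[of x] A_psd[of x], of "B x *v w" w]
    by (simp add: A_B power2_norm_eq_inner)
  also have "\<dots> \<le> (N x w)\<^sup>2 * (\<Lambda> * (norm w)\<^sup>2)"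
    unfolding B_form[symmetric] N_square[symmetric]
    by (intro mult_left_mono A_form_le assms) simp
  finally have "(norm w)\<^sup>2 * ((norm w)\<^sup>2 - \<Lambda> * (N x w)\<^sup>2) \<le> 0"
    by (simp add: power2_eq_square algebra_simps)
  then have "(norm w)\<^sup>2 \<le> \<Lambda> * (N x w)\<^sup>2"
    using \<Lambda>_pos by (cases "w = 0") (auto simp: mult_le_0_iff)
  then show "(norm w)\<^sup>2 \<le> (sqrt \<Lambda> * N x w)\<^sup>2"
    using \<Lambda>_pos by (simp add: power_mult_distrib)
qed (use \<Lambda>_pos N_nonneg in auto)

text \<open>The distance of the matrices is measured in units of \<open>c\<close> so that
  ellipticity turns the absolute error into a relative one.\<close>

lemma A_form_compare:
  assumes "norm (A x - A y) \<le> \<delta> * c"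
  shows "(A y *v p) \<bullet> p \<le> (1 + \<delta>) * ((A x *v p) \<bullet> p)"
    and "(A y *v p) \<bullet> p \<ge> (1 - \<delta>) * ((A x *v p) \<bullet> p)"
proof -
  have \<delta>: "\<delta> \<ge> 0" using assms c_pos by (meson norm_ge_zero order_trans zero_le_mult_iff less_imp_le not_less)
  have "\<bar>((A x - A y) *v p) \<bullet> p\<bar> \<le> norm ((A x - A y) *v p) * norm p"
    by (rule Cauchy_Schwarz_ineq2)
  also have "\<dots> \<le> (norm (A x - A y) * norm p) * norm p"
    by (intro mult_right_mono norm_matrix_vector_mult_le norm_ge_zero)
  also have "\<dots> \<le> (\<delta> * c * norm p) * norm p"
    by (intro mult_right_mono assms norm_ge_zero)
  also have "\<dots> = \<delta> * (c * (norm p)\<^sup>2)" by (simp add: power2_eq_square)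
  also have "\<dots> \<le> \<delta> * ((A x *v p) \<bullet> p)" by (intro mult_left_mono elliptic \<delta>)
  finally have "\<bar>(A x *v p) \<bullet> p - (A y *v p) \<bullet> p\<bar> \<le> \<delta> * ((A x *v p) \<bullet> p)"
    by (simp add: matrix_vector_mult_diff_rdistrib inner_diff_left)
  then show "(A y *v p) \<bullet> p \<le> (1 + \<delta>) * ((A x *v p) \<bullet> p)"
    and "(A y *v p) \<bullet> p \<ge> (1 - \<delta>) * ((A x *v p) \<bullet> p)"
    by (auto simp: abs_le_iff algebra_simps)
qed

text \<open>Closeness passes from the matrices to their inverses by duality: with
  \<open>p = B x *v w\<close> and \<open>n\<close> the squared norm at \<open>x\<close>, the
  Cauchy-Schwarz inequality for \<open>A y\<close> bounds the square of \<open>n\<close> by the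
  squared norm at \<open>y\<close> times the form of \<open>A y\<close> at \<open>p\<close>, which
  is at most \<open>(1 + \<delta>) * n\<close>. The resulting factor \<open>1 + \<delta>\<close> for
  the squares is rounded up to its square.\<close>

lemma N_compare:
  assumes "norm (A x - A y) \<le> \<delta> * c" and "\<delta> \<ge> 0"
  shows "N x w \<le> (1 + \<delta>) * N y w"
proof -
  define p where "p = B x *v w"
  define n where "n = (N x w)\<^sup>2"
  have n: "n = (A x *v p) \<bullet> p" "n \<ge> 0" using N_square B_form A_psd by (auto simp: n_def p_def)
  have "n = (A y *v (B y *v w)) \<bullet> p"
    by (simp add: n_def N_square A_B p_def inner_commute)
  then have "n\<^sup>2 \<le> ((A y *v (B y *v w)) \<bullet> (B y *v w)) * ((A y *v p) \<bullet> p)"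
    using psd_form_Cauchy_Schwarz[OF symmetric[of y] A_psd[of y]] by simp
  also have "\<dots> \<le> (N y w)\<^sup>2 * ((1 + \<delta>) * n)"
    unfolding B_form[symmetric] N_square[symmetric] n(1)
    by (intro mult_left_mono A_form_compare assms(1)) simp
  finally have "n * (n - (1 + \<delta>) * (N y w)\<^sup>2) \<le> 0"
    by (simp add: power2_eq_square algebra_simps)
  then have "n \<le> (1 + \<delta>) * (N y w)\<^sup>2"
    using n(2) assms(2) by (cases "n = 0") (auto simp: mult_le_0_iff)
  also have "\<dots> \<le> (1 + \<delta>)\<^sup>2 * (N y w)\<^sup>2"
    using assms(2) by (intro mult_right_mono) (auto simp: power2_eq_square algebra_simps)
  finally have "(N x w)\<^sup>2 \<le> ((1 + \<delta>) * N y w)\<^sup>2"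
    unfolding n_def power_mult_distrib .
  then show ?thesis by (rule power2_le_imp_le) (use assms(2) N_nonneg in simp)
qed

lemma coefficients_close:
  assumes "\<delta> > 0"
  obtains \<rho> where "\<rho> > 0"
    "\<And>x y. \<lbrakk>x \<in> cball 0 R; y \<in> cball 0 R; norm (y - x) < \<rho>\<rbrakk> \<Longrightarrow> norm (A x - A y) \<le> \<delta> * c"
proof -
  have "uniformly_continuous_on (cball 0 R) A"
    by (rule compact_uniformly_continuous[OF continuous_on_subset[OF continuous]]) auto
  then obtain \<rho> where "\<rho> > 0" "\<And>x y. \<lbrakk>x \<in> cball 0 R; y \<in> cball 0 R; dist y x < \<rho>\<rbrakk> \<Longrightarrow> dist (A y) (A x) < \<delta> * c"
    unfolding uniformly_continuous_on_def using assms c_pos by (metis mult_pos_pos)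
  then show thesis
    by (intro that[of \<rho>]) (auto simp: dist_norm norm_minus_commute less_imp_le)
qed

lemma continuous_on_N:
  assumes "continuous_on S g"
  shows "continuous_on S (\<lambda>y. N x (g y))"
proof -
  have "continuous_on S (\<lambda>y. B x *v g y)"
    by (rule continuous_on_compose2[OF linear_continuous_on[OF matrix_vector_mul_bounded_linear] assms subset_UNIV])
  then show ?thesis unfolding norm_A_def
    by (intro continuous_on_real_sqrt continuous_on_inner assms)
qed

lemma trace_A_B_le:
  assumes "y \<in> cball 0 R"
  shows "trace (A y ** B x) \<le> real CARD('n) * \<Lambda> / c"
proof -
  obtain b :: "'n \<Rightarrow> real^'n" where b: "\<And>i j. A y $ i $ j = (\<Sum>k\<in>UNIV. b k $ i * b k $ j)"
    using symmetric_psd_decomposition[OF symmetric[of y] A_psd] by metis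
  have "trace (A y ** B x) = (\<Sum>k\<in>UNIV. (N x (b k))\<^sup>2)"
    unfolding N_square by (rule trace_mult_decomposition[of "A y" b, OF b])
  also have "\<dots> \<le> (\<Sum>k\<in>UNIV. (norm (b k))\<^sup>2 / c)"
    by (intro sum_mono N_square_le)
  also have "\<dots> = trace (A y) / c"
    by (simp add: trace_decomposition[of "A y" b, OF b] sum_divide_distrib)
  also have "trace (A y) \<le> (\<Sum>i\<in>(UNIV::'n set). \<Lambda>)"
    unfolding trace_def
  proof (rule sum_mono)
    fix i
    have "A y $ i $ i \<le> norm (A y $ i $ i)" by simp
    also have "\<dots> \<le> norm (A y $ i)" by (rule Finite_Cartesian_Product.norm_nth_le)
    also have "\<dots> \<le> norm (A y)" by (rule Finite_Cartesian_Product.norm_nth_le)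
    finally show "A y $ i $ i \<le> \<Lambda>" using bound[OF assms] by simp
  qed
  finally show ?thesis using c_pos by (simp add: divide_right_mono)
qed

section \<open>The resolvent equation: maximum principle and barrier steps\<close>

definition resolvent_solution :: "real \<Rightarrow> (real^'n \<Rightarrow> real) \<Rightarrow> bool" where
  "resolvent_solution \<epsilon> v \<longleftrightarrow>
     twice_differentiable_on v \<Omega> \<and> continuous_on (closure \<Omega>) v \<and>
     (\<forall>y\<in>\<Omega>. \<epsilon>\<^sup>2 * trace (A y ** hessian v y) = v y)"

lemma compact_closure_domain: "compact (closure \<Omega>)"
proof -
  have "bounded (closure \<Omega>)" using domain_subset bounded_subset bounded_ball by blast
  then show ?thesis by (simp add: compact_eq_bounded_closed)
qed

lemma closure_in_cball: "x \<in> closure \<Omega> \<Longrightarrow> x \<in> cball 0 R"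
  by (rule subsetD[OF ball_subset_cball subsetD[OF domain_subset]])

lemma frontier_eq: "frontier \<Omega> = closure \<Omega> - \<Omega>"
  by (simp add: frontier_def open_domain interior_open)

text \<open>The barrier estimate with amplitude \<open>0\<close>; the smoothing constant
  \<open>1\<close> only keeps the root positive.\<close>

lemma trace_hessian_sign_at_min:
  assumes "twice_differentiable_on v \<Omega>" "x \<in> \<Omega>"
    and "\<And>y. y \<in> \<Omega> \<Longrightarrow> a * v x \<le> a * v y"
  shows "a * trace (A x ** hessian v x) \<ge> 0"
proof -
  have "eventually (\<lambda>y. y \<in> \<Omega>) (nhds x)"
    using open_domain assms(2) by (rule eventually_nhds_in_open)
  then have "\<forall>\<^sub>F y in nhds x. a * v x - 0 * exp (0 * sqrt ((B x *v (x - x)) \<bullet> (x - x) + 1))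
                 \<le> a * v y - 0 * exp (0 * sqrt ((B x *v (y - x)) \<bullet> (y - x) + 1))"
    by (rule eventually_mono) (use assms(3) in auto)
  from trace_hessian_ge_barrier[OF symmetric[of x] A_psd symmetric_B open_domain assms(1,2) _ this]
  show ?thesis by simp
qed

text \<open>At an interior maximum of \<open>a * v\<close> the trace of \<open>a\<close> times the
  Hessian term is nonpositive, but by the equation it is a positive multiple of
  \<open>a * v\<close>; so a value above \<open>m \<ge> 0\<close> can only be attained on the
  frontier. The factor \<open>a\<close> covers upper and lower bounds at once.\<close>

lemma resolvent_solution_maximum_principle:
  assumes "resolvent_solution \<epsilon> v" "\<epsilon> > 0"
    and "\<And>y. y \<in> frontier \<Omega> \<Longrightarrow> a * v y \<le> m" "m \<ge> 0" "x \<in> closure \<Omega>"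
  shows "a * v x \<le> m"
proof (rule ccontr)
  assume neg: "\<not> a * v x \<le> m"
  have "continuous_on (closure \<Omega>) (\<lambda>y. a * v y)"
    using assms(1) by (auto simp: resolvent_solution_def intro!: continuous_intros)
  then obtain y where y: "y \<in> closure \<Omega>" "\<And>z. z \<in> closure \<Omega> \<Longrightarrow> a * v z \<le> a * v y"
    using continuous_attains_sup[OF compact_closure_domain] assms(5) by (metis empty_iff)
  have gt: "a * v y > m" using y(2)[OF assms(5)] neg by simp
  have "y \<in> \<Omega>" using gt assms(3)[of y] y(1) frontier_eq by force
  have "(- a) * trace (A y ** hessian v y) \<ge> 0"
    using assms(1) y(2) closure_subset \<open>y \<in> \<Omega>\<close>
    by (intro trace_hessian_sign_at_min) (auto simp: resolvent_solution_def)
  then have "\<epsilon>\<^sup>2 * (a * trace (A y ** hessian v y)) \<le> 0"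
    by (intro mult_nonneg_nonpos[OF zero_le_power2]) simp
  moreover have "\<epsilon>\<^sup>2 * trace (A y ** hessian v y) = v y"
    using assms(1) \<open>y \<in> \<Omega>\<close> by (simp add: resolvent_solution_def)
  ultimately have "a * v y \<le> 0" by (simp add: mult.left_commute)
  then show False using gt assms(4) by simp
qed

lemma near_in_N_ball:
  assumes "\<delta> > 0"
  obtains \<rho> where "\<rho> > 0"
    "\<And>x y r. \<lbrakk>x \<in> cball 0 R; y \<in> cball 0 R; N x (y - x) \<le> r; r < \<rho>\<rbrakk> \<Longrightarrow> norm (A x - A y) \<le> \<delta> * c"
proof -
  obtain \<rho> where \<rho>: "\<rho> > 0"
    "\<And>x y. \<lbrakk>x \<in> cball 0 R; y \<in> cball 0 R; norm (y - x) < \<rho>\<rbrakk> \<Longrightarrow> norm (A x - A y) \<le> \<delta> * c"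
    using coefficients_close[OF assms] by blast
  have s: "sqrt \<Lambda> > 0" using \<Lambda>_pos by simp
  show thesis
  proof (rule that[of "\<rho> / sqrt \<Lambda>"])
    show "\<rho> / sqrt \<Lambda> > 0" using \<rho>(1) s by simp
    fix x y r assume a: "x \<in> cball 0 R" "y \<in> cball 0 R" "N x (y - x) \<le> r" "r < \<rho> / sqrt \<Lambda>"
    have "norm (y - x) \<le> sqrt \<Lambda> * N x (y - x)" by (rule norm_le_N[OF a(1)])
    also have "\<dots> \<le> sqrt \<Lambda> * r" using a(3) s by (intro mult_left_mono) auto
    also have "\<dots> < \<rho>" using a(4) s by (simp add: pos_less_divide_eq mult.commute)
    finally show "norm (A x - A y) \<le> \<delta> * c" using \<rho>(2) a by blast
  qed
qed

definition trace_bound where "trace_bound = real CARD('n) * \<Lambda> / c"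

lemma trace_bound_pos: "trace_bound > 0"
  using \<Lambda>_pos c_pos by (simp add: trace_bound_def)

lemma trace_A_B_nonneg: "trace (A y ** B x) \<ge> 0"
proof -
  obtain b :: "'n \<Rightarrow> real^'n" where b: "\<And>i j. A y $ i $ j = (\<Sum>k\<in>UNIV. b k $ i * b k $ j)"
    using symmetric_psd_decomposition[OF symmetric[of y] A_psd] by metis
  show ?thesis
    unfolding trace_mult_decomposition[of "A y" b, OF b] by (intro sum_nonneg B_psd)
qed

lemma barrier_form_bounds:
  assumes "x \<in> cball 0 R" "y \<in> cball 0 R" "norm (A x - A y) \<le> \<delta> * c"
  defines "P \<equiv> (A y *v (B x *v (y - x))) \<bullet> (B x *v (y - x))"
  shows "0 \<le> P" "P \<le> (1 + \<delta>) * (N x (y - x))\<^sup>2" "(1 - \<delta>) * (N x (y - x))\<^sup>2 \<le> P"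
  using A_psd A_form_compare[OF assms(3), of "B x *v (y - x)"]
  unfolding P_def N_square B_form[of x "y - x"] by blast+

lemma resolvent_solution_trace_ge_barrier:
  assumes v: "resolvent_solution \<epsilon> v" and "y \<in> \<Omega>"
    and pos: "(N x (y - x))\<^sup>2 + \<kappa> > 0"
    and min: "\<forall>\<^sub>F z in nhds y. a * v y - C * exp (\<sigma> * sqrt ((N x (y - x))\<^sup>2 + \<kappa>))
                 \<le> a * v z - C * exp (\<sigma> * sqrt ((N x (z - x))\<^sup>2 + \<kappa>))"
  defines "\<phi> \<equiv> sqrt ((N x (y - x))\<^sup>2 + \<kappa>)"
    and "P \<equiv> (A y *v (B x *v (y - x))) \<bullet> (B x *v (y - x))"
  shows "a * v y \<ge>
     \<epsilon>\<^sup>2 * (C * exp (\<sigma> * \<phi>) * (\<sigma> * (trace (A y ** B x) / \<phi> - P / \<phi> ^ 3) + \<sigma>\<^sup>2 * (P / \<phi>\<^sup>2)))"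
proof -
  have "C * exp (\<sigma> * \<phi>) * (\<sigma> * (trace (A y ** B x) / \<phi> - P / \<phi> ^ 3) + \<sigma>\<^sup>2 * (P / \<phi>\<^sup>2))
      \<le> a * trace (A y ** hessian v y)"
    using trace_hessian_ge_barrier[OF symmetric[of y] A_psd symmetric_B[of x] open_domain _ \<open>y \<in> \<Omega>\<close>
        pos[unfolded N_square] min[unfolded N_square]] v
    unfolding \<phi>_def P_def N_square resolvent_solution_def by blast
  then have "\<epsilon>\<^sup>2 * (C * exp (\<sigma> * \<phi>) * (\<sigma> * (trace (A y ** B x) / \<phi> - P / \<phi> ^ 3) + \<sigma>\<^sup>2 * (P / \<phi>\<^sup>2)))
      \<le> \<epsilon>\<^sup>2 * (a * trace (A y ** hessian v y))"
    by (rule mult_left_mono) simp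
  also have "\<dots> = a * v y"
    using v \<open>y \<in> \<Omega>\<close> unfolding resolvent_solution_def by (metis mult.left_commute)
  finally show ?thesis .
qed

lemma compact_N_ball: "compact {y \<in> closure \<Omega>. N x (y - x) \<le> r}"
proof -
  have "closed {y. N x (y - x) \<le> r}"
    by (intro closed_Collect_le continuous_on_N continuous_intros)
  then have "compact (closure \<Omega> \<inter> {y. N x (y - x) \<le> r})"
    by (rule compact_Int_closed[OF compact_closure_domain])
  then show ?thesis by (simp add: Int_def)
qed

lemma eventually_N_less:
  assumes "y \<in> \<Omega>" "N x (y - x) < r"
  shows "\<forall>\<^sub>F z in nhds y. z \<in> \<Omega> \<and> N x (z - x) < r"
proof -
  have "open {z. N x (z - x) < r}"
    by (intro open_Collect_less continuous_on_N continuous_intros)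
  then have "eventually (\<lambda>z. z \<in> {z. N x (z - x) < r}) (nhds y)"
    using assms by (intro eventually_nhds_in_open) auto
  with eventually_nhds_in_open[OF open_domain assms(1)] show ?thesis
    by eventually_elim auto
qed

text \<open>The barrier \<open>b\<close> is at least \<open>m\<close> on the sphere of radius
  \<open>r\<close>, nonnegative on the frontier, and a supersolution inside, so \<open>v\<close>
  cannot exceed it; its value at the centre is the gain. It has to be smooth at the centre because
  the maximum of \<open>v - b\<close> may occur there. That maximum is fed to the minimum criterion
  with \<open>a = -1\<close> and the amplitude negated. The threshold \<open>\<epsilon>0\<close>
  depends on \<open>r\<close> but not on \<open>x\<close>, \<open>v\<close> or \<open>m\<close>,
  which is what makes the step iterable.\<close>

lemma upper_barrier_step:
  assumes \<delta>: "0 < \<delta>" "\<delta> < 1"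
  obtains \<rho> where "\<rho> > 0"
    "\<And>r. \<lbrakk>0 < r; r < \<rho>\<rbrakk> \<Longrightarrow> \<exists>\<epsilon>0>0. \<forall>\<epsilon> v m x. 0 < \<epsilon> \<longrightarrow> \<epsilon> < \<epsilon>0 \<longrightarrow> resolvent_solution \<epsilon> v \<longrightarrow>
        x \<in> closure \<Omega> \<longrightarrow> m \<ge> 0 \<longrightarrow>
        (\<forall>y\<in>closure \<Omega>. N x (y - x) \<le> r \<longrightarrow> v y \<le> m) \<longrightarrow>
        (\<forall>y\<in>frontier \<Omega>. N x (y - x) \<le> r \<longrightarrow> v y \<le> 0) \<longrightarrow>
        v x \<le> m * exp (- (1 - \<delta>) * r / \<epsilon>)"
proof -
  have "\<delta> / 2 > 0" using \<delta> by simp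
  from near_in_N_ball[OF this] obtain \<rho> where \<rho>: "\<rho> > 0"
    "\<And>x y r. \<lbrakk>x \<in> cball 0 R; y \<in> cball 0 R; N x (y - x) \<le> r; r < \<rho>\<rbrakk> \<Longrightarrow> norm (A x - A y) \<le> \<delta> / 2 * c"
    by blast
  show thesis
  proof (rule that[OF \<rho>(1)])
    fix r assume r: "0 < r" "r < \<rho>"
    \<comment> \<open>Smoothing radius. It costs a factor \<open>1 - \<delta> / 2\<close> in the
      exponent at the centre, and it bounds \<open>\<phi>\<close> away from zero in the curvature
      term.\<close>
    define k where "k = \<delta> / 2 * r"
    have k: "k > 0" using \<delta> r by (simp add: k_def)
    \<comment> \<open>Below this threshold the curvature term is at most
      \<open>\<delta> / 2\<close>.\<close>
    define \<epsilon>0 where "\<epsilon>0 = \<delta> / 2 * k / trace_bound"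
    have \<epsilon>0: "\<epsilon>0 > 0" using \<delta> k trace_bound_pos by (simp add: \<epsilon>0_def)
    have step: "v x \<le> m * exp (- (1 - \<delta>) * r / \<epsilon>)"
      if \<epsilon>: "0 < \<epsilon>" "\<epsilon> < \<epsilon>0" and v: "resolvent_solution \<epsilon> v" and x: "x \<in> closure \<Omega>" and m: "m \<ge> 0"
        and vm: "\<And>y. y \<in> closure \<Omega> \<Longrightarrow> N x (y - x) \<le> r \<Longrightarrow> v y \<le> m"
        and v0: "\<And>y. y \<in> frontier \<Omega> \<Longrightarrow> N x (y - x) \<le> r \<Longrightarrow> v y \<le> 0" for \<epsilon> v m x
    proof -
      \<comment> \<open>The slope is reduced just enough that \<open>s2\<close>, which includes the
        freezing error, leaves room \<open>\<delta> / 2\<close> for the curvature term, while the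
        product of both losses stays above \<open>1 - \<delta>\<close>.\<close>
      define s where "s = 1 - \<delta> / 2"
      define \<sigma> where "\<sigma> = s / \<epsilon>"
      have s: "0 < s" "s < 1" "s * (1 - \<delta> / 2) \<ge> 1 - \<delta>" and s2: "s\<^sup>2 * (1 + \<delta> / 2) \<le> 1 - \<delta> / 2"
        using \<delta> by (auto simp: s_def power2_eq_square algebra_simps)
      have \<sigma>: "\<sigma> > 0" using s \<epsilon> by (simp add: \<sigma>_def)
      define \<phi> where "\<phi> = (\<lambda>y. sqrt ((N x (y - x))\<^sup>2 + k\<^sup>2))"
      define C where "C = m * exp (- \<sigma> * r)"
      define b where "b = (\<lambda>y. C * exp (\<sigma> * \<phi> y))"
      have C: "C \<ge> 0" using m by (simp add: C_def)
      have b0: "b y \<ge> 0" for y using C by (simp add: b_def)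
      have \<phi>_ge: "\<phi> y \<ge> N x (y - x)" "\<phi> y \<ge> k" for y
        unfolding \<phi>_def by (auto intro: real_le_rsqrt)
      have "v x \<le> b x"
      proof (rule ccontr)
        assume gt: "\<not> v x \<le> b x"
        let ?Q = "{y \<in> closure \<Omega>. N x (y - x) \<le> r}"
        have cont: "continuous_on ?Q (\<lambda>y. v y - b y)"
          unfolding b_def \<phi>_def using v continuous_on_subset[of "closure \<Omega>" v ?Q]
          by (auto simp: resolvent_solution_def intro!: continuous_intros continuous_on_N)
        have xQ: "x \<in> ?Q" using x r by simp
        then have "?Q \<noteq> {}" by blast
        from continuous_attains_sup[OF compact_N_ball this cont]
        obtain y where y: "y \<in> ?Q" "\<And>z. z \<in> ?Q \<Longrightarrow> v z - b z \<le> v y - b y"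
          by blast
        have gty: "v y > b y" using y(2)[OF xQ] gt by simp
        have "y \<notin> frontier \<Omega>" using v0[of y] y(1) b0[of y] gty by force
        then have y\<Omega>: "y \<in> \<Omega>" using y(1) frontier_eq by blast
        have Nr: "N x (y - x) < r"
        proof (rule ccontr)
          assume "\<not> N x (y - x) < r"
          then have "\<phi> y \<ge> r" using \<phi>_ge(1)[of y] by simp
          then have "\<sigma> * \<phi> y \<ge> \<sigma> * r" using \<sigma> by simp
          then have "exp (- \<sigma> * r) * exp (\<sigma> * \<phi> y) \<ge> 1"
            by (simp add: exp_add[symmetric])
          then have "b y \<ge> m"
            using mult_left_mono[OF _ m] by (fastforce simp: b_def C_def mult.assoc)
          then show False using vm[of y] y(1) gty by simp
        qed
        have "\<forall>\<^sub>F z in nhds y. -1 * v y - (- C) * exp (\<sigma> * sqrt ((N x (y - x))\<^sup>2 + k\<^sup>2))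
                 \<le> -1 * v z - (- C) * exp (\<sigma> * sqrt ((N x (z - x))\<^sup>2 + k\<^sup>2))"
          using eventually_N_less[OF y\<Omega> Nr]
        proof eventually_elim
          case (elim z)
          then have "z \<in> ?Q" using closure_subset by auto
          from y(2)[OF this] show ?case by (simp add: b_def \<phi>_def)
        qed
        note ev = this
        have "(N x (y - x))\<^sup>2 + k\<^sup>2 > 0" using k by (simp add: add_nonneg_pos)
        note bar = resolvent_solution_trace_ge_barrier[OF v y\<Omega> this ev]
        have \<phi>eq: "sqrt ((N x (y - x))\<^sup>2 + k\<^sup>2) = \<phi> y" by (simp add: \<phi>_def)
        have main: "v y \<le> b y * (\<epsilon>\<^sup>2 * (\<sigma> * (trace (A y ** B x) / \<phi> y -
              (A y *v (B x *v (y - x))) \<bullet> (B x *v (y - x)) / \<phi> y ^ 3) + \<sigma>\<^sup>2 *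
              ((A y *v (B x *v (y - x))) \<bullet> (B x *v (y - x)) / (\<phi> y)\<^sup>2)))"
          using bar unfolding \<phi>eq b_def by (simp add: mult_ac)
        have yR: "y \<in> cball 0 R" and xR: "x \<in> cball 0 R" using y(1) x closure_in_cball by auto
        define P where "P = (A y *v (B x *v (y - x))) \<bullet> (B x *v (y - x))"
        have "norm (A x - A y) \<le> \<delta> / 2 * c" using \<rho>(2) xR yR y(1) r by blast
        from barrier_form_bounds[OF xR yR this] have P: "0 \<le> P" "P \<le> (1 + \<delta> / 2) * (N x (y - x))\<^sup>2"
          by (auto simp: P_def)
        have \<phi>y: "\<phi> y > 0" "(N x (y - x))\<^sup>2 \<le> (\<phi> y)\<^sup>2"
          using \<phi>_ge[of y] k N_nonneg by (auto intro: power_mono)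
        have 1: "\<sigma> * (trace (A y ** B x) / \<phi> y - P / \<phi> y ^ 3) \<le> \<sigma> * (trace_bound / k)"
        proof (rule mult_left_mono)
          have "trace (A y ** B x) / \<phi> y \<le> trace_bound / k"
            using trace_A_B_le[OF yR, of x] trace_A_B_nonneg \<phi>_ge(2)[of y] k trace_bound_pos
            by (intro frac_le) (auto simp: trace_bound_def)
          moreover have "P / \<phi> y ^ 3 \<ge> 0" using P \<phi>y by simp
          ultimately show "trace (A y ** B x) / \<phi> y - P / \<phi> y ^ 3 \<le> trace_bound / k" by simp
        qed (use \<sigma> in simp)
        have "P \<le> (1 + \<delta> / 2) * (\<phi> y)\<^sup>2"
          using P(2) mult_left_mono[OF \<phi>y(2), of "1 + \<delta> / 2"] \<delta> by linarith
        then have "P / (\<phi> y)\<^sup>2 \<le> 1 + \<delta> / 2" using \<phi>y(1) by (simp add: pos_divide_le_eq)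
        then have 2: "\<sigma>\<^sup>2 * (P / (\<phi> y)\<^sup>2) \<le> \<sigma>\<^sup>2 * (1 + \<delta> / 2)" by (rule mult_left_mono) simp
        have "\<epsilon>\<^sup>2 * (\<sigma> * (trace (A y ** B x) / \<phi> y - P / \<phi> y ^ 3) + \<sigma>\<^sup>2 * (P / (\<phi> y)\<^sup>2))
            \<le> \<epsilon>\<^sup>2 * (\<sigma> * (trace_bound / k) + \<sigma>\<^sup>2 * (1 + \<delta> / 2))"
          by (rule mult_left_mono[OF add_mono[OF 1 2] zero_le_power2])
        also have "\<dots> = s * (\<epsilon> * trace_bound / k) + s\<^sup>2 * (1 + \<delta> / 2)"
          using \<epsilon> by (simp add: \<sigma>_def power2_eq_square field_simps)
        also have "\<dots> \<le> 1"
        proof -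
          have "\<epsilon> * trace_bound / k \<le> \<delta> / 2"
            using \<epsilon>(2) trace_bound_pos k by (simp add: \<epsilon>0_def field_simps)
          moreover have "0 \<le> \<epsilon> * trace_bound / k" using \<epsilon>(1) trace_bound_pos k by simp
          ultimately have "s * (\<epsilon> * trace_bound / k) \<le> 1 * (\<delta> / 2)"
            using s by (intro mult_mono) auto
          then show ?thesis using s2 by linarith
        qed
        finally have "b y * (\<epsilon>\<^sup>2 * (\<sigma> * (trace (A y ** B x) / \<phi> y - P / \<phi> y ^ 3) + \<sigma>\<^sup>2 * (P / (\<phi> y)\<^sup>2))) \<le> b y"
          using mult_left_mono[OF _ b0[of y]] by fastforce
        then show False using main gty unfolding P_def by linarith
      qed
      also have "b x = m * exp (- (s * (1 - \<delta> / 2)) * r / \<epsilon>)"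
      proof -
        have "\<phi> x = k" using k by (simp add: \<phi>_def)
        then have "b x = m * exp (- \<sigma> * r + \<sigma> * k)" unfolding b_def C_def by (simp only: exp_add mult.assoc)
        also have "- \<sigma> * r + \<sigma> * k = - (s * (1 - \<delta> / 2)) * r / \<epsilon>"
          using \<epsilon>(1) by (simp add: \<sigma>_def k_def diff_divide_distrib right_diff_distrib left_diff_distrib mult_ac)
        finally show ?thesis .
      qed
      also have "\<dots> \<le> m * exp (- (1 - \<delta>) * r / \<epsilon>)"
      proof (intro mult_left_mono m)
        have "(1 - \<delta>) * r / \<epsilon> \<le> s * (1 - \<delta> / 2) * r / \<epsilon>"
          using s(3) r \<epsilon> by (intro divide_right_mono mult_right_mono) auto
        then show "exp (- (s * (1 - \<delta> / 2)) * r / \<epsilon>) \<le> exp (- (1 - \<delta>) * r / \<epsilon>)"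
          by (simp only: exp_le_cancel_iff mult_minus_left minus_divide_left[symmetric] neg_le_iff_le)
      qed
      finally show ?thesis .
    qed
    show "\<exists>\<epsilon>0>0. \<forall>\<epsilon> v m x. 0 < \<epsilon> \<longrightarrow> \<epsilon> < \<epsilon>0 \<longrightarrow> resolvent_solution \<epsilon> v \<longrightarrow>
        x \<in> closure \<Omega> \<longrightarrow> m \<ge> 0 \<longrightarrow>
        (\<forall>y\<in>closure \<Omega>. N x (y - x) \<le> r \<longrightarrow> v y \<le> m) \<longrightarrow>
        (\<forall>y\<in>frontier \<Omega>. N x (y - x) \<le> r \<longrightarrow> v y \<le> 0) \<longrightarrow>
        v x \<le> m * exp (- (1 - \<delta>) * r / \<epsilon>)"
      by (intro exI[of _ \<epsilon>0] conjI allI impI ballI \<epsilon>0) (rule step; (assumption | blast))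
  qed
qed

lemma lower_barrier_step:
  assumes \<delta>: "0 < \<delta>" "\<delta> < 1"
  obtains \<rho> where "\<rho> > 0"
    "\<And>r \<kappa>. \<lbrakk>0 < \<kappa>; \<kappa> < r; r < \<rho>\<rbrakk> \<Longrightarrow> \<exists>\<epsilon>0>0. \<forall>\<epsilon> v m x. 0 < \<epsilon> \<longrightarrow> \<epsilon> < \<epsilon>0 \<longrightarrow> resolvent_solution \<epsilon> v \<longrightarrow>
        x \<in> cball 0 R \<longrightarrow> m \<ge> 0 \<longrightarrow>
        (\<forall>y\<in>closure \<Omega>. v y \<ge> 0) \<longrightarrow>
        (\<forall>y\<in>closure \<Omega>. N x (y - x) \<le> \<kappa> \<longrightarrow> v y \<ge> m) \<longrightarrow>
        (\<forall>y\<in>frontier \<Omega>. N x (y - x) \<le> r \<longrightarrow> v y \<ge> m) \<longrightarrow>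
        (\<forall>y\<in>closure \<Omega>. N x (y - x) \<le> r \<longrightarrow>
           v y \<ge> m * (exp (- (1 + \<delta>) * N x (y - x) / \<epsilon>) - exp (- (1 + \<delta>) * r / \<epsilon>)))"
proof -
  have "\<delta> / 2 > 0" using \<delta> by simp
  from near_in_N_ball[OF this] obtain \<rho> where \<rho>: "\<rho> > 0"
    "\<And>x y r. \<lbrakk>x \<in> cball 0 R; y \<in> cball 0 R; N x (y - x) \<le> r; r < \<rho>\<rbrakk> \<Longrightarrow> norm (A x - A y) \<le> \<delta> / 2 * c"
    by blast
  show thesis
  proof (rule that[OF \<rho>(1)])
    fix r \<kappa> :: real assume r: "0 < \<kappa>" "\<kappa> < r" "r < \<rho>"
    \<comment> \<open>At a touching point the metric distance to the centre exceeds
      \<open>\<kappa>\<close> and \<open>s < 2\<close>, so the curvature term is at most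
      \<open>\<delta>\<close>.\<close>
    define \<epsilon>0 where "\<epsilon>0 = \<delta> * \<kappa> / (2 * trace_bound)"
    have \<epsilon>0: "\<epsilon>0 > 0" using \<delta> r trace_bound_pos by (simp add: \<epsilon>0_def)
    have step: "v w \<ge> m * (exp (- (1 + \<delta>) * N x (w - x) / \<epsilon>) - exp (- (1 + \<delta>) * r / \<epsilon>))"
      if \<epsilon>: "0 < \<epsilon>" "\<epsilon> < \<epsilon>0" and v: "resolvent_solution \<epsilon> v" and xR: "x \<in> cball 0 R" and m: "m \<ge> 0"
        and v0: "\<And>y. y \<in> closure \<Omega> \<Longrightarrow> v y \<ge> 0"
        and vi: "\<And>y. y \<in> closure \<Omega> \<Longrightarrow> N x (y - x) \<le> \<kappa> \<Longrightarrow> v y \<ge> m"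
        and vf: "\<And>y. y \<in> frontier \<Omega> \<Longrightarrow> N x (y - x) \<le> r \<Longrightarrow> v y \<ge> m"
        and w: "w \<in> closure \<Omega>" "N x (w - x) \<le> r" for \<epsilon> v m x w
    proof -
      define s where "s = 1 + \<delta>"
      define \<sigma> where "\<sigma> = - s / \<epsilon>"
      have s: "0 < s" "s < 2" using \<delta> by (auto simp: s_def)
      \<comment> \<open>The left side equals \<open>1 + 3/2 * \<delta> - \<delta> ^ 3 / 2\<close>;
        since \<open>\<delta> < 1\<close> it exceeds \<open>1\<close> by the \<open>\<delta>\<close>
        that the curvature term may consume.\<close>
      have s2: "s\<^sup>2 * (1 - \<delta> / 2) \<ge> 1 + \<delta>"
      proof -
        have "\<delta> * \<delta> \<le> \<delta> * 1" using \<delta> by (intro mult_left_mono) auto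
        then have "\<delta> * (\<delta> * \<delta>) \<le> \<delta> * 1" using \<delta> by (intro mult_left_mono) linarith+
        then show ?thesis by (simp add: s_def power2_eq_square algebra_simps)
      qed
      have \<sigma>: "\<sigma> < 0" using s \<epsilon> by (simp add: \<sigma>_def)
      define \<phi> where "\<phi> = (\<lambda>y. N x (y - x))"
      define b where "b = (\<lambda>y. m * exp (\<sigma> * \<phi> y))"
      define e where "e = m * exp (\<sigma> * r)"
      have e0: "e \<ge> 0" and b0: "\<And>y. b y \<ge> 0" using m by (auto simp: e_def b_def)
      have bm: "b y \<le> m" for y
      proof -
        have "\<sigma> * \<phi> y \<le> 0" using \<sigma> N_nonneg by (simp add: \<phi>_def mult_nonpos_nonneg)
        then show ?thesis using mult_left_mono[OF _ m, of "exp (\<sigma> * \<phi> y)" 1] by (simp add: b_def)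
      qed
      have "v w \<ge> b w - e"
      proof (rule ccontr)
        assume gt: "\<not> v w \<ge> b w - e"
        let ?Q = "{y \<in> closure \<Omega>. N x (y - x) \<le> r}"
        have cont: "continuous_on ?Q (\<lambda>y. v y - b y)"
          unfolding b_def \<phi>_def using v continuous_on_subset[of "closure \<Omega>" v ?Q]
          by (auto simp: resolvent_solution_def intro!: continuous_intros continuous_on_N)
        have wQ: "w \<in> ?Q" using w by simp
        then have "?Q \<noteq> {}" by blast
        from continuous_attains_inf[OF compact_N_ball this cont]
        obtain y where y: "y \<in> ?Q" "\<And>z. z \<in> ?Q \<Longrightarrow> v y - b y \<le> v z - b z"
          by blast
        have gty: "v y < b y - e" using y(2)[OF wQ] gt by simp
        have "y \<notin> frontier \<Omega>" using vf[of y] y(1) bm[of y] e0 gty by force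
        then have y\<Omega>: "y \<in> \<Omega>" using y(1) frontier_eq by blast
        have Nk: "\<phi> y > \<kappa>" using vi[of y] y(1) bm[of y] e0 gty unfolding \<phi>_def by force
        have Nr: "N x (y - x) < r"
        proof (rule ccontr)
          assume "\<not> N x (y - x) < r"
          then have "\<phi> y = r" using y(1) by (simp add: \<phi>_def)
          then have "b y = e" by (simp add: b_def e_def)
          then show False using v0[of y] y(1) gty by simp
        qed
        have sq: "sqrt ((N x z)\<^sup>2 + 0) = N x z" for z using N_nonneg by simp
        have ev: "\<forall>\<^sub>F z in nhds y. 1 * v y - m * exp (\<sigma> * sqrt ((N x (y - x))\<^sup>2 + 0))
                 \<le> 1 * v z - m * exp (\<sigma> * sqrt ((N x (z - x))\<^sup>2 + 0))"
          using eventually_N_less[OF y\<Omega> Nr]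
        proof eventually_elim
          case (elim z)
          then have "z \<in> ?Q" using closure_subset by auto
          from y(2)[OF this] show ?case unfolding sq by (simp add: b_def \<phi>_def)
        qed
        have \<phi>y: "\<phi> y > 0" using Nk r by simp
        define P where "P = (A y *v (B x *v (y - x))) \<bullet> (B x *v (y - x))"
        have "(N x (y - x))\<^sup>2 + 0 > 0" using \<phi>y by (simp add: \<phi>_def)
        note bar = resolvent_solution_trace_ge_barrier[OF v y\<Omega> this ev]
        have \<phi>eq: "N x (y - x) = \<phi> y" by (simp add: \<phi>_def)
        have main: "v y \<ge> b y * (\<epsilon>\<^sup>2 * (\<sigma> * (trace (A y ** B x) / \<phi> y - P / \<phi> y ^ 3) + \<sigma>\<^sup>2 * (P / (\<phi> y)\<^sup>2)))"
          using bar \<phi>y unfolding sq P_def[symmetric] \<phi>eq b_def by (simp add: mult_ac)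
        have yR: "y \<in> cball 0 R" using y(1) closure_in_cball by auto
        have "norm (A x - A y) \<le> \<delta> / 2 * c" using \<rho>(2) xR yR y(1) r by blast
        from barrier_form_bounds[OF xR yR this] have P: "0 \<le> P" "P \<ge> (1 - \<delta> / 2) * (\<phi> y)\<^sup>2"
          by (auto simp: P_def \<phi>_def)
        have 1: "\<sigma> * (trace (A y ** B x) / \<phi> y - P / \<phi> y ^ 3) \<ge> \<sigma> * (trace_bound / \<kappa>)"
        proof (rule mult_left_mono_neg)
          have "trace (A y ** B x) / \<phi> y \<le> trace_bound / \<kappa>"
            using trace_A_B_le[OF yR, of x] trace_A_B_nonneg Nk r trace_bound_pos
            by (intro frac_le) (auto simp: trace_bound_def)
          moreover have "P / \<phi> y ^ 3 \<ge> 0" using P \<phi>y by simp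
          ultimately show "trace (A y ** B x) / \<phi> y - P / \<phi> y ^ 3 \<le> trace_bound / \<kappa>" by simp
        qed (use \<sigma> in simp)
        have "P / (\<phi> y)\<^sup>2 \<ge> 1 - \<delta> / 2" using \<phi>y(1) P(2) by (simp add: pos_le_divide_eq)
        then have 2: "\<sigma>\<^sup>2 * (P / (\<phi> y)\<^sup>2) \<ge> \<sigma>\<^sup>2 * (1 - \<delta> / 2)" by (rule mult_left_mono) simp
        have "1 \<le> - s * (\<epsilon> * trace_bound / \<kappa>) + s\<^sup>2 * (1 - \<delta> / 2)"
        proof -
          have "\<epsilon> * trace_bound / \<kappa> \<le> \<delta> / 2"
            using \<epsilon>(2) trace_bound_pos r by (simp add: \<epsilon>0_def field_simps)
          moreover have "0 \<le> \<epsilon> * trace_bound / \<kappa>" using \<epsilon>(1) trace_bound_pos r by simp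
          ultimately have "s * (\<epsilon> * trace_bound / \<kappa>) \<le> 2 * (\<delta> / 2)"
            using s by (intro mult_mono) auto
          then show ?thesis using s2 by linarith
        qed
        also have "\<dots> = \<epsilon>\<^sup>2 * (\<sigma> * (trace_bound / \<kappa>) + \<sigma>\<^sup>2 * (1 - \<delta> / 2))"
          using \<epsilon> by (simp add: \<sigma>_def power2_eq_square field_simps)
        also have "\<dots> \<le> \<epsilon>\<^sup>2 * (\<sigma> * (trace (A y ** B x) / \<phi> y - P / \<phi> y ^ 3) + \<sigma>\<^sup>2 * (P / (\<phi> y)\<^sup>2))"
          by (rule mult_left_mono[OF add_mono[OF 1 2] zero_le_power2])
        finally have "b y \<le> b y * (\<epsilon>\<^sup>2 * (\<sigma> * (trace (A y ** B x) / \<phi> y - P / \<phi> y ^ 3) + \<sigma>\<^sup>2 * (P / (\<phi> y)\<^sup>2)))"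
          using mult_left_mono[OF _ b0[of y]] by fastforce
        then show False using main gty e0 by linarith
      qed
      then show ?thesis
        by (simp add: b_def e_def \<phi>_def \<sigma>_def s_def right_diff_distrib)
    qed
    show "\<exists>\<epsilon>0>0. \<forall>\<epsilon> v m x. 0 < \<epsilon> \<longrightarrow> \<epsilon> < \<epsilon>0 \<longrightarrow> resolvent_solution \<epsilon> v \<longrightarrow>
        x \<in> cball 0 R \<longrightarrow> m \<ge> 0 \<longrightarrow>
        (\<forall>y\<in>closure \<Omega>. v y \<ge> 0) \<longrightarrow>
        (\<forall>y\<in>closure \<Omega>. N x (y - x) \<le> \<kappa> \<longrightarrow> v y \<ge> m) \<longrightarrow>
        (\<forall>y\<in>frontier \<Omega>. N x (y - x) \<le> r \<longrightarrow> v y \<ge> m) \<longrightarrow>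
        (\<forall>y\<in>closure \<Omega>. N x (y - x) \<le> r \<longrightarrow>
           v y \<ge> m * (exp (- (1 + \<delta>) * N x (y - x) / \<epsilon>) - exp (- (1 + \<delta>) * r / \<epsilon>)))"
      by (intro exI[of _ \<epsilon>0] conjI allI impI ballI \<epsilon>0) (rule step; (assumption | blast))
  qed
qed

end

section \<open>Domains with regular boundary\<close>

text \<open>The later arguments only translate along \<open>e\<close>, which leaves the argument of
  \<open>g\<close> unchanged; hence the graph function can be hidden behind an existential
  quantifier.\<close>

definition graph_chart :: "(real^'n) set \<Rightarrow> real^'n \<Rightarrow> real \<Rightarrow> real^'n \<Rightarrow> bool" where
  "graph_chart \<Omega> p r e \<longleftrightarrow> r > 0 \<and> norm e = 1 \<and>
     (\<exists>g :: real^'n \<Rightarrow> real. continuous_on UNIV g \<and>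
        \<Omega> \<inter> ball p r = {y \<in> ball p r. y \<bullet> e > g (y - (y \<bullet> e) *\<^sub>R e)})"

lemma C11_boundary_graph_chart:
  assumes "C11_boundary \<Omega>" "p \<in> frontier \<Omega>"
  shows "\<exists>r e. graph_chart \<Omega> p r e"
proof -
  obtain r e g where *: "r > 0" "norm e = 1" "C11_function g"
    "\<Omega> \<inter> ball p r = {y \<in> ball p r. y \<bullet> e > g (y - (y \<bullet> e) *\<^sub>R e)}"
    using assms unfolding C11_boundary_def by blast
  have "isCont g y" for y
    using *(3) unfolding C11_function_def gderiv_def by (metis has_derivative_continuous)
  then have "continuous_on UNIV g" by (simp add: continuous_at_imp_continuous_on)
  with * show ?thesis unfolding graph_chart_def by blast
qed

lemma graph_chart_projection:
  fixes e :: "real^'n"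
  assumes "norm e = 1"
  shows "(y + a *\<^sub>R e) - (y \<bullet> e + a) *\<^sub>R e = y - (y \<bullet> e) *\<^sub>R e"
    and "(y + a *\<^sub>R e) \<bullet> e = y \<bullet> e + a"
  using assms by (simp_all add: inner_add_left norm_eq_1 algebra_simps)

text \<open>The region strictly below the graph within the ball is open and contains no point of the
  domain, hence none of its closure.\<close>

lemma graph_chart_below:
  assumes "continuous_on UNIV g" "y \<in> ball p r" "y \<bullet> e < g (y - (y \<bullet> e) *\<^sub>R e)"
    and "\<Omega> \<inter> ball p r = {y \<in> ball p r. y \<bullet> e > g (y - (y \<bullet> e) *\<^sub>R e)}"
  shows "y \<notin> closure \<Omega>"
proof
  assume y: "y \<in> closure \<Omega>"
  let ?U = "ball p r \<inter> {y. y \<bullet> e < g (y - (y \<bullet> e) *\<^sub>R e)}"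
  have "open ?U"
    by (intro open_Int open_ball open_Collect_less continuous_intros
        continuous_on_compose2[OF assms(1)]) auto
  moreover have "y \<in> ?U" using assms by simp
  ultimately have "?U \<inter> \<Omega> \<noteq> {}" using y open_Int_closure_eq_empty[of ?U \<Omega>] by blast
  then obtain x where x: "x \<in> ball p r" "x \<bullet> e < g (x - (x \<bullet> e) *\<^sub>R e)" "x \<in> \<Omega>" by blast
  then have "x \<in> {y \<in> ball p r. y \<bullet> e > g (y - (y \<bullet> e) *\<^sub>R e)}" using assms(4) by blast
  then show False using x(2) by simp
qed

lemma graph_chart_push:
  assumes "graph_chart \<Omega> p r e" "y \<in> closure \<Omega>" "y \<in> ball p r" "y + a *\<^sub>R e \<in> ball p r" "a > 0"
  shows "y + a *\<^sub>R e \<in> \<Omega>"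
proof -
  obtain g where g: "norm e = 1" "continuous_on UNIV g"
     "\<Omega> \<inter> ball p r = {y \<in> ball p r. y \<bullet> e > g (y - (y \<bullet> e) *\<^sub>R e)}"
    using assms(1) unfolding graph_chart_def by blast
  have "\<not> y \<bullet> e < g (y - (y \<bullet> e) *\<^sub>R e)"
    using graph_chart_below[OF g(2) assms(3) _ g(3)] assms(2) by blast
  then have "(y + a *\<^sub>R e) \<bullet> e > g ((y + a *\<^sub>R e) - ((y + a *\<^sub>R e) \<bullet> e) *\<^sub>R e)"
    unfolding graph_chart_projection(2)[OF g(1)] graph_chart_projection(1)[OF g(1)] using assms(5) by simp
  then show ?thesis using g(3) assms(4) by blast
qed

text \<open>Moving from the frontier point along \<open>- e\<close> leads strictly below the graph.
  Such a point serves as a barrier centre for which the inner ball misses the closed domain.\<close>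

lemma exterior_point_near:
  assumes "open \<Omega>" "C11_boundary \<Omega>" "z \<in> frontier \<Omega>" "\<eta> > 0"
  obtains y where "y \<notin> closure \<Omega>" "norm (y - z) < \<eta>"
proof -
  obtain r e where "graph_chart \<Omega> z r e" using C11_boundary_graph_chart[OF assms(2,3)] by blast
  then obtain g where g: "r > 0" "norm e = 1" "continuous_on UNIV g"
     "\<Omega> \<inter> ball z r = {y \<in> ball z r. y \<bullet> e > g (y - (y \<bullet> e) *\<^sub>R e)}"
    unfolding graph_chart_def by blast
  have "z \<notin> \<Omega>" using assms(1,3) by (simp add: frontier_def interior_open)
  then have z: "z \<bullet> e \<le> g (z - (z \<bullet> e) *\<^sub>R e)" using g by (metis (mono_tags, lifting) Int_iff centre_in_ball mem_Collect_eq not_le)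
  define a where "a = min r \<eta> / 2"
  have a: "0 < a" "a < r" "a < \<eta>" using g(1) assms(4) by (auto simp: a_def min_def)
  define y where "y = z + (- a) *\<^sub>R e"
  have "y \<bullet> e < g (y - (y \<bullet> e) *\<^sub>R e)"
    unfolding y_def graph_chart_projection(2)[OF g(2)] graph_chart_projection(1)[OF g(2)] using z a by simp
  moreover have "y \<in> ball z r" using a g(2) by (simp add: y_def dist_norm)
  ultimately have "y \<notin> closure \<Omega>" using graph_chart_below[OF g(3) _ _ g(4)] by blast
  moreover have "norm (y - z) < \<eta>" using a g(2) by (simp add: y_def)
  ultimately show thesis by (rule that)
qed

text \<open>The field is a sum of cut-off chart directions, and translating a point of the closure by
  one chart direction after the other never leaves the closure.\<close>

lemma inward_field:
  fixes \<Omega> :: "(real^'n) set"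
  assumes "bounded \<Omega>" "open \<Omega>" "C11_boundary \<Omega>"
  obtains V :: "real^'n \<Rightarrow> real^'n" and s0 L where "s0 > 0" "L > 0"
    "\<And>x s. \<lbrakk>x \<in> closure \<Omega>; 0 < s; s \<le> s0\<rbrakk> \<Longrightarrow> x + s *\<^sub>R V x \<in> \<Omega>"
    "\<And>x y. norm (V x - V y) \<le> L * norm (x - y)"
    "\<And>x. norm (V x) \<le> L"
proof -
  obtain r e where re: "\<And>p. p \<in> frontier \<Omega> \<Longrightarrow> graph_chart \<Omega> p (r p) (e p)"
    using C11_boundary_graph_chart[OF assms(3)] by metis
  have "compact (frontier \<Omega>)" by (rule compact_frontier_bounded[OF assms(1)])
  moreover have "\<And>B. B \<in> (\<lambda>p. ball p (r p / 2)) ` frontier \<Omega> \<Longrightarrow> open B" by auto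
  moreover have "frontier \<Omega> \<subseteq> \<Union> ((\<lambda>p. ball p (r p / 2)) ` frontier \<Omega>)"
    using re by (force simp: graph_chart_def)
  ultimately obtain D where D: "D \<subseteq> frontier \<Omega>" "finite D" "frontier \<Omega> \<subseteq> (\<Union>p\<in>D. ball p (r p / 2))"
    by (metis (no_types, lifting) compactE finite_subset_image)
  have r: "r p > 0" "norm (e p) = 1" if "p \<in> D" for p
    using re D(1) that by (auto simp: graph_chart_def)
  define \<psi> where "\<psi> = (\<lambda>p x. max 0 (r p / 2 - dist x p))"
  have \<psi>: "0 \<le> \<psi> p x" "\<psi> p x \<le> r p / 2" "\<psi> p x > 0 \<longleftrightarrow> dist x p < r p / 2" if "p \<in> D" for p x
    using r(1)[OF that] zero_le_dist[of x p] by (auto simp: \<psi>_def max_def)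
  have \<psi>_lip: "\<bar>\<psi> p x - \<psi> p y\<bar> \<le> norm (x - y)" for p x y
  proof -
    have "\<bar>dist x p - dist y p\<bar> \<le> dist x y" by (metis abs_dist_diff_le dist_commute)
    then show ?thesis unfolding \<psi>_def dist_norm[symmetric] by (auto simp: max_def abs_le_iff)
  qed
  define \<tau> where "\<tau> = (\<Sum>p\<in>D. r p / 2)"
  have \<tau>: "\<tau> \<ge> 0" unfolding \<tau>_def by (intro sum_nonneg) (simp add: r less_imp_le)
  define \<rho> where "\<rho> = Min (insert 1 ((\<lambda>p. r p / 2) ` D))"
  have \<rho>: "\<rho> > 0" "\<And>p. p \<in> D \<Longrightarrow> \<rho> \<le> r p / 2"
  proof -
    show "\<rho> > 0" using D(2) r by (simp add: \<rho>_def)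
    show "\<rho> \<le> r p / 2" if "p \<in> D" for p
      unfolding \<rho>_def using D(2) that by (intro Min_le) auto
  qed
  \<comment> \<open>\<open>\<tau>\<close> bounds every partial sum of the field. Up to time
    \<open>s0\<close> all partial displacements are therefore at most half of each chart radius, so
    a point in the support of a cut-off stays in the corresponding chart ball.\<close>
  define s0 where "s0 = \<rho> / (\<tau> + 1)"
  have s0: "s0 > 0" "s0 * \<tau> \<le> \<rho>"
  proof -
    show "s0 > 0" using \<rho>(1) \<tau> by (simp add: s0_def)
    have "s0 * \<tau> \<le> s0 * (\<tau> + 1)" using \<open>s0 > 0\<close> by simp
    also have "\<dots> = \<rho>" using \<tau> by (simp add: s0_def)
    finally show "s0 * \<tau> \<le> \<rho>" .
  qed
  define V where "V = (\<lambda>x. \<Sum>p\<in>D. \<psi> p x *\<^sub>R e p)"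
  define W where "W = (\<lambda>F x. \<Sum>p\<in>F. \<psi> p x *\<^sub>R e p)"
  have Wn: "norm (W F x) \<le> \<tau>" if "F \<subseteq> D" for F x
  proof -
    have "norm (W F x) \<le> (\<Sum>p\<in>F. r p / 2)"
      unfolding W_def using that \<psi> r by (intro sum_norm_le) (auto simp: subset_iff)
    also have "\<dots> \<le> \<tau>" unfolding \<tau>_def using r D(2) that
      by (intro sum_mono2) (auto intro: less_imp_le)
    finally show ?thesis .
  qed
  have near: "x + s *\<^sub>R W F x \<in> ball p (r p)"
    if "F \<subseteq> D" "p \<in> D" "dist x p < r p / 2" "0 < s" "s \<le> s0" for F p x s
  proof -
    have "dist (x + s *\<^sub>R W F x) x \<le> s * \<tau>"
      using Wn[OF that(1), of x] that by (simp add: dist_norm mult_left_mono)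
    also have "\<dots> \<le> s0 * \<tau>" using that \<tau> by (intro mult_right_mono) auto
    also have "\<dots> \<le> r p / 2" using s0(2) \<rho>(2)[OF that(2)] by simp
    finally have "dist (x + s *\<^sub>R W F x) p < r p"
      using dist_triangle[of "x + s *\<^sub>R W F x" p x] that(3) by simp
    then show ?thesis by (simp add: dist_commute)
  qed
  \<comment> \<open>Induction on the set of charts used: a chart with positive cut-off moves a point
    of the closure into the domain, and a chart with vanishing cut-off changes nothing.\<close>
  have push: "x + s *\<^sub>R W F x \<in> closure \<Omega> \<and> (x \<in> \<Omega> \<or> (\<exists>p\<in>F. \<psi> p x > 0) \<longrightarrow> x + s *\<^sub>R W F x \<in> \<Omega>)"
    if x: "x \<in> closure \<Omega>" and s: "0 < s" "s \<le> s0" and F: "F \<subseteq> D" for x s F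
    using finite_subset[OF F D(2)] F
  proof (induction F rule: finite_induct)
    case empty
    then show ?case using x by (simp add: W_def)
  next
    case (insert p F)
    then have p: "p \<in> D" "F \<subseteq> D" by auto
    have W: "W (insert p F) x = W F x + \<psi> p x *\<^sub>R e p"
      using insert.hyps by (simp add: W_def add.commute)
    show ?case
    proof (cases "\<psi> p x > 0")
      case True
      then have d: "dist x p < r p / 2" using \<psi>(3)[OF p(1)] by blast
      have eq: "x + s *\<^sub>R W (insert p F) x = (x + s *\<^sub>R W F x) + (s * \<psi> p x) *\<^sub>R e p"
        by (simp add: W scaleR_add_right)
      have "x + s *\<^sub>R W (insert p F) x \<in> \<Omega>"
        unfolding eq
      proof (rule graph_chart_push)
        show "graph_chart \<Omega> p (r p) (e p)" using re D(1) p(1) by blast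
        show "x + s *\<^sub>R W F x \<in> closure \<Omega>" using insert.IH p by blast
        show "x + s *\<^sub>R W F x \<in> ball p (r p)" by (rule near[OF p(2) p(1) d s])
        show "x + s *\<^sub>R W F x + (s * \<psi> p x) *\<^sub>R e p \<in> ball p (r p)"
          using near[OF insert.prems p(1) d s] unfolding eq .
        show "0 < s * \<psi> p x" using True s by simp
      qed
      then show ?thesis using closure_subset by blast
    next
      case False
      then have "\<psi> p x = 0" using \<psi>(1)[OF p(1), of x] by linarith
      then have "W (insert p F) x = W F x" by (simp add: W)
      then show ?thesis using insert.IH p False by auto
    qed
  qed
  have inside: "x + s *\<^sub>R V x \<in> \<Omega>" if "x \<in> closure \<Omega>" "0 < s" "s \<le> s0" for x s
  proof -
    have "x \<in> \<Omega> \<or> (\<exists>p\<in>D. \<psi> p x > 0)"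
    proof (cases "x \<in> \<Omega>")
      case False
      then have "x \<in> frontier \<Omega>" using that(1) assms(2) by (simp add: frontier_def interior_open)
      then obtain p where "p \<in> D" "dist x p < r p / 2"
        using D(3) by (force simp: dist_commute)
      then show ?thesis using \<psi>(3) by blast
    qed simp
    then show ?thesis using push[OF that, of D] by (simp add: V_def W_def)
  qed
  define L where "L = \<tau> + real (card D) + 1"
  have lip: "norm (V x - V y) \<le> L * norm (x - y)" for x y
  proof -
    have "norm (V x - V y) = norm (\<Sum>p\<in>D. (\<psi> p x - \<psi> p y) *\<^sub>R e p)"
      by (simp add: V_def sum_subtractf scaleR_diff_left)
    also have "\<dots> \<le> (\<Sum>p\<in>D. norm (x - y))"
      using \<psi>_lip r by (intro sum_norm_le) auto
    also have "\<dots> = real (card D) * norm (x - y)" by simp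
    also have "\<dots> \<le> L * norm (x - y)" using \<tau> by (intro mult_right_mono) (auto simp: L_def)
    finally show ?thesis .
  qed
  have bd: "norm (V x) \<le> L" for x using Wn[of D x] by (simp add: L_def V_def W_def)
  show thesis
    by (rule that[OF s0(1) _ inside lip bd]) (use \<tau> in \<open>auto simp: L_def\<close>)
qed

section \<open>Chains\<close>

context elliptic_setting
begin

text \<open>The points that reach \<open>S\<close> in \<open>k + 1\<close> jumps, since index
  \<open>0\<close> already allows one. Each jump is measured in the metric frozen at its start, and
  only its end points must lie in the closure, because the upper barrier step only involves values
  on the closed domain.\<close>

fun chain_set :: "real \<Rightarrow> (real^'n) set \<Rightarrow> nat \<Rightarrow> (real^'n) set" where
  "chain_set r S 0 = {x \<in> closure \<Omega>. \<exists>z\<in>S. N x (z - x) \<le> r}"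
| "chain_set r S (Suc k) = {x \<in> closure \<Omega>. \<exists>y\<in>chain_set r S k. N x (y - x) \<le> r}"

lemma chain_set_subset_closure: "chain_set r S k \<subseteq> closure \<Omega>"
  by (cases k) auto

lemma boundary_set_subset_chain_set:
  assumes "S \<subseteq> closure \<Omega>" "r > 0"
  shows "S \<subseteq> chain_set r S k"
proof (induction k)
  case 0
  then show ?case using assms by force
next
  case (Suc k)
  show ?case
  proof
    fix x assume "x \<in> S"
    then show "x \<in> chain_set r S (Suc k)" using Suc assms by (auto intro!: bexI[of _ x])
  qed
qed

text \<open>Outside \<open>chain_set r S (Suc k)\<close> no point within one jump belongs to
  \<open>chain_set r S k\<close>. The inductive bound thus holds on the whole metric ball and plays
  the role of \<open>m\<close> in the barrier step; the frontier points of that ball avoid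
  \<open>S\<close>, which lies in every chain set, so \<open>v\<close> is nonpositive there.\<close>

lemma chain_upper_bound:
  assumes \<delta>: "0 < \<delta>" "\<delta> < 1"
  obtains \<rho> where "\<rho> > 0"
    "\<And>r. \<lbrakk>0 < r; r < \<rho>\<rbrakk> \<Longrightarrow> \<exists>\<epsilon>0>0. \<forall>\<epsilon> v M S k x. 0 < \<epsilon> \<longrightarrow> \<epsilon> < \<epsilon>0 \<longrightarrow> resolvent_solution \<epsilon> v \<longrightarrow>
        M \<ge> 0 \<longrightarrow> (\<forall>y\<in>closure \<Omega>. v y \<le> M) \<longrightarrow> S \<subseteq> closure \<Omega> \<longrightarrow> (\<forall>y\<in>frontier \<Omega> - S. v y \<le> 0) \<longrightarrow>
        x \<in> closure \<Omega> \<longrightarrow> x \<notin> chain_set r S k \<longrightarrow> v x \<le> M * exp (- (1 - \<delta>) * r / \<epsilon>) ^ Suc k"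
proof -
  obtain \<rho> where \<rho>: "\<rho> > 0"
    "\<And>r. \<lbrakk>0 < r; r < \<rho>\<rbrakk> \<Longrightarrow> \<exists>\<epsilon>0>0. \<forall>\<epsilon> v m x. 0 < \<epsilon> \<longrightarrow> \<epsilon> < \<epsilon>0 \<longrightarrow> resolvent_solution \<epsilon> v \<longrightarrow>
        x \<in> closure \<Omega> \<longrightarrow> m \<ge> 0 \<longrightarrow>
        (\<forall>y\<in>closure \<Omega>. N x (y - x) \<le> r \<longrightarrow> v y \<le> m) \<longrightarrow>
        (\<forall>y\<in>frontier \<Omega>. N x (y - x) \<le> r \<longrightarrow> v y \<le> 0) \<longrightarrow>
        v x \<le> m * exp (- (1 - \<delta>) * r / \<epsilon>)"
    using upper_barrier_step[OF \<delta>] by blast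
  show thesis
  proof (rule that[OF \<rho>(1)])
    fix r assume r: "0 < r" "r < \<rho>"
    obtain \<epsilon>0 where \<epsilon>0: "\<epsilon>0 > 0" "\<And>\<epsilon> v m x. \<lbrakk>0 < \<epsilon>; \<epsilon> < \<epsilon>0; resolvent_solution \<epsilon> v;
        x \<in> closure \<Omega>; m \<ge> 0; \<forall>y\<in>closure \<Omega>. N x (y - x) \<le> r \<longrightarrow> v y \<le> m;
        \<forall>y\<in>frontier \<Omega>. N x (y - x) \<le> r \<longrightarrow> v y \<le> 0\<rbrakk> \<Longrightarrow> v x \<le> m * exp (- (1 - \<delta>) * r / \<epsilon>)"
      using \<rho>(2)[OF r] by metis
    have "v x \<le> M * exp (- (1 - \<delta>) * r / \<epsilon>) ^ Suc k"
      if \<epsilon>: "0 < \<epsilon>" "\<epsilon> < \<epsilon>0" and v: "resolvent_solution \<epsilon> v" and M: "M \<ge> 0" "\<forall>y\<in>closure \<Omega>. v y \<le> M"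
        and S: "S \<subseteq> closure \<Omega>" "\<forall>y\<in>frontier \<Omega> - S. v y \<le> 0"
        and x: "x \<in> closure \<Omega>" "x \<notin> chain_set r S k" for \<epsilon> v M S k x
      using x
    proof (induction k arbitrary: x)
      case 0
      have "v x \<le> M * exp (- (1 - \<delta>) * r / \<epsilon>)"
      proof (rule \<epsilon>0(2)[OF \<epsilon> v 0(1) M(1)])
        show "\<forall>y\<in>frontier \<Omega>. N x (y - x) \<le> r \<longrightarrow> v y \<le> 0" using 0 S by auto
      qed (use M in auto)
      then show ?case by simp
    next
      case (Suc k)
      have nk: "y \<notin> chain_set r S k" if "N x (y - x) \<le> r" for y
        using Suc.prems that by auto
      have "v x \<le> (M * exp (- (1 - \<delta>) * r / \<epsilon>) ^ Suc k) * exp (- (1 - \<delta>) * r / \<epsilon>)"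
      proof (rule \<epsilon>0(2)[OF \<epsilon> v Suc.prems(1)])
        show "0 \<le> M * exp (- (1 - \<delta>) * r / \<epsilon>) ^ Suc k" using M(1) by simp
        show "\<forall>y\<in>closure \<Omega>. N x (y - x) \<le> r \<longrightarrow> v y \<le> M * exp (- (1 - \<delta>) * r / \<epsilon>) ^ Suc k"
          using Suc.IH nk by blast
        show "\<forall>y\<in>frontier \<Omega>. N x (y - x) \<le> r \<longrightarrow> v y \<le> 0"
          using S nk boundary_set_subset_chain_set[OF S(1) r(1), of k] by blast
      qed
      then show ?case by (simp only: power_Suc2 mult.assoc)
    qed
    then show "\<exists>\<epsilon>0>0. \<forall>\<epsilon> v M S k x. 0 < \<epsilon> \<longrightarrow> \<epsilon> < \<epsilon>0 \<longrightarrow> resolvent_solution \<epsilon> v \<longrightarrow>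
        M \<ge> 0 \<longrightarrow> (\<forall>y\<in>closure \<Omega>. v y \<le> M) \<longrightarrow> S \<subseteq> closure \<Omega> \<longrightarrow> (\<forall>y\<in>frontier \<Omega> - S. v y \<le> 0) \<longrightarrow>
        x \<in> closure \<Omega> \<longrightarrow> x \<notin> chain_set r S k \<longrightarrow> v x \<le> M * exp (- (1 - \<delta>) * r / \<epsilon>) ^ Suc k"
      using \<epsilon>0(1) by blast
  qed
qed

end

section \<open>Polygonal paths\<close>

definition path_lengths ::
  "(real^'n \<Rightarrow> real^'n^'n) \<Rightarrow> (real^'n) set \<Rightarrow> (real^'n) set \<Rightarrow> real^'n \<Rightarrow> real set" where
  "path_lengths A \<Omega> S x = {LINT t:{0..T}|lborel. norm_A A (\<gamma> t) (\<gamma>' t) | \<gamma> \<gamma>' T.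
     H1_loc_path \<gamma> \<gamma>' \<and> \<gamma> 0 = x \<and> ereal T = exit_time \<Omega> \<gamma> \<and> \<gamma> T \<in> S}"

lemma dist_S_eq_Inf: "dist_S A \<Omega> S x = Inf (path_lengths A \<Omega> S x)"
  by (simp add: dist_S_def path_lengths_def)

definition clamp_unit :: "real \<Rightarrow> real" where "clamp_unit s = max 0 (min 1 s)"

lemma clamp_unit_simps:
  "s \<le> 0 \<Longrightarrow> clamp_unit s = 0" "s \<ge> 1 \<Longrightarrow> clamp_unit s = 1" "0 \<le> s \<Longrightarrow> s \<le> 1 \<Longrightarrow> clamp_unit s = s"
  by (auto simp: clamp_unit_def)

text \<open>The polygon through \<open>p 0\<close>, ..., \<open>p m\<close> at one unit of time per
  edge, resting at \<open>p m\<close> afterwards. Writing it as a sum of clamped increments makes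
  continuity immediate.\<close>

definition polygon_path :: "(nat \<Rightarrow> 'a::real_normed_vector) \<Rightarrow> nat \<Rightarrow> real \<Rightarrow> 'a" where
  "polygon_path p m t = p 0 + (\<Sum>j<m. clamp_unit (t - real j) *\<^sub>R (p (Suc j) - p j))"

text \<open>The open intervals give the velocity \<open>0\<close> at the nodes, where the path need
  not be differentiable.\<close>

definition polygon_velocity :: "(nat \<Rightarrow> 'a::real_normed_vector) \<Rightarrow> nat \<Rightarrow> real \<Rightarrow> 'a" where
  "polygon_velocity p m t = (\<Sum>j<m. indicator {real j<..<real (Suc j)} t *\<^sub>R (p (Suc j) - p j))"

lemma polygon_path_segment:
  assumes "j < m" "real j \<le> t" "t \<le> real (Suc j)"
  shows "polygon_path p m t = p j + (t - real j) *\<^sub>R (p (Suc j) - p j)"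
proof -
  have "(\<Sum>i<m. clamp_unit (t - real i) *\<^sub>R (p (Suc i) - p i)) =
      (\<Sum>i<m. (if i < j then p (Suc i) - p i else 0) + (if i = j then (t - real j) *\<^sub>R (p (Suc j) - p j) else 0))"
  proof (rule sum.cong)
    fix i assume "i \<in> {..<m}"
    consider "i < j" | "i = j" | "i > j" by linarith
    then show "clamp_unit (t - real i) *\<^sub>R (p (Suc i) - p i) =
      (if i < j then p (Suc i) - p i else 0) + (if i = j then (t - real j) *\<^sub>R (p (Suc j) - p j) else 0)"
    proof cases
      case 1
      then have "t - real i \<ge> 1" using assms(2) by linarith
      then show ?thesis using 1 by (simp add: clamp_unit_simps)
    next
      case 2
      then show ?thesis using assms by (simp add: clamp_unit_simps)
    next
      case 3
      then have "t - real i \<le> 0" using assms(3) by linarith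
      then show ?thesis using 3 by (simp add: clamp_unit_simps)
    qed
  qed simp
  also have "\<dots> = (\<Sum>i<m. if i < j then p (Suc i) - p i else 0) + (t - real j) *\<^sub>R (p (Suc j) - p j)"
    using assms(1) by (simp add: sum.distrib)
  also have "(\<Sum>i<m. if i < j then p (Suc i) - p i else 0) = (\<Sum>i<j. p (Suc i) - p i)"
    using assms(1) by (intro sum.mono_neutral_cong_right) auto
  also have "\<dots> = p j - p 0" by (rule sum_lessThan_telescope)
  finally show ?thesis by (simp add: polygon_path_def)
qed

lemma continuous_polygon_path: "continuous_on S (polygon_path p m)"
  unfolding polygon_path_def clamp_unit_def by (intro continuous_intros)

lemma clamp_unit_derivative:
  assumes "t \<noteq> real j" "t \<noteq> real (Suc j)"
  shows "((\<lambda>t. clamp_unit (t - real j)) has_vector_derivative indicator {real j<..<real (Suc j)} t) (at t)"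
proof -
  consider "t < real j" | "real j < t \<and> t < real (Suc j)" | "t > real (Suc j)" using assms by linarith
  then show ?thesis
  proof cases
    case 1
    have "((\<lambda>t. 0 :: real) has_vector_derivative 0) (at t)" by simp
    then have "((\<lambda>t. clamp_unit (t - real j)) has_vector_derivative 0) (at t)"
      by (rule has_vector_derivative_transform_within_open[of _ _ _ "{..<real j}"]) (use 1 in \<open>auto simp: clamp_unit_simps\<close>)
    then show ?thesis using 1 by simp
  next
    case 2
    have "((\<lambda>t. t - real j) has_vector_derivative 1) (at t)"
      by (auto intro!: derivative_eq_intros)
    then have "((\<lambda>t. clamp_unit (t - real j)) has_vector_derivative 1) (at t)"
      by (rule has_vector_derivative_transform_within_open[of _ _ _ "{real j<..<real (Suc j)}"])
         (use 2 in \<open>auto simp: clamp_unit_simps\<close>)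
    then show ?thesis using 2 by simp
  next
    case 3
    have "((\<lambda>t. 1 :: real) has_vector_derivative 0) (at t)" by simp
    then have "((\<lambda>t. clamp_unit (t - real j)) has_vector_derivative 0) (at t)"
      by (rule has_vector_derivative_transform_within_open[of _ _ _ "{real (Suc j)<..}"]) (use 3 in \<open>auto simp: clamp_unit_simps\<close>)
    then show ?thesis using 3 by simp
  qed
qed

lemma polygon_path_derivative:
  assumes "t \<notin> real ` {..m}"
  shows "(polygon_path p m has_vector_derivative polygon_velocity p m t) (at t)"
proof -
  have "((\<lambda>t. clamp_unit (t - real j) *\<^sub>R (p (Suc j) - p j)) has_vector_derivative
      indicator {real j<..<real (Suc j)} t *\<^sub>R (p (Suc j) - p j)) (at t)" if "j < m" for j
  proof -
    have "t \<noteq> real j" "t \<noteq> real (Suc j)" using assms that by (force simp del: of_nat_Suc)+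
    from has_vector_derivative_scaleR[OF
        clamp_unit_derivative[OF this, folded has_real_derivative_iff_has_vector_derivative] has_vector_derivative_const[of "p (Suc j) - p j"]]
    show ?thesis by simp
  qed
  then have "((\<lambda>t. p 0 + (\<Sum>j<m. clamp_unit (t - real j) *\<^sub>R (p (Suc j) - p j))) has_vector_derivative
     0 + polygon_velocity p m t) (at t)"
    unfolding polygon_velocity_def
    by (intro has_vector_derivative_add has_vector_derivative_const has_vector_derivative_sum) auto
  then show ?thesis unfolding polygon_path_def[abs_def] by simp
qed

lemma polygon_velocity_measurable [measurable]:
  fixes p :: "nat \<Rightarrow> real^'n"
  shows "polygon_velocity p m \<in> borel_measurable borel"
  unfolding polygon_velocity_def[abs_def] by measurable

lemma norm_polygon_velocity_le:
  "norm (polygon_velocity p m t) \<le> (\<Sum>j<m. norm (p (Suc j) - p j))"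
  unfolding polygon_velocity_def by (intro sum_norm_le) (auto simp: indicator_def)

text \<open>The weak derivative identity is the fundamental theorem of calculus for the product of
  the test function and the path, with the finitely many nodes as exceptional points; the boundary
  values vanish since the support stays away from \<open>0\<close>.\<close>

lemma H1_loc_path_polygon:
  fixes p :: "nat \<Rightarrow> real^'n"
  shows "H1_loc_path (polygon_path p m) (polygon_velocity p m)"
  unfolding H1_loc_path_def
proof (intro conjI allI impI)
  let ?\<gamma> = "polygon_path p m" and ?v = "polygon_velocity p m"
  define C where "C = (\<Sum>j<m. norm (p (Suc j) - p j))"
  have v: "norm (?v t) \<le> C" for t unfolding C_def by (rule norm_polygon_velocity_le)
  then have C: "C \<ge> 0" using norm_ge_zero order_trans by blast
  show "continuous_on {0..} ?\<gamma>" by (rule continuous_polygon_path)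
  show "set_borel_measurable lborel {0..} ?v"
    unfolding set_borel_measurable_def by measurable
  show "set_integrable lborel {0..T} (\<lambda>t. (norm (?v t))\<^sup>2)" if "T > 0" for T :: real
    unfolding set_integrable_def
  proof (rule integrableI_bounded_set_indicator[where B = "C\<^sup>2"])
    show "AE t in lborel. t \<in> {0..T} \<longrightarrow> norm ((norm (?v t))\<^sup>2) \<le> C\<^sup>2"
      using v by (auto intro!: power_mono)
  qed (use that in auto)
  fix \<phi> assume "test_function \<phi>"
  then obtain a b where \<phi>: "\<And>t. \<phi> differentiable (at t)" "continuous_on UNIV (deriv \<phi>)" "0 < a"
    "\<And>t. \<phi> t \<noteq> 0 \<Longrightarrow> t \<in> {a..b}"
    unfolding test_function_def by blast
  have D: "(\<phi> has_real_derivative deriv \<phi> t) (at t)" for t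
    using \<phi>(1) by (simp add: DERIV_deriv_iff_real_differentiable)
  have \<phi>cont: "continuous_on UNIV \<phi>"
    using D by (meson DERIV_isCont continuous_at_imp_continuous_on)
  \<comment> \<open>A positive time beyond the support of the test function, whatever the sign of
    \<open>b\<close>.\<close>
  define b' where "b' = max b 0 + 1"
  have zero: "\<phi> t = 0" "deriv \<phi> t = 0" if "t \<notin> {a..b}" for t
  proof -
    show "\<phi> t = 0" using \<phi>(4) that by blast
    have "((\<lambda>t. 0) has_real_derivative deriv \<phi> t) (at t)"
      by (rule has_field_derivative_transform_within_open[OF D[of t], of "- {a..b}"]) (use that \<phi>(4) in \<open>auto simp: open_Compl\<close>)
    then show "deriv \<phi> t = 0" using DERIV_unique[OF _ DERIV_const] by blast
  qed
  let ?F = "\<lambda>t. \<phi> t *\<^sub>R ?\<gamma> t"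
  let ?f1 = "\<lambda>t. deriv \<phi> t *\<^sub>R ?\<gamma> t" and ?f2 = "\<lambda>t. \<phi> t *\<^sub>R ?v t"
  have b': "b' > 0" "b' > b" by (auto simp: b'_def)
  have FTC: "((\<lambda>t. ?f2 t + ?f1 t) has_integral (?F b' - ?F 0)) {0..b'}"
  proof (rule fundamental_theorem_of_calculus_interior_strong[where S = "real ` {..m}"])
    show "continuous_on {0..b'} ?F"
      by (intro continuous_intros continuous_polygon_path continuous_on_subset[OF \<phi>cont]) auto
    fix t assume "t \<in> {0<..<b'} - real ` {..m}"
    then show "(?F has_vector_derivative ?f2 t + ?f1 t) (at t)"
      by (intro has_vector_derivative_scaleR D polygon_path_derivative) auto
  qed (use b' in auto)
  have "?F b' - ?F 0 = 0" using zero(1)[of 0] zero(1)[of b'] b' \<phi>(3) by simp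
  with FTC have int0: "integral {0..b'} (\<lambda>t. ?f2 t + ?f1 t) = 0" by (simp add: integral_unique)
  have m1: "?f1 \<in> borel_measurable borel"
    using borel_measurable_continuous_onI[OF \<phi>(2)] borel_measurable_continuous_onI[OF continuous_polygon_path]
    by measurable
  have m2: "?f2 \<in> borel_measurable borel"
    using borel_measurable_continuous_onI[OF \<phi>cont] by measurable
  have bdd: "\<exists>K. \<forall>t\<in>{0..b'}. norm (g t) \<le> K" if "continuous_on {0..b'} g" for g :: "real \<Rightarrow> real^'n"
    using compact_imp_bounded[OF compact_continuous_image[OF that compact_Icc]]
    by (auto simp: bounded_iff)
  have "continuous_on {0..b'} ?f1"
    by (intro continuous_intros continuous_polygon_path continuous_on_subset[OF \<phi>(2)]) auto
  from bdd[OF this] obtain K1 where K1: "\<And>t. t \<in> {0..b'} \<Longrightarrow> norm (?f1 t) \<le> K1" by blast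
  have "bounded (\<phi> ` {0..b'})"
    by (intro compact_imp_bounded compact_continuous_image continuous_on_subset[OF \<phi>cont]) auto
  then obtain K2 where "\<And>t. t \<in> {0..b'} \<Longrightarrow> norm (\<phi> t) \<le> K2"
    unfolding bounded_iff by blast
  then have K2: "\<And>t. t \<in> {0..b'} \<Longrightarrow> \<bar>\<phi> t\<bar> \<le> K2" by simp
  have fin: "emeasure lborel {0..b'} < \<infinity>" using b' by simp
  have i1: "set_integrable lborel {0..b'} ?f1"
    unfolding set_integrable_def
    by (rule integrableI_bounded_set_indicator[where B = K1]) (use m1 K1 fin in auto)
  have i2: "set_integrable lborel {0..b'} ?f2"
    unfolding set_integrable_def
  proof (rule integrableI_bounded_set_indicator[where B = "K2 * C"])
    show "AE t in lborel. t \<in> {0..b'} \<longrightarrow> norm (?f2 t) \<le> K2 * C"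
    proof (intro AE_I2 impI)
      fix t assume "t \<in> {0..b'}"
      then have "\<bar>\<phi> t\<bar> * norm (?v t) \<le> K2 * C" using K2 v C
        by (intro mult_mono) (auto intro: order_trans[OF abs_ge_zero])
      then show "norm (?f2 t) \<le> K2 * C" by simp
    qed
  qed (use m2 fin in auto)
  have "(LINT t:{0..b'}|lborel. ?f2 t + ?f1 t) = 0"
    using set_borel_integral_eq_integral(2)[OF set_integral_add(1)[OF i2 i1]] int0 by simp
  then have sum0: "(LINT t:{0..b'}|lborel. ?f2 t) + (LINT t:{0..b'}|lborel. ?f1 t) = 0"
    by (simp add: set_integral_add(2)[OF i2 i1])
  have eq: "(LINT t:{0<..}|lborel. g t) = (LINT t:{0..b'}|lborel. g t)"
    if "\<And>t. t \<notin> {a..b} \<Longrightarrow> g t = 0" for g :: "real \<Rightarrow> real^'n"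
    unfolding set_lebesgue_integral_def
  proof (rule Bochner_Integration.integral_cong)
    fix t
    show "indicator {0<..} t *\<^sub>R g t = indicator {0..b'} t *\<^sub>R g t"
    proof (cases "t \<in> {a..b}")
      case True
      then show ?thesis using \<phi>(3) b' by (auto simp: indicator_def)
    qed (use that in simp)
  qed simp
  have "(LINT t:{0<..}|lborel. ?f1 t) = (LINT t:{0..b'}|lborel. ?f1 t)"
    "(LINT t:{0<..}|lborel. ?f2 t) = (LINT t:{0..b'}|lborel. ?f2 t)"
    by (rule eq, use zero in simp)+
  then show "(LINT t:{0<..}|lborel. ?f1 t) = - (LINT t:{0<..}|lborel. ?f2 t)"
    using sum0 by (simp add: add_eq_0_iff2)
qed

text \<open>Every edge lies in the domain up to, but excluding, its end point at unit time, and the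
  last vertex does not lie in the domain; hence the exit time is exactly \<open>m\<close>. The
  bounds \<open>c j\<close> are required on whole edges because the metric varies along
  them.\<close>

lemma polygon_path_length:
  fixes p :: "nat \<Rightarrow> real^'n"
  assumes "m > 0" "p m \<in> S" "S \<inter> \<Omega> = {}"
    and inside: "\<And>j t. \<lbrakk>j < m; 0 \<le> t; t < 1\<rbrakk> \<Longrightarrow> p j + t *\<^sub>R (p (Suc j) - p j) \<in> \<Omega>"
    and len: "\<And>j y. \<lbrakk>j < m; y \<in> closed_segment (p j) (p (Suc j))\<rbrakk> \<Longrightarrow> norm_A A y (p (Suc j) - p j) \<le> c j"
    and nonneg: "\<And>j. j < m \<Longrightarrow> c j \<ge> 0"
  shows "\<exists>l\<in>path_lengths A \<Omega> S (p 0). l \<le> (\<Sum>j<m. c j)"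
proof -
  let ?\<gamma> = "polygon_path p m" and ?v = "polygon_velocity p m"
  have at_nat: "?\<gamma> (real (Suc j)) = p (Suc j)" if "j < m" for j
    using polygon_path_segment[OF that, of "real (Suc j)" p] by simp
  have end_point: "?\<gamma> (real m) = p m"
    using at_nat[of "m - 1"] assms(1) by simp
  have start: "?\<gamma> 0 = p 0" using polygon_path_segment[OF assms(1), of 0 p] by simp
  have seg: "\<exists>j<m. real j \<le> t \<and> t < real (Suc j)" if "0 \<le> t" "t < real m" for t
    using that by (intro exI[of _ "nat \<lfloor>t\<rfloor>"]) linarith
  have in\<Omega>: "?\<gamma> t \<in> \<Omega>" if t: "0 \<le> t" "t < real m" for t
  proof -
    obtain j where j: "j < m" "real j \<le> t" "t < real (Suc j)" using seg[OF t] by blast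
    show ?thesis
      using inside[OF j(1), of "t - real j"] polygon_path_segment[OF j(1,2), of p] j by simp
  qed
  have exit: "ereal (real m) = exit_time \<Omega> ?\<gamma>"
    unfolding exit_time_def
  proof (rule antisym)
    show "ereal (real m) \<le> Inf (ereal ` {\<tau>. \<tau> > 0 \<and> ?\<gamma> \<tau> \<notin> \<Omega>})"
    proof (rule Inf_greatest)
      fix z assume "z \<in> ereal ` {\<tau>. \<tau> > 0 \<and> ?\<gamma> \<tau> \<notin> \<Omega>}"
      then obtain \<tau> where "z = ereal \<tau>" "\<tau> > 0" "?\<gamma> \<tau> \<notin> \<Omega>" by blast
      then show "ereal (real m) \<le> z" using in\<Omega>[of \<tau>] by fastforce
    qed
    show "Inf (ereal ` {\<tau>. \<tau> > 0 \<and> ?\<gamma> \<tau> \<notin> \<Omega>}) \<le> ereal (real m)"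
      using assms(1,2,3) end_point by (intro Inf_lower imageI) auto
  qed
  have "(LINT t:{0..real m}|lborel. norm_A A (?\<gamma> t) (?v t)) \<in> path_lengths A \<Omega> S (p 0)"
    unfolding path_lengths_def using H1_loc_path_polygon start exit end_point assms(2) by fastforce
  moreover have "(LINT t:{0..real m}|lborel. norm_A A (?\<gamma> t) (?v t)) \<le>
      (\<integral>t. (\<Sum>j<m. indicator {real j<..<real (Suc j)} t *\<^sub>R c j) \<partial>lborel)"
    unfolding set_lebesgue_integral_def
  \<comment> \<open>This rule asks for integrability of the nonnegative majorant only; a
    non-integrable speed would have integral \<open>0\<close>.\<close>
  proof (rule integral_mono')
    show "integrable lborel (\<lambda>t. \<Sum>j<m. indicator {real j<..<real (Suc j)} t *\<^sub>R c j)"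
      by (intro Bochner_Integration.integrable_sum integrable_scaleR_left integrable_real_indicator) auto
    fix t :: real
    show "0 \<le> (\<Sum>j<m. indicator {real j<..<real (Suc j)} t *\<^sub>R c j)"
      using nonneg by (intro sum_nonneg) auto
    show "indicator {0..real m} t *\<^sub>R norm_A A (?\<gamma> t) (?v t) \<le>
        (\<Sum>j<m. indicator {real j<..<real (Suc j)} t *\<^sub>R c j)"
    proof (cases "\<exists>j<m. real j < t \<and> t < real (Suc j)")
      case True
      then obtain j where j: "j < m" "real j < t" "t < real (Suc j)" by blast
      have other: "t \<notin> {real i<..<real (Suc i)}" if "i \<noteq> j" for i
        using that j by (cases i j rule: linorder_cases) auto
      have one: "(\<Sum>i<m. indicator {real i<..<real (Suc i)} t *\<^sub>R h i) = h j" for h :: "nat \<Rightarrow> 'b::real_vector"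
      proof -
        have "(\<Sum>i<m. indicator {real i<..<real (Suc i)} t *\<^sub>R h i) = (\<Sum>i<m. if i = j then h j else 0)"
          using other j by (intro sum.cong) (auto simp: indicator_def)
        then show ?thesis using j(1) by simp
      qed
      have "?v t = p (Suc j) - p j" unfolding polygon_velocity_def by (rule one)
      moreover have "?\<gamma> t \<in> closed_segment (p j) (p (Suc j))"
        using polygon_path_segment[of j m t p] j
        by (auto simp: in_segment algebra_simps intro!: exI[of _ "t - real j"])
      ultimately have "norm_A A (?\<gamma> t) (?v t) \<le> c j" using len[OF j(1)] by simp
      then show ?thesis unfolding one using j by (auto simp: indicator_def)
    next
      case False
      then have "?v t = 0" unfolding polygon_velocity_def by (intro sum.neutral) auto
      moreover have "(\<Sum>j<m. indicator {real j<..<real (Suc j)} t *\<^sub>R c j) \<ge> 0"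
        using nonneg by (intro sum_nonneg) auto
      ultimately show ?thesis by (simp add: norm_A_def)
    qed
  qed
  moreover have "(\<integral>t. (\<Sum>j<m. indicator {real j<..<real (Suc j)} t *\<^sub>R c j) \<partial>lborel) = (\<Sum>j<m. c j)"
  proof -
    have "(\<integral>t. (\<Sum>j<m. indicator {real j<..<real (Suc j)} t *\<^sub>R c j) \<partial>lborel)
        = (\<Sum>j<m. \<integral>t. indicator {real j<..<real (Suc j)} t *\<^sub>R c j \<partial>lborel)"
      by (intro Bochner_Integration.integral_sum integrable_scaleR_left integrable_real_indicator) auto
    also have "\<dots> = (\<Sum>j<m. c j)"
    proof (rule sum.cong[OF refl])
      fix j
      have "(\<integral>t. indicator {real j<..<real (Suc j)} t *\<^sub>R c j \<partial>lborel)
          = (\<integral>t. indicator {real j<..<real (Suc j)} t \<partial>lborel) *\<^sub>R c j"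
        by (rule integral_scaleR_left) (intro integrable_real_indicator, auto)
      also have "\<dots> = c j" by simp
      finally show "(\<integral>t. indicator {real j<..<real (Suc j)} t *\<^sub>R c j \<partial>lborel) = c j" .
    qed
    finally show ?thesis .
  qed
  ultimately show ?thesis by fastforce
qed

lemma path_lengths_nonneg:
  assumes "\<And>y w. norm_A A y w \<ge> 0" "l \<in> path_lengths A \<Omega> S x"
  shows "l \<ge> 0"
  using assms unfolding path_lengths_def set_lebesgue_integral_def
  by (auto intro!: integral_nonneg_AE)

section \<open>Increments of weakly differentiable paths\<close>

text \<open>The test functions of the weak derivative are \<open>C\<^sup>1\<close>, so the cut-offs are quadratic splines.\<close>

definition ramp :: "real \<Rightarrow> real" where
  "ramp s = 2 * ((max 0 s)\<^sup>2 - 2 * (max 0 (s - 1/2))\<^sup>2 + (max 0 (s - 1))\<^sup>2)"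

text \<open>The derivative of \<open>ramp\<close>: a hat on the unit interval with peak
  \<open>2\<close> and mass \<open>1\<close>, so that its rescalings form an approximate
  identity.\<close>

definition tent :: "real \<Rightarrow> real" where
  "tent s = 4 * (max 0 s - 2 * max 0 (s - 1/2) + max 0 (s - 1))"

lemma max_square_derivative: "((\<lambda>s. (max 0 s)\<^sup>2) has_real_derivative 2 * max 0 s) (at (s::real))"
proof -
  consider "s < 0" | "s = 0" | "s > 0" by linarith
  then show ?thesis
  proof cases
    case 1
    have "((\<lambda>s. 0) has_real_derivative 0) (at s)" by simp
    then have "((\<lambda>s. (max 0 s)\<^sup>2) has_real_derivative 0) (at s)"
      by (rule has_field_derivative_transform_within_open[of _ _ _ "{..<0}"]) (use 1 in auto)
    then show ?thesis using 1 by simp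
  next
    case 2
    have "(\<lambda>h::real. ((max 0 (0 + h))\<^sup>2 - (max 0 0)\<^sup>2) / h) \<midarrow>0\<rightarrow> 0"
    proof (rule Lim_null_comparison)
      show "\<forall>\<^sub>F h::real in at 0. norm (((max 0 (0 + h))\<^sup>2 - (max 0 0)\<^sup>2) / h) \<le> \<bar>h\<bar>"
        by (rule always_eventually) (auto simp: max_def power2_eq_square abs_mult)
      show "(\<lambda>h::real. \<bar>h\<bar>) \<midarrow>0\<rightarrow> 0" by (rule tendsto_rabs_zero) (rule tendsto_ident_at)
    qed
    then show ?thesis using 2 by (simp add: DERIV_def)
  next
    case 3
    have "((\<lambda>s. s\<^sup>2) has_real_derivative 2 * s) (at s)" by (auto intro!: derivative_eq_intros)
    then have "((\<lambda>s. (max 0 s)\<^sup>2) has_real_derivative 2 * s) (at s)"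
      by (rule has_field_derivative_transform_within_open[of _ _ _ "{0<..}"]) (use 3 in auto)
    then show ?thesis using 3 by simp
  qed
qed

lemma ramp_derivative: "(ramp has_real_derivative tent s) (at s)"
proof -
  have "((\<lambda>s. (max 0 (s - r))\<^sup>2) has_real_derivative 2 * max 0 (s - r)) (at s)" for r :: real
  proof -
    have "((\<lambda>s. s - r) has_real_derivative 1) (at s)" by (auto intro!: derivative_eq_intros)
    from DERIV_chain2[OF max_square_derivative this] show ?thesis by simp
  qed
  from this[of "1/2"] this[of 1] max_square_derivative[of s]
  have "((\<lambda>s. 2 * ((max 0 s)\<^sup>2 - 2 * (max 0 (s - 1/2))\<^sup>2 + (max 0 (s - 1))\<^sup>2)) has_real_derivative
     2 * (2 * max 0 s - 2 * (2 * max 0 (s - 1/2)) + 2 * max 0 (s - 1))) (at s)"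
    by (intro DERIV_cmult DERIV_add DERIV_diff) auto
  then show ?thesis by (simp add: ramp_def[abs_def] tent_def algebra_simps)
qed

lemma continuous_ramp: "continuous_on S ramp"
  by (rule DERIV_continuous_on[OF has_field_derivative_at_within[OF ramp_derivative]])

lemma continuous_tent: "continuous_on S tent"
  unfolding tent_def by (intro continuous_intros)

lemma tent_support: "s \<le> 0 \<Longrightarrow> tent s = 0" "s \<ge> 1 \<Longrightarrow> tent s = 0"
  by (auto simp: tent_def max_def)

lemma ramp_simps: "s \<le> 0 \<Longrightarrow> ramp s = 0" "s \<ge> 1 \<Longrightarrow> ramp s = 1"
  by (auto simp: ramp_def max_def power2_eq_square algebra_simps)

lemma ramp_bounds: "0 \<le> ramp s" "ramp s \<le> 1"
proof -
  have "0 \<le> ramp s \<and> ramp s \<le> 1"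
  proof -
    consider "s \<le> 0" | "s \<ge> 1" | "0 < s \<and> s \<le> 1/2" | "1/2 < s \<and> s < 1" by linarith
    then show ?thesis
    proof cases
      case 3
      then have "ramp s = 2 * s\<^sup>2" by (auto simp: ramp_def max_def)
      moreover have "s\<^sup>2 \<le> (1/2)\<^sup>2" using 3 by (intro power_mono) auto
      ultimately show ?thesis by (simp add: power2_eq_square)
    next
      case 4
      then have "ramp s = 1 - 2 * (1 - s)\<^sup>2" by (auto simp: ramp_def max_def power2_eq_square algebra_simps)
      moreover have "(1 - s)\<^sup>2 \<le> (1/2)\<^sup>2" using 4 by (intro power_mono) auto
      moreover have "(1 - s)\<^sup>2 \<ge> 0" by simp
      ultimately show ?thesis by (simp add: power2_eq_square)
    qed (simp_all add: ramp_simps)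
  qed
  then show "0 \<le> ramp s" "ramp s \<le> 1" by auto
qed

lemma tent_bound: "\<bar>tent s\<bar> \<le> 2"
  unfolding tent_def by (auto simp: max_def abs_le_iff)

lemma tent_integral: "integrable lborel tent" "(\<integral>s. tent s \<partial>lborel) = 1"
proof -
  have eq: "(\<lambda>s. indicator {0..1} s *\<^sub>R tent s) = tent"
  proof
    fix s show "indicator {0..1} s *\<^sub>R tent s = tent s"
      using tent_support[of s] by (cases "s \<in> {0..1}") auto
  qed
  have i: "set_integrable lborel {0..1} tent"
    by (intro borel_integrable_atLeastAtMost' continuous_tent)
  then show "integrable lborel tent"
    unfolding set_integrable_def eq .
  have "(tent has_integral (ramp 1 - ramp 0)) {0..1}"
    by (rule fundamental_theorem_of_calculus)
       (auto intro: has_vector_derivative_at_within ramp_derivative[unfolded has_real_derivative_iff_has_vector_derivative])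
  then have "integral {0..1} tent = 1" by (simp add: integral_unique ramp_simps)
  then have "(LINT s:{0..1}|lborel. tent s) = 1"
    using set_borel_integral_eq_integral(2)[OF i] by simp
  then show "(\<integral>s. tent s \<partial>lborel) = 1"
    unfolding set_lebesgue_integral_def eq .
qed

text \<open>The substitution \<open>t = a + s / Suc n\<close> moves the scaling from the kernel to
  \<open>g\<close>, and dominated convergence applies with a bound of \<open>g\<close> on one fixed
  interval, because the kernel is supported to the right of \<open>a\<close>.\<close>

lemma approximate_identity_limit:
  fixes g :: "real \<Rightarrow> real^'n"
  assumes "continuous_on UNIV g"
  shows "(\<lambda>n. \<integral>t. (real (Suc n) * tent (real (Suc n) * (t - a))) *\<^sub>R g t \<partial>lborel) \<longlonglongrightarrow> g a"
    and "integrable lborel (\<lambda>t. (real (Suc n) * tent (real (Suc n) * (t - a))) *\<^sub>R g t)"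
proof -
  have eq: "(\<integral>t. (real (Suc n) * tent (real (Suc n) * (t - a))) *\<^sub>R g t \<partial>lborel)
      = (\<integral>s. tent s *\<^sub>R g (a + 1 / real (Suc n) * s) \<partial>lborel)" for n
  proof -
    have "(\<integral>t. (k * tent (k * (t - a))) *\<^sub>R g t \<partial>lborel) = (\<integral>s. tent s *\<^sub>R g (a + 1 / k * s) \<partial>lborel)"
      if "k > 0" for k
    proof -
      have "(\<integral>t. (k * tent (k * (t - a))) *\<^sub>R g t \<partial>lborel)
        = \<bar>1 / k\<bar> *\<^sub>R (\<integral>s. (k * tent (k * (a + 1 / k * s - a))) *\<^sub>R g (a + 1 / k * s) \<partial>lborel)"
        by (rule lborel_integral_real_affine) (use that in simp)
      also have "\<dots> = \<bar>1 / k\<bar> *\<^sub>R (\<integral>s. k *\<^sub>R (tent s *\<^sub>R g (a + 1 / k * s)) \<partial>lborel)"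
        using that by simp
      also have "\<dots> = (\<bar>1 / k\<bar> * k) *\<^sub>R (\<integral>s. tent s *\<^sub>R g (a + 1 / k * s) \<partial>lborel)"
        unfolding integral_scaleR_right by (rule scaleR_scaleR)
      also have "\<bar>1 / k\<bar> * k = 1" using that by simp
      finally show ?thesis by simp
    qed
    then show ?thesis by (simp del: of_nat_Suc)
  qed
  obtain K where K: "\<And>t. t \<in> {a..a+1} \<Longrightarrow> norm (g t) \<le> K"
  proof -
    have "bounded (g ` {a..a+1})"
      by (intro compact_imp_bounded compact_continuous_image continuous_on_subset[OF assms]) auto
    then show thesis unfolding bounded_iff using that by blast
  qed
  have K0: "K \<ge> 0" using order_trans[OF norm_ge_zero K[of a]] by simp
  have gm[measurable]: "g \<in> borel_measurable borel" by (rule borel_measurable_continuous_onI[OF assms])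
  have tm[measurable]: "tent \<in> borel_measurable borel" by (rule borel_measurable_continuous_onI[OF continuous_tent])
  have "(\<lambda>n. \<integral>s. tent s *\<^sub>R g (a + 1 / real (Suc n) * s) \<partial>lborel) \<longlonglongrightarrow> (\<integral>s. tent s *\<^sub>R g a \<partial>lborel)"
  proof (rule integral_dominated_convergence[where w = "\<lambda>s. \<bar>tent s\<bar> * K"])
    show "integrable lborel (\<lambda>s. \<bar>tent s\<bar> * K)"
      using tent_integral(1) by (intro integrable_mult_left integrable_abs)
    show "AE s in lborel. (\<lambda>n. tent s *\<^sub>R g (a + 1 / real (Suc n) * s)) \<longlonglongrightarrow> tent s *\<^sub>R g a"
    proof (rule AE_I2)
      fix s
      have "(\<lambda>n. a + 1 / real (Suc n) * s) \<longlonglongrightarrow> a + 0 * s"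
        by (intro tendsto_intros) (rule LIMSEQ_Suc[OF lim_1_over_n])
      then have "(\<lambda>n. g (a + 1 / real (Suc n) * s)) \<longlonglongrightarrow> g a"
        using assms by (intro continuous_on_tendsto_compose[OF assms]) auto
      then show "(\<lambda>n. tent s *\<^sub>R g (a + 1 / real (Suc n) * s)) \<longlonglongrightarrow> tent s *\<^sub>R g a"
        by (intro tendsto_intros)
    qed
    fix n
    show "AE s in lborel. norm (tent s *\<^sub>R g (a + 1 / real (Suc n) * s)) \<le> \<bar>tent s\<bar> * K"
    proof (rule AE_I2)
      fix s
      show "norm (tent s *\<^sub>R g (a + 1 / real (Suc n) * s)) \<le> \<bar>tent s\<bar> * K"
      proof (cases "0 \<le> s \<and> s \<le> 1")
        case True
        then have "0 \<le> 1 / real (Suc n) * s" "1 / real (Suc n) * s \<le> 1 * 1"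
          by (auto intro!: mult_mono simp del: of_nat_Suc simp: divide_le_eq)
        then show ?thesis using K[of "a + 1 / real (Suc n) * s"] by (auto intro!: mult_left_mono)
      next
        case False
        then have "tent s = 0" using tent_support[of s] by linarith
        then show ?thesis by simp
      qed
    qed
  qed measurable
  then show "(\<lambda>n. \<integral>t. (real (Suc n) * tent (real (Suc n) * (t - a))) *\<^sub>R g t \<partial>lborel) \<longlonglongrightarrow> g a"
    unfolding eq using tent_integral by simp
  show "integrable lborel (\<lambda>t. (real (Suc n) * tent (real (Suc n) * (t - a))) *\<^sub>R g t)"
  proof (rule integrableI_bounded_set[where A = "{a..a+1}" and B = "(real (Suc n) * 2) * K"])
    show "AE t in lborel. t \<in> {a..a + 1} \<longrightarrow>
       norm ((real (Suc n) * tent (real (Suc n) * (t - a))) *\<^sub>R g t) \<le> (real (Suc n) * 2) * K"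
    proof (intro AE_I2 impI)
      fix t assume "t \<in> {a..a+1}"
      then have "(real (Suc n) * \<bar>tent (real (Suc n) * (t - a))\<bar>) * norm (g t) \<le> (real (Suc n) * 2) * K"
        using K K0 tent_bound by (intro mult_mono) auto
      then show "norm ((real (Suc n) * tent (real (Suc n) * (t - a))) *\<^sub>R g t) \<le> (real (Suc n) * 2) * K"
        by (simp add: abs_mult)
    qed
    show "AE t in lborel. t \<notin> {a..a + 1} \<longrightarrow> (real (Suc n) * tent (real (Suc n) * (t - a))) *\<^sub>R g t = 0"
    proof (intro AE_I2 impI)
      fix t assume "t \<notin> {a..a+1}"
      then consider "t < a" | "t > a + 1" by force
      then have "tent (real (Suc n) * (t - a)) = 0"
      proof cases
        case 1
        then show ?thesis by (intro tent_support(1)) (simp add: mult_nonneg_nonpos)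
      next
        case 2
        then have "1 * 1 \<le> real (Suc n) * (t - a)" by (intro mult_mono) auto
        then show ?thesis by (intro tent_support(2)) simp
      qed
      then show "(real (Suc n) * tent (real (Suc n) * (t - a))) *\<^sub>R g t = 0" by simp
    qed
  qed auto
qed

text \<open>On bounded intervals square integrability implies integrability, since a norm is at most
  one plus its square.\<close>

lemma H1_loc_path_integrable:
  assumes "H1_loc_path \<gamma> \<gamma>'" "0 \<le> a"
  shows "set_integrable lborel {a..b} \<gamma>'"
proof -
  define T where "T = max b 1"
  have "T > 0" by (simp add: T_def)
  then have sq: "set_integrable lborel {0..T} (\<lambda>t. (norm (\<gamma>' t))\<^sup>2)"
    using assms(1) unfolding H1_loc_path_def by blast
  have m: "(\<lambda>t. indicator {0..} t *\<^sub>R \<gamma>' t) \<in> borel_measurable lborel"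
    using assms(1) unfolding H1_loc_path_def set_borel_measurable_def by blast
  have one: "set_integrable lborel {0..T} (\<lambda>t. 1 :: real)"
    by (intro borel_integrable_atLeastAtMost' continuous_intros)
  have "set_integrable lborel {0..T} \<gamma>'"
  proof (rule set_integrable_bound[OF set_integral_add(1)[OF one sq]])
    have "(\<lambda>t. indicator {0..T} t *\<^sub>R (indicator {0..} t *\<^sub>R \<gamma>' t)) \<in> borel_measurable lborel"
      using m by measurable
    also have "(\<lambda>t. indicator {0..T} t *\<^sub>R (indicator {0..} t *\<^sub>R \<gamma>' t)) = (\<lambda>t. indicator {0..T} t *\<^sub>R \<gamma>' t)"
      by (auto simp: indicator_def fun_eq_iff)
    finally show "set_borel_measurable lborel {0..T} \<gamma>'" by (simp add: set_borel_measurable_def)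
    show "AE t in lborel. t \<in> {0..T} \<longrightarrow> norm (\<gamma>' t) \<le> norm (1 + (norm (\<gamma>' t))\<^sup>2)"
    proof (intro AE_I2 impI)
      fix t
      have "0 \<le> (norm (\<gamma>' t) - 1/2)\<^sup>2" by simp
      then have "norm (\<gamma>' t) \<le> 1 + (norm (\<gamma>' t))\<^sup>2" by (simp add: power2_eq_square algebra_simps)
      then show "norm (\<gamma>' t) \<le> norm (1 + (norm (\<gamma>' t))\<^sup>2)" by simp
    qed
  qed
  then show ?thesis
    by (rule set_integrable_subset) (use assms(2) in \<open>auto simp: T_def\<close>)
qed

text \<open>The difference of two steep ramps is a smoothed indicator of the interval from
  \<open>a\<close> to \<open>b\<close>, and its derivative is a difference of approximate identities
  at \<open>a\<close> and at \<open>b\<close>.\<close>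

lemma test_function_ramps:
  assumes "0 < a" "a < b"
  shows "test_function (\<lambda>t. ramp (real (Suc n) * (t - a)) - ramp (real (Suc n) * (t - b)))"
    and "deriv (\<lambda>t. ramp (real (Suc n) * (t - a)) - ramp (real (Suc n) * (t - b))) =
      (\<lambda>t. real (Suc n) * tent (real (Suc n) * (t - a)) - real (Suc n) * tent (real (Suc n) * (t - b)))"
proof -
  let ?k = "real (Suc n)"
  let ?\<phi> = "\<lambda>t. ramp (?k * (t - a)) - ramp (?k * (t - b))"
  let ?\<phi>' = "\<lambda>t. ?k * tent (?k * (t - a)) - ?k * tent (?k * (t - b))"
  have "((\<lambda>t. ramp (?k * (t - r))) has_real_derivative tent (?k * (t - r)) * ?k) (at t)" for r t
    by (rule DERIV_chain2[OF ramp_derivative]) (auto intro!: derivative_eq_intros)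
  from DERIV_diff[OF this this]
  have D: "(?\<phi> has_real_derivative ?\<phi>' t) (at t)" for t by (simp add: mult.commute)
  then show d: "deriv ?\<phi> = ?\<phi>'" by (intro ext DERIV_imp_deriv)
  have "continuous_on UNIV ?\<phi>'"
    by (intro continuous_intros continuous_on_compose2[OF continuous_tent[of UNIV]]) auto
  moreover have "t \<in> {a..b + 1}" if "?\<phi> t \<noteq> 0" for t
  proof (rule ccontr)
    assume "t \<notin> {a..b + 1}"
    then consider "t < a" | "t > b + 1" by force
    then show False
    proof cases
      case 1
      then have "?k * (t - a) \<le> 0" "?k * (t - b) \<le> 0" using assms by (simp_all add: mult_nonneg_nonpos)
      then show False using that by (simp add: ramp_simps del: of_nat_Suc)
    next
      case 2
      then have "1 * 1 \<le> ?k * (t - a)" "1 * 1 \<le> ?k * (t - b)" using assms by (intro mult_mono; simp)+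
      then show False using that by (simp add: ramp_simps del: of_nat_Suc)
    qed
  qed
  moreover have "?\<phi> differentiable (at t)" for t
    using D[of t] real_differentiable_def by blast
  ultimately show "test_function ?\<phi>"
    unfolding test_function_def d using assms(1) by blast
qed

text \<open>Testing the weak derivative with smoothed indicators produces
  \<open>\<gamma> a - \<gamma> b\<close> on one side and minus the integral of
  \<open>\<gamma>'\<close> on the other. The condition \<open>0 < a\<close> reflects that test
  functions vanish near \<open>0\<close>; the case \<open>a = 0\<close> is recovered later by
  continuity.\<close>

lemma H1_loc_path_increment:
  fixes \<gamma> :: "real \<Rightarrow> real^'n"
  assumes H: "H1_loc_path \<gamma> \<gamma>'" and ab: "0 < a" "a < b"
  shows "\<gamma> b - \<gamma> a = (LINT t:{a..b}|lborel. \<gamma>' t)"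
proof -
  define \<phi> where "\<phi> = (\<lambda>n t. ramp (real (Suc n) * (t - a)) - ramp (real (Suc n) * (t - b)))"
  \<comment> \<open>A continuous extension to the whole line, as \<open>\<gamma>\<close> is
    arbitrary at negative times.\<close>
  define g where "g = (\<lambda>t. \<gamma> (max 0 t))"
  have g: "continuous_on UNIV g"
  proof -
    have "continuous_on {0..} \<gamma>" using H unfolding H1_loc_path_def by blast
    then show ?thesis unfolding g_def
      by (rule continuous_on_compose2) (auto intro!: continuous_intros)
  qed
  have weak: "(LINT t:{0<..}|lborel. deriv (\<phi> n) t *\<^sub>R \<gamma> t) = - (LINT t:{0<..}|lborel. \<phi> n t *\<^sub>R \<gamma>' t)" for n
    using H test_function_ramps(1)[OF ab] unfolding H1_loc_path_def \<phi>_def by blast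
  let ?\<tau> = "\<lambda>n r t. real (Suc n) * tent (real (Suc n) * (t - r))"
  have zero: "?\<tau> n r t = 0" if "t \<le> 0" "r > 0" for n r t
    using that by (intro mult_eq_0_iff[THEN iffD2] disjI2 tent_support(1)) (simp add: mult_nonneg_nonpos)
  have left: "(LINT t:{0<..}|lborel. deriv (\<phi> n) t *\<^sub>R \<gamma> t) =
      (\<integral>t. ?\<tau> n a t *\<^sub>R g t \<partial>lborel) - (\<integral>t. ?\<tau> n b t *\<^sub>R g t \<partial>lborel)" for n
  proof -
    have "(LINT t:{0<..}|lborel. deriv (\<phi> n) t *\<^sub>R \<gamma> t) = (\<integral>t. ?\<tau> n a t *\<^sub>R g t - ?\<tau> n b t *\<^sub>R g t \<partial>lborel)"
      unfolding set_lebesgue_integral_def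
    proof (rule Bochner_Integration.integral_cong[OF refl])
      fix t
      show "indicator {0<..} t *\<^sub>R deriv (\<phi> n) t *\<^sub>R \<gamma> t = ?\<tau> n a t *\<^sub>R g t - ?\<tau> n b t *\<^sub>R g t"
      proof (cases "t > 0")
        case True
        then show ?thesis
          unfolding \<phi>_def test_function_ramps(2)[OF ab] by (simp add: g_def scaleR_diff_left)
      next
        case False
        then have "?\<tau> n a t = 0" "?\<tau> n b t = 0" using zero[of t a n] zero[of t b n] ab by auto
        then show ?thesis using False by simp
      qed
    qed
    also have "\<dots> = (\<integral>t. ?\<tau> n a t *\<^sub>R g t \<partial>lborel) - (\<integral>t. ?\<tau> n b t *\<^sub>R g t \<partial>lborel)"
      by (intro Bochner_Integration.integral_diff approximate_identity_limit(2)[OF g])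
    finally show ?thesis .
  qed
  have lim1: "(\<lambda>n. LINT t:{0<..}|lborel. deriv (\<phi> n) t *\<^sub>R \<gamma> t) \<longlonglongrightarrow> g a - g b"
    unfolding left by (intro tendsto_diff approximate_identity_limit(1)[OF g])
  have int: "set_integrable lborel {a..b+1} \<gamma>'" using H1_loc_path_integrable[OF H, of a] ab by simp
  have \<phi>_out: "\<phi> n t = 0" if "t \<notin> {a..b+1}" for n t
  proof -
    from that consider "t < a" | "t > b + 1" by force
    then show ?thesis
    proof cases
      case 1
      then have "real (Suc n) * (t - a) \<le> 0" "real (Suc n) * (t - b) \<le> 0" using ab by (simp_all add: mult_nonneg_nonpos)
      then show ?thesis by (simp add: \<phi>_def ramp_simps del: of_nat_Suc)
    next
      case 2
      then have "1 * 1 \<le> real (Suc n) * (t - a)" "1 * 1 \<le> real (Suc n) * (t - b)" using ab by (intro mult_mono; simp)+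
      then show ?thesis by (simp add: \<phi>_def ramp_simps del: of_nat_Suc)
    qed
  qed
  have \<phi>_bd: "\<bar>\<phi> n t\<bar> \<le> 1" for n t
    using ramp_bounds[of "real (Suc n) * (t - a)"] ramp_bounds[of "real (Suc n) * (t - b)"]
    unfolding \<phi>_def by linarith
  have \<phi>_lim: "(\<lambda>n. \<phi> n t) \<longlonglongrightarrow> indicator {a<..b} t" for t
  proof -
    have R: "(\<lambda>n. ramp (real (Suc n) * (t - r))) \<longlonglongrightarrow> indicator {r<..} t" for r
    proof (cases "t > r")
      case True
      obtain n0 where n0: "real n0 > 1 / (t - r)" using reals_Archimedean2 by blast
      have "ramp (real (Suc n) * (t - r)) = 1" if "n \<ge> n0" for n
      proof (rule ramp_simps(2))
        have "1 / (t - r) \<le> real (Suc n)" using n0 that by simp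
        then show "1 \<le> real (Suc n) * (t - r)" using True by (simp only: pos_divide_le_eq diff_gt_0_iff_gt)
      qed
      then have "\<forall>\<^sub>F n in sequentially. ramp (real (Suc n) * (t - r)) = 1"
        unfolding eventually_sequentially by blast
      then show ?thesis using True by (simp add: tendsto_eventually del: of_nat_Suc)
    next
      case False
      then have "ramp (real (Suc n) * (t - r)) = 0" for n
        by (intro ramp_simps(1)) (simp add: mult_nonneg_nonpos)
      then show ?thesis using False by simp
    qed
    have "(\<lambda>n. \<phi> n t) \<longlonglongrightarrow> indicator {a<..} t - indicator {b<..} t"
      unfolding \<phi>_def by (intro tendsto_diff R)
    also have "indicator {a<..} t - indicator {b<..} t = (indicator {a<..b} t :: real)"
      using ab by (auto simp: indicator_def)
    finally show ?thesis .
  qed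
  have mg: "(\<lambda>t. indicator {a..b+1} t *\<^sub>R \<gamma>' t) \<in> borel_measurable lborel"
    using int unfolding set_integrable_def by (rule borel_measurable_integrable)
  have \<phi>_cont: "continuous_on UNIV (\<phi> n)" for n
  proof -
    have "continuous_on UNIV (\<lambda>t. ramp (real (Suc n) * (t - r)))" for r
      by (rule continuous_on_compose2[OF continuous_ramp[of UNIV]]) (auto intro!: continuous_intros)
    then show ?thesis unfolding \<phi>_def by (intro continuous_on_diff)
  qed
  have lim2: "(\<lambda>n. \<integral>t. \<phi> n t *\<^sub>R (indicator {a..b+1} t *\<^sub>R \<gamma>' t) \<partial>lborel) \<longlonglongrightarrow>
      (\<integral>t. indicator {a<..b} t *\<^sub>R (indicator {a..b+1} t *\<^sub>R \<gamma>' t) \<partial>lborel)"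
  proof (rule integral_dominated_convergence[where w = "\<lambda>t. norm (indicator {a..b+1} t *\<^sub>R \<gamma>' t)"])
    show "integrable lborel (\<lambda>t. norm (indicator {a..b+1} t *\<^sub>R \<gamma>' t))"
      using int unfolding set_integrable_def by (rule integrable_norm)
    show "AE t in lborel. (\<lambda>n. \<phi> n t *\<^sub>R (indicator {a..b+1} t *\<^sub>R \<gamma>' t)) \<longlonglongrightarrow>
        indicator {a<..b} t *\<^sub>R (indicator {a..b+1} t *\<^sub>R \<gamma>' t)"
      by (intro AE_I2 tendsto_scaleR \<phi>_lim tendsto_const)
    fix n
    show "AE t in lborel. norm (\<phi> n t *\<^sub>R (indicator {a..b+1} t *\<^sub>R \<gamma>' t)) \<le> norm (indicator {a..b+1} t *\<^sub>R \<gamma>' t)"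
    proof (rule AE_I2)
      fix t
      show "norm (\<phi> n t *\<^sub>R (indicator {a..b+1} t *\<^sub>R \<gamma>' t)) \<le> norm (indicator {a..b+1} t *\<^sub>R \<gamma>' t)"
        unfolding norm_scaleR[of "\<phi> n t"]
        using mult_right_mono[OF \<phi>_bd[of n t], of "norm (indicator {a..b+1} t *\<^sub>R \<gamma>' t)"] by (simp only: mult_1 norm_ge_zero)
    qed
    show "(\<lambda>t. \<phi> n t *\<^sub>R (indicator {a..b+1} t *\<^sub>R \<gamma>' t)) \<in> borel_measurable lborel"
      by (rule borel_measurable_scaleR[OF _ mg])
         (use borel_measurable_continuous_onI[OF \<phi>_cont[of n]] in simp)
  next
    show "(\<lambda>t. indicator {a<..b} t *\<^sub>R (indicator {a..b+1} t *\<^sub>R \<gamma>' t)) \<in> borel_measurable lborel"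
      by (rule borel_measurable_scaleR[OF _ mg]) measurable
  qed
  have right: "(LINT t:{0<..}|lborel. \<phi> n t *\<^sub>R \<gamma>' t) = (\<integral>t. \<phi> n t *\<^sub>R (indicator {a..b+1} t *\<^sub>R \<gamma>' t) \<partial>lborel)" for n
    unfolding set_lebesgue_integral_def
  proof (rule Bochner_Integration.integral_cong[OF refl])
    fix t
    show "indicator {0<..} t *\<^sub>R \<phi> n t *\<^sub>R \<gamma>' t = \<phi> n t *\<^sub>R (indicator {a..b+1} t *\<^sub>R \<gamma>' t)"
      using \<phi>_out[of t n] ab by (cases "t \<in> {a..b+1}") (auto simp: indicator_def)
  qed
  have "(\<integral>t. indicator {a<..b} t *\<^sub>R (indicator {a..b+1} t *\<^sub>R \<gamma>' t) \<partial>lborel) = (LINT t:{a..b}|lborel. \<gamma>' t)"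
    unfolding set_lebesgue_integral_def
  proof (rule integral_cong_AE)
    show "(\<lambda>t. indicator {a<..b} t *\<^sub>R (indicator {a..b+1} t *\<^sub>R \<gamma>' t)) \<in> borel_measurable lborel"
      by (rule borel_measurable_scaleR[OF _ mg]) measurable
    show "(\<lambda>t. indicator {a..b} t *\<^sub>R \<gamma>' t) \<in> borel_measurable lborel"
      using H1_loc_path_integrable[OF H, of a b] ab unfolding set_integrable_def
      by (intro borel_measurable_integrable) auto
    have "AE t in lborel. t \<noteq> a" by (rule AE_lborel_singleton)
    then show "AE t in lborel. indicator {a<..b} t *\<^sub>R (indicator {a..b+1} t *\<^sub>R \<gamma>' t) = indicator {a..b} t *\<^sub>R \<gamma>' t"
      by (rule AE_mp) (auto simp: indicator_def)
  qed
  then have "(\<lambda>n. - (LINT t:{0<..}|lborel. \<phi> n t *\<^sub>R \<gamma>' t)) \<longlonglongrightarrow> - (LINT t:{a..b}|lborel. \<gamma>' t)"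
    using tendsto_minus[OF lim2] unfolding right by simp
  with lim1 have "g a - g b = - (LINT t:{a..b}|lborel. \<gamma>' t)"
    unfolding weak by (rule LIMSEQ_unique)
  then have "g b - g a = (LINT t:{a..b}|lborel. \<gamma>' t)"
    by (metis minus_diff_eq minus_minus)
  then show ?thesis using ab by (simp add: g_def)
qed

section \<open>From chains in the closure to admissible paths\<close>

context elliptic_setting
begin

lemma chain_set_nodes:
  assumes "x \<in> chain_set r S k"
  shows "\<exists>xs. xs 0 = x \<and> xs (Suc k) \<in> S \<and>
    (\<forall>j\<le>k. xs j \<in> closure \<Omega> \<and> N (xs j) (xs (Suc j) - xs j) \<le> r)"
  using assms
proof (induction k arbitrary: x)
  case 0
  then obtain z where z: "x \<in> closure \<Omega>" "z \<in> S" "N x (z - x) \<le> r" by auto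
  show ?case
    by (rule exI[of _ "\<lambda>j. if j = 0 then x else z"]) (use z in auto)
next
  case (Suc k)
  then obtain y where y: "x \<in> closure \<Omega>" "y \<in> chain_set r S k" "N x (y - x) \<le> r" by auto
  obtain xs where xs: "xs 0 = y" "xs (Suc k) \<in> S"
    "\<And>j. j \<le> k \<Longrightarrow> xs j \<in> closure \<Omega> \<and> N (xs j) (xs (Suc j) - xs j) \<le> r"
    using Suc.IH[OF y(2)] by blast
  show ?case
  proof (rule exI[of _ "\<lambda>j. case j of 0 \<Rightarrow> x | Suc i \<Rightarrow> xs i"], intro conjI allI impI)
    fix j assume "j \<le> Suc k"
    then show "(case j of 0 \<Rightarrow> x | Suc i \<Rightarrow> xs i) \<in> closure \<Omega>"
      and "N (case j of 0 \<Rightarrow> x | Suc i \<Rightarrow> xs i) ((case Suc j of 0 \<Rightarrow> x | Suc i \<Rightarrow> xs i) - (case j of 0 \<Rightarrow> x | Suc i \<Rightarrow> xs i)) \<le> r"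
      using y xs by (auto split: nat.split)
  qed (use xs in auto)
qed

text \<open>A chain in the closure is pushed into the domain along the inward field; the resulting
  polygon is joined to the end points of the chain by two short segments.\<close>

lemma chain_set_path_length:
  assumes "C11_boundary \<Omega>" "\<delta> > 0" "S \<subseteq> frontier \<Omega>"
  obtains r0 where "r0 > 0"
    "\<And>r k x. \<lbrakk>0 < r; r < r0; x \<in> \<Omega>; x \<in> chain_set r S k\<rbrakk> \<Longrightarrow>
       \<exists>l\<in>path_lengths A \<Omega> S x. l \<le> (1 + \<delta>) * (real (Suc k) * r) + \<delta>"
proof -
  have bounded: "bounded \<Omega>"
    using compact_imp_bounded[OF compact_closure_domain] bounded_subset closure_subset by blast
  obtain V :: "real^'n \<Rightarrow> real^'n" and s0 L where V: "s0 > 0" "L > 0"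
    "\<And>x s. \<lbrakk>x \<in> closure \<Omega>; 0 < s; s \<le> s0\<rbrakk> \<Longrightarrow> x + s *\<^sub>R V x \<in> \<Omega>"
    "\<And>x y. norm (V x - V y) \<le> L * norm (x - y)" "\<And>x. norm (V x) \<le> L"
    using inward_field[OF bounded open_domain assms(1)] by metis
  obtain \<rho> where \<rho>: "\<rho> > 0"
    "\<And>x y. \<lbrakk>x \<in> cball 0 R; y \<in> cball 0 R; norm (y - x) < \<rho>\<rbrakk> \<Longrightarrow> norm (A x - A y) \<le> (\<delta> / 2) * c"
    using coefficients_close[of "\<delta> / 2"] assms(2) by auto
  have sc: "sqrt c > 0" "sqrt \<Lambda> > 0" using c_pos \<Lambda>_pos by auto
  \<comment> \<open>The four bounds keep the shift within the range of the inward field, make each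
    of the two end segments cost at most \<open>\<delta> / 2\<close>, let the variation of the field
    add at most \<open>\<delta> / 2 * r\<close> to an edge, and keep the displacement below
    \<open>\<rho> / 2\<close>.\<close>
  define s where "s = Min {s0, \<delta> / 2 * sqrt c / L, \<delta> / 2 * sqrt c / (L * sqrt \<Lambda>), \<rho> / 2 / L}"
  have s: "s > 0" "s \<le> s0" "s \<le> \<delta> / 2 * sqrt c / L" "s \<le> \<delta> / 2 * sqrt c / (L * sqrt \<Lambda>)" "s \<le> \<rho> / 2 / L"
    using V(1,2) sc assms(2) \<rho>(1) by (auto simp: s_def)
  have s': "s * L / sqrt c \<le> \<delta> / 2" "s * L * sqrt \<Lambda> / sqrt c \<le> \<delta> / 2" "s * L \<le> \<rho> / 2"
    using s(3-5) V(2) sc by (simp_all add: field_simps)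
  define \<Phi> where "\<Phi> = (\<lambda>x. x + s *\<^sub>R V x)"
  have \<Phi>_in: "\<Phi> x \<in> \<Omega>" if "x \<in> closure \<Omega>" for x
    unfolding \<Phi>_def using V(3)[OF that s(1,2)] .
  have \<Phi>_lip: "norm (\<Phi> x - \<Phi> y) \<le> (1 + s * L) * norm (x - y)" for x y
  proof -
    have "\<Phi> x - \<Phi> y = (x - y) + s *\<^sub>R (V x - V y)" by (simp add: \<Phi>_def algebra_simps)
    then have "norm (\<Phi> x - \<Phi> y) \<le> norm (x - y) + s * norm (V x - V y)"
      using norm_triangle_ineq[of "x - y" "s *\<^sub>R (V x - V y)"] s(1) by simp
    also have "\<dots> \<le> norm (x - y) + s * (L * norm (x - y))"
      using V(4)[of x y] s(1) by (intro add_left_mono mult_left_mono) auto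
    finally show ?thesis by (simp add: algebra_simps)
  qed
  have "continuous_on (closure \<Omega>) \<Phi>"
    using \<Phi>_lip V(2) s(1) by (intro lipschitz_on_continuous_on[of "1 + s * L"] lipschitz_onI) (auto simp: dist_norm)
  then have "compact (\<Phi> ` closure \<Omega>)" by (rule compact_continuous_image[OF _ compact_closure_domain])
  \<comment> \<open>The shifted closure is a compact subset of the domain, so a straight edge that
    starts in it and is shorter than \<open>d0\<close> stays in the domain.\<close>
  then obtain d0 where d0: "d0 > 0" "\<And>y. y \<in> \<Phi> ` closure \<Omega> \<Longrightarrow> ball y d0 \<subseteq> \<Omega>"
    using compact_subset_open_imp_ball_epsilon_subset[OF _ open_domain, of "\<Phi> ` closure \<Omega>"] \<Phi>_in by (metis (no_types, lifting) SUP_le_iff image_subsetI)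
  \<comment> \<open>\<open>q * r\<close> bounds the Euclidean length of an edge after the
    shift.\<close>
  define q where "q = (1 + s * L) * sqrt \<Lambda>"
  have q: "q > 0" using s(1) V(2) sc by (simp add: q_def add_pos_pos)
  define r0 where "r0 = min d0 (\<rho> / 2) / q"
  show thesis
  proof (rule that[of r0])
    show "r0 > 0" using d0(1) \<rho>(1) q by (simp add: r0_def)
    fix r k x assume r: "0 < r" "r < r0" and x: "x \<in> \<Omega>" "x \<in> chain_set r S k"
    have qr: "q * r < d0" "q * r < \<rho> / 2"
      using r(2) q by (auto simp: r0_def min_less_iff_conj pos_less_divide_eq mult.commute)
    obtain xs where xs: "xs 0 = x" "xs (Suc k) \<in> S"
      "\<And>j. j \<le> k \<Longrightarrow> xs j \<in> closure \<Omega> \<and> N (xs j) (xs (Suc j) - xs j) \<le> r"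
      using chain_set_nodes[OF x(2)] by blast
    have z: "xs (Suc k) \<in> closure \<Omega>" using xs(2) assms(3) frontier_eq by blast
    have xcl: "xs j \<in> closure \<Omega>" if "j \<le> Suc k" for j
      using that xs(3)[of j] z le_Suc_eq by blast
    \<comment> \<open>The vertices are \<open>x\<close>, then the shifts of the \<open>k + 2\<close>
      nodes, then the unshifted last node. Of the \<open>k + 3\<close> edges the first and the last
      cost \<open>\<delta> / 2\<close> each, and each of the \<open>k + 1\<close> others costs
      \<open>(1 + \<delta>) * r\<close>.\<close>
    define p where "p = (\<lambda>j. if j = 0 then x else if j \<le> Suc (Suc k) then \<Phi> (xs (j - 1)) else xs (Suc k))"
    define cc where "cc = (\<lambda>j. if j = 0 \<or> j = Suc (Suc k) then \<delta> / 2 else (1 + \<delta>) * r)"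
    have short: "norm (xs (Suc j) - xs j) \<le> sqrt \<Lambda> * r" if "j \<le> k" for j
    proof -
      have "norm (xs (Suc j) - xs j) \<le> sqrt \<Lambda> * N (xs j) (xs (Suc j) - xs j)"
        using closure_in_cball xs(3)[OF that] by (intro norm_le_N) auto
      also have "\<dots> \<le> sqrt \<Lambda> * r" using xs(3)[OF that] sc by (intro mult_left_mono) auto
      finally show ?thesis .
    qed
    have \<Phi>short: "norm (\<Phi> (xs (Suc j)) - \<Phi> (xs j)) \<le> q * r" if "j \<le> k" for j
    proof -
      have "norm (\<Phi> (xs (Suc j)) - \<Phi> (xs j)) \<le> (1 + s * L) * norm (xs (Suc j) - xs j)" by (rule \<Phi>_lip)
      also have "\<dots> \<le> (1 + s * L) * (sqrt \<Lambda> * r)"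
        using short[OF that] s(1) V(2) by (intro mult_left_mono) auto
      finally show ?thesis by (simp add: q_def mult.assoc)
    qed
    have Vshort: "N y (s *\<^sub>R V w) \<le> \<delta> / 2" for y w
    proof -
      have "N y (s *\<^sub>R V w) \<le> norm (s *\<^sub>R V w) / sqrt c" by (rule N_le)
      also have "\<dots> \<le> s * L / sqrt c" using V(5)[of w] s(1) sc by (simp add: divide_right_mono)
      finally show ?thesis using s'(1) by linarith
    qed
    have "\<exists>l\<in>path_lengths A \<Omega> S (p 0). l \<le> (\<Sum>j<Suc (Suc (Suc k)). cc j)"
    proof (rule polygon_path_length)
      show "p (Suc (Suc (Suc k))) \<in> S" using xs(2) by (simp add: p_def)
      show "S \<inter> \<Omega> = {}" using assms(3) frontier_eq by blast
      fix j assume j: "j < Suc (Suc (Suc k))"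
      show "cc j \<ge> 0" using assms(2) r by (simp add: cc_def)
      consider "j = 0" | i where "j = Suc i" "i \<le> k" | "j = Suc (Suc k)"
        using j by (cases j) (auto simp: less_Suc_eq_le le_Suc_eq)
      note cases = this
      {
        fix t :: real assume t: "0 \<le> t" "t < 1"
        show "p j + t *\<^sub>R (p (Suc j) - p j) \<in> \<Omega>"
        proof (cases rule: cases)
          case 1
          then have "p j + t *\<^sub>R (p (Suc j) - p j) = x + (t * s) *\<^sub>R V x"
            by (simp add: p_def \<Phi>_def xs(1))
          also have "\<dots> \<in> \<Omega>"
          proof (cases "t = 0")
            case False
            have "t * s \<le> 1 * s0" using t s by (intro mult_mono) auto
            then show ?thesis using V(3)[of x "t * s"] False t s x(1) closure_subset by auto
          qed (use x in simp)
          finally show ?thesis .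
        next
          case (2 i)
          have "dist (\<Phi> (xs i)) (p j + t *\<^sub>R (p (Suc j) - p j)) = t * norm (\<Phi> (xs (Suc i)) - \<Phi> (xs i))"
            using 2 t by (simp add: p_def dist_norm)
          also have "\<dots> \<le> 1 * (q * r)" using t \<Phi>short[OF 2(2)] by (intro mult_mono) auto
          also have "\<dots> < d0" using qr by simp
          finally show ?thesis using d0(2)[of "\<Phi> (xs i)"] xcl[of i] 2(2) by (auto simp: subset_iff)
        next
          case 3
          \<comment> \<open>The last edge runs backwards along the inward field and meets the
            frontier only at its end, \<open>t = 1\<close>.\<close>
          then have "p j + t *\<^sub>R (p (Suc j) - p j) = xs (Suc k) + ((1 - t) * s) *\<^sub>R V (xs (Suc k))"
            by (simp add: p_def \<Phi>_def algebra_simps)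
          also have "\<dots> \<in> \<Omega>"
          proof (rule V(3)[OF z])
            show "0 < (1 - t) * s" using t s by simp
            have "(1 - t) * s \<le> 1 * s0" using t s by (intro mult_mono) auto
            then show "(1 - t) * s \<le> s0" by simp
          qed
          finally show ?thesis .
        qed
      }
      {
        fix y assume y: "y \<in> closed_segment (p j) (p (Suc j))"
        show "N y (p (Suc j) - p j) \<le> cc j"
        proof (cases rule: cases)
          case 1
          then show ?thesis using Vshort[of y x] by (simp add: p_def \<Phi>_def cc_def xs(1))
        next
          case (2 i)
          then have yi: "y \<in> closed_segment (\<Phi> (xs i)) (\<Phi> (xs (Suc i)))" using y by (simp add: p_def)
          have xi: "xs i \<in> cball 0 R" "xs (Suc i) \<in> cball 0 R" using xcl closure_in_cball 2 by auto
          have "norm (y - \<Phi> (xs i)) \<le> norm (\<Phi> (xs (Suc i)) - \<Phi> (xs i))"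
            by (rule segment_bound1[OF yi])
          moreover have "norm (\<Phi> (xs i) - xs i) \<le> \<rho> / 2"
          proof -
            have "norm (\<Phi> (xs i) - xs i) = s * norm (V (xs i))" using s(1) by (simp add: \<Phi>_def)
            also have "\<dots> \<le> s * L" using V(5)[of "xs i"] s(1) by (intro mult_left_mono) auto
            finally show ?thesis using s'(3) by linarith
          qed
          ultimately have near: "norm (y - xs i) < \<rho>"
            using \<Phi>short[OF 2(2)] qr(2) norm_triangle_ineq[of "y - \<Phi> (xs i)" "\<Phi> (xs i) - xs i"] by simp
          have yR: "y \<in> cball 0 R"
          proof -
            have "\<Phi> (xs i) \<in> cball 0 R" "\<Phi> (xs (Suc i)) \<in> cball 0 R"
              using \<Phi>_in xcl 2 closure_subset closure_in_cball by (meson Suc_le_mono le_SucI subsetD)+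
            then show ?thesis using yi convex_cball convex_contains_segment by blast
          qed
          have "norm (A y - A (xs i)) \<le> (\<delta> / 2) * c"
            using \<rho>(2)[OF xi(1) yR near] by (simp add: norm_minus_commute)
          from N_compare[OF this] assms(2)
          have n1: "N y (xs (Suc i) - xs i) \<le> (1 + \<delta> / 2) * r"
            using xs(3)[OF 2(2)] mult_left_mono[of "N (xs i) (xs (Suc i) - xs i)" r "1 + \<delta> / 2"]
            by (meson add_nonneg_nonneg half_gt_zero_iff less_imp_le order_trans zero_le_one)
          have "N y (s *\<^sub>R (V (xs (Suc i)) - V (xs i))) \<le> norm (s *\<^sub>R (V (xs (Suc i)) - V (xs i))) / sqrt c"
            by (rule N_le)
          also have "\<dots> \<le> (s * (L * (sqrt \<Lambda> * r))) / sqrt c"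
          proof -
            have "norm (V (xs (Suc i)) - V (xs i)) \<le> L * norm (xs (Suc i) - xs i)" by (rule V(4))
            also have "\<dots> \<le> L * (sqrt \<Lambda> * r)" using short[OF 2(2)] V(2) by (intro mult_left_mono) auto
            finally show ?thesis using s(1) sc by (simp add: divide_right_mono)
          qed
          also have "\<dots> = (s * L * sqrt \<Lambda> / sqrt c) * r" by simp
          also have "\<dots> \<le> \<delta> / 2 * r" using s'(2) r(1) by (intro mult_right_mono) auto
          finally have n2: "N y (s *\<^sub>R (V (xs (Suc i)) - V (xs i))) \<le> \<delta> / 2 * r" .
          have "p (Suc j) - p j = (xs (Suc i) - xs i) + s *\<^sub>R (V (xs (Suc i)) - V (xs i))"
            using 2 by (simp add: p_def \<Phi>_def algebra_simps)
          then have "N y (p (Suc j) - p j) \<le> (1 + \<delta> / 2) * r + \<delta> / 2 * r"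
            using N_triangle[of y "xs (Suc i) - xs i" "s *\<^sub>R (V (xs (Suc i)) - V (xs i))"] n1 n2 by simp
          also have "\<dots> = (1 + \<delta>) * r" by (simp add: algebra_simps)
          finally show ?thesis using 2 by (simp add: cc_def)
        next
          case 3
          then have "p (Suc j) - p j = - (s *\<^sub>R V (xs (Suc k)))" by (simp add: p_def \<Phi>_def)
          then have "N y (p (Suc j) - p j) = N y (s *\<^sub>R V (xs (Suc k)))" by (simp only: N_minus)
          then show ?thesis using Vshort[of y "xs (Suc k)"] 3 by (simp add: cc_def)
        qed
      }
    qed simp
    moreover have "p 0 = x" by (simp add: p_def)
    moreover have "(\<Sum>j<Suc (Suc (Suc k)). cc j) = (1 + \<delta>) * (real (Suc k) * r) + \<delta>"
    proof -
      have "(\<Sum>j<Suc (Suc (Suc k)). cc j) = cc 0 + (\<Sum>j<Suc k. cc (Suc j)) + cc (Suc (Suc k))"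
        by (simp only: sum.lessThan_Suc[of cc "Suc (Suc k)"] sum.lessThan_Suc_shift[of cc "Suc k"])
      also have "(\<Sum>j<Suc k. cc (Suc j)) = (\<Sum>j<Suc k. (1 + \<delta>) * r)"
        by (rule sum.cong) (auto simp: cc_def)
      finally show ?thesis by (simp add: cc_def)
    qed
    ultimately show "\<exists>l\<in>path_lengths A \<Omega> S x. l \<le> (1 + \<delta>) * (real (Suc k) * r) + \<delta>" by simp
  qed
qed

text \<open>By the Euclidean bound on the metric, points of the closure at distance less than
  \<open>r * sqrt c\<close> from each other are joined by a jump in both directions. The union of
  all chain sets is therefore both open and closed in the connected closure.\<close>

lemma chain_set_exhausts:
  assumes "connected \<Omega>" "S \<subseteq> closure \<Omega>" "S \<noteq> {}" "r > 0" "x \<in> closure \<Omega>"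
  obtains k where "x \<in> chain_set r S k"
proof -
  define G where "G = (\<Union>k. chain_set r S k)"
  define e where "e = r * sqrt c"
  have e: "e > 0" using assms(4) c_pos by (simp add: e_def)
  have nbr: "x \<in> G" if "y \<in> G" "x \<in> closure \<Omega>" "dist x y < e" for x y
  proof -
    obtain k where "y \<in> chain_set r S k" using \<open>y \<in> G\<close> by (auto simp: G_def)
    moreover have "N x (y - x) \<le> r"
    proof -
      have "N x (y - x) \<le> norm (y - x) / sqrt c" by (rule N_le)
      also have "\<dots> \<le> e / sqrt c"
        using that(3) c_pos by (intro divide_right_mono) (auto simp: dist_norm norm_minus_commute)
      also have "\<dots> = r" using c_pos by (simp add: e_def)
      finally show ?thesis .
    qed
    ultimately have "x \<in> chain_set r S (Suc k)" using that(2) by auto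
    then show ?thesis unfolding G_def by blast
  qed
  have sub: "G \<subseteq> closure \<Omega>" unfolding G_def using chain_set_subset_closure by blast
  have "openin (top_of_set (closure \<Omega>)) G"
    unfolding openin_euclidean_subtopology_iff using sub nbr e by blast
  moreover have "openin (top_of_set (closure \<Omega>)) (closure \<Omega> - G)"
    unfolding openin_euclidean_subtopology_iff using nbr e by (metis Diff_iff Diff_subset dist_commute)
  then have "closedin (top_of_set (closure \<Omega>)) G"
    using sub by (simp add: closedin_def topspace_euclidean_subtopology)
  moreover have "connected (closure \<Omega>)" using assms(1) by (rule connected_imp_connected_closure)
  ultimately have "G = {} \<or> G = closure \<Omega>" unfolding connected_clopen by blast
  moreover have "G \<noteq> {}"
    using boundary_set_subset_chain_set[OF assms(2,4), of 0] assms(3) unfolding G_def by blast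
  ultimately show thesis using that assms(5) unfolding G_def by blast
qed

lemma path_lengths_bdd_below: "bdd_below (path_lengths A \<Omega> S x)"
  using path_lengths_nonneg[of A] N_nonneg by (intro bdd_belowI[of _ 0]) blast

lemma dist_S_le: "l \<in> path_lengths A \<Omega> S x \<Longrightarrow> dist_S A \<Omega> S x \<le> l"
  unfolding dist_S_eq_Inf by (rule cInf_lower[OF _ path_lengths_bdd_below])

text \<open>Needed because the infimum of real numbers in \<open>dist_S\<close> is meaningful only
  for a nonempty set; any chain to \<open>S\<close> yields an admissible path, with the tolerance
  \<open>1\<close> chosen for convenience.\<close>

lemma path_lengths_nonempty:
  assumes "C11_boundary \<Omega>" "connected \<Omega>" "S \<subseteq> frontier \<Omega>" "S \<noteq> {}" "x \<in> \<Omega>"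
  shows "path_lengths A \<Omega> S x \<noteq> {}"
proof -
  obtain r0 where r0: "r0 > 0"
    "\<And>r k x. \<lbrakk>0 < r; r < r0; x \<in> \<Omega>; x \<in> chain_set r S k\<rbrakk> \<Longrightarrow>
       \<exists>l\<in>path_lengths A \<Omega> S x. l \<le> (1 + 1) * (real (Suc k) * r) + 1"
    using chain_set_path_length[OF assms(1) _ assms(3), of 1] by auto
  have "S \<subseteq> closure \<Omega>" "x \<in> closure \<Omega>" using assms(3,5) frontier_eq closure_subset by auto
  then obtain k where "x \<in> chain_set (r0 / 2) S k"
    using chain_set_exhausts[OF assms(2) _ assms(4), of "r0 / 2" x] r0(1) by auto
  then show ?thesis using r0(2)[of "r0 / 2" x k] r0(1) assms(5) by auto
qed

text \<open>For the least \<open>k\<close> with \<open>x\<close> in the chain set, failure at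
  \<open>k - 1\<close> gives \<open>k\<close> factors of decay, while membership at \<open>k\<close>
  gives a path whose length is about \<open>k + 1\<close> jumps. The surplus jump is absorbed by
  taking \<open>r\<close> small.\<close>

lemma resolvent_upper_bound:
  assumes "C11_boundary \<Omega>" "connected \<Omega>" "S \<subseteq> frontier \<Omega>" "S \<noteq> {}" and \<delta>: "0 < \<delta>" "\<delta> < 1"
  shows "\<exists>\<epsilon>0>0. \<forall>\<epsilon> v M x. 0 < \<epsilon> \<longrightarrow> \<epsilon> < \<epsilon>0 \<longrightarrow> resolvent_solution \<epsilon> v \<longrightarrow> M \<ge> 0 \<longrightarrow>
      (\<forall>y\<in>closure \<Omega>. v y \<le> M) \<longrightarrow> (\<forall>y\<in>frontier \<Omega> - S. v y \<le> 0) \<longrightarrow> x \<in> \<Omega> \<longrightarrow>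
      v x \<le> M * exp (- ((1 - \<delta>) * dist_S A \<Omega> S x - \<delta>) / \<epsilon>)"
proof -
  \<comment> \<open>A quarter suffices: \<open>(1 - \<delta>) * (1 + \<delta>')\<close> is at most
    \<open>1 - \<delta>'\<close>, and the additive errors sum to at most
    \<open>3 * \<delta>'\<close>.\<close>
  define \<delta>' where "\<delta>' = \<delta> / 4"
  have \<delta>': "0 < \<delta>'" "\<delta>' < 1" using \<delta> by (auto simp: \<delta>'_def)
  obtain \<rho> where \<rho>: "\<rho> > 0"
    "\<And>r. \<lbrakk>0 < r; r < \<rho>\<rbrakk> \<Longrightarrow> \<exists>\<epsilon>0>0. \<forall>\<epsilon> v M S k x. 0 < \<epsilon> \<longrightarrow> \<epsilon> < \<epsilon>0 \<longrightarrow> resolvent_solution \<epsilon> v \<longrightarrow>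
        M \<ge> 0 \<longrightarrow> (\<forall>y\<in>closure \<Omega>. v y \<le> M) \<longrightarrow> S \<subseteq> closure \<Omega> \<longrightarrow> (\<forall>y\<in>frontier \<Omega> - S. v y \<le> 0) \<longrightarrow>
        x \<in> closure \<Omega> \<longrightarrow> x \<notin> chain_set r S k \<longrightarrow> v x \<le> M * exp (- (1 - \<delta>') * r / \<epsilon>) ^ Suc k"
    using chain_upper_bound[OF \<delta>'] by blast
  obtain r0 where r0: "r0 > 0"
    "\<And>r k x. \<lbrakk>0 < r; r < r0; x \<in> \<Omega>; x \<in> chain_set r S k\<rbrakk> \<Longrightarrow>
       \<exists>l\<in>path_lengths A \<Omega> S x. l \<le> (1 + \<delta>') * (real (Suc k) * r) + \<delta>'"
    using chain_set_path_length[OF assms(1) \<delta>'(1) assms(3)] by blast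
  define r where "r = Min {\<rho>, r0, \<delta>'} / 2"
  have r: "0 < r" "r < \<rho>" "r < r0" "r < \<delta>'"
    using \<rho>(1) r0(1) \<delta>' by (auto simp: r_def min_def)
  obtain \<epsilon>0 where \<epsilon>0: "\<epsilon>0 > 0" "\<And>\<epsilon> v M S k x. \<lbrakk>0 < \<epsilon>; \<epsilon> < \<epsilon>0; resolvent_solution \<epsilon> v;
        M \<ge> 0; \<forall>y\<in>closure \<Omega>. v y \<le> M; S \<subseteq> closure \<Omega>; \<forall>y\<in>frontier \<Omega> - S. v y \<le> 0;
        x \<in> closure \<Omega>; x \<notin> chain_set r S k\<rbrakk> \<Longrightarrow> v x \<le> M * exp (- (1 - \<delta>') * r / \<epsilon>) ^ Suc k"
    using \<rho>(2)[OF r(1,2)] by metis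
  have Scl: "S \<subseteq> closure \<Omega>" using assms(3) frontier_eq by blast
  have "v x \<le> M * exp (- ((1 - \<delta>) * dist_S A \<Omega> S x - \<delta>) / \<epsilon>)"
    if \<epsilon>: "0 < \<epsilon>" "\<epsilon> < \<epsilon>0" and v: "resolvent_solution \<epsilon> v" and M: "M \<ge> 0"
      "\<forall>y\<in>closure \<Omega>. v y \<le> M" "\<forall>y\<in>frontier \<Omega> - S. v y \<le> 0" and x: "x \<in> \<Omega>" for \<epsilon> v M x
  proof -
    have xcl: "x \<in> closure \<Omega>" using x closure_subset by blast
    define k where "k = (LEAST k. x \<in> chain_set r S k)"
    have k: "x \<in> chain_set r S k"
      unfolding k_def using chain_set_exhausts[OF assms(2) Scl assms(4) r(1) xcl] by (metis LeastI)
    define d where "d = dist_S A \<Omega> S x"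
    obtain l where "l \<in> path_lengths A \<Omega> S x" "l \<le> (1 + \<delta>') * (real (Suc k) * r) + \<delta>'"
      using r0(2)[OF r(1,3) x k] by blast
    then have d: "d \<le> (1 + \<delta>') * (real (Suc k) * r) + \<delta>'" using dist_S_le d_def by fastforce
    have "v x \<le> M * exp (- (1 - \<delta>') * r / \<epsilon>) ^ k"
    proof (cases k)
      \<comment> \<open>For \<open>k = 0\<close> no decay is available, and the claim is the global
        bound \<open>M\<close>.\<close>
      case 0
      then show ?thesis using M xcl by simp
    next
      case (Suc j)
      then have "x \<notin> chain_set r S j" unfolding k_def using not_less_Least by (metis lessI)
      then show ?thesis using \<epsilon>0(2)[OF \<epsilon> v M(1,2) Scl M(3) xcl] Suc by blast
    qed
    also have "exp (- (1 - \<delta>') * r / \<epsilon>) ^ k = exp (- ((1 - \<delta>') * (real k * r)) / \<epsilon>)"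
    proof -
      have "real k * (- a * r / \<epsilon>) = - (a * (real k * r)) / \<epsilon>" for a by (simp add: mult_ac)
      then show ?thesis unfolding exp_of_nat_mult[symmetric] by (rule arg_cong)
    qed
    also have "M * \<dots> \<le> M * exp (- ((1 - \<delta>) * d - \<delta>) / \<epsilon>)"
    proof (intro mult_left_mono M)
      have "(1 - \<delta>) * d \<le> (1 - \<delta>) * ((1 + \<delta>') * (real (Suc k) * r) + \<delta>')"
        using d \<delta> by (intro mult_left_mono) auto
      also have "\<dots> = ((1 - \<delta>) * (1 + \<delta>')) * (real k * r) + (1 - \<delta>) * ((1 + \<delta>') * r + \<delta>')"
        by (simp add: algebra_simps)
      also have "\<dots> \<le> (1 - \<delta>') * (real k * r) + \<delta>"
      proof (rule add_mono)
        have "(1 - \<delta>) * (1 + \<delta>') \<le> 1 - \<delta>'"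
          using \<delta> by (simp add: \<delta>'_def algebra_simps)
        then show "((1 - \<delta>) * (1 + \<delta>')) * (real k * r) \<le> (1 - \<delta>') * (real k * r)"
          using r(1) by (intro mult_right_mono) auto
        have "(1 + \<delta>') * r \<le> 2 * \<delta>'" using r \<delta>' by (intro mult_mono) auto
        then have "(1 - \<delta>) * ((1 + \<delta>') * r + \<delta>') \<le> 1 * (3 * \<delta>')"
          using \<delta> r \<delta>' by (intro mult_mono) auto
        then show "(1 - \<delta>) * ((1 + \<delta>') * r + \<delta>') \<le> \<delta>" using \<delta> by (simp add: \<delta>'_def)
      qed
      finally have "- ((1 - \<delta>') * (real k * r)) \<le> - ((1 - \<delta>) * d - \<delta>)" by simp
      then show "exp (- ((1 - \<delta>') * (real k * r)) / \<epsilon>) \<le> exp (- ((1 - \<delta>) * d - \<delta>) / \<epsilon>)"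
        using \<epsilon>(1) by (simp add: divide_right_mono del: minus_diff_eq)
    qed
    finally show ?thesis unfolding d_def .
  qed
  then show ?thesis using \<epsilon>0(1) by blast
qed

end

section \<open>Lower bounds along paths\<close>

lemma exp_small:
  fixes k \<theta> :: real
  assumes "k > 0" "\<theta> > 0"
  shows "\<exists>\<epsilon>0>0. \<forall>\<epsilon>. 0 < \<epsilon> \<longrightarrow> \<epsilon> < \<epsilon>0 \<longrightarrow> exp (- k / \<epsilon>) \<le> \<theta>"
proof (intro exI[of _ "\<theta> * k"] conjI allI impI)
  fix \<epsilon> assume \<epsilon>: "0 < \<epsilon>" "\<epsilon> < \<theta> * k"
  have "k / \<epsilon> \<le> exp (k / \<epsilon>)" using exp_ge_add_one_self[of "k / \<epsilon>"] by linarith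
  then have "inverse (exp (k / \<epsilon>)) \<le> inverse (k / \<epsilon>)"
    using assms \<epsilon> by (intro le_imp_inverse_le) auto
  also have "\<dots> \<le> \<theta>" using assms \<epsilon> by (simp add: field_simps)
  finally show "exp (- k / \<epsilon>) \<le> \<theta>" by (simp add: exp_minus)
qed (use assms in simp)

text \<open>The prefactor \<open>m\<close> and the subtracted boundary value of a lower barrier,
  with rate \<open>\<beta>'\<close>, are both absorbed by passing from the rate
  \<open>\<alpha>\<close> to any larger rate \<open>\<beta>\<close>.\<close>

lemma exp_gap:
  fixes \<alpha> \<beta> \<beta>' m :: real
  assumes "\<alpha> < \<beta>'" "\<alpha> < \<beta>" "m > 0"
  shows "\<exists>\<epsilon>0>0. \<forall>\<epsilon>. 0 < \<epsilon> \<longrightarrow> \<epsilon> < \<epsilon>0 \<longrightarrow> exp (- \<beta> / \<epsilon>) \<le> m * (exp (- \<alpha> / \<epsilon>) - exp (- \<beta>' / \<epsilon>))"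
proof -
  obtain e1 where e1: "e1 > 0" "\<And>\<epsilon>. 0 < \<epsilon> \<Longrightarrow> \<epsilon> < e1 \<Longrightarrow> exp (- (\<beta>' - \<alpha>) / \<epsilon>) \<le> 1 / 2"
    using exp_small[of "\<beta>' - \<alpha>" "1/2"] assms(1) by auto
  obtain e2 where e2: "e2 > 0" "\<And>\<epsilon>. 0 < \<epsilon> \<Longrightarrow> \<epsilon> < e2 \<Longrightarrow> exp (- (\<beta> - \<alpha>) / \<epsilon>) \<le> m / 2"
    using exp_small[of "\<beta> - \<alpha>" "m/2"] assms(2,3) by auto
  show ?thesis
  proof (intro exI[of _ "min e1 e2"] conjI allI impI)
    fix \<epsilon> assume \<epsilon>: "0 < \<epsilon>" "\<epsilon> < min e1 e2"
    have split: "exp (- b / \<epsilon>) = exp (- \<alpha> / \<epsilon>) * exp (- (b - \<alpha>) / \<epsilon>)" for b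
    proof -
      have "- b / \<epsilon> = - \<alpha> / \<epsilon> + - (b - \<alpha>) / \<epsilon>" by (simp add: diff_divide_distrib)
      then show ?thesis by (simp only: exp_add)
    qed
    have "exp (- \<beta> / \<epsilon>) \<le> exp (- \<alpha> / \<epsilon>) * (m / 2)"
      unfolding split[of \<beta>] using e2(2) \<epsilon> by (intro mult_left_mono) auto
    also have "\<dots> = m * (exp (- \<alpha> / \<epsilon>) - exp (- \<alpha> / \<epsilon>) * (1 / 2))" by (simp add: algebra_simps)
    also have "\<dots> \<le> m * (exp (- \<alpha> / \<epsilon>) - exp (- \<beta>' / \<epsilon>))"
      unfolding split[of \<beta>'] using e1(2) \<epsilon> assms(3) by (intro mult_left_mono diff_left_mono) auto
    finally show "exp (- \<beta> / \<epsilon>) \<le> m * (exp (- \<alpha> / \<epsilon>) - exp (- \<beta>' / \<epsilon>))" .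
  qed (use e1 e2 in simp)
qed

context elliptic_setting
begin

lemma norm_B_le: "norm (B x *v w) \<le> norm w / c"
proof -
  have "c * (norm (B x *v w))\<^sup>2 \<le> (A x *v (B x *v w)) \<bullet> (B x *v w)" by (rule elliptic)
  also have "\<dots> \<le> norm w * norm (B x *v w)" unfolding A_B by (rule norm_cauchy_schwarz)
  finally have "norm (B x *v w) * (c * norm (B x *v w) - norm w) \<le> 0"
    by (simp add: power2_eq_square algebra_simps)
  then have "c * norm (B x *v w) \<le> norm w"
    using c_pos by (cases "norm (B x *v w) = 0") (auto simp: mult_le_0_iff)
  then show ?thesis using c_pos by (simp add: pos_le_divide_eq mult.commute)
qed

text \<open>Resolvent identity: the difference of the inverses is \<open>B y\<close>, times
  \<open>A x - A y\<close>, times \<open>B x\<close>, and the norm of \<open>B y\<close> is at most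
  \<open>1 / c\<close>. Continuity of the entries is what makes the metric speed of a path
  measurable.\<close>

lemma continuous_B_component: "continuous_on UNIV (\<lambda>y. B y $ i $ j)"
proof (rule continuous_at_imp_continuous_on, rule ballI)
  fix x
  let ?e = "axis j 1 :: real^'n"
  have comp: "B y $ i $ j = (B y *v ?e) $ i" for y
    by (simp add: matrix_vector_mul_component inner_axis)
  have bound: "norm (B y $ i $ j - B x $ i $ j) \<le> (1 / c) * (norm (A x - A y) * norm (B x *v ?e))" for y
  proof -
    have "B y *v ?e - B x *v ?e = B y *v ((A x - A y) *v (B x *v ?e))"
      by (simp add: matrix_vector_mult_diff_rdistrib matrix_vector_mult_diff_distrib A_B B_A)
    then have "norm (B y *v ?e - B x *v ?e) \<le> norm ((A x - A y) *v (B x *v ?e)) / c"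
      using norm_B_le by simp
    also have "\<dots> \<le> (norm (A x - A y) * norm (B x *v ?e)) / c"
      using c_pos by (intro divide_right_mono norm_matrix_vector_mult_le) auto
    finally have "norm (B y *v ?e - B x *v ?e) \<le> (norm (A x - A y) * norm (B x *v ?e)) / c" .
    moreover have "norm (B y $ i $ j - B x $ i $ j) \<le> norm (B y *v ?e - B x *v ?e)"
      unfolding comp using component_le_norm_cart[of "B y *v ?e - B x *v ?e" i] by simp
    ultimately show ?thesis by simp
  qed
  have "((\<lambda>y. (1 / c) * (norm (A x - A y) * norm (B x *v ?e))) \<longlongrightarrow> (1 / c) * (norm (A x - A x) * norm (B x *v ?e))) (at x)"
    using continuous continuous_on_eq_continuous_at[of UNIV A]
    by (intro tendsto_intros) (auto simp: continuous_at)
  then have lim: "((\<lambda>y. (1 / c) * (norm (A x - A y) * norm (B x *v ?e))) \<longlongrightarrow> 0) (at x)" by simp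
  have "((\<lambda>y. B y $ i $ j - B x $ i $ j) \<longlongrightarrow> 0) (at x)"
    by (rule Lim_null_comparison[OF _ lim]) (intro always_eventually allI bound)
  then show "isCont (\<lambda>y. B y $ i $ j) x"
    unfolding isCont_def by (simp add: LIM_zero_iff)
qed

lemma metric_speed_integrable:
  assumes H: "H1_loc_path \<gamma> \<gamma>'" and "0 \<le> a"
  shows "set_integrable lborel {a..b} (\<lambda>t. N (\<gamma> t) (\<gamma>' t))"
proof -
  define g where "g = (\<lambda>t. \<gamma> (max 0 t))"
  define h where "h = (\<lambda>t. indicator {0..} t *\<^sub>R \<gamma>' t)"
  have "continuous_on {0..} \<gamma>" using H unfolding H1_loc_path_def by blast
  then have g: "continuous_on UNIV g"
    unfolding g_def by (rule continuous_on_compose2) (auto intro!: continuous_intros)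
  have h: "h \<in> borel_measurable borel"
    using H unfolding H1_loc_path_def set_borel_measurable_def h_def by simp
  have hj: "(\<lambda>t. h t $ j) \<in> borel_measurable borel" for j
  proof -
    have "(\<lambda>t. h t \<bullet> axis j 1) \<in> borel_measurable borel"
      by (intro borel_measurable_inner h borel_measurable_const)
    then show ?thesis by (simp add: inner_axis)
  qed
  have Bg: "(\<lambda>t. B (g t) $ i $ j) \<in> borel_measurable borel" for i j
    by (rule borel_measurable_continuous_onI, rule continuous_on_compose2[OF continuous_B_component g]) auto
  have "(\<lambda>t. sqrt (\<Sum>i\<in>UNIV. \<Sum>j\<in>UNIV. B (g t) $ i $ j * h t $ j * h t $ i)) \<in> borel_measurable borel"
    using Bg hj by measurable
  then have Nm: "(\<lambda>t. N (g t) (h t)) \<in> borel_measurable borel"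
    unfolding norm_A_def inner_matrix_vector_sum .
  have "set_borel_measurable lborel {a..b} (\<lambda>t. N (\<gamma> t) (\<gamma>' t))"
  proof -
    have "(\<lambda>t. indicator {a..b} t *\<^sub>R N (g t) (h t)) \<in> borel_measurable lborel"
      using Nm by simp
    also have "(\<lambda>t. indicator {a..b} t *\<^sub>R N (g t) (h t)) = (\<lambda>t. indicator {a..b} t *\<^sub>R N (\<gamma> t) (\<gamma>' t))"
      using assms(2) by (auto simp: fun_eq_iff indicator_def g_def h_def)
    finally show ?thesis unfolding set_borel_measurable_def .
  qed
  moreover have "set_integrable lborel {a..b} (\<lambda>t. (1 / sqrt c) *\<^sub>R \<gamma>' t)"
    by (intro set_integrable_scaleR_right H1_loc_path_integrable[OF assms])
  moreover have "norm (N (\<gamma> t) (\<gamma>' t)) \<le> norm ((1 / sqrt c) *\<^sub>R \<gamma>' t)" for t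
    using N_le[of "\<gamma> t" "\<gamma>' t"] N_nonneg c_pos by simp
  ultimately show ?thesis
    by (intro set_integrable_bound[of lborel "{a..b}" "\<lambda>t. (1 / sqrt c) *\<^sub>R \<gamma>' t" "\<lambda>t. N (\<gamma> t) (\<gamma>' t)"]
        AE_I2 impI)
qed

text \<open>Duality: with \<open>w\<close> the increment, the squared norm of \<open>w\<close> is
  the inner product of \<open>B x *v w\<close> with the integral of the velocity. The inner product
  is moved under the integral, estimated pointwise by the product of the norms, and one factor
  \<open>N x w\<close> is cancelled.\<close>

lemma N_increment_le_aux:
  assumes H: "H1_loc_path \<gamma> \<gamma>'" and ab: "0 < a" "a < b"
    and K: "\<And>t w. t \<in> {a..b} \<Longrightarrow> N x w \<le> K * N (\<gamma> t) w"
  shows "N x (\<gamma> b - \<gamma> a) \<le> K * (LINT t:{a..b}|lborel. N (\<gamma> t) (\<gamma>' t))"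
proof -
  define w where "w = \<gamma> b - \<gamma> a"
  have int: "set_integrable lborel {a..b} \<gamma>'" using H1_loc_path_integrable[OF H] ab by simp
  have intN: "set_integrable lborel {a..b} (\<lambda>t. N (\<gamma> t) (\<gamma>' t))" using metric_speed_integrable[OF H] ab by simp
  have "(N x w)\<^sup>2 = (B x *v w) \<bullet> (LINT t:{a..b}|lborel. \<gamma>' t)"
    unfolding N_square using H1_loc_path_increment[OF H ab] by (simp add: w_def)
  also have "\<dots> = (LINT t:{a..b}|lborel. (B x *v w) \<bullet> \<gamma>' t)"
    unfolding set_lebesgue_integral_def
    using integral_inner_right[of "B x *v w" lborel "\<lambda>t. indicator {a..b} t *\<^sub>R \<gamma>' t"] int
    unfolding set_integrable_def by simp
  also have "\<dots> \<le> (LINT t:{a..b}|lborel. (N x w * K) * N (\<gamma> t) (\<gamma>' t))"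
  proof (rule set_integral_mono)
    show "set_integrable lborel {a..b} (\<lambda>t. (B x *v w) \<bullet> \<gamma>' t)"
      using integrable_inner_right[of "B x *v w" lborel "\<lambda>t. indicator {a..b} t *\<^sub>R \<gamma>' t"] int
      unfolding set_integrable_def by simp
    show "set_integrable lborel {a..b} (\<lambda>t. (N x w * K) * N (\<gamma> t) (\<gamma>' t))"
      by (intro set_integrable_mult_right intN)
    fix t assume t: "t \<in> {a..b}"
    have "(B x *v w) \<bullet> \<gamma>' t \<le> N x w * N x (\<gamma>' t)" by (rule inner_B_le)
    also have "\<dots> \<le> N x w * (K * N (\<gamma> t) (\<gamma>' t))" using K[OF t] N_nonneg by (intro mult_left_mono) auto
    finally show "(B x *v w) \<bullet> \<gamma>' t \<le> (N x w * K) * N (\<gamma> t) (\<gamma>' t)" by (simp add: mult.assoc)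
  qed
  also have "\<dots> = N x w * (K * (LINT t:{a..b}|lborel. N (\<gamma> t) (\<gamma>' t)))"
    by (simp add: mult.assoc)
  finally have le: "N x w * N x w \<le> N x w * (K * (LINT t:{a..b}|lborel. N (\<gamma> t) (\<gamma>' t)))"
    by (simp add: power2_eq_square)
  show ?thesis
  proof (cases "N x w = 0")
    case False
    then have "N x w > 0" using N_nonneg[of x w] by simp
    then show ?thesis using le unfolding w_def by simp
  next
    \<comment> \<open>No sign of \<open>K\<close> is assumed; by the comparison hypothesis
      \<open>K * N (\<gamma> t) (\<gamma>' t)\<close> is at least \<open>N x (\<gamma>' t)\<close>
      on the interval, hence nonnegative.\<close>
    case True
    have "(LINT t:{a..b}|lborel. K * N (\<gamma> t) (\<gamma>' t)) \<ge> 0"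
      unfolding set_lebesgue_integral_def
    proof (intro integral_nonneg_AE AE_I2)
      fix t
      show "0 \<le> indicator {a..b} t *\<^sub>R (K * N (\<gamma> t) (\<gamma>' t))"
        using K[of t "\<gamma>' t"] N_nonneg[of x "\<gamma>' t"] by (auto simp: indicator_def)
    qed
    then show ?thesis using True w_def by simp
  qed
qed

lemma metric_length_HK:
  assumes H: "H1_loc_path \<gamma> \<gamma>'" "0 \<le> a"
  shows "(LINT t:{a..b}|lborel. N (\<gamma> t) (\<gamma>' t)) = integral {a..b} (\<lambda>t. N (\<gamma> t) (\<gamma>' t))"
    and "(\<lambda>t. N (\<gamma> t) (\<gamma>' t)) integrable_on {a..b}"
  using set_borel_integral_eq_integral[OF metric_speed_integrable[OF H]] by auto

text \<open>The initial time \<open>0\<close> is reached by letting the left end point decrease to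
  it: the increment is continuous in that point, and the integrals are monotone.\<close>

lemma N_increment_le:
  assumes H: "H1_loc_path \<gamma> \<gamma>'" and ab: "0 \<le> a" "a < b" and "K \<ge> 0"
    and K: "\<And>t w. t \<in> {a..b} \<Longrightarrow> N x w \<le> K * N (\<gamma> t) w"
  shows "N x (\<gamma> b - \<gamma> a) \<le> K * integral {a..b} (\<lambda>t. N (\<gamma> t) (\<gamma>' t))"
proof (cases "a > 0")
  case True
  show ?thesis using N_increment_le_aux[OF H True ab(2) K] metric_length_HK(1)[OF H ab(1)] by simp
next
  case False
  then have a: "a = 0" using ab by simp
  have cont: "continuous_on {0..b} \<gamma>"
    using H continuous_on_subset[of "{0..}" \<gamma> "{0..b}"] unfolding H1_loc_path_def by auto
  have "((\<lambda>s. N x (\<gamma> b - \<gamma> s)) \<longlongrightarrow> N x (\<gamma> b - \<gamma> 0)) (at 0 within {0..b})"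
  proof -
    have "continuous_on {0..b} (\<lambda>s. N x (\<gamma> b - \<gamma> s))"
      by (intro continuous_on_N continuous_intros cont)
    then show ?thesis using ab a unfolding continuous_on_def by auto
  qed
  moreover have "at 0 within {0..b} = at_right (0::real)"
    using ab a by (intro at_within_Icc_at_right) simp
  ultimately have lim: "((\<lambda>s. N x (\<gamma> b - \<gamma> s)) \<longlongrightarrow> N x (\<gamma> b - \<gamma> 0)) (at_right 0)" by simp
  have "\<forall>\<^sub>F s in at_right 0. N x (\<gamma> b - \<gamma> s) \<le> K * integral {0..b} (\<lambda>t. N (\<gamma> t) (\<gamma>' t))"
  proof (rule eventually_at_rightI[of 0 b])
    fix s assume s: "s \<in> {0<..<b}"
    have "N x (\<gamma> b - \<gamma> s) \<le> K * integral {s..b} (\<lambda>t. N (\<gamma> t) (\<gamma>' t))"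
      using N_increment_le_aux[OF H, of s b x K] K s a metric_length_HK(1)[OF H, of s b] by auto
    also have "\<dots> \<le> K * integral {0..b} (\<lambda>t. N (\<gamma> t) (\<gamma>' t))"
      using s by (intro mult_left_mono assms(4) integral_subset_le metric_length_HK(2)[OF H]) (auto simp: N_nonneg)
    finally show "N x (\<gamma> b - \<gamma> s) \<le> K * integral {0..b} (\<lambda>t. N (\<gamma> t) (\<gamma>' t))" .
  qed (use ab a in simp)
  then have "N x (\<gamma> b - \<gamma> 0) \<le> K * integral {0..b} (\<lambda>t. N (\<gamma> t) (\<gamma>' t))"
    by (intro tendsto_upperbound[OF lim]) auto
  then show ?thesis using a by simp
qed

section \<open>Lower rates: start at the boundary and propagation along paths\<close>

definition dirichlet_solution :: "(real^'n \<Rightarrow> real) \<Rightarrow> real \<Rightarrow> (real^'n \<Rightarrow> real) \<Rightarrow> bool" where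
  "dirichlet_solution f \<epsilon> v \<longleftrightarrow> 0 < \<epsilon> \<and> resolvent_solution \<epsilon> v \<and> (\<forall>z\<in>frontier \<Omega>. v z = f z)"

text \<open>That is, the limit superior of \<open>- \<epsilon> ln v\<close> is at most \<open>a\<close>, locally uniformly at \<open>y\<close>.\<close>

definition lower_rate :: "(real^'n \<Rightarrow> real) \<Rightarrow> real^'n \<Rightarrow> real \<Rightarrow> bool" where
  "lower_rate f y a \<longleftrightarrow> (\<exists>\<kappa>>0. \<exists>\<epsilon>0>0. \<forall>\<epsilon> v w. \<epsilon> < \<epsilon>0 \<longrightarrow> dirichlet_solution f \<epsilon> v \<longrightarrow>
     w \<in> closure \<Omega> \<longrightarrow> norm (w - y) \<le> \<kappa> \<longrightarrow> v w \<ge> exp (- a / \<epsilon>))"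

lemma lower_rateI:
  assumes "\<kappa> > 0" "\<epsilon>0 > 0"
    "\<And>\<epsilon> v w. \<lbrakk>\<epsilon> < \<epsilon>0; dirichlet_solution f \<epsilon> v; w \<in> closure \<Omega>; norm (w - y) \<le> \<kappa>\<rbrakk> \<Longrightarrow> v w \<ge> exp (- a / \<epsilon>)"
  shows "lower_rate f y a"
  unfolding lower_rate_def using assms by blast

lemma lower_rate_near:
  assumes "lower_rate f y a"
  obtains \<kappa> where "\<kappa> > 0" "\<And>x. norm (x - y) < \<kappa> \<Longrightarrow> lower_rate f x a"
proof -
  obtain \<kappa> \<epsilon>0 where *: "\<kappa> > 0" "\<epsilon>0 > 0"
    "\<And>\<epsilon> v w. \<lbrakk>\<epsilon> < \<epsilon>0; dirichlet_solution f \<epsilon> v; w \<in> closure \<Omega>; norm (w - y) \<le> \<kappa>\<rbrakk> \<Longrightarrow> v w \<ge> exp (- a / \<epsilon>)"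
    using assms unfolding lower_rate_def by blast
  have "lower_rate f x a" if x: "norm (x - y) < \<kappa>" for x
  proof (rule lower_rateI[of "\<kappa> - norm (x - y)" \<epsilon>0])
    fix \<epsilon> v w assume a: "\<epsilon> < \<epsilon>0" "dirichlet_solution f \<epsilon> v"
      "w \<in> closure \<Omega>" "norm (w - x) \<le> \<kappa> - norm (x - y)"
    have "norm (w - y) \<le> norm (w - x) + norm (x - y)" using norm_triangle_ineq[of "w - x" "x - y"] by simp
    then have "norm (w - y) \<le> \<kappa>" using a(4) by linarith
    then show "v w \<ge> exp (- a / \<epsilon>)" by (rule *(3)[OF a(1-3)])
  qed (use x * in auto)
  with *(1) show thesis by (rule that)
qed

lemma lower_rate_mono:
  assumes "lower_rate f y a" "a \<le> b"
  shows "lower_rate f y b"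
proof -
  obtain \<kappa> \<epsilon>0 where *: "\<kappa> > 0" "\<epsilon>0 > 0"
    "\<And>\<epsilon> v w. \<lbrakk>\<epsilon> < \<epsilon>0; dirichlet_solution f \<epsilon> v; w \<in> closure \<Omega>; norm (w - y) \<le> \<kappa>\<rbrakk> \<Longrightarrow> v w \<ge> exp (- a / \<epsilon>)"
    using assms(1) unfolding lower_rate_def by blast
  have e: "exp (- b / \<epsilon>) \<le> exp (- a / \<epsilon>)" if "\<epsilon> > 0" for \<epsilon>
    using assms(2) that by (simp add: divide_right_mono)
  show ?thesis
  proof (rule lower_rateI[OF *(1,2)])
    fix \<epsilon> v w assume a: "\<epsilon> < \<epsilon>0" "dirichlet_solution f \<epsilon> v" "w \<in> closure \<Omega>" "norm (w - y) \<le> \<kappa>"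
    have "exp (- b / \<epsilon>) \<le> exp (- a / \<epsilon>)" using a(2) e unfolding dirichlet_solution_def by blast
    also have "\<dots> \<le> v w" by (rule *(3)[OF a])
    finally show "v w \<ge> exp (- b / \<epsilon>)" .
  qed
qed

lemma resolvent_solution_boundary_nonneg:
  assumes "resolvent_solution \<epsilon> v" "\<epsilon> > 0" "\<And>z. z \<in> frontier \<Omega> \<Longrightarrow> v z = f z"
    "\<forall>z\<in>frontier \<Omega>. f z \<ge> 0" "w \<in> closure \<Omega>"
  shows "v w \<ge> 0"
  using resolvent_solution_maximum_principle[OF assms(1,2), of "-1" 0 w] assms(3-5) by simp

text \<open>The barrier is centred at a point just outside the closure, so its inner-ball condition
  is void. On the frontier near \<open>z\<close> the data are at least \<open>f z / 2\<close>, and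
  the barrier carries this bound into a neighbourhood of \<open>z\<close> at an arbitrarily small
  exponential cost. The loose tolerance \<open>1/2\<close> in the barrier suffices since
  \<open>r\<close> can be taken small.\<close>

lemma lower_rate_boundary:
  assumes C11: "C11_boundary \<Omega>" and f: "continuous_on (frontier \<Omega>) f" "\<forall>z\<in>frontier \<Omega>. f z \<ge> 0"
    and z: "z \<in> frontier \<Omega>" "f z > 0" and \<eta>: "\<eta> > 0"
  shows "lower_rate f z \<eta>"
proof -
  have sc: "sqrt c > 0" "sqrt \<Lambda> > 0" using c_pos \<Lambda>_pos by auto
  define m where "m = f z / 2"
  have m: "m > 0" using z by (simp add: m_def)
  obtain \<rho>' where \<rho>': "\<rho>' > 0" "\<And>w. w \<in> frontier \<Omega> \<Longrightarrow> norm (w - z) < \<rho>' \<Longrightarrow> f w \<ge> m"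
  proof -
    obtain d where d: "d > 0" "\<forall>w\<in>frontier \<Omega>. dist w z < d \<longrightarrow> dist (f w) (f z) < m"
      using f(1) z(1) m unfolding continuous_on_iff by blast
    show thesis
    proof (rule that[OF d(1)])
      fix w assume "w \<in> frontier \<Omega>" "norm (w - z) < d"
      then have "\<bar>f w - f z\<bar> < m" using d(2) by (auto simp: dist_norm)
      then show "f w \<ge> m" unfolding m_def abs_less_iff by linarith
    qed
  qed
  obtain \<rho> where \<rho>: "\<rho> > 0"
    "\<And>r \<kappa>. \<lbrakk>0 < \<kappa>; \<kappa> < r; r < \<rho>\<rbrakk> \<Longrightarrow> \<exists>\<epsilon>0>0. \<forall>\<epsilon> v m x. 0 < \<epsilon> \<longrightarrow> \<epsilon> < \<epsilon>0 \<longrightarrow> resolvent_solution \<epsilon> v \<longrightarrow>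
        x \<in> cball 0 R \<longrightarrow> m \<ge> 0 \<longrightarrow>
        (\<forall>y\<in>closure \<Omega>. v y \<ge> 0) \<longrightarrow>
        (\<forall>y\<in>closure \<Omega>. N x (y - x) \<le> \<kappa> \<longrightarrow> v y \<ge> m) \<longrightarrow>
        (\<forall>y\<in>frontier \<Omega>. N x (y - x) \<le> r \<longrightarrow> v y \<ge> m) \<longrightarrow>
        (\<forall>y\<in>closure \<Omega>. N x (y - x) \<le> r \<longrightarrow>
           v y \<ge> m * (exp (- (1 + 1/2) * N x (y - x) / \<epsilon>) - exp (- (1 + 1/2) * r / \<epsilon>)))"
  proof -
    have half: "0 < (1/2 :: real)" "(1/2 :: real) < 1" by simp_all
    show thesis by (rule lower_barrier_step[OF half]) (rule that)
  qed
  define q where "q = \<rho>' / (2 * sqrt \<Lambda>)"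
  define r where "r = min \<rho> (min \<eta> q) / 2"
  have "q > 0" using \<rho>'(1) sc by (simp add: q_def)
  then have r: "r > 0" "r < \<rho>" "r < \<eta>" "r < q"
    using \<rho>(1) \<eta> by (auto simp: r_def min_def)
  have "z \<in> ball 0 R" using z(1) frontier_eq domain_subset by blast
  then obtain e0 where e0: "e0 > 0" "ball z e0 \<subseteq> ball 0 R" using open_contains_ball[of "ball 0 R"] open_ball by blast
  \<comment> \<open>Both the evaluation point and the centre lie within \<open>\<kappa>2\<close> of
    \<open>z\<close>, so their metric distance is at most \<open>r / 4\<close>; with the slope
    \<open>3/2\<close> this gives the exponent \<open>3/8 * r\<close>.\<close>
  define \<kappa>2 where "\<kappa>2 = r * sqrt c / 8"
  have \<kappa>2: "\<kappa>2 > 0" using r sc by (simp add: \<kappa>2_def)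
  obtain y0 where y0: "y0 \<notin> closure \<Omega>" "norm (y0 - z) < Min {\<rho>' / 2, \<kappa>2, e0}"
    using exterior_point_near[OF open_domain C11 z(1), of "Min {\<rho>' / 2, \<kappa>2, e0}"] \<rho>'(1) \<kappa>2 e0(1) by auto
  have y0n: "norm (y0 - z) < \<rho>' / 2" "norm (y0 - z) < \<kappa>2" "norm (y0 - z) < e0" using y0(2) by auto
  have y0R: "y0 \<in> cball 0 R"
    using e0(2) y0n(3) by (metis ball_subset_cball dist_norm mem_ball norm_minus_commute subsetD)
  obtain d where d: "d > 0" "\<And>w. w \<in> closure \<Omega> \<Longrightarrow> norm (w - y0) \<ge> d"
  proof -
    have "open (- closure \<Omega>)" by (rule open_Compl[OF closed_closure])
    then obtain d where "d > 0" "ball y0 d \<subseteq> - closure \<Omega>" using y0(1) open_contains_ball[of "- closure \<Omega>"] by blast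
    then show thesis by (intro that[of d]) (force simp: dist_norm norm_minus_commute)+
  qed
  \<comment> \<open>The metric ball of this radius around \<open>y0\<close> lies inside the
    Euclidean ball that misses the closure.\<close>
  define \<kappa> where "\<kappa> = min (d / (2 * sqrt \<Lambda>)) (r / 2)"
  have \<kappa>: "0 < \<kappa>" "\<kappa> < r" "sqrt \<Lambda> * \<kappa> < d"
  proof -
    show "0 < \<kappa>" "\<kappa> < r" using d(1) sc r(1) by (auto simp: \<kappa>_def)
    have "sqrt \<Lambda> * \<kappa> \<le> sqrt \<Lambda> * (d / (2 * sqrt \<Lambda>))" using sc by (intro mult_left_mono) (auto simp: \<kappa>_def)
    then show "sqrt \<Lambda> * \<kappa> < d" using sc d(1) by simp
  qed
  obtain e1 where e1: "e1 > 0" "\<And>\<epsilon> v m x. \<lbrakk>0 < \<epsilon>; \<epsilon> < e1; resolvent_solution \<epsilon> v; x \<in> cball 0 R; m \<ge> 0;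
        \<forall>y\<in>closure \<Omega>. v y \<ge> 0; \<forall>y\<in>closure \<Omega>. N x (y - x) \<le> \<kappa> \<longrightarrow> v y \<ge> m;
        \<forall>y\<in>frontier \<Omega>. N x (y - x) \<le> r \<longrightarrow> v y \<ge> m\<rbrakk> \<Longrightarrow>
        \<forall>y\<in>closure \<Omega>. N x (y - x) \<le> r \<longrightarrow>
           v y \<ge> m * (exp (- (1 + 1/2) * N x (y - x) / \<epsilon>) - exp (- (1 + 1/2) * r / \<epsilon>))"
    using \<rho>(2)[OF \<kappa>(1,2) r(2)] by metis
  \<comment> \<open>The rate \<open>r\<close> lies above the rate \<open>3/8 * r\<close> of the
    barrier near \<open>z\<close>, and \<open>3/2 * r\<close> is the rate on the sphere; finally
    \<open>r < \<eta>\<close>.\<close>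
  obtain e2 where e2: "e2 > 0" "\<And>\<epsilon>. 0 < \<epsilon> \<Longrightarrow> \<epsilon> < e2 \<Longrightarrow>
      exp (- r / \<epsilon>) \<le> m * (exp (- (3/8 * r) / \<epsilon>) - exp (- (3/2 * r) / \<epsilon>))"
    using exp_gap[of "3/8 * r" "3/2 * r" r m] r(1) m by auto
  show ?thesis
  proof (rule lower_rateI[OF \<kappa>2, of "min e1 e2"])
    show "min e1 e2 > 0" using e1 e2 by simp
    fix \<epsilon> v w assume a0: "\<epsilon> < min e1 e2" "dirichlet_solution f \<epsilon> v"
      "w \<in> closure \<Omega>" "norm (w - z) \<le> \<kappa>2"
    then have a: "0 < \<epsilon>" "\<epsilon> < min e1 e2" "resolvent_solution \<epsilon> v" "\<And>z. z \<in> frontier \<Omega> \<Longrightarrow> v z = f z"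
      "w \<in> closure \<Omega>" "norm (w - z) \<le> \<kappa>2" by (auto simp: dirichlet_solution_def)
    have "norm (w - y0) \<le> \<kappa>2 + \<kappa>2"
      using norm_triangle_ineq[of "w - z" "z - y0"] a(6) y0n(2) by (simp add: norm_minus_commute)
    then have "norm (w - y0) / sqrt c \<le> (\<kappa>2 + \<kappa>2) / sqrt c" using sc by (intro divide_right_mono) auto
    also have "\<dots> = r / 4" using c_pos by (simp add: \<kappa>2_def)
    finally have Nw: "N y0 (w - y0) \<le> r / 4" using N_le[of y0 "w - y0"] by linarith
    have "v w \<ge> m * (exp (- (1 + 1/2) * N y0 (w - y0) / \<epsilon>) - exp (- (1 + 1/2) * r / \<epsilon>))"
    proof (rule e1(2)[of \<epsilon> v y0 m, rule_format])
      show "v y \<ge> 0" if "y \<in> closure \<Omega>" for y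
        using resolvent_solution_boundary_nonneg[OF a(3,1,4) f(2) that] by simp
      show "v y \<ge> m" if "y \<in> closure \<Omega>" "N y0 (y - y0) \<le> \<kappa>" for y
      proof -
        have "norm (y - y0) \<le> sqrt \<Lambda> * N y0 (y - y0)" by (rule norm_le_N[OF y0R])
        also have "\<dots> \<le> sqrt \<Lambda> * \<kappa>" using that sc by (intro mult_left_mono) auto
        finally show ?thesis using d(2)[OF that(1)] \<kappa>(3) by linarith
      qed
      show "v y \<ge> m" if "y \<in> frontier \<Omega>" "N y0 (y - y0) \<le> r" for y
      proof -
        have "norm (y - y0) \<le> sqrt \<Lambda> * N y0 (y - y0)" by (rule norm_le_N[OF y0R])
        also have "\<dots> \<le> sqrt \<Lambda> * r" using that sc by (intro mult_left_mono) auto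
        also have "\<dots> < \<rho>' / 2" using r(4) sc by (simp add: q_def field_simps)
        finally have "norm (y - z) < \<rho>'"
          using y0n(1) norm_triangle_ineq[of "y - y0" "y0 - z"] by simp
        then show ?thesis using \<rho>'(2)[OF that(1)] a(4)[OF that(1)] by simp
      qed
    qed (use a y0R m Nw r in auto)
    moreover have "m * (exp (- (3/8 * r) / \<epsilon>) - exp (- (3/2 * r) / \<epsilon>)) \<le>
        m * (exp (- (1 + 1/2) * N y0 (w - y0) / \<epsilon>) - exp (- (1 + 1/2) * r / \<epsilon>))"
    proof (intro mult_left_mono diff_mono)
      have "- (3/8 * r) / \<epsilon> \<le> - (1 + 1/2) * N y0 (w - y0) / \<epsilon>"
        using Nw a(1) by (intro divide_right_mono) auto
      then show "exp (- (3/8 * r) / \<epsilon>) \<le> exp (- (1 + 1/2) * N y0 (w - y0) / \<epsilon>)" by simp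
    qed (use m in auto)
    moreover have small: "exp (- r / \<epsilon>) \<le> m * (exp (- (3/8 * r) / \<epsilon>) - exp (- (3/2 * r) / \<epsilon>))"
      by (rule e2(2)) (use a in auto)
    moreover have "exp (- \<eta> / \<epsilon>) \<le> exp (- r / \<epsilon>)" using r(3) a(1) by (simp add: divide_right_mono)
    ultimately show "v w \<ge> exp (- \<eta> / \<epsilon>)" using small by linarith
  qed
qed

text \<open>The lower barrier is centred at \<open>y\<close>, where the known rate supplies its
  inner-ball condition; the frontier condition is void because the metric ball of radius
  \<open>r\<close> misses the frontier. The summand \<open>\<eta>\<close> pays for the lowering of
  the barrier and for the uniformity near \<open>x\<close>.\<close>

lemma lower_rate_step:
  assumes \<delta>: "0 < \<delta>" "\<delta> < 1" and f: "\<forall>z\<in>frontier \<Omega>. f z \<ge> 0"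
  obtains \<rho> where "\<rho> > 0"
    "\<And>r x y a \<eta>. \<lbrakk>0 < r; r < \<rho>; lower_rate f y a; y \<in> \<Omega>; \<forall>w\<in>frontier \<Omega>. N y (w - y) > r;
       N y (x - y) < r; \<eta> > 0\<rbrakk> \<Longrightarrow> lower_rate f x (a + (1 + \<delta>) * N y (x - y) + \<eta>)"
proof -
  have sc: "sqrt c > 0" "sqrt \<Lambda> > 0" using c_pos \<Lambda>_pos by auto
  obtain \<rho> where \<rho>: "\<rho> > 0"
    "\<And>r \<kappa>. \<lbrakk>0 < \<kappa>; \<kappa> < r; r < \<rho>\<rbrakk> \<Longrightarrow> \<exists>\<epsilon>0>0. \<forall>\<epsilon> v m x. 0 < \<epsilon> \<longrightarrow> \<epsilon> < \<epsilon>0 \<longrightarrow> resolvent_solution \<epsilon> v \<longrightarrow>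
        x \<in> cball 0 R \<longrightarrow> m \<ge> 0 \<longrightarrow>
        (\<forall>y\<in>closure \<Omega>. v y \<ge> 0) \<longrightarrow>
        (\<forall>y\<in>closure \<Omega>. N x (y - x) \<le> \<kappa> \<longrightarrow> v y \<ge> m) \<longrightarrow>
        (\<forall>y\<in>frontier \<Omega>. N x (y - x) \<le> r \<longrightarrow> v y \<ge> m) \<longrightarrow>
        (\<forall>y\<in>closure \<Omega>. N x (y - x) \<le> r \<longrightarrow>
           v y \<ge> m * (exp (- (1 + \<delta>) * N x (y - x) / \<epsilon>) - exp (- (1 + \<delta>) * r / \<epsilon>)))"
    using lower_barrier_step[OF \<delta>] by blast
  show thesis
  proof (rule that[OF \<rho>(1)])
    fix r x y a \<eta>
    assume r: "0 < r" "r < \<rho>" and G: "lower_rate f y a" and y: "y \<in> \<Omega>" "\<forall>w\<in>frontier \<Omega>. N y (w - y) > r"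
      and x: "N y (x - y) < r" and \<eta>: "(\<eta>::real) > 0"
    have yR: "y \<in> cball 0 R" using y(1) closure_subset closure_in_cball by blast
    obtain \<kappa>y e0 where e0: "\<kappa>y > 0" "e0 > 0"
      "\<And>\<epsilon> v w. \<lbrakk>\<epsilon> < e0; dirichlet_solution f \<epsilon> v; w \<in> closure \<Omega>; norm (w - y) \<le> \<kappa>y\<rbrakk> \<Longrightarrow> v w \<ge> exp (- a / \<epsilon>)"
      using G unfolding lower_rate_def by blast
    define \<kappa> where "\<kappa> = min (\<kappa>y / sqrt \<Lambda>) (r / 2)"
    have \<kappa>: "0 < \<kappa>" "\<kappa> < r" "sqrt \<Lambda> * \<kappa> \<le> \<kappa>y"
    proof -
      show "0 < \<kappa>" "\<kappa> < r" using e0(1) sc r(1) by (auto simp: \<kappa>_def)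
      have "sqrt \<Lambda> * \<kappa> \<le> sqrt \<Lambda> * (\<kappa>y / sqrt \<Lambda>)" using sc by (intro mult_left_mono) (auto simp: \<kappa>_def)
      then show "sqrt \<Lambda> * \<kappa> \<le> \<kappa>y" using sc by simp
    qed
    obtain e1 where e1: "e1 > 0" "\<And>\<epsilon> v m x. \<lbrakk>0 < \<epsilon>; \<epsilon> < e1; resolvent_solution \<epsilon> v; x \<in> cball 0 R; m \<ge> 0;
        \<forall>y\<in>closure \<Omega>. v y \<ge> 0; \<forall>y\<in>closure \<Omega>. N x (y - x) \<le> \<kappa> \<longrightarrow> v y \<ge> m;
        \<forall>y\<in>frontier \<Omega>. N x (y - x) \<le> r \<longrightarrow> v y \<ge> m\<rbrakk> \<Longrightarrow>
        \<forall>y\<in>closure \<Omega>. N x (y - x) \<le> r \<longrightarrow>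
           v y \<ge> m * (exp (- (1 + \<delta>) * N x (y - x) / \<epsilon>) - exp (- (1 + \<delta>) * r / \<epsilon>))"
      using \<rho>(2)[OF \<kappa>(1,2) r(2)] by metis
    define n where "n = N y (x - y)"
    \<comment> \<open>Metric radius of the neighbourhood of \<open>x\<close> covered by the new
      rate: it keeps the points inside the barrier ball, and it raises the exponent by at most
      \<open>\<eta> / 2\<close>.\<close>
    define h where "h = min (\<eta> / 4) ((r - n) / 2)"
    have h: "h > 0" "h \<le> \<eta> / 4" using \<eta> x by (auto simp: h_def n_def)
    have hle: "h \<le> (r - n) / 2" unfolding h_def by (rule min.cobounded2)
    have "r - n > 0" using x by (simp add: n_def)
    then have "(r - n) / 2 < r - n" by (simp add: pos_divide_less_eq)
    with hle have h3: "h < r - n" by (rule le_less_trans)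
    define \<alpha> where "\<alpha> = (1 + \<delta>) * (n + h)"
    have "\<alpha> < (1 + \<delta>) * r" using h3 \<delta> by (simp add: \<alpha>_def)
    moreover have "\<alpha> < (1 + \<delta>) * n + \<eta>"
    proof -
      have "(1 + \<delta>) * h \<le> 2 * (\<eta> / 4)" using \<delta> h by (intro mult_mono) auto
      then show ?thesis using \<eta> by (simp add: \<alpha>_def distrib_left)
    qed
    ultimately obtain e2 where e2: "e2 > 0" "\<And>\<epsilon>. 0 < \<epsilon> \<Longrightarrow> \<epsilon> < e2 \<Longrightarrow>
      exp (- ((1 + \<delta>) * n + \<eta>) / \<epsilon>) \<le> 1 * (exp (- \<alpha> / \<epsilon>) - exp (- ((1 + \<delta>) * r) / \<epsilon>))"
      using exp_gap[of \<alpha> "(1 + \<delta>) * r" "(1 + \<delta>) * n + \<eta>" 1] by auto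
    have "lower_rate f x (a + ((1 + \<delta>) * n + \<eta>))"
    proof (rule lower_rateI[of "h * sqrt c" "Min {e0, e1, e2}"])
      fix \<epsilon> v w assume *: "\<epsilon> < Min {e0, e1, e2}" "dirichlet_solution f \<epsilon> v"
        "w \<in> closure \<Omega>" "norm (w - x) \<le> h * sqrt c"
      have sol: "resolvent_solution \<epsilon> v" "0 < \<epsilon>" "\<And>z. z \<in> frontier \<Omega> \<Longrightarrow> v z = f z"
        using *(2) by (auto simp: dirichlet_solution_def)
      have small: "\<epsilon> < e0" "\<epsilon> < e1" "\<epsilon> < e2" using *(1) by auto
      have "N y (w - x) \<le> h"
        using N_le[of y "w - x"] divide_right_mono[OF *(4), of "sqrt c"] c_pos by simp
      then have Nw: "N y (w - y) \<le> n + h"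
        using N_triangle[of y "w - x" "x - y"] by (simp add: n_def)
      have 1: "v w \<ge> exp (- a / \<epsilon>) * (exp (- (1 + \<delta>) * N y (w - y) / \<epsilon>) - exp (- (1 + \<delta>) * r / \<epsilon>))"
      proof (rule e1(2)[of \<epsilon> v y "exp (- a / \<epsilon>)", rule_format])
        show "v y \<ge> 0" if "y \<in> closure \<Omega>" for y
          using resolvent_solution_boundary_nonneg[OF sol f that] by simp
        show "v z \<ge> exp (- a / \<epsilon>)" if "z \<in> closure \<Omega>" "N y (z - y) \<le> \<kappa>" for z
        proof -
          have "norm (z - y) \<le> sqrt \<Lambda> * N y (z - y)" by (rule norm_le_N[OF yR])
          also have "\<dots> \<le> sqrt \<Lambda> * \<kappa>" using that sc by (intro mult_left_mono) auto
          finally show ?thesis using e0(3)[OF small(1) *(2) that(1)] \<kappa>(3) by linarith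
        qed
        show "v z \<ge> exp (- a / \<epsilon>)" if "z \<in> frontier \<Omega>" "N y (z - y) \<le> r" for z
          using bspec[OF y(2) that(1)] that(2) by simp
      qed (use * sol small yR Nw h h3 in auto)
      have 2: "exp (- a / \<epsilon>) * exp (- ((1 + \<delta>) * n + \<eta>) / \<epsilon>) \<le>
          exp (- a / \<epsilon>) * (exp (- (1 + \<delta>) * N y (w - y) / \<epsilon>) - exp (- (1 + \<delta>) * r / \<epsilon>))"
      proof (intro mult_left_mono)
        have "(1 + \<delta>) * N y (w - y) \<le> \<alpha>"
          unfolding \<alpha>_def using Nw \<delta> by (intro mult_left_mono) auto
        then have "(1 + \<delta>) * N y (w - y) / \<epsilon> \<le> \<alpha> / \<epsilon>" using sol(2) by (simp add: divide_right_mono)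
        then have "exp (- \<alpha> / \<epsilon>) \<le> exp (- (1 + \<delta>) * N y (w - y) / \<epsilon>)"
          by (simp only: exp_le_cancel_iff mult_minus_left minus_divide_left[symmetric] neg_le_iff_le)
        moreover have "exp (- ((1 + \<delta>) * r) / \<epsilon>) = exp (- (1 + \<delta>) * r / \<epsilon>)" by (simp only: mult_minus_left)
        ultimately have "exp (- \<alpha> / \<epsilon>) - exp (- ((1 + \<delta>) * r) / \<epsilon>)
            \<le> exp (- (1 + \<delta>) * N y (w - y) / \<epsilon>) - exp (- (1 + \<delta>) * r / \<epsilon>)"
          by (intro diff_mono) (simp_all only: order_refl)
        with e2(2)[OF sol(2) small(3)]
        show "exp (- ((1 + \<delta>) * n + \<eta>) / \<epsilon>) \<le> exp (- (1 + \<delta>) * N y (w - y) / \<epsilon>) - exp (- (1 + \<delta>) * r / \<epsilon>)"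
          unfolding mult_1 by (rule order_trans)
      qed simp
      have 3: "exp (- (a + ((1 + \<delta>) * n + \<eta>)) / \<epsilon>) = exp (- a / \<epsilon>) * exp (- ((1 + \<delta>) * n + \<eta>) / \<epsilon>)"
      proof -
        have "- (a + q) / \<epsilon> = - a / \<epsilon> + - q / \<epsilon>" for q
          by (simp only: minus_add_distrib add_divide_distrib)
        then show ?thesis by (simp only: exp_add)
      qed
      show "v w \<ge> exp (- (a + ((1 + \<delta>) * n + \<eta>)) / \<epsilon>)"
        unfolding 3 by (rule order_trans[OF 2 1])
    qed (use h e0 e1 e2 c_pos in auto)
    then show "lower_rate f x (a + (1 + \<delta>) * N y (x - y) + \<eta>)" by (simp add: n_def add.assoc)
  qed
qed

lemma lower_rate_along_path:
  assumes \<delta>: "0 < \<delta>" "\<delta> < 1" and f: "\<forall>z\<in>frontier \<Omega>. f z \<ge> 0"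
    and H: "H1_loc_path \<gamma> \<gamma>'" and b: "b > 0" and inside: "\<gamma> ` {0..b} \<subseteq> \<Omega>"
    and G: "lower_rate f (\<gamma> b) a" and \<eta>: "\<eta> > 0"
  shows "lower_rate f (\<gamma> 0) (a + (1 + \<delta>)\<^sup>2 * integral {0..b} (\<lambda>t. N (\<gamma> t) (\<gamma>' t)) + \<eta>)"
proof -
  have sc: "sqrt c > 0" "sqrt \<Lambda> > 0" using c_pos \<Lambda>_pos by auto
  have cont: "continuous_on {0..b} \<gamma>"
    using H continuous_on_subset[of "{0..}" \<gamma> "{0..b}"] unfolding H1_loc_path_def by auto
  have "compact (\<gamma> ` {0..b})" by (rule compact_continuous_image[OF cont compact_Icc])
  then obtain d0 where d0: "d0 > 0" "(\<Union>y\<in>\<gamma> ` {0..b}. ball y d0) \<subseteq> \<Omega>"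
    using compact_subset_open_imp_ball_epsilon_subset[OF _ open_domain inside] by metis
  obtain \<rho> where \<rho>: "\<rho> > 0"
    "\<And>r x y a \<eta>. \<lbrakk>0 < r; r < \<rho>; lower_rate f y a; y \<in> \<Omega>; \<forall>w\<in>frontier \<Omega>. N y (w - y) > r;
       N y (x - y) < r; \<eta> > 0\<rbrakk> \<Longrightarrow> lower_rate f x (a + (1 + \<delta>) * N y (x - y) + \<eta>)"
    using lower_rate_step[OF \<delta> f] by blast
  define q where "q = d0 / sqrt \<Lambda>"
  define r where "r = min \<rho> q / 2"
  have "q > 0" using d0(1) sc by (simp add: q_def)
  then have r: "r > 0" "r < \<rho>" "r < q" using \<rho>(1) by (auto simp: r_def min_def)
  have far: "\<forall>w\<in>frontier \<Omega>. N y (w - y) > r" if "y \<in> \<gamma> ` {0..b}" for y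
  proof
    fix w assume "w \<in> frontier \<Omega>"
    then have "w \<notin> ball y d0" using d0(2) that frontier_eq by blast
    then have "d0 \<le> norm (w - y)" by (simp add: dist_norm norm_minus_commute)
    also have "\<dots> \<le> sqrt \<Lambda> * N y (w - y)"
      using that inside closure_subset closure_in_cball by (intro norm_le_N) blast
    finally have "d0 / sqrt \<Lambda> \<le> N y (w - y)" using sc by (simp add: pos_divide_le_eq mult.commute)
    then show "N y (w - y) > r" using r by (simp add: q_def)
  qed
  obtain \<rho>1 where \<rho>1: "\<rho>1 > 0"
    "\<And>x y. \<lbrakk>x \<in> cball 0 R; y \<in> cball 0 R; norm (y - x) < \<rho>1\<rbrakk> \<Longrightarrow> norm (A x - A y) \<le> \<delta> * c"
    using coefficients_close[OF \<delta>(1)] by blast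
  \<comment> \<open>Increments below \<open>e\<close> are short enough both for the comparison of
    metrics and for reaching the next point inside the barrier ball of radius
    \<open>r\<close>.\<close>
  define e where "e = min \<rho>1 (r * sqrt c)"
  have e: "e > 0" "e \<le> \<rho>1" "e \<le> r * sqrt c" using \<rho>1(1) r sc by (auto simp: e_def)
  obtain \<tau> where \<tau>: "\<tau> > 0" "\<And>s t. \<lbrakk>s \<in> {0..b}; t \<in> {0..b}; \<bar>s - t\<bar> < \<tau>\<rbrakk> \<Longrightarrow> norm (\<gamma> s - \<gamma> t) < e"
    using compact_uniformly_continuous[OF cont compact_Icc] e(1)
    unfolding uniformly_continuous_on_def by (metis dist_norm dist_real_def)
  obtain n where n: "real n > b / \<tau>" using reals_Archimedean2 by blast
  then have n0: "n > 0" using b \<tau>(1) by (metis divide_pos_pos less_trans of_nat_0_less_iff)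
  define h where "h = b / real n"
  have h: "h > 0" "h < \<tau>" "real n * h = b"
    using b n0 n \<tau>(1) by (auto simp: h_def field_simps)
  define I where "I = (\<lambda>s. integral {s..b} (\<lambda>t. N (\<gamma> t) (\<gamma>' t)))"
  have main: "lower_rate f (\<gamma> (b - real j * h)) (a + (1 + \<delta>)\<^sup>2 * I (b - real j * h) + real j * (\<eta> / real n))" if "j \<le> n" for j
    using that
  proof (induction j)
    case 0
    then show ?case using G by (simp add: I_def)
  next
    case (Suc j)
    define s where "s = b - real (Suc j) * h"
    define t where "t = b - real j * h"
    have st: "t = s + h" by (simp add: s_def t_def algebra_simps)
    have "real (Suc j) * h \<le> real n * h" using Suc.prems h by (intro mult_right_mono) auto
    then have s0: "0 \<le> s" using h(3) by (simp add: s_def)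
    have tb: "t \<le> b" using h by (simp add: t_def)
    have range: "u \<in> {0..b}" if "u \<in> {s..t}" for u using that s0 tb by auto
    have close: "norm (\<gamma> u - \<gamma> t) < e" if "u \<in> {s..t}" for u
      using \<tau>(2)[OF range[OF that] range[of t]] that st h by auto
    have in_ball: "\<gamma> u \<in> cball 0 R" if "u \<in> {s..t}" for u
      using range[OF that] inside closure_subset closure_in_cball by blast
    have cmp: "N (\<gamma> t) w \<le> (1 + \<delta>) * N (\<gamma> u) w" if "u \<in> {s..t}" for u w
    proof (rule N_compare)
      show "norm (A (\<gamma> t) - A (\<gamma> u)) \<le> \<delta> * c"
        using \<rho>1(2)[of "\<gamma> t" "\<gamma> u"] in_ball[OF that] in_ball[of t] close[OF that] e st h by auto
    qed (use \<delta> in simp)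
    have incr: "N (\<gamma> t) (\<gamma> s - \<gamma> t) \<le> (1 + \<delta>) * integral {s..t} (\<lambda>t. N (\<gamma> t) (\<gamma>' t))"
    proof -
      have "N (\<gamma> t) (\<gamma> t - \<gamma> s) \<le> (1 + \<delta>) * integral {s..t} (\<lambda>t. N (\<gamma> t) (\<gamma>' t))"
        by (rule N_increment_le[OF H s0]) (use st h \<delta> cmp in auto)
      then show ?thesis using N_minus[of "\<gamma> t" "\<gamma> t - \<gamma> s"] by simp
    qed
    have "N (\<gamma> t) (\<gamma> s - \<gamma> t) \<le> norm (\<gamma> s - \<gamma> t) / sqrt c" by (rule N_le)
    also have "\<dots> < r" using close[of s] st h e(3) sc by (simp add: pos_divide_less_eq)
    finally have small: "N (\<gamma> t) (\<gamma> s - \<gamma> t) < r" .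
    have ti: "\<gamma> t \<in> \<gamma> ` {0..b}" using range[of t] st h by auto
    have IH: "lower_rate f (\<gamma> t) (a + (1 + \<delta>)\<^sup>2 * I t + real j * (\<eta> / real n))"
      using Suc.IH Suc.prems unfolding t_def by simp
    have "lower_rate f (\<gamma> s) ((a + (1 + \<delta>)\<^sup>2 * I t + real j * (\<eta> / real n)) + (1 + \<delta>) * N (\<gamma> t) (\<gamma> s - \<gamma> t) + \<eta> / real n)"
      by (rule \<rho>(2)[OF r(1,2) IH _ far[OF ti] small]) (use ti inside \<eta> n0 in auto)
    moreover have "(a + (1 + \<delta>)\<^sup>2 * I t + real j * (\<eta> / real n)) + (1 + \<delta>) * N (\<gamma> t) (\<gamma> s - \<gamma> t) + \<eta> / real n
        \<le> a + (1 + \<delta>)\<^sup>2 * I s + real (Suc j) * (\<eta> / real n)"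
    proof -
      have "integral {s..t} (\<lambda>t. N (\<gamma> t) (\<gamma>' t)) + I t = I s"
        unfolding I_def using st h tb
        by (intro Henstock_Kurzweil_Integration.integral_combine metric_length_HK(2)[OF H s0]) auto
      moreover have "(1 + \<delta>) * N (\<gamma> t) (\<gamma> s - \<gamma> t) \<le> (1 + \<delta>) * ((1 + \<delta>) * integral {s..t} (\<lambda>t. N (\<gamma> t) (\<gamma>' t)))"
        using incr \<delta> by (intro mult_left_mono) auto
      moreover have "real (Suc j) * (\<eta> / real n) = real j * (\<eta> / real n) + \<eta> / real n"
      proof -
        have "real (Suc j) * q = real j * q + q" for q by (simp add: algebra_simps)
        then show ?thesis .
      qed
      moreover have "(1 + \<delta>) * ((1 + \<delta>) * x) = (1 + \<delta>)\<^sup>2 * x" for x :: real by (simp add: power2_eq_square)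
      ultimately have "(1 + \<delta>)\<^sup>2 * I s = (1 + \<delta>)\<^sup>2 * integral {s..t} (\<lambda>t. N (\<gamma> t) (\<gamma>' t)) + (1 + \<delta>)\<^sup>2 * I t"
        "(1 + \<delta>) * N (\<gamma> t) (\<gamma> s - \<gamma> t) \<le> (1 + \<delta>)\<^sup>2 * integral {s..t} (\<lambda>t. N (\<gamma> t) (\<gamma>' t))"
        "real (Suc j) * (\<eta> / real n) = real j * (\<eta> / real n) + \<eta> / real n"
        by (simp_all add: distrib_left[symmetric])
      then show ?thesis by linarith
    qed
    ultimately show ?case unfolding s_def[symmetric] by (rule lower_rate_mono)
  qed
  have "b - real n * h = 0" using h by simp
  then show ?thesis using main[of n] n0 by (simp add: I_def)
qed

text \<open>The path is inside the domain only before its exit. It is therefore cut slightly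
  earlier, at a point that still belongs to the neighbourhood in which the rate of the exit point
  holds.\<close>

lemma lower_rate_path_length:
  assumes C11: "C11_boundary \<Omega>" and f: "continuous_on (frontier \<Omega>) f" "\<forall>z\<in>frontier \<Omega>. f z \<ge> 0"
    and S: "S = {z \<in> frontier \<Omega>. f z > 0}"
    and x: "x \<in> \<Omega>" and l: "l \<in> path_lengths A \<Omega> S x" and \<delta>: "0 < \<delta>" "\<delta> < 1" and \<eta>: "\<eta> > 0"
  shows "lower_rate f x ((1 + \<delta>)\<^sup>2 * l + \<eta>)"
proof -
  obtain \<gamma> \<gamma>' T where path: "H1_loc_path \<gamma> \<gamma>'" "\<gamma> 0 = x" "ereal T = exit_time \<Omega> \<gamma>" "\<gamma> T \<in> S"
    "l = (LINT t:{0..T}|lborel. N (\<gamma> t) (\<gamma>' t))"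
    using l unfolding path_lengths_def by blast
  have in\<Omega>: "\<gamma> t \<in> \<Omega>" if "0 < t" "t < T" for t
  proof (rule ccontr)
    assume "\<gamma> t \<notin> \<Omega>"
    then have "exit_time \<Omega> \<gamma> \<le> ereal t" unfolding exit_time_def using that by (intro Inf_lower imageI) simp
    then show False using that path(3) by (metis ereal_less_eq(3) not_less)
  qed
  have "exit_time \<Omega> \<gamma> \<ge> 0" unfolding exit_time_def by (rule Inf_greatest) auto
  then have "T \<ge> 0" unfolding path(3)[symmetric] by simp
  moreover have "T \<noteq> 0" using path(2,4) x S frontier_eq by auto
  ultimately have T: "T > 0" by simp
  have z: "\<gamma> T \<in> frontier \<Omega>" "f (\<gamma> T) > 0" using path(4) S by auto
  have "\<eta> / 2 > 0" using \<eta> by simp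
  then have "lower_rate f (\<gamma> T) (\<eta> / 2)" by (rule lower_rate_boundary[OF C11 f z])
  then obtain \<kappa> where \<kappa>: "\<kappa> > 0" "\<And>y. norm (y - \<gamma> T) < \<kappa> \<Longrightarrow> lower_rate f y (\<eta> / 2)"
    by (rule lower_rate_near) (rule that)
  have "continuous_on {0..T} \<gamma>"
    using path(1) continuous_on_subset[of "{0..}" \<gamma> "{0..T}"] unfolding H1_loc_path_def by auto
  then obtain d where d: "d > 0" "\<And>t. t \<in> {0..T} \<Longrightarrow> dist t T < d \<Longrightarrow> dist (\<gamma> t) (\<gamma> T) < \<kappa>"
    using T \<kappa>(1) unfolding continuous_on_iff by (metis atLeastAtMost_iff less_imp_le order_refl)
  \<comment> \<open>A positive time before \<open>T\<close>, within \<open>d\<close> of it.\<close>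
  define b where "b = max (T / 2) (T - d / 2)"
  have b: "0 < b" "b < T" "dist b T < d" using T d(1) by (auto simp: b_def dist_real_def)
  have Gb: "lower_rate f (\<gamma> b) (\<eta> / 2)"
    using \<kappa>(2) d(2)[of b] b by (simp add: dist_norm)
  have "\<gamma> ` {0..b} \<subseteq> \<Omega>"
  proof
    fix y assume "y \<in> \<gamma> ` {0..b}"
    then obtain t where "t \<in> {0..b}" "y = \<gamma> t" by blast
    then show "y \<in> \<Omega>" using in\<Omega>[of t] b path(2) x by (cases "t = 0") auto
  qed
  from lower_rate_along_path[OF \<delta> f(2) path(1) b(1) this Gb \<open>\<eta> / 2 > 0\<close>]
  have "lower_rate f x (\<eta> / 2 + (1 + \<delta>)\<^sup>2 * integral {0..b} (\<lambda>t. N (\<gamma> t) (\<gamma>' t)) + \<eta> / 2)"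
    unfolding path(2) by blast
  moreover have "integral {0..b} (\<lambda>t. N (\<gamma> t) (\<gamma>' t)) \<le> l"
    unfolding path(5) metric_length_HK(1)[OF path(1) order_refl]
    using b by (intro integral_subset_le metric_length_HK(2)[OF path(1)]) (auto simp: N_nonneg)
  then have "(1 + \<delta>)\<^sup>2 * integral {0..b} (\<lambda>t. N (\<gamma> t) (\<gamma>' t)) \<le> (1 + \<delta>)\<^sup>2 * l"
    by (rule mult_left_mono) simp
  then have "\<eta> / 2 + (1 + \<delta>)\<^sup>2 * integral {0..b} (\<lambda>t. N (\<gamma> t) (\<gamma>' t)) + \<eta> / 2 \<le> (1 + \<delta>)\<^sup>2 * l + \<eta>"
    by simp
  ultimately show ?thesis by (rule lower_rate_mono)
qed

lemma dist_S_nonneg: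
  assumes "path_lengths A \<Omega> S x \<noteq> {}"
  shows "dist_S A \<Omega> S x \<ge> 0"
  unfolding dist_S_eq_Inf using path_lengths_nonneg[of A] N_nonneg assms
  by (intro cInf_greatest) blast+

lemma lower_rate_dist:
  assumes C11: "C11_boundary \<Omega>" and f: "continuous_on (frontier \<Omega>) f" "\<forall>z\<in>frontier \<Omega>. f z \<ge> 0"
    and S: "S = {z \<in> frontier \<Omega>. f z > 0}"
    and x: "x \<in> \<Omega>" and ne: "path_lengths A \<Omega> S x \<noteq> {}" and \<eta>: "\<eta> > 0"
  shows "lower_rate f x (dist_S A \<Omega> S x + \<eta>)"
proof -
  define d where "d = dist_S A \<Omega> S x"
  have d: "d \<ge> 0" unfolding d_def by (rule dist_S_nonneg[OF ne])
  obtain l where l: "l \<in> path_lengths A \<Omega> S x" "l < d + \<eta> / 3"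
    using cInf_lessD[OF ne, of "d + \<eta> / 3"] \<eta> unfolding d_def dist_S_eq_Inf by auto
  \<comment> \<open>\<open>\<eta>\<close> is split into thirds: for a nearly optimal path, for the
    factor \<open>(1 + \<delta>)\<^sup>2 \<le> 1 + 3 * \<delta>\<close>, and for the rate estimate.
    The denominator makes the second third suffice.\<close>
  define \<delta> where "\<delta> = min (1 / 2) (\<eta> / (9 * (d + \<eta>)))"
  have \<delta>: "0 < \<delta>" "\<delta> < 1" "\<delta> \<le> \<eta> / (9 * (d + \<eta>))"
    using d \<eta> by (auto simp: \<delta>_def)
  have "\<delta> * (9 * (d + \<eta>)) \<le> \<eta>"
  proof -
    have "0 < 9 * (d + \<eta>)" using d \<eta> by simp
    from pos_le_divide_eq[OF this] show ?thesis using \<delta>(3) by blast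
  qed
  then have "\<delta> * (d + \<eta>) \<le> \<eta> / 9" by (simp add: algebra_simps)
  have "lower_rate f x ((1 + \<delta>)\<^sup>2 * l + \<eta> / 3)"
    using lower_rate_path_length[OF C11 f S x l(1) \<delta>(1,2), of "\<eta> / 3"] \<eta> by simp
  moreover have "(1 + \<delta>)\<^sup>2 * l + \<eta> / 3 \<le> d + \<eta>"
  proof -
    have "\<delta> * \<delta> \<le> 1 * \<delta>" using \<delta> by (intro mult_right_mono) auto
    then have sq: "(1 + \<delta>)\<^sup>2 \<le> 1 + 3 * \<delta>" by (simp add: power2_eq_square algebra_simps)
    have "(1 + \<delta>)\<^sup>2 * l \<le> (1 + \<delta>)\<^sup>2 * (d + \<eta> / 3)" using l(2) by (intro mult_left_mono) auto
    also have "\<dots> \<le> (1 + 3 * \<delta>) * (d + \<eta> / 3)" using sq d \<eta> by (intro mult_right_mono) auto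
    also have "\<dots> = d + \<eta> / 3 + 3 * (\<delta> * (d + \<eta> / 3))" by (simp add: algebra_simps)
    also have "\<dots> \<le> d + \<eta> / 3 + 3 * (\<delta> * (d + \<eta>))"
      using \<delta> \<eta> by (intro add_left_mono mult_left_mono) auto
    also have "\<dots> \<le> d + \<eta> / 3 + 3 * (\<eta> / 9)" using \<open>\<delta> * (d + \<eta>) \<le> \<eta> / 9\<close> by simp
    finally show ?thesis by simp
  qed
  ultimately show ?thesis unfolding d_def by (rule lower_rate_mono)
qed

end

section \<open>The minimum principle for caloric functions\<close>

text \<open>The integral is Lipschitz in its upper limit with the constant \<open>M\<close>,
  uniformly in \<open>x\<close>, and continuous in \<open>x\<close> at a fixed upper limit; together
  this gives joint continuity.\<close>

lemma continuous_on_integral_upto: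
  fixes z :: "'a::topological_space \<Rightarrow> real \<Rightarrow> real"
  assumes cont: "continuous_on (X \<times> {\<tau>..T}) (\<lambda>(x, t). z x t)"
    and bound: "\<And>x t. \<lbrakk>x \<in> X; t \<in> {\<tau>..T}\<rbrakk> \<Longrightarrow> \<bar>z x t\<bar> \<le> M"
  shows "continuous_on (X \<times> {\<tau>..T}) (\<lambda>(x, t). integral {\<tau>..t} (z x))"
  unfolding continuous_on_def
proof (intro ballI)
  let ?P = "\<lambda>x t. integral {\<tau>..t} (z x)"
  let ?D = "X \<times> {\<tau>..T}"
  fix p0 assume "p0 \<in> ?D"
  then obtain x0 t0 where p0: "p0 = (x0, t0)" "x0 \<in> X" "t0 \<in> {\<tau>..T}" by auto
  have zc: "continuous_on {\<tau>..T} (z x)" if "x \<in> X" for x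
  proof -
    have "continuous_on {\<tau>..T} (\<lambda>t. (\<lambda>(x, t). z x t) (x, t))"
      by (rule continuous_on_compose2[OF cont]) (use that in \<open>auto intro!: continuous_intros\<close>)
    then show ?thesis by simp
  qed
  have zi: "(z x) integrable_on {a..b}" if "x \<in> X" "\<tau> \<le> a" "b \<le> T" for x a b
    by (rule integrable_continuous_interval[OF continuous_on_subset[OF zc[OF that(1)]]]) (use that in auto)
  have inc: "\<bar>?P x t - ?P x s\<bar> \<le> M * \<bar>t - s\<bar>" if "x \<in> X" "s \<in> {\<tau>..T}" "t \<in> {\<tau>..T}" for x s t
  proof -
    have le: "\<bar>?P x t - ?P x s\<bar> \<le> M * \<bar>t - s\<bar>" if "s \<in> {\<tau>..T}" "t \<in> {\<tau>..T}" "s \<le> t" for s t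
    proof -
      have "?P x s + integral {s..t} (z x) = ?P x t"
        by (rule Henstock_Kurzweil_Integration.integral_combine) (use that zi[OF \<open>x \<in> X\<close>] in auto)
      moreover have "norm (integral {s..t} (z x)) \<le> M * (t - s)"
        by (rule integral_bound) (use that \<open>x \<in> X\<close> bound in \<open>auto intro!: continuous_on_subset[OF zc]\<close>)
      ultimately show ?thesis using that(3) by (simp add: algebra_simps)
    qed
    show ?thesis
    proof (cases "s \<le> t")
      case True
      then show ?thesis using le that by blast
    next
      case False
      then show ?thesis using le[of t s] that by (simp add: abs_minus_commute)
    qed
  qed
  have "continuous_on X (\<lambda>x. integral (cbox \<tau> t0) (z x))"
    by (rule integral_continuous_on_param) (rule continuous_on_subset[OF cont], use p0 in auto)
  then have Q: "continuous_on X (\<lambda>x. ?P x t0)" by simp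
  have "continuous_on ?D (\<lambda>p. ?P (fst p) t0)"
    by (rule continuous_on_compose2[OF Q]) (auto intro!: continuous_intros)
  then have Qlim: "((\<lambda>p. ?P (fst p) t0) \<longlongrightarrow> ?P x0 t0) (at p0 within ?D)"
    using \<open>p0 \<in> ?D\<close> p0(1) unfolding continuous_on_def by force
  have snd_lim: "((\<lambda>p. snd p) \<longlongrightarrow> t0) (at p0 within ?D)"
    using p0(1) tendsto_snd[OF tendsto_ident_at[of p0 ?D]] by simp
  have "((\<lambda>p. M * \<bar>snd p - t0\<bar>) \<longlongrightarrow> M * \<bar>t0 - t0\<bar>) (at p0 within ?D)"
    by (intro tendsto_intros snd_lim)
  then have lim0: "((\<lambda>p. M * \<bar>snd p - t0\<bar>) \<longlongrightarrow> 0) (at p0 within ?D)" by simp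
  have "eventually (\<lambda>p. p \<in> ?D) (at p0 within ?D)" by (simp add: eventually_at_filter)
  then have "\<forall>\<^sub>F p in at p0 within ?D. norm (?P (fst p) (snd p) - ?P (fst p) t0) \<le> M * \<bar>snd p - t0\<bar>"
  proof (rule eventually_mono)
    fix p assume "p \<in> ?D"
    then have "fst p \<in> X" "snd p \<in> {\<tau>..T}" by auto
    then show "norm (?P (fst p) (snd p) - ?P (fst p) t0) \<le> M * \<bar>snd p - t0\<bar>"
      unfolding real_norm_def using inc p0(3) by blast
  qed
  then have "((\<lambda>p. ?P (fst p) (snd p) - ?P (fst p) t0) \<longlongrightarrow> 0) (at p0 within ?D)"
    by (rule Lim_null_comparison[OF _ lim0])
  from tendsto_add[OF this Qlim]
  have "((\<lambda>p. ?P (fst p) (snd p)) \<longlongrightarrow> ?P x0 t0) (at p0 within ?D)" by simp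
  then show "((\<lambda>(x, t). ?P x t) \<longlongrightarrow> (\<lambda>(x, t). ?P x t) p0) (at p0 within ?D)"
    by (simp only: split_def p0(1) fst_conv snd_conv)
qed

context elliptic_setting
begin

text \<open>The derivatives are carried as explicit functions \<open>G\<close> and \<open>H\<close>,
  so linear combinations are handled with the rules of differentiation and without evaluating
  \<open>gradient\<close> and \<open>hessian\<close> of a sum. The parabolic equation is built into
  the time derivative.\<close>

definition caloric_derivatives ::
  "(real^'n \<Rightarrow> real \<Rightarrow> real) \<Rightarrow> (real^'n \<Rightarrow> real \<Rightarrow> real^'n) \<Rightarrow> (real^'n \<Rightarrow> real \<Rightarrow> real^'n^'n) \<Rightarrow> bool" where
  "caloric_derivatives z G H \<longleftrightarrow>
     (\<forall>x\<in>\<Omega>. \<forall>t>0. ((\<lambda>y. z y t) has_derivative (\<lambda>h. G x t \<bullet> h)) (at x) \<and>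
        ((\<lambda>y. G y t) has_derivative (\<lambda>h. H x t *v h)) (at x) \<and>
        (z x has_real_derivative trace (A x ** H x t)) (at t)) \<and>
     continuous_on (\<Omega> \<times> {0<..}) (\<lambda>(x, t). G x t) \<and> continuous_on (\<Omega> \<times> {0<..}) (\<lambda>(x, t). H x t)"

text \<open>Boundedness is asked on finite time intervals only, since the comparison functions
  \<open>exp (t / \<epsilon>\<^sup>2) * U \<epsilon> x\<close> grow in time.\<close>

definition caloric :: "(real^'n \<Rightarrow> real \<Rightarrow> real) \<Rightarrow> bool" where
  "caloric z \<longleftrightarrow> (\<exists>G H. caloric_derivatives z G H) \<and>
     continuous_on (closure \<Omega> \<times> {0..} - frontier \<Omega> \<times> {0}) (\<lambda>(x, t). z x t) \<and>
     (\<forall>T. \<exists>M. \<forall>x\<in>closure \<Omega>. \<forall>t. 0 \<le> t \<longrightarrow> t \<le> T \<longrightarrow> (x, t) \<notin> frontier \<Omega> \<times> {0} \<longrightarrow> \<bar>z x t\<bar> \<le> M)"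

lemma line_has_derivative:
  fixes z :: "real^'n \<Rightarrow> 'b::real_normed_vector"
  assumes "(z has_derivative D) (at (x + r *\<^sub>R \<xi>))"
  shows "((\<lambda>r. z (x + r *\<^sub>R \<xi>)) has_derivative (\<lambda>h. D (h *\<^sub>R \<xi>))) (at r)"
proof -
  have "((\<lambda>r. x + r *\<^sub>R \<xi>) has_derivative (\<lambda>h. h *\<^sub>R \<xi>)) (at r)"
    by (auto intro!: derivative_eq_intros)
  from has_derivative_compose[OF this assms] show ?thesis .
qed

text \<open>At a spatial minimum of a time integral of a caloric function the integrated Laplacian, which
  is the increment of the function, is nonnegative.\<close>

lemma caloric_increment_at_integral_min:
  assumes z: "caloric_derivatives z G H" and x: "x \<in> \<Omega>" and ab: "0 < a" "a \<le> b"
    and min: "\<And>y. y \<in> \<Omega> \<Longrightarrow> integral {a..b} (z x) \<le> integral {a..b} (z y)"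
  shows "z x a \<le> z x b"
proof -
  have G: "continuous_on (\<Omega> \<times> {0<..}) (\<lambda>(x, t). G x t)" and H: "continuous_on (\<Omega> \<times> {0<..}) (\<lambda>(x, t). H x t)"
    and D1: "\<And>x t. x \<in> \<Omega> \<Longrightarrow> t > 0 \<Longrightarrow> ((\<lambda>y. z y t) has_derivative (\<lambda>h. G x t \<bullet> h)) (at x)"
    and D2: "\<And>x t. x \<in> \<Omega> \<Longrightarrow> t > 0 \<Longrightarrow> ((\<lambda>y. G y t) has_derivative (\<lambda>h. H x t *v h)) (at x)"
    and Dt: "\<And>x t. x \<in> \<Omega> \<Longrightarrow> t > 0 \<Longrightarrow> (z x has_real_derivative trace (A x ** H x t)) (at t)"
    using z unfolding caloric_derivatives_def by blast+
  obtain e :: "'n \<Rightarrow> real^'n" where e: "\<And>i j. A x $ i $ j = (\<Sum>k\<in>UNIV. e k $ i * e k $ j)"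
    using symmetric_psd_decomposition[OF symmetric[of x] A_psd] by metis
  have Hx: "continuous_on {a..b} (\<lambda>t. (H x t *v \<xi>) \<bullet> \<xi>)" for \<xi>
  proof -
    have "continuous_on {a..b} (\<lambda>t. (\<lambda>(x, t). H x t) (x, t))"
      by (rule continuous_on_compose2[OF H]) (use x ab in \<open>auto intro!: continuous_intros\<close>)
    then have "continuous_on {a..b} (\<lambda>t. H x t)" by simp
    then show ?thesis
      unfolding inner_matrix_vector_sum by (intro continuous_intros)
  qed
  have "0 \<le> integral {a..b} (\<lambda>t. (H x t *v \<xi>) \<bullet> \<xi>)" for \<xi>
  proof -
    obtain d where d: "d > 0" "\<And>r. \<bar>r\<bar> < d \<Longrightarrow> x + r *\<^sub>R \<xi> \<in> \<Omega>"
      using open_line_segment[OF open_domain x] by blast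
    let ?U = "{-d<..<d}"
    have U: "r \<in> ?U \<longleftrightarrow> \<bar>r\<bar> < d" for r by auto
    have line: "continuous_on (?U \<times> cbox a b) (\<lambda>p. (x + fst p *\<^sub>R \<xi>, snd p))"
      by (intro continuous_intros)
    have sub: "(\<lambda>p. (x + fst p *\<^sub>R \<xi>, snd p)) ` (?U \<times> cbox a b) \<subseteq> \<Omega> \<times> {0<..}"
      using d(2) ab by (auto simp: U)
    have cG: "continuous_on (?U \<times> cbox a b) (\<lambda>(r, t). G (x + r *\<^sub>R \<xi>) t \<bullet> \<xi>)"
      using continuous_on_inner[OF continuous_on_compose2[OF G line sub] continuous_on_const[of _ \<xi>]]
      by (simp add: case_prod_beta)
    have cH: "continuous_on (?U \<times> cbox a b) (\<lambda>(r, t). (H (x + r *\<^sub>R \<xi>) t *v \<xi>) \<bullet> \<xi>)"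
      unfolding inner_matrix_vector_sum case_prod_beta
      using continuous_on_compose2[OF H line sub] by (intro continuous_intros) (simp add: case_prod_beta)
    have L1: "((\<lambda>r. z (x + r *\<^sub>R \<xi>) t) has_real_derivative G (x + r *\<^sub>R \<xi>) t \<bullet> \<xi>) (at r)"
      if "\<bar>r\<bar> < d" "t \<in> cbox a b" for r t
      using line_has_derivative[OF D1[OF d(2)[OF that(1)]], of t] that(2) ab
      unfolding has_field_derivative_def by (auto elim!: has_derivative_eq_rhs)
    have L2: "((\<lambda>r. G (x + r *\<^sub>R \<xi>) t \<bullet> \<xi>) has_real_derivative (H (x + r *\<^sub>R \<xi>) t *v \<xi>) \<bullet> \<xi>) (at r)"
      if "\<bar>r\<bar> < d" "t \<in> cbox a b" for r t
      using has_derivative_inner_left[OF line_has_derivative[OF D2[OF d(2)[OF that(1)]], of t], of \<xi>] that(2) ab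
      unfolding has_field_derivative_def
      by (auto elim!: has_derivative_eq_rhs simp: matrix_vector_mult_scaleR)
    have iz: "(\<lambda>t. z (x + r *\<^sub>R \<xi>) t) integrable_on cbox a b" if "r \<in> ?U" for r
    proof -
      have "x + r *\<^sub>R \<xi> \<in> \<Omega>" using d(2)[of r] that U by blast
      then have "continuous_on (cbox a b) (z (x + r *\<^sub>R \<xi>))"
        using ab by (intro continuous_at_imp_continuous_on ballI DERIV_isCont[OF Dt]) auto
      then show ?thesis by (rule integrable_continuous)
    qed
    have iG: "(\<lambda>t. G (x + r *\<^sub>R \<xi>) t \<bullet> \<xi>) integrable_on cbox a b" if "r \<in> ?U" for r
    proof -
      have "continuous_on (cbox a b) (\<lambda>t. (\<lambda>(r, t). G (x + r *\<^sub>R \<xi>) t \<bullet> \<xi>) (r, t))"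
        by (rule continuous_on_compose2[OF cG]) (use that in \<open>auto intro!: continuous_intros\<close>)
      then show ?thesis by (intro integrable_continuous) simp
    qed
    \<comment> \<open>Differentiation under the integral sign is available because the interval from
      \<open>a\<close> to \<open>b\<close> stays away from time \<open>0\<close>, so
      \<open>G\<close> and \<open>H\<close> are jointly continuous on the range of
      integration.\<close>
    have I1: "((\<lambda>r. integral (cbox a b) (\<lambda>t. z (x + r *\<^sub>R \<xi>) t)) has_real_derivative
        integral (cbox a b) (\<lambda>t. G (x + r *\<^sub>R \<xi>) t \<bullet> \<xi>)) (at r)" if r: "\<bar>r\<bar> < d" for r
    proof -
      have "((\<lambda>r. integral (cbox a b) (\<lambda>t. z (x + r *\<^sub>R \<xi>) t)) has_real_derivative
        integral (cbox a b) (\<lambda>t. G (x + r *\<^sub>R \<xi>) t \<bullet> \<xi>)) (at r within ?U)"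
        by (rule leibniz_rule_field_derivative[OF _ iz cG])
           (use L1 r in \<open>auto simp: U intro: has_field_derivative_at_within\<close>)
      moreover have "at r within ?U = at r" by (rule at_within_open) (use r in \<open>auto simp: U\<close>)
      ultimately show ?thesis by (simp only:)
    qed
    have I2: "((\<lambda>r. integral (cbox a b) (\<lambda>t. G (x + r *\<^sub>R \<xi>) t \<bullet> \<xi>)) has_real_derivative
        integral (cbox a b) (\<lambda>t. (H (x + r *\<^sub>R \<xi>) t *v \<xi>) \<bullet> \<xi>)) (at r)" if r: "\<bar>r\<bar> < d" for r
    proof -
      have "((\<lambda>r. integral (cbox a b) (\<lambda>t. G (x + r *\<^sub>R \<xi>) t \<bullet> \<xi>)) has_real_derivative
        integral (cbox a b) (\<lambda>t. (H (x + r *\<^sub>R \<xi>) t *v \<xi>) \<bullet> \<xi>)) (at r within ?U)"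
        by (rule leibniz_rule_field_derivative[OF _ iG cH])
           (use L2 r in \<open>auto simp: U intro: has_field_derivative_at_within\<close>)
      moreover have "at r within ?U = at r" by (rule at_within_open) (use r in \<open>auto simp: U\<close>)
      ultimately show ?thesis by (simp only:)
    qed
    have "0 \<le> integral (cbox a b) (\<lambda>t. (H (x + 0 *\<^sub>R \<xi>) t *v \<xi>) \<bullet> \<xi>)"
      by (rule second_derivative_nonneg_at_local_min[OF d(1) I1 I2[of 0]])
         (use d min in auto)
    then show ?thesis by simp
  qed
  then have "0 \<le> (\<Sum>k\<in>UNIV. integral {a..b} (\<lambda>t. (H x t *v e k) \<bullet> e k))" by (simp add: sum_nonneg)
  also have "\<dots> = integral {a..b} (\<lambda>t. \<Sum>k\<in>UNIV. (H x t *v e k) \<bullet> e k)"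
    by (rule integral_sum[symmetric]) (auto intro!: integrable_continuous_interval Hx)
  also have "\<dots> = integral {a..b} (\<lambda>t. trace (A x ** H x t))"
    by (simp add: trace_mult_decomposition[of "A x" e, OF e])
  also have "\<dots> = z x b - z x a"
  proof (rule integral_unique, rule fundamental_theorem_of_calculus[OF ab(2)])
    fix t assume "t \<in> {a..b}"
    then show "(z x has_vector_derivative trace (A x ** H x t)) (at t within {a..b})"
      using Dt[OF x, of t] ab
      by (auto simp: has_real_derivative_iff_has_vector_derivative intro: has_vector_derivative_at_within)
  qed
  finally show ?thesis by simp
qed

lemma caloric_bound:
  assumes "caloric z" "T1 > 0"
  obtains M where "M > 0"
    "\<And>x t. \<lbrakk>x \<in> closure \<Omega>; 0 \<le> t; t \<le> T1; t > 0 \<or> x \<in> \<Omega>\<rbrakk> \<Longrightarrow> \<bar>z x t\<bar> \<le> M"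
proof -
  obtain M where M: "\<And>x t. \<lbrakk>x \<in> closure \<Omega>; 0 \<le> t; t \<le> T1; (x, t) \<notin> frontier \<Omega> \<times> {0}\<rbrakk> \<Longrightarrow> \<bar>z x t\<bar> \<le> M"
    using assms(1) unfolding caloric_def by blast
  show thesis
  proof (rule that[of "max M 1"])
    fix x t assume "x \<in> closure \<Omega>" "0 \<le> t" "t \<le> T1" "t > 0 \<or> x \<in> \<Omega>"
    moreover from this have "(x, t) \<notin> frontier \<Omega> \<times> {0}" using frontier_eq by auto
    ultimately show "\<bar>z x t\<bar> \<le> max M 1" using M by (simp add: le_max_iff_disj)
  qed simp
qed

text \<open>The data are discontinuous at the corner \<open>frontier \<Omega> \<times> {0}\<close>. Minimising the time
  integrals of the function over all time intervals, instead of the function, avoids the corner: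
  these integrals are continuous up to the boundary and to the initial time.\<close>

lemma caloric_minimum_principle:
  assumes z: "caloric z" and T0: "T0 > 0"
    and bd: "\<And>x t. \<lbrakk>x \<in> frontier \<Omega>; 0 < t; t \<le> T0\<rbrakk> \<Longrightarrow> z x t \<ge> 0"
    and init: "\<And>x. x \<in> \<Omega> \<Longrightarrow> z x 0 \<ge> 0"
    and xs: "xs \<in> \<Omega>" and ts: "0 < ts" "ts \<le> T0"
  shows "z xs ts \<ge> 0"
proof (rule ccontr)
  assume "\<not> z xs ts \<ge> 0"
  then have neg: "z xs ts < 0" by simp
  obtain G H where GH: "caloric_derivatives z G H" using z unfolding caloric_def by blast
  have cont: "continuous_on (closure \<Omega> \<times> {0..} - frontier \<Omega> \<times> {0}) (\<lambda>(x, t). z x t)"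
    using z unfolding caloric_def by blast
  obtain M where M: "M > 0"
    "\<And>x t. \<lbrakk>x \<in> closure \<Omega>; 0 \<le> t; t \<le> T0; t > 0 \<or> x \<in> \<Omega>\<rbrakk> \<Longrightarrow> \<bar>z x t\<bar> \<le> M"
    using caloric_bound[OF z T0] by blast
  have cont_pos: "continuous_on (closure \<Omega> \<times> {\<tau>..T0}) (\<lambda>(x, t). z x t)" if "\<tau> > 0" for \<tau>
    by (rule continuous_on_subset[OF cont]) (use that in auto)
  have zc: "continuous_on {a..b} (z x)" if "x \<in> closure \<Omega>" "0 < a" "b \<le> T0" for x a b
  proof -
    have "continuous_on {a..b} (\<lambda>t. (\<lambda>(x, t). z x t) (x, t))"
      by (rule continuous_on_compose2[OF cont_pos[OF that(2)]]) (use that in \<open>auto intro!: continuous_intros\<close>)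
    then show ?thesis by simp
  qed
  have zi: "z x integrable_on {a..b}" if "x \<in> closure \<Omega>" "0 < a" "b \<le> T0" for x a b
    by (rule integrable_continuous_interval[OF zc[OF that]])
  define Y where "Y = (\<lambda>x a b. integral {a..b} (z x))"
  have Y_split: "Y x a b + Y x b c = Y x a c" if "x \<in> closure \<Omega>" "0 < a" "a \<le> b" "b \<le> c" "c \<le> T0" for x a b c
    unfolding Y_def
    by (rule Henstock_Kurzweil_Integration.integral_combine) (use that zi in auto)
  have Y_bound: "\<bar>Y x a b\<bar> \<le> M * (b - a)" if "x \<in> closure \<Omega>" "0 < a" "a \<le> b" "b \<le> T0" for x a b
  proof -
    have "norm (integral {a..b} (z x)) \<le> M * (b - a)"
      by (rule integral_bound[OF that(3) zc]) (use that M in auto)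
    then show ?thesis by (simp add: Y_def)
  qed
  have xcl: "xs \<in> closure \<Omega>" using xs closure_subset by blast
  have "continuous_on {ts / 2..ts} (z xs)" by (rule zc[OF xcl]) (use ts in auto)
  then obtain d where d: "d > 0" "\<And>s. \<lbrakk>s \<in> {ts / 2..ts}; dist s ts < d\<rbrakk> \<Longrightarrow> dist (z xs s) (z xs ts) < - z xs ts / 2"
    using neg ts unfolding continuous_on_iff by (metis atLeastAtMost_iff half_gt_zero neg_0_less_iff_less order_refl field_sum_of_halves less_add_same_cancel1 less_imp_le)
  \<comment> \<open>On this interval before \<open>ts\<close> the function is at most half its
    negative final value, so one time integral is strictly negative.\<close>
  define as where "as = max (ts / 2) (ts - d / 2)"
  have as: "0 < as" "as < ts" using ts d(1) by (auto simp: as_def)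
  have below: "z xs s \<le> z xs ts / 2" if "s \<in> {as..ts}" for s
  proof -
    have "s \<in> {ts / 2..ts}" "dist s ts < d" using that d(1) by (auto simp: as_def dist_real_def)
    from d(2)[OF this] show ?thesis unfolding dist_real_def abs_less_iff by linarith
  qed
  have "Y xs as ts \<le> integral {as..ts} (\<lambda>_. z xs ts / 2)"
    unfolding Y_def using below as ts by (intro integral_le zi xcl) auto
  also have "\<dots> = (ts - as) * (z xs ts / 2)" using as by simp
  also have "\<dots> < 0" using as neg by (simp add: mult_pos_neg)
  finally have Yneg: "Y xs as ts < 0" .
  define m where "m = - Y xs as ts / 3"
  have m: "m > 0" "Y xs as ts = - 3 * m" using Yneg by (auto simp: m_def)
  \<comment> \<open>The penalty \<open>\<delta> * b\<close> added to the integrals costs at most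
    \<open>m\<close> at \<open>ts\<close>, so the minimum remains at most \<open>- 2 * m\<close>. It
    makes the optimality condition at the upper limit strict.\<close>
  define \<delta> where "\<delta> = m / T0"
  have \<delta>: "\<delta> > 0" "\<delta> * ts \<le> m"
  proof -
    show "\<delta> > 0" using m T0 by (simp add: \<delta>_def)
    then have "\<delta> * ts \<le> \<delta> * T0" using ts by (intro mult_left_mono) auto
    then show "\<delta> * ts \<le> m" using T0 by (simp add: \<delta>_def)
  qed
  \<comment> \<open>Times before \<open>\<tau>0\<close> contribute at most \<open>m\<close> to any
    integral. Hence a minimiser keeps an integral of at most \<open>- m\<close> after
    \<open>\<tau>0\<close>, which puts its spatial point into the set \<open>K\<close>
    below.\<close>
  define \<tau>0 where "\<tau>0 = min as (m / (2 * M))"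
  have \<tau>0: "0 < \<tau>0" "\<tau>0 \<le> as" "2 * M * \<tau>0 \<le> m"
  proof -
    show "0 < \<tau>0" "\<tau>0 \<le> as" using as m M by (auto simp: \<tau>0_def)
    have "2 * M * \<tau>0 \<le> 2 * M * (m / (2 * M))" using M by (intro mult_left_mono) (auto simp: \<tau>0_def)
    then show "2 * M * \<tau>0 \<le> m" using M by simp
  qed
  have Pcont: "continuous_on (closure \<Omega> \<times> {\<tau>..T0}) (\<lambda>(x, t). Y x \<tau> t)" if "\<tau> > 0" for \<tau>
    unfolding Y_def by (rule continuous_on_integral_upto[OF cont_pos[OF that], where M = M]) (use M that in auto)
  have Fcont: "continuous_on (closure \<Omega> \<times> ({\<tau>..T0} \<times> {\<tau>..T0})) (\<lambda>(x, a, b). Y x \<tau> b - Y x \<tau> a)" if "\<tau> > 0" for \<tau>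
  proof -
    have 1: "continuous_on (closure \<Omega> \<times> ({\<tau>..T0} \<times> {\<tau>..T0})) (\<lambda>p. (\<lambda>(x, t). Y x \<tau> t) (fst p, snd (snd p)))"
      by (rule continuous_on_compose2[OF Pcont[OF that]]) (auto intro!: continuous_intros)
    have 2: "continuous_on (closure \<Omega> \<times> ({\<tau>..T0} \<times> {\<tau>..T0})) (\<lambda>p. (\<lambda>(x, t). Y x \<tau> t) (fst p, fst (snd p)))"
      by (rule continuous_on_compose2[OF Pcont[OF that]]) (auto intro!: continuous_intros)
    from continuous_on_diff[OF 1 2] show ?thesis by (simp add: split_def)
  qed
  have Feq: "Y x \<tau> b - Y x \<tau> a = Y x a b" if "x \<in> closure \<Omega>" "0 < \<tau>" "\<tau> \<le> a" "a \<le> b" "b \<le> T0" for x \<tau> a b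
    using Y_split[of x \<tau> a b] that by simp
  have compact_D: "compact ({(x, a, b). x \<in> closure \<Omega> \<and> \<tau> \<le> a \<and> a \<le> b \<and> b \<le> T0})" for \<tau>
  proof -
    have eq: "{(x, a, b). x \<in> closure \<Omega> \<and> \<tau> \<le> a \<and> a \<le> b \<and> b \<le> T0}
        = (closure \<Omega> \<times> ({\<tau>..T0} \<times> {\<tau>..T0})) \<inter> {p. fst (snd p) \<le> snd (snd p)}"
      by auto
    have "closed {p :: (real^'n) \<times> real \<times> real. fst (snd p) \<le> snd (snd p)}"
      by (intro closed_Collect_le continuous_intros)
    moreover have "compact (closure \<Omega> \<times> ({\<tau>..T0} \<times> {\<tau>..T0}))"
      by (intro compact_Times compact_closure_domain compact_Icc)
    ultimately show ?thesis unfolding eq by (intro compact_Int_closed)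
  qed
  \<comment> \<open>\<open>K\<close> collects the points at which some time integral after
    \<open>\<tau>0\<close> is at most \<open>- m\<close>. It is compact by joint continuity, and it
    avoids the frontier because integrals there are nonnegative.\<close>
  define Q where "Q = {(x, a, b). x \<in> closure \<Omega> \<and> \<tau>0 \<le> a \<and> a \<le> b \<and> b \<le> T0} \<inter>
     (closure \<Omega> \<times> ({\<tau>0..T0} \<times> {\<tau>0..T0}) \<inter> (\<lambda>(x, a, b). Y x \<tau>0 b - Y x \<tau>0 a) -` {..- m})"
  have "closed (closure \<Omega> \<times> ({\<tau>0..T0} \<times> {\<tau>0..T0}) \<inter> (\<lambda>(x, a, b). Y x \<tau>0 b - Y x \<tau>0 a) -` {..- m})"
    by (rule continuous_closed_preimage[OF Fcont[OF \<tau>0(1)]]) (auto intro!: closed_Times)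
  then have "compact Q" unfolding Q_def by (rule compact_Int_closed[OF compact_D])
  define K where "K = fst ` Q"
  have "compact K" unfolding K_def by (rule compact_continuous_image[OF _ \<open>compact Q\<close>]) (intro continuous_intros)
  have K_in: "x \<in> K" if "x \<in> closure \<Omega>" "\<tau>0 \<le> a" "a \<le> b" "b \<le> T0" "Y x a b \<le> - m" for x a b
  proof -
    have "(x, a, b) \<in> Q" unfolding Q_def using that Feq[of x \<tau>0 a b] \<tau>0(1) by auto
    then show ?thesis unfolding K_def by force
  qed
  have K_sub: "K \<subseteq> \<Omega>"
  proof
    fix x assume "x \<in> K"
    then obtain a b where ab: "x \<in> closure \<Omega>" "\<tau>0 \<le> a" "a \<le> b" "b \<le> T0" "Y x \<tau>0 b - Y x \<tau>0 a \<le> - m"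
      unfolding K_def Q_def by auto
    then have "Y x a b \<le> - m" using Feq[of x \<tau>0 a b] \<tau>0(1) by simp
    have "x \<notin> frontier \<Omega>"
    proof
      assume "x \<in> frontier \<Omega>"
      then have "Y x a b \<ge> 0"
        unfolding Y_def using ab \<tau>0(1) bd by (intro integral_nonneg zi) auto
      then show False using \<open>Y x a b \<le> - m\<close> m by simp
    qed
    then show "x \<in> \<Omega>" using ab(1) frontier_eq by blast
  qed
  have "continuous_on (K \<times> {0..T0}) (\<lambda>(x, t). z x t)"
    by (rule continuous_on_subset[OF cont]) (use K_sub closure_subset frontier_eq in auto)
  moreover have "compact (K \<times> {0..T0})" using \<open>compact K\<close> by (intro compact_Times) auto
  ultimately have "uniformly_continuous_on (K \<times> {0..T0}) (\<lambda>(x, t). z x t)"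
    by (rule compact_uniformly_continuous)
  then obtain \<tau>1 where \<tau>1: "\<tau>1 > 0"
    "\<And>p q. \<lbrakk>p \<in> K \<times> {0..T0}; q \<in> K \<times> {0..T0}; dist q p < \<tau>1\<rbrakk> \<Longrightarrow> dist ((\<lambda>(x, t). z x t) q) ((\<lambda>(x, t). z x t) p) < \<delta> / 2"
    unfolding uniformly_continuous_on_def using \<delta>(1) by (metis half_gt_zero)
  \<comment> \<open>The starting time is chosen only after \<open>K\<close>: on this compact subset
    of the open domain the function is uniformly continuous down to time \<open>0\<close>, so it
    exceeds \<open>- \<delta> / 2\<close> at time \<open>\<tau>\<close>.\<close>
  define \<tau> where "\<tau> = min \<tau>0 (\<tau>1 / 2)"
  have \<tau>: "0 < \<tau>" "\<tau> \<le> \<tau>0" "\<tau> < \<tau>1" using \<tau>0(1) \<tau>1(1) by (auto simp: \<tau>_def min_def)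
  have start: "z x \<tau> \<ge> - \<delta> / 2" if "x \<in> K" for x
  proof -
    have "\<tau> \<le> T0" using \<tau>(2) \<tau>0(2) as ts by simp
    then have "dist (z x \<tau>) (z x 0) < \<delta> / 2"
      using \<tau>1(2)[of "(x, 0)" "(x, \<tau>)"] that \<tau> T0 by (simp add: dist_Pair_Pair dist_real_def)
    moreover have "z x 0 \<ge> 0" using init K_sub that by blast
    ultimately show ?thesis unfolding dist_real_def abs_less_iff by linarith
  qed
  let ?D = "{(x, a, b). x \<in> closure \<Omega> \<and> \<tau> \<le> a \<and> a \<le> b \<and> b \<le> T0}"
  have D_in: "(xs, as, ts) \<in> ?D" using xcl \<tau>(2) \<tau>0(2) as ts by simp
  have "continuous_on ?D (\<lambda>(x, a, b). Y x \<tau> b - Y x \<tau> a)"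
    by (rule continuous_on_subset[OF Fcont[OF \<tau>(1)]]) auto
  then have "continuous_on ?D (\<lambda>p. (\<lambda>(x, a, b). Y x \<tau> b - Y x \<tau> a) p + \<delta> * snd (snd p))"
    by (intro continuous_intros)
  from continuous_attains_inf[OF compact_D _ this] D_in
  obtain p where p: "p \<in> ?D" "\<And>q. q \<in> ?D \<Longrightarrow>
      (\<lambda>(x, a, b). Y x \<tau> b - Y x \<tau> a) p + \<delta> * snd (snd p) \<le> (\<lambda>(x, a, b). Y x \<tau> b - Y x \<tau> a) q + \<delta> * snd (snd q)"
    by blast
  obtain x a b where pe: "p = (x, a, b)" by (cases p) auto
  have x: "x \<in> closure \<Omega>" and ab: "\<tau> \<le> a" "a \<le> b" "b \<le> T0" using p(1) pe by auto
  have min: "Y x a b + \<delta> * b \<le> Y x' a' b' + \<delta> * b'"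
    if "x' \<in> closure \<Omega>" "\<tau> \<le> a'" "a' \<le> b'" "b' \<le> T0" for x' a' b'
  proof -
    have "(x', a', b') \<in> ?D" using that by simp
    from p(2)[OF this] show ?thesis
      unfolding pe using Feq[OF x \<tau>(1) ab] Feq[OF that(1) \<tau>(1) that(2-4)] by simp
  qed
  have ab_pos: "0 < a" "0 < b" using \<tau>(1) ab by auto
  have "Y x a b + \<delta> * b \<le> Y xs as ts + \<delta> * ts" using min[of xs as ts] D_in by simp
  then have val: "Y x a b + \<delta> * b \<le> - 2 * m" using m(2) \<delta>(2) by linarith
  have "\<delta> * b \<ge> 0" using \<delta>(1) ab_pos by simp
  then have Yab: "Y x a b \<le> - 2 * m" using val by linarith
  have "a \<noteq> b" using Yab m(1) by (auto simp: Y_def)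
  then have lt: "a < b" using ab by simp
  have "x \<in> K"
  \<comment> \<open>An interval ending before \<open>\<tau>0\<close> cannot have an integral of at
    most \<open>- 2 * m\<close>; otherwise discarding the part before \<open>\<tau>0\<close> loses
    at most \<open>m\<close>.\<close>
  proof (cases "b \<le> \<tau>0")
    case True
    have "\<bar>Y x a b\<bar> \<le> M * (b - a)" by (rule Y_bound[OF x ab_pos(1) ab(2,3)])
    also have "\<dots> \<le> M * \<tau>0" using M True ab_pos by (intro mult_left_mono) auto
    finally have "\<bar>Y x a b\<bar> \<le> m" using \<tau>0(3) M \<tau>0(1) mult_pos_pos[OF M(1) \<tau>0(1)] by linarith
    then show ?thesis using Yab m(1) by linarith
  next
    case False
    define a' where "a' = max a \<tau>0"
    have a': "a \<le> a'" "\<tau>0 \<le> a'" "a' \<le> b" "a' - a \<le> \<tau>0"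
      using False ab ab_pos \<tau>0(1) by (auto simp: a'_def)
    have "\<bar>Y x a a'\<bar> \<le> M * (a' - a)" by (rule Y_bound[OF x ab_pos(1) a'(1)]) (use a' ab in simp)
    also have "\<dots> \<le> M * \<tau>0" using M a' by (intro mult_left_mono) auto
    finally have "\<bar>Y x a a'\<bar> \<le> m" using \<tau>0(3) mult_pos_pos[OF M(1) \<tau>0(1)] by linarith
    moreover have "Y x a a' + Y x a' b = Y x a b" by (rule Y_split[OF x ab_pos(1) a'(1,3) ab(3)])
    ultimately have "Y x a' b \<le> - m" using Yab by linarith
    then show ?thesis using K_in[OF x a'(2,3) ab(3)] by blast
  qed
  then have x\<Omega>: "x \<in> \<Omega>" using K_sub by blast
  \<comment> \<open>Optimality in the upper limit: if the function were larger than
    \<open>- \<delta>\<close> at \<open>b\<close>, shortening the interval would lower the penalised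
    integral.\<close>
  have zb: "z x b \<le> - \<delta>"
  proof (rule ccontr)
    assume "\<not> z x b \<le> - \<delta>"
    then have pos: "z x b + \<delta> > 0" by simp
    have "((\<lambda>u. integral {a..u} (z x)) has_real_derivative z x b) (at b within {a..b})"
      by (rule integral_has_real_derivative[OF zc[OF x ab_pos(1) ab(3)]]) (use lt in simp)
    moreover have "((\<lambda>u. \<delta> * u) has_real_derivative \<delta>) (at b within {a..b})"
      by (auto intro!: derivative_eq_intros)
    ultimately have "((\<lambda>u. Y x a u + \<delta> * u) has_real_derivative (z x b + \<delta>)) (at b within {a..b})"
      unfolding Y_def by (rule DERIV_add)
    from has_real_derivative_pos_inc_left[OF this pos]
    obtain e where e: "e > 0" "\<And>h. \<lbrakk>0 < h; b - h \<in> {a..b}; h < e\<rbrakk> \<Longrightarrow> Y x a (b - h) + \<delta> * (b - h) < Y x a b + \<delta> * b"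
      by blast
    define h where "h = min e (b - a) / 2"
    have h: "0 < h" "h < e" "b - h \<in> {a..b}" using e(1) lt by (auto simp: h_def min_def field_simps)
    have "Y x a b + \<delta> * b \<le> Y x a (b - h) + \<delta> * (b - h)"
      by (rule min[OF x ab(1)]) (use h ab in auto)
    then show False using e(2)[OF h(1,3,2)] by linarith
  qed
  \<comment> \<open>Optimality in the lower limit: a negative value at \<open>a > \<tau>\<close>
    would allow a longer interval with a smaller integral; at \<open>a = \<tau>\<close> the choice
    of \<open>\<tau>\<close> applies. With \<open>zb\<close> the function strictly decreases from
    \<open>a\<close> to \<open>b\<close>, against the increment inequality at a spatial
    minimum.\<close>
  have za: "z x a \<ge> - \<delta> / 2"
  proof (cases "a = \<tau>")
    case True
    then show ?thesis using start[OF \<open>x \<in> K\<close>] by simp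
  next
    case False
    then have a\<tau>: "\<tau> < a" using ab by simp
    show ?thesis
    proof (rule ccontr)
      assume "\<not> z x a \<ge> - \<delta> / 2"
      then have neg: "- z x a > 0" using \<delta>(1) by simp
      have "((\<lambda>u. integral {\<tau>..u} (z x)) has_real_derivative z x a) (at a within {\<tau>..a})"
        by (rule integral_has_real_derivative[OF zc[OF x \<tau>(1)]]) (use a\<tau> ab in auto)
      from DERIV_minus[OF this]
      have "((\<lambda>u. - Y x \<tau> u) has_real_derivative - z x a) (at a within {\<tau>..a})"
        unfolding Y_def .
      from has_real_derivative_pos_inc_left[OF this neg]
      obtain e where e: "e > 0" "\<And>h. \<lbrakk>0 < h; a - h \<in> {\<tau>..a}; h < e\<rbrakk> \<Longrightarrow> - Y x \<tau> (a - h) < - Y x \<tau> a"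
        by blast
      define h where "h = min e (a - \<tau>) / 2"
      have h: "0 < h" "h < e" "a - h \<in> {\<tau>..a}" using e(1) a\<tau> by (auto simp: h_def min_def field_simps)
      have "Y x a b + \<delta> * b \<le> Y x (a - h) b + \<delta> * b"
        by (rule min[OF x]) (use h ab in auto)
      moreover have "Y x \<tau> b - Y x \<tau> (a - h) = Y x (a - h) b" by (rule Feq[OF x \<tau>(1)]) (use h ab in auto)
      moreover have "Y x \<tau> b - Y x \<tau> a = Y x a b" by (rule Feq[OF x \<tau>(1) ab])
      ultimately show False using e(2)[OF h(1,3,2)] by linarith
    qed
  qed
  have "z x a \<le> z x b"
  proof (rule caloric_increment_at_integral_min[OF GH x\<Omega> ab_pos(1) ab(2)])
    fix y assume "y \<in> \<Omega>"
    then have "Y x a b + \<delta> * b \<le> Y y a b + \<delta> * b"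
      using closure_subset ab by (intro min) auto
    then show "integral {a..b} (z x) \<le> integral {a..b} (z y)" by (simp add: Y_def)
  qed
  then show False using za zb \<delta>(1) by linarith
qed

section \<open>Caloric functions from linear combinations and resolvent solutions\<close>

lemma caloric_add:
  assumes "caloric y" "caloric z"
  shows "caloric (\<lambda>x t. y x t + z x t)"
proof -
  obtain G1 H1 G2 H2 where 1: "caloric_derivatives y G1 H1" and 2: "caloric_derivatives z G2 H2"
    using assms unfolding caloric_def by blast
  have "caloric_derivatives (\<lambda>x t. y x t + z x t) (\<lambda>x t. G1 x t + G2 x t) (\<lambda>x t. H1 x t + H2 x t)"
    unfolding caloric_derivatives_def
  proof (intro conjI ballI allI impI)
    fix x t assume x: "x \<in> \<Omega>" and t: "(t::real) > 0"
    have d: "((\<lambda>x. y x t) has_derivative (\<lambda>h. G1 x t \<bullet> h)) (at x)" "((\<lambda>x. z x t) has_derivative (\<lambda>h. G2 x t \<bullet> h)) (at x)"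
      "((\<lambda>x. G1 x t) has_derivative (\<lambda>h. H1 x t *v h)) (at x)" "((\<lambda>x. G2 x t) has_derivative (\<lambda>h. H2 x t *v h)) (at x)"
      "(y x has_real_derivative trace (A x ** H1 x t)) (at t)" "(z x has_real_derivative trace (A x ** H2 x t)) (at t)"
      using 1 2 x t unfolding caloric_derivatives_def by blast+
    show "((\<lambda>x. y x t + z x t) has_derivative (\<lambda>h. (G1 x t + G2 x t) \<bullet> h)) (at x)"
      unfolding inner_add_left by (rule has_derivative_add[OF d(1,2)])
    show "((\<lambda>x. G1 x t + G2 x t) has_derivative (\<lambda>h. (H1 x t + H2 x t) *v h)) (at x)"
      unfolding matrix_vector_mult_add_rdistrib by (rule has_derivative_add[OF d(3,4)])
    show "((\<lambda>t. y x t + z x t) has_real_derivative trace (A x ** (H1 x t + H2 x t))) (at t)"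
      unfolding trace_mult_add by (rule DERIV_add[OF d(5,6)])
  next
    show "continuous_on (\<Omega> \<times> {0<..}) (\<lambda>(x, t). G1 x t + G2 x t)"
      using 1 2 unfolding caloric_derivatives_def split_def by (intro continuous_on_add) auto
    show "continuous_on (\<Omega> \<times> {0<..}) (\<lambda>(x, t). H1 x t + H2 x t)"
      using 1 2 unfolding caloric_derivatives_def split_def by (intro continuous_on_add) auto
  qed
  moreover have "continuous_on (closure \<Omega> \<times> {0..} - frontier \<Omega> \<times> {0}) (\<lambda>(x, t). y x t + z x t)"
    using assms unfolding caloric_def split_def by (intro continuous_on_add) auto
  moreover have "\<exists>M. \<forall>x\<in>closure \<Omega>. \<forall>t. 0 \<le> t \<longrightarrow> t \<le> T1 \<longrightarrow> (x, t) \<notin> frontier \<Omega> \<times> {0} \<longrightarrow> \<bar>y x t + z x t\<bar> \<le> M" for T1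
  proof -
    obtain M1 where M1: "\<And>x t. x \<in> closure \<Omega> \<Longrightarrow> 0 \<le> t \<Longrightarrow> t \<le> T1 \<Longrightarrow> (x, t) \<notin> frontier \<Omega> \<times> {0} \<Longrightarrow> \<bar>y x t\<bar> \<le> M1"
      using assms(1) unfolding caloric_def by blast
    obtain M2 where M2: "\<And>x t. x \<in> closure \<Omega> \<Longrightarrow> 0 \<le> t \<Longrightarrow> t \<le> T1 \<Longrightarrow> (x, t) \<notin> frontier \<Omega> \<times> {0} \<Longrightarrow> \<bar>z x t\<bar> \<le> M2"
      using assms(2) unfolding caloric_def by blast
    show ?thesis
    proof (intro exI[of _ "M1 + M2"] ballI allI impI)
      fix x t assume a: "x \<in> closure \<Omega>" "0 \<le> t" "t \<le> T1" "(x, t) \<notin> frontier \<Omega> \<times> {0}"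
      show "\<bar>y x t + z x t\<bar> \<le> M1 + M2" using M1[OF a] M2[OF a] by linarith
    qed
  qed
  ultimately show ?thesis unfolding caloric_def by blast
qed

lemma caloric_cmult:
  assumes "caloric z"
  shows "caloric (\<lambda>x t. k * z x t)"
proof -
  obtain G H where 1: "caloric_derivatives z G H"
    using assms unfolding caloric_def by blast
  have "caloric_derivatives (\<lambda>x t. k * z x t) (\<lambda>x t. k *\<^sub>R G x t) (\<lambda>x t. k *\<^sub>R H x t)"
    unfolding caloric_derivatives_def
  proof (intro conjI ballI allI impI)
    fix x t assume x: "x \<in> \<Omega>" and t: "(t::real) > 0"
    have d: "((\<lambda>x. z x t) has_derivative (\<lambda>h. G x t \<bullet> h)) (at x)"
      "((\<lambda>x. G x t) has_derivative (\<lambda>h. H x t *v h)) (at x)"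
      "(z x has_real_derivative trace (A x ** H x t)) (at t)"
      using 1 x t unfolding caloric_derivatives_def by blast+
    show "((\<lambda>x. k * z x t) has_derivative (\<lambda>h. (k *\<^sub>R G x t) \<bullet> h)) (at x)"
      unfolding inner_scaleR_left by (rule has_derivative_mult_right[OF d(1)])
    show "((\<lambda>x. k *\<^sub>R G x t) has_derivative (\<lambda>h. (k *\<^sub>R H x t) *v h)) (at x)"
      unfolding scaleR_matrix_vector_mult by (rule has_derivative_scaleR_right[OF d(2)])
    show "((\<lambda>t. k * z x t) has_real_derivative trace (A x ** (k *\<^sub>R H x t))) (at t)"
      unfolding trace_mult_scaleR by (rule DERIV_cmult[OF d(3)])
  next
    show "continuous_on (\<Omega> \<times> {0<..}) (\<lambda>(x, t). k *\<^sub>R G x t)"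
      using 1 unfolding caloric_derivatives_def split_def by (intro continuous_on_scaleR continuous_on_const) auto
    show "continuous_on (\<Omega> \<times> {0<..}) (\<lambda>(x, t). k *\<^sub>R H x t)"
      using 1 unfolding caloric_derivatives_def split_def by (intro continuous_on_scaleR continuous_on_const) auto
  qed
  moreover have "continuous_on (closure \<Omega> \<times> {0..} - frontier \<Omega> \<times> {0}) (\<lambda>(x, t). k * z x t)"
    using assms unfolding caloric_def split_def by (intro continuous_on_mult continuous_on_const) auto
  moreover have "\<exists>M. \<forall>x\<in>closure \<Omega>. \<forall>t. 0 \<le> t \<longrightarrow> t \<le> T1 \<longrightarrow> (x, t) \<notin> frontier \<Omega> \<times> {0} \<longrightarrow> \<bar>k * z x t\<bar> \<le> M" for T1
  proof -
    obtain M1 where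
      "\<And>x t. x \<in> closure \<Omega> \<Longrightarrow> 0 \<le> t \<Longrightarrow> t \<le> T1 \<Longrightarrow> (x, t) \<notin> frontier \<Omega> \<times> {0} \<Longrightarrow> \<bar>z x t\<bar> \<le> M1"
      using assms unfolding caloric_def by blast
    then show ?thesis
      by (intro exI[of _ "\<bar>k\<bar> * M1"] ballI allI impI) (simp add: abs_mult mult_left_mono)
  qed
  ultimately show ?thesis unfolding caloric_def by blast
qed

lemma caloric_resolvent:
  assumes v: "resolvent_solution \<epsilon> v" and hess: "continuous_on \<Omega> (hessian v)" and \<epsilon>: "\<epsilon> > 0"
  shows "caloric (\<lambda>x t. exp (t / \<epsilon>\<^sup>2) * v x)"
proof -
  have td: "v differentiable (at x)" "gradient v differentiable (at x)" if "x \<in> \<Omega>" for x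
    using v that unfolding resolvent_solution_def twice_differentiable_on_def by auto
  have grad: "continuous_on \<Omega> (gradient v)"
    using td(2) by (meson continuous_at_imp_continuous_on differentiable_imp_continuous_within)
  have vc: "continuous_on (closure \<Omega>) v" using v unfolding resolvent_solution_def by blast
  let ?e = "\<lambda>t. exp (t / \<epsilon>\<^sup>2)"
  have fst_c: "continuous_on S (\<lambda>p. g (fst p))" if "continuous_on X g" "fst ` S \<subseteq> X"
    for S :: "((real^'n) \<times> real) set" and X and g :: "real^'n \<Rightarrow> 'c::topological_space"
    by (rule continuous_on_compose2[OF that(1) continuous_on_fst[OF continuous_on_id] that(2)])
  have ec: "continuous_on S (\<lambda>p. ?e (snd p))" for S :: "((real^'n) \<times> real) set"
    using \<epsilon> by (intro continuous_intros) auto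
  have "caloric_derivatives (\<lambda>x t. ?e t * v x) (\<lambda>x t. ?e t *\<^sub>R gradient v x) (\<lambda>x t. ?e t *\<^sub>R hessian v x)"
    unfolding caloric_derivatives_def
  proof (intro conjI ballI allI impI)
    fix x t assume x: "x \<in> \<Omega>" and t: "(t::real) > 0"
    show "((\<lambda>x. ?e t * v x) has_derivative (\<lambda>h. (?e t *\<^sub>R gradient v x) \<bullet> h)) (at x)"
      unfolding inner_scaleR_left by (rule has_derivative_mult_right[OF has_derivative_gradient[OF td(1)[OF x]]])
    show "((\<lambda>x. ?e t *\<^sub>R gradient v x) has_derivative (\<lambda>h. (?e t *\<^sub>R hessian v x) *v h)) (at x)"
      unfolding scaleR_matrix_vector_mult by (rule has_derivative_scaleR_right[OF has_derivative_hessian[OF td(2)[OF x]]])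
    have eq: "v x = \<epsilon>\<^sup>2 * trace (A x ** hessian v x)" using v x unfolding resolvent_solution_def by simp
    have "((\<lambda>t. t / \<epsilon>\<^sup>2) has_real_derivative 1 / \<epsilon>\<^sup>2) (at t)" by (rule DERIV_cdivide[OF DERIV_ident])
    then have "((\<lambda>t. ?e t * v x) has_real_derivative (?e t * (1 / \<epsilon>\<^sup>2)) * v x) (at t)"
      by (intro DERIV_cmult_right DERIV_fun_exp)
    also have "(?e t * (1 / \<epsilon>\<^sup>2)) * v x = trace (A x ** (?e t *\<^sub>R hessian v x))"
      unfolding trace_mult_scaleR eq using \<epsilon> by simp
    finally show "((\<lambda>t. ?e t * v x) has_real_derivative trace (A x ** (?e t *\<^sub>R hessian v x))) (at t)" .
  next
    show "continuous_on (\<Omega> \<times> {0<..}) (\<lambda>(x, t). ?e t *\<^sub>R gradient v x)"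
      unfolding split_def by (intro continuous_on_scaleR ec fst_c[OF grad]) auto
    show "continuous_on (\<Omega> \<times> {0<..}) (\<lambda>(x, t). ?e t *\<^sub>R hessian v x)"
      unfolding split_def by (intro continuous_on_scaleR ec fst_c[OF hess]) auto
  qed
  moreover have "continuous_on (closure \<Omega> \<times> {0..} - frontier \<Omega> \<times> {0}) (\<lambda>(x, t). ?e t * v x)"
    unfolding split_def by (intro continuous_on_mult ec fst_c[OF vc]) auto
  moreover have "\<exists>M. \<forall>x\<in>closure \<Omega>. \<forall>t. 0 \<le> t \<longrightarrow> t \<le> T1 \<longrightarrow> (x, t) \<notin> frontier \<Omega> \<times> {0} \<longrightarrow> \<bar>?e t * v x\<bar> \<le> M" for T1
  proof -
    have "bounded (v ` closure \<Omega>)"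
      by (intro compact_imp_bounded compact_continuous_image vc compact_closure_domain)
    then obtain M where M: "\<And>x. x \<in> closure \<Omega> \<Longrightarrow> \<bar>v x\<bar> \<le> M"
      unfolding bounded_iff by auto
    have "\<bar>?e t * v x\<bar> \<le> ?e T1 * M" if "x \<in> closure \<Omega>" "t \<le> T1" for x t
      unfolding abs_mult using that M \<epsilon> by (intro mult_mono) (auto simp: divide_right_mono)
    then show ?thesis by blast
  qed
  ultimately show ?thesis unfolding caloric_def by blast
qed

lemma caloric_parabolic_solution:
  assumes u: "parabolic_solution A \<Omega> f u"
  shows "caloric u"
proof -
  have C21: "C21_on u \<Omega> {0<..}" using u unfolding parabolic_solution_def by blast
  have "caloric_derivatives u (\<lambda>x t. gradient (\<lambda>y. u y t) x) (\<lambda>x t. hessian (\<lambda>y. u y t) x)"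
    unfolding caloric_derivatives_def
  proof (intro conjI ballI allI impI)
    fix x t assume x: "x \<in> \<Omega>" and t: "(t::real) > 0"
    have "twice_differentiable_on (\<lambda>x. u x t) \<Omega>" "u x differentiable (at t)"
      using C21 x t unfolding C21_on_def by auto
    then have d: "(\<lambda>y. u y t) differentiable (at x)" "gradient (\<lambda>y. u y t) differentiable (at x)"
      "(u x has_real_derivative deriv (u x) t) (at t)"
      using x unfolding twice_differentiable_on_def by (auto simp: DERIV_deriv_iff_real_differentiable)
    show "((\<lambda>y. u y t) has_derivative (\<lambda>h. gradient (\<lambda>y. u y t) x \<bullet> h)) (at x)"
      by (rule has_derivative_gradient[OF d(1)])
    show "((\<lambda>x. gradient (\<lambda>y. u y t) x) has_derivative (\<lambda>h. hessian (\<lambda>y. u y t) x *v h)) (at x)"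
      by (rule has_derivative_hessian[OF d(2)])
    show "(u x has_real_derivative trace (A x ** hessian (\<lambda>y. u y t) x)) (at t)"
      using d(3) u x t unfolding parabolic_solution_def by simp
  qed (use C21 in \<open>auto simp: C21_on_def\<close>)
  moreover have "\<exists>M. \<forall>x\<in>closure \<Omega>. \<forall>t. 0 \<le> t \<longrightarrow> t \<le> T1 \<longrightarrow> (x, t) \<notin> frontier \<Omega> \<times> {0} \<longrightarrow> \<bar>u x t\<bar> \<le> M" for T1
  proof -
    have "bounded ((\<lambda>(x, t). u x t) ` (closure \<Omega> \<times> {0..} - frontier \<Omega> \<times> {0}))"
      using u unfolding parabolic_solution_def by blast
    then obtain M where M: "\<forall>q\<in>(\<lambda>(x, t). u x t) ` (closure \<Omega> \<times> {0..} - frontier \<Omega> \<times> {0}). norm q \<le> M"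
      unfolding bounded_iff by blast
    have "\<bar>u x t\<bar> \<le> M" if "x \<in> closure \<Omega>" "0 \<le> t" "(x, t) \<notin> frontier \<Omega> \<times> {0}" for x t
      using bspec[OF M imageI[of "(x, t)"]] that by simp
    then show ?thesis by blast
  qed
  ultimately show ?thesis using u unfolding caloric_def parabolic_solution_def by blast
qed

text \<open>At an interior minimum of \<open>v' - v\<close> the traces of the two Hessian terms
  compare, and for the nonnegative \<open>v\<close> the larger parameter gives
  \<open>v \<le> v'\<close> there. The function \<open>v\<close> itself, restricted to lines, serves
  as comparison function. This monotonicity provides the initial inequality in
  \<open>U_le_combination\<close>.\<close>

lemma resolvent_solution_mono:
  assumes v: "resolvent_solution \<epsilon> v" and v': "resolvent_solution \<epsilon>' v'" and \<epsilon>: "0 < \<epsilon>" "\<epsilon> \<le> \<epsilon>'"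
    and eq: "\<And>y. y \<in> frontier \<Omega> \<Longrightarrow> v y = v' y" and nonneg: "\<And>y. y \<in> closure \<Omega> \<Longrightarrow> v y \<ge> 0" and x: "x \<in> closure \<Omega>"
  shows "v x \<le> v' x"
proof (rule ccontr)
  assume neg: "\<not> v x \<le> v' x"
  have "continuous_on (closure \<Omega>) (\<lambda>y. v' y - v y)"
    using v v' unfolding resolvent_solution_def by (intro continuous_on_diff) auto
  moreover have "closure \<Omega> \<noteq> {}" using x by force
  ultimately obtain y0 where y0: "y0 \<in> closure \<Omega>" "\<forall>z\<in>closure \<Omega>. v' y0 - v y0 \<le> v' z - v z"
    using continuous_attains_inf[OF compact_closure_domain] by blast
  then obtain y where y: "y \<in> closure \<Omega>" "\<And>z. z \<in> closure \<Omega> \<Longrightarrow> v' y - v y \<le> v' z - v z" by blast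
  have lt: "v' y < v y" using y(2)[OF x] neg by simp
  then have y\<Omega>: "y \<in> \<Omega>" using eq[of y] y(1) frontier_eq by force
  obtain b :: "'n \<Rightarrow> real^'n" where b: "\<And>i j. A y $ i $ j = (\<Sum>k\<in>UNIV. b k $ i * b k $ j)"
    using symmetric_psd_decomposition[OF symmetric[of y] A_psd] by metis
  have td: "twice_differentiable_on v \<Omega>" "twice_differentiable_on v' \<Omega>"
    using v v' unfolding resolvent_solution_def by auto
  have "(\<Sum>k\<in>UNIV. (hessian v y *v b k) \<bullet> b k) \<le> 1 * trace (A y ** hessian v' y)"
  proof (rule trace_hessian_ge_at_local_min[OF b open_domain td(2) y\<Omega>, where \<beta> = "\<lambda>k s. v (y + s *\<^sub>R b k)"
        and \<beta>' = "\<lambda>k s. gradient v (y + s *\<^sub>R b k) \<bullet> b k"])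
    fix k
    obtain d where d: "d > 0" "\<And>s. \<bar>s\<bar> < d \<Longrightarrow> y + s *\<^sub>R b k \<in> \<Omega>"
      using open_line_segment[OF open_domain y\<Omega>] by blast
    have D1: "((\<lambda>s. v (y + s *\<^sub>R b k)) has_real_derivative gradient v (y + s *\<^sub>R b k) \<bullet> b k) (at s)" if "\<bar>s\<bar> < d" for s
      using td(1) d(2)[OF that] unfolding twice_differentiable_on_def by (intro line_derivative) auto
    have "gradient v differentiable (at (y + 0 *\<^sub>R b k))"
      using td(1) y\<Omega> unfolding twice_differentiable_on_def by simp
    from line_derivative2[OF this]
    have D2: "((\<lambda>s. gradient v (y + s *\<^sub>R b k) \<bullet> b k) has_real_derivative (hessian v y *v b k) \<bullet> b k) (at 0)" by simp
    have "1 * v' y - v (y + 0 *\<^sub>R b k) \<le> 1 * v' (y + s *\<^sub>R b k) - v (y + s *\<^sub>R b k)" if "\<bar>s\<bar> < d" for s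
      using y(2)[of "y + s *\<^sub>R b k"] d(2)[OF that] closure_subset by auto
    with d(1) D1 D2 show "\<exists>d>0. (\<forall>s. \<bar>s\<bar> < d \<longrightarrow>
          ((\<lambda>s. v (y + s *\<^sub>R b k)) has_real_derivative gradient v (y + s *\<^sub>R b k) \<bullet> b k) (at s) \<and>
          1 * v' y - v (y + 0 *\<^sub>R b k) \<le> 1 * v' (y + s *\<^sub>R b k) - v (y + s *\<^sub>R b k)) \<and>
        ((\<lambda>s. gradient v (y + s *\<^sub>R b k) \<bullet> b k) has_real_derivative (hessian v y *v b k) \<bullet> b k) (at 0)"
      by blast
  qed
  then have le: "trace (A y ** hessian v y) \<le> trace (A y ** hessian v' y)"
    by (simp add: trace_mult_decomposition[of "A y" b, OF b])
  have e: "\<epsilon>\<^sup>2 * trace (A y ** hessian v y) = v y" "\<epsilon>'\<^sup>2 * trace (A y ** hessian v' y) = v' y"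
    using v v' y\<Omega> unfolding resolvent_solution_def by auto
  have vy: "v y \<ge> 0" by (rule nonneg[OF y(1)])
  then have "trace (A y ** hessian v y) \<ge> 0" using e(1) \<epsilon> by (metis zero_less_power zero_le_mult_iff not_less)
  then have "v y \<le> \<epsilon>'\<^sup>2 * trace (A y ** hessian v y)"
    unfolding e(1)[symmetric] using \<epsilon> by (intro mult_right_mono power_mono) auto
  also have "\<dots> \<le> \<epsilon>'\<^sup>2 * trace (A y ** hessian v' y)" using le by (rule mult_left_mono) simp
  finally show False using lt e(2) by simp
qed

lemma H1_loc_path_constant: "H1_loc_path (\<lambda>t. x) (\<lambda>t. 0 :: real^'n)"
proof -
  have "polygon_path (\<lambda>_. x) 0 = (\<lambda>t. x)" "polygon_velocity (\<lambda>_. x) 0 = (\<lambda>t. 0)"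
    by (auto simp: polygon_path_def polygon_velocity_def)
  then show ?thesis using H1_loc_path_polygon[of "\<lambda>_. x" 0] by simp
qed

text \<open>For the constant path every positive time counts as an exit, so the exit time is the
  infimum \<open>0\<close>, which is not itself one of these times, and the length is an integral
  over a single point.\<close>

lemma dist_S_boundary:
  assumes "x \<in> S" "S \<subseteq> frontier \<Omega>"
  shows "dist_S A \<Omega> S x = 0"
proof -
  have nin: "x \<notin> \<Omega>" using assms frontier_eq by blast
  have "exit_time \<Omega> (\<lambda>t. x) = 0"
    unfolding exit_time_def
  proof (rule antisym)
    show "0 \<le> Inf (ereal ` {\<tau>. \<tau> > 0 \<and> x \<notin> \<Omega>})" by (rule Inf_greatest) auto
    show "Inf (ereal ` {\<tau>. \<tau> > 0 \<and> x \<notin> \<Omega>}) \<le> 0"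
    proof (rule ccontr)
      assume "\<not> Inf (ereal ` {\<tau>. \<tau> > 0 \<and> x \<notin> \<Omega>}) \<le> 0"
      then obtain e where e: "0 < ereal e" "ereal e < Inf (ereal ` {\<tau>. \<tau> > 0 \<and> x \<notin> \<Omega>})"
        using ereal_dense2[of 0 "Inf (ereal ` {\<tau>. \<tau> > 0 \<and> x \<notin> \<Omega>})"] not_le by blast
      have "Inf (ereal ` {\<tau>. \<tau> > 0 \<and> x \<notin> \<Omega>}) \<le> ereal e"
        using nin e(1) by (intro Inf_lower imageI) simp
      then show False using e(2) by simp
    qed
  qed
  then have "ereal 0 = exit_time \<Omega> (\<lambda>t. x)" by simp
  then have "(LINT t:{0..0}|lborel. N x 0) \<in> path_lengths A \<Omega> S x"
    unfolding path_lengths_def using H1_loc_path_constant[of x] assms(1)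
    by (intro CollectI exI[of _ "\<lambda>t. x"] exI[of _ "\<lambda>t. 0"] exI[of _ 0] conjI refl) auto
  then have 0: "0 \<in> path_lengths A \<Omega> S x" by (simp add: set_lebesgue_integral_def)
  then have "dist_S A \<Omega> S x \<le> 0" by (rule dist_S_le)
  moreover have "dist_S A \<Omega> S x \<ge> 0" using 0 by (intro dist_S_nonneg) blast
  ultimately show ?thesis by simp
qed

end

section \<open>Uniform limits\<close>

lemma compact_uniform_threshold:
  fixes K :: "'a::real_normed_vector set"
  assumes "compact K"
    and loc: "\<And>x. x \<in> K \<Longrightarrow> \<exists>\<kappa>>0. \<exists>\<epsilon>0>0. \<forall>y\<in>K. norm (y - x) < \<kappa> \<longrightarrow> (\<forall>\<epsilon>. 0 < \<epsilon> \<longrightarrow> \<epsilon> < \<epsilon>0 \<longrightarrow> P \<epsilon> y)"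
  shows "\<exists>\<epsilon>0>(0::real). \<forall>y\<in>K. \<forall>\<epsilon>. 0 < \<epsilon> \<longrightarrow> \<epsilon> < \<epsilon>0 \<longrightarrow> P \<epsilon> y"
proof -
  obtain \<kappa> e where *: "\<And>x. x \<in> K \<Longrightarrow> \<kappa> x > 0" "\<And>x. x \<in> K \<Longrightarrow> e x > (0::real)"
    "\<And>x y \<epsilon>. \<lbrakk>x \<in> K; y \<in> K; norm (y - x) < \<kappa> x; 0 < \<epsilon>; \<epsilon> < e x\<rbrakk> \<Longrightarrow> P \<epsilon> y"
    using loc by metis
  have "\<And>B. B \<in> (\<lambda>x. ball x (\<kappa> x)) ` K \<Longrightarrow> open B" by auto
  moreover have "K \<subseteq> \<Union> ((\<lambda>x. ball x (\<kappa> x)) ` K)" using *(1) by force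
  ultimately obtain D where D: "D \<subseteq> K" "finite D" "K \<subseteq> (\<Union>x\<in>D. ball x (\<kappa> x))"
    using assms(1) by (metis (no_types, lifting) compactE finite_subset_image)
  define \<epsilon>0 where "\<epsilon>0 = Min (insert 1 (e ` D))"
  have "\<epsilon>0 > 0" unfolding \<epsilon>0_def using D *(2) by (subst Min_gr_iff) auto
  moreover have "P \<epsilon> y" if y: "y \<in> K" "0 < \<epsilon>" "\<epsilon> < \<epsilon>0" for y \<epsilon>
  proof -
    obtain x where x: "x \<in> D" "y \<in> ball x (\<kappa> x)" using D(3) y(1) by blast
    have "\<epsilon>0 \<le> e x" unfolding \<epsilon>0_def using D(2) x(1) by (intro Min_le) auto
    then show ?thesis
      using *(3)[of x y \<epsilon>] x D(1) y by (auto simp: dist_norm norm_minus_commute)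
  qed
  ultimately show ?thesis by blast
qed

lemma exp_rate_compare:
  fixes a b M :: real
  assumes "M > 0" "\<epsilon>0 > 0" "\<And>\<epsilon>. \<lbrakk>0 < \<epsilon>; \<epsilon> < \<epsilon>0\<rbrakk> \<Longrightarrow> exp (- a / \<epsilon>) \<le> M * exp (- b / \<epsilon>)"
  shows "b \<le> a"
proof (rule ccontr)
  assume "\<not> b \<le> a"
  then obtain e where e: "e > 0" "\<And>\<epsilon>. 0 < \<epsilon> \<Longrightarrow> \<epsilon> < e \<Longrightarrow> exp (- (b - a) / \<epsilon>) \<le> 1 / (2 * M)"
    using exp_small[of "b - a" "1 / (2 * M)"] assms(1) by auto
  define \<epsilon> where "\<epsilon> = min e \<epsilon>0 / 2"
  have \<epsilon>: "0 < \<epsilon>" "\<epsilon> < e" "\<epsilon> < \<epsilon>0" using e(1) assms(2) by (auto simp: \<epsilon>_def)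
  have "- b / \<epsilon> = - a / \<epsilon> + - (b - a) / \<epsilon>" by (simp add: diff_divide_distrib)
  then have split: "exp (- b / \<epsilon>) = exp (- a / \<epsilon>) * exp (- (b - a) / \<epsilon>)" by (simp only: exp_add)
  have "M * exp (- b / \<epsilon>) \<le> M * (exp (- a / \<epsilon>) * (1 / (2 * M)))"
    unfolding split using assms(1) by (intro mult_left_mono e(2)[OF \<epsilon>(1,2)]) auto
  also have "\<dots> = exp (- a / \<epsilon>) / 2" using assms(1) by simp
  finally show False using assms(3)[OF \<epsilon>(1,3)] exp_gt_zero[of "- a / \<epsilon>"] by linarith
qed

lemma log_bounds:
  fixes \<epsilon> a \<eta> v :: real
  assumes "\<epsilon> > 0" "exp (- (a + \<eta>) / \<epsilon>) \<le> v" "v \<le> exp (- (a - \<eta>) / \<epsilon>)"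
  shows "\<bar>- \<epsilon> * ln v - a\<bar> \<le> \<eta>"
proof -
  have v: "v > 0" by (rule less_le_trans[OF exp_gt_zero assms(2)])
  have "- (a + \<eta>) / \<epsilon> \<le> ln v" using assms(2) v by (simp add: ln_ge_iff)
  then have "- (a + \<eta>) \<le> ln v * \<epsilon>" using assms(1) by (simp add: pos_divide_le_eq)
  moreover have "ln v \<le> ln (exp (- (a - \<eta>) / \<epsilon>))"
    using assms(3) v by (subst ln_le_cancel_iff) auto
  then have "ln v \<le> - (a - \<eta>) / \<epsilon>" by (simp only: ln_exp)
  then have "ln v * \<epsilon> \<le> - (a - \<eta>)" using assms(1) by (simp add: pos_le_divide_eq)
  ultimately show ?thesis by (simp add: abs_le_iff mult.commute)
qed

text \<open>The factor \<open>1/2\<close> costs at most \<open>4 * t\<close> after scaling, because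
  \<open>ln 2 < 1\<close>; this vanishes in the limit.\<close>

lemma log_lower_bound:
  fixes t \<epsilon> a v :: real
  assumes "t > 0" "exp (- a / \<epsilon>) / 2 \<le> v"
  shows "v > 0" "- 4 * t * ln v \<le> 4 * t / \<epsilon> * a + 4 * t"
proof -
  show v: "v > 0" by (rule less_le_trans[OF _ assms(2)]) simp
  have "ln (exp (- a / \<epsilon>) / 2) \<le> ln v" using assms(2) v by (subst ln_le_cancel_iff) auto
  then have "- a / \<epsilon> - ln 2 \<le> ln v" by (simp add: ln_div)
  then have "- (a / \<epsilon>) - 1 \<le> ln v" using ln_2_less_1 by simp
  then have "(4 * t) * (- (a / \<epsilon>) - 1) \<le> (4 * t) * ln v" using assms(1) by (intro mult_left_mono) auto
  then show "- 4 * t * ln v \<le> 4 * t / \<epsilon> * a + 4 * t" by (simp add: right_diff_distrib)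
qed

text \<open>Exponents multiplied by \<open>\<epsilon>\<close>, at the time with
  \<open>t / \<epsilon> = y * (1 + \<kappa>) / 2\<close>. The common expression on the right is the
  exponent of the solution with parameter \<open>\<epsilon>\<close>; the left sides belong to the
  parameters \<open>\<epsilon> / (1 - \<kappa>)\<close> and, with its weight,
  \<open>\<epsilon> / (1 + \<kappa>)\<close>. Both fall short by a term of second order in
  \<open>\<kappa>\<close>, and \<open>\<eta>\<close> is so small that the uncertainty in the rates
  uses up only part of this gain.\<close>

lemma Chebyshev_exponents:
  fixes y \<kappa> \<eta> \<delta>0 :: real
  assumes \<kappa>: "0 < \<kappa>" "\<kappa> \<le> 1/2" and y: "0 < \<delta>0" "\<delta>0 \<le> y" and \<eta>: "0 < \<eta>" "\<eta> \<le> \<delta>0 * \<kappa>\<^sup>2 / 16"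
  shows "y * (1 + \<kappa>) * (1 - \<kappa>)\<^sup>2 / 2 - (y - \<eta>) * (1 - \<kappa>) \<le> (- y * (1 - \<kappa>) / 2 - \<eta>) - \<delta>0 * \<kappa>\<^sup>2 / 8"
    and "- y * \<kappa> * (2 * \<kappa> + \<kappa>\<^sup>2) + y * (1 + \<kappa>) ^ 3 / 2 - (y - \<eta>) * (1 + \<kappa>) \<le> (- y * (1 - \<kappa>) / 2 - \<eta>) - \<delta>0 * \<kappa>\<^sup>2 / 8"
proof -
  have y\<kappa>: "\<delta>0 * \<kappa>\<^sup>2 \<le> y * \<kappa>\<^sup>2" using y by (intro mult_right_mono) auto
  have "(\<delta>0 * \<kappa>\<^sup>2) * (1/2) \<le> (y * \<kappa>\<^sup>2) * (1 - \<kappa>)" using y\<kappa> \<kappa> y by (intro mult_mono) auto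
  moreover have "\<eta> * (2 - \<kappa>) \<le> \<eta> * 2" using \<eta> \<kappa> by (intro mult_left_mono) auto
  moreover have "((- y * (1 - \<kappa>) / 2 - \<eta>)) - (y * (1 + \<kappa>) * (1 - \<kappa>)\<^sup>2 / 2 - (y - \<eta>) * (1 - \<kappa>))
      = (y * \<kappa>\<^sup>2) * (1 - \<kappa>) / 2 - \<eta> * (2 - \<kappa>)"
    by (simp add: field_simps power2_eq_square power3_eq_cube)
  ultimately show "y * (1 + \<kappa>) * (1 - \<kappa>)\<^sup>2 / 2 - (y - \<eta>) * (1 - \<kappa>) \<le> (- y * (1 - \<kappa>) / 2 - \<eta>) - \<delta>0 * \<kappa>\<^sup>2 / 8"
    using \<eta>(2) by linarith
  have "\<eta> * (2 + \<kappa>) \<le> \<eta> * 3" using \<eta> \<kappa> by (intro mult_left_mono) auto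
  moreover have "y * \<kappa>\<^sup>2 * \<kappa> \<ge> 0" using y \<kappa> by simp
  moreover have "((- y * (1 - \<kappa>) / 2 - \<eta>)) - (- y * \<kappa> * (2 * \<kappa> + \<kappa>\<^sup>2) + y * (1 + \<kappa>) ^ 3 / 2 - (y - \<eta>) * (1 + \<kappa>))
      = (y * \<kappa>\<^sup>2) / 2 + (y * \<kappa>\<^sup>2 * \<kappa>) / 2 - \<eta> * (2 + \<kappa>)"
    by (simp add: field_simps power2_eq_square power3_eq_cube)
  moreover have "\<delta>0 * \<kappa>\<^sup>2 \<ge> 0" using y by simp
  ultimately show "- y * \<kappa> * (2 * \<kappa> + \<kappa>\<^sup>2) + y * (1 + \<kappa>) ^ 3 / 2 - (y - \<eta>) * (1 + \<kappa>) \<le> (- y * (1 - \<kappa>) / 2 - \<eta>) - \<delta>0 * \<kappa>\<^sup>2 / 8"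
    using \<eta>(2) y\<kappa> y by linarith
qed

section \<open>The family of Dirichlet solutions and the continuity of the distance\<close>

locale dirichlet_problem = elliptic_setting \<Omega> A c \<Lambda> R
  for \<Omega> :: "(real^'n) set" and A :: "real^'n \<Rightarrow> real^'n^'n" and c \<Lambda> R :: real +
  fixes f :: "real^'n \<Rightarrow> real" and S :: "(real^'n) set"
    and u :: "real^'n \<Rightarrow> real \<Rightarrow> real" and U :: "real \<Rightarrow> real^'n \<Rightarrow> real" and M :: real
  assumes C11: "C11_boundary \<Omega>" and connected: "connected \<Omega>"
    and f_continuous: "continuous_on (frontier \<Omega>) f"
    and f_nonneg: "\<forall>z\<in>frontier \<Omega>. f z \<ge> 0"
    and f_le: "\<And>z. z \<in> frontier \<Omega> \<Longrightarrow> f z \<le> M" and M_pos: "M > 0"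
    and S_eq: "S = {z \<in> frontier \<Omega>. f z > 0}" and S_nonempty: "S \<noteq> {}"
    and U: "\<epsilon> > 0 \<Longrightarrow> dirichlet_solution f \<epsilon> (U \<epsilon>)"
    and U_hessian: "\<epsilon> > 0 \<Longrightarrow> continuous_on \<Omega> (hessian (U \<epsilon>))"
    and u_caloric: "caloric u"
    and u_init: "x \<in> \<Omega> \<Longrightarrow> u x 0 = 0"
    and u_boundary: "\<lbrakk>x \<in> frontier \<Omega>; t > 0\<rbrakk> \<Longrightarrow> u x t = f x"
begin

abbreviation d :: "real^'n \<Rightarrow> real" where "d \<equiv> dist_S A \<Omega> S"

lemma S_subset: "S \<subseteq> frontier \<Omega>"
  using S_eq by blast

lemma U_resolvent: "\<epsilon> > 0 \<Longrightarrow> resolvent_solution \<epsilon> (U \<epsilon>)"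
  using U unfolding dirichlet_solution_def by blast

lemma U_boundary: "\<epsilon> > 0 \<Longrightarrow> z \<in> frontier \<Omega> \<Longrightarrow> U \<epsilon> z = f z"
  using U unfolding dirichlet_solution_def by blast

lemma U_nonneg: "\<epsilon> > 0 \<Longrightarrow> x \<in> closure \<Omega> \<Longrightarrow> U \<epsilon> x \<ge> 0"
  using resolvent_solution_maximum_principle[OF U_resolvent, of \<epsilon> "-1" 0 x] U_boundary f_nonneg by simp

lemma U_le: "\<epsilon> > 0 \<Longrightarrow> x \<in> closure \<Omega> \<Longrightarrow> U \<epsilon> x \<le> M"
  using resolvent_solution_maximum_principle[OF U_resolvent, of \<epsilon> 1 M x] U_boundary f_le M_pos by simp

lemma d_nonneg:
  assumes "x \<in> \<Omega>"
  shows "d x \<ge> 0"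
  by (rule dist_S_nonneg[OF path_lengths_nonempty[OF C11 connected S_subset S_nonempty assms]])

lemma d_boundary: "x \<in> S \<Longrightarrow> d x = 0"
  by (rule dist_S_boundary[OF _ S_subset])

lemma U_upper:
  assumes "0 < \<delta>" "\<delta> < 1"
  obtains \<epsilon>0 where "\<epsilon>0 > 0"
    "\<And>\<epsilon> x. \<lbrakk>0 < \<epsilon>; \<epsilon> < \<epsilon>0; x \<in> \<Omega>\<rbrakk> \<Longrightarrow> U \<epsilon> x \<le> M * exp (- ((1 - \<delta>) * d x - \<delta>) / \<epsilon>)"
proof -
  obtain \<epsilon>0 where \<epsilon>0: "\<epsilon>0 > 0" "\<And>\<epsilon> v M x. \<lbrakk>0 < \<epsilon>; \<epsilon> < \<epsilon>0; resolvent_solution \<epsilon> v; M \<ge> 0;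
      \<forall>y\<in>closure \<Omega>. v y \<le> M; \<forall>y\<in>frontier \<Omega> - S. v y \<le> 0; x \<in> \<Omega>\<rbrakk> \<Longrightarrow>
      v x \<le> M * exp (- ((1 - \<delta>) * d x - \<delta>) / \<epsilon>)"
    using resolvent_upper_bound[OF C11 connected S_subset S_nonempty assms] by metis
  show thesis
  proof (rule that[OF \<epsilon>0(1)])
    fix \<epsilon> x assume \<epsilon>: "0 < \<epsilon>" "\<epsilon> < \<epsilon>0" and x: "x \<in> \<Omega>"
    show "U \<epsilon> x \<le> M * exp (- ((1 - \<delta>) * d x - \<delta>) / \<epsilon>)"
    proof (rule \<epsilon>0(2)[OF \<epsilon> U_resolvent[OF \<epsilon>(1)] _ _ _ x])
      show "\<forall>y\<in>closure \<Omega>. U \<epsilon> y \<le> M" using U_le[OF \<epsilon>(1)] by blast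
      show "\<forall>y\<in>frontier \<Omega> - S. U \<epsilon> y \<le> 0"
        using U_boundary[OF \<epsilon>(1)] S_eq f_nonneg by force
    qed (use M_pos in simp)
  qed
qed

lemma lower_rate_U:
  assumes "lower_rate f x a"
  obtains \<kappa> \<epsilon>0 where "\<kappa> > 0" "\<epsilon>0 > 0"
    "\<And>\<epsilon> y. \<lbrakk>0 < \<epsilon>; \<epsilon> < \<epsilon>0; y \<in> closure \<Omega>; norm (y - x) \<le> \<kappa>\<rbrakk> \<Longrightarrow> exp (- a / \<epsilon>) \<le> U \<epsilon> y"
proof -
  obtain \<kappa> \<epsilon>0 where *: "\<kappa> > 0" "\<epsilon>0 > 0"
    "\<And>\<epsilon> v w. \<lbrakk>\<epsilon> < \<epsilon>0; dirichlet_solution f \<epsilon> v; w \<in> closure \<Omega>; norm (w - x) \<le> \<kappa>\<rbrakk> \<Longrightarrow> v w \<ge> exp (- a / \<epsilon>)"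
    using assms unfolding lower_rate_def by blast
  show thesis by (rule that[OF *(1,2)]) (rule *(3)[OF _ U]; assumption)
qed

text \<open>The same solution decays at least with a rate close to \<open>d x\<close> and at most
  with the rate \<open>a\<close>, so \<open>d x\<close> cannot exceed \<open>a\<close>. Estimates
  for solutions thereby become estimates for the distance.\<close>

lemma d_le_lower_rate:
  assumes "lower_rate f x a" "x \<in> \<Omega>" "a \<ge> 0"
  shows "d x \<le> a"
proof (rule ccontr)
  assume "\<not> d x \<le> a"
  then have gt: "d x > a" by simp
  \<comment> \<open>Chosen so that \<open>(1 - \<delta>) * d x - \<delta>\<close> is the midpoint of
    \<open>a\<close> and \<open>d x\<close>, hence still above \<open>a\<close>.\<close>
  define \<delta> where "\<delta> = (d x - a) / (2 * (d x + 1))"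
  have dp: "d x + 1 > 0" using gt assms(3) by simp
  have cancel: "z / (2 * q) * q = z / 2" if "q \<noteq> 0" for z q :: real using that by simp
  have \<delta>: "\<delta> > 0" "\<delta> < 1" "\<delta> * (d x + 1) = (d x - a) / 2"
  proof -
    show "\<delta> > 0" using gt dp by (simp add: \<delta>_def)
    have "d x - a < 1 * (2 * (d x + 1))" using gt assms(3) by simp
    then show "\<delta> < 1" unfolding \<delta>_def using dp by (subst pos_divide_less_eq) auto
    show "\<delta> * (d x + 1) = (d x - a) / 2" unfolding \<delta>_def using cancel[of "d x + 1"] dp by simp
  qed
  obtain e1 where e1: "e1 > 0"
    "\<And>\<epsilon> x. \<lbrakk>0 < \<epsilon>; \<epsilon> < e1; x \<in> \<Omega>\<rbrakk> \<Longrightarrow> U \<epsilon> x \<le> M * exp (- ((1 - \<delta>) * d x - \<delta>) / \<epsilon>)"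
    using U_upper[OF \<delta>(1,2)] by blast
  obtain \<kappa> e2 where e2: "\<kappa> > 0" "e2 > 0"
    "\<And>\<epsilon> y. \<lbrakk>0 < \<epsilon>; \<epsilon> < e2; y \<in> closure \<Omega>; norm (y - x) \<le> \<kappa>\<rbrakk> \<Longrightarrow> exp (- a / \<epsilon>) \<le> U \<epsilon> y"
    using lower_rate_U[OF assms(1)] by blast
  have "(1 - \<delta>) * d x - \<delta> \<le> a"
  proof (rule exp_rate_compare[OF M_pos])
    show "min e1 e2 > 0" using e1 e2 by simp
    fix \<epsilon> assume "0 < \<epsilon>" "\<epsilon> < min e1 e2"
    then show "exp (- a / \<epsilon>) \<le> M * exp (- ((1 - \<delta>) * d x - \<delta>) / \<epsilon>)"
      using e1(2)[of \<epsilon> x] e2(3)[of \<epsilon> x] assms(2) closure_subset e2(1) by force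
  qed
  moreover have "(1 - \<delta>) * d x - \<delta> = d x - \<delta> * (d x + 1)" by (simp add: algebra_simps)
  moreover have "2 * (\<delta> * (d x + 1)) = d x - a" using \<delta>(3) by (simp add: field_simps)
  ultimately show False using gt by linarith
qed

text \<open>Both inequalities come from lower rates. The rate at \<open>x\<close> holds on a
  neighbourhood and bounds \<open>d y\<close>; one barrier step from \<open>y\<close> to
  \<open>x\<close> bounds \<open>d x\<close>, with a radius \<open>r\<close> that is uniform in
  \<open>y\<close>.\<close>

lemma d_interior_continuous:
  assumes x: "x \<in> \<Omega>" and \<eta>: "\<eta> > 0"
  obtains \<kappa> where "\<kappa> > 0" "\<And>y. norm (y - x) < \<kappa> \<Longrightarrow> y \<in> \<Omega> \<and> d x \<le> d y + \<eta> \<and> d y \<le> d x + \<eta>"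
proof -
  have sc: "sqrt c > 0" "sqrt \<Lambda> > 0" using c_pos \<Lambda>_pos by auto
  have ne: "path_lengths A \<Omega> S y \<noteq> {}" if "y \<in> \<Omega>" for y
    by (rule path_lengths_nonempty[OF C11 connected S_subset S_nonempty that])
  have rate: "lower_rate f y (d y + e)" if "y \<in> \<Omega>" "e > 0" for y e
    by (rule lower_rate_dist[OF C11 f_continuous f_nonneg S_eq that(1) ne[OF that(1)] that(2)])
  obtain \<kappa>1 where \<kappa>1: "\<kappa>1 > 0" "\<And>y. norm (y - x) < \<kappa>1 \<Longrightarrow> lower_rate f y (d x + \<eta>)"
    using lower_rate_near[OF rate[OF x \<eta>]] by blast
  obtain e where e: "e > 0" "ball x e \<subseteq> \<Omega>" using open_domain x open_contains_ball by blast
  have half: "0 < (1/2 :: real)" "(1/2 :: real) < 1" by simp_all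
  obtain \<rho> where \<rho>: "\<rho> > 0"
    "\<And>r x y a \<eta>. \<lbrakk>0 < r; r < \<rho>; lower_rate f y a; y \<in> \<Omega>; \<forall>w\<in>frontier \<Omega>. N y (w - y) > r;
       N y (x - y) < r; \<eta> > 0\<rbrakk> \<Longrightarrow> lower_rate f x (a + (1 + 1/2) * N y (x - y) + \<eta>)"
    using lower_rate_step[OF half f_nonneg] by blast
  define q where "q = e / (2 * sqrt \<Lambda>)"
  define r where "r = min (min \<rho> q) (\<eta> / 3) / 2"
  have "q > 0" using e(1) sc by (simp add: q_def)
  then have r: "0 < r" "r < \<rho>" "r < q" "r < \<eta> / 3" using \<rho>(1) \<eta> by (auto simp: r_def)
  define \<kappa> where "\<kappa> = min (min \<kappa>1 (e / 2)) (r * sqrt c)"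
  have \<kappa>: "\<kappa> > 0" "\<kappa> \<le> \<kappa>1" "\<kappa> \<le> e / 2" "\<kappa> \<le> r * sqrt c" using \<kappa>1(1) e(1) r(1) sc by (auto simp: \<kappa>_def)
  show thesis
  proof (rule that[OF \<kappa>(1)])
    fix y assume y: "norm (y - x) < \<kappa>"
    have y\<Omega>: "y \<in> \<Omega>" using e y \<kappa>(3) by (auto simp: subset_iff dist_norm norm_minus_commute)
    have yR: "y \<in> cball 0 R" using y\<Omega> closure_subset closure_in_cball by blast
    have "d y \<le> d x + \<eta>"
      using d_le_lower_rate[OF \<kappa>1(2) y\<Omega>] y \<kappa>(2) d_nonneg[OF x] \<eta> by simp
    moreover have "d x \<le> d y + \<eta>"
    proof -
      have "N y (x - y) \<le> norm (x - y) / sqrt c" by (rule N_le)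
      also have "\<dots> < r" using y \<kappa>(4) sc by (simp add: pos_divide_less_eq norm_minus_commute)
      finally have Nxy: "N y (x - y) < r" .
      have far: "N y (w - y) > r" if "w \<in> frontier \<Omega>" for w
      proof -
        have "w \<notin> ball x e" using e(2) that frontier_eq by blast
        then have "e \<le> norm (w - x)" by (simp add: dist_norm norm_minus_commute)
        also have "\<dots> \<le> norm (w - y) + norm (y - x)" using norm_triangle_ineq[of "w - y" "y - x"] by simp
        finally have "e / 2 \<le> norm (w - y)" using y \<kappa>(3) by linarith
        also have "\<dots> \<le> sqrt \<Lambda> * N y (w - y)" by (rule norm_le_N[OF yR])
        finally have "q \<le> N y (w - y)" using sc by (simp add: q_def pos_divide_le_eq mult_ac)
        then show ?thesis using r by simp
      qed
      have "lower_rate f x ((d y + \<eta> / 4) + (1 + 1/2) * N y (x - y) + \<eta> / 4)"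
        by (rule \<rho>(2)[OF r(1,2) rate[OF y\<Omega>] y\<Omega> _ Nxy]) (use \<eta> far in auto)
      moreover have "(d y + \<eta> / 4) + (1 + 1/2) * N y (x - y) + \<eta> / 4 \<le> d y + \<eta>"
        using Nxy r(4) by simp
      ultimately have "lower_rate f x (d y + \<eta>)" by (rule lower_rate_mono)
      then show ?thesis using d_nonneg[OF y\<Omega>] \<eta> by (intro d_le_lower_rate x) simp_all
    qed
    ultimately show "y \<in> \<Omega> \<and> d x \<le> d y + \<eta> \<and> d y \<le> d x + \<eta>" using y\<Omega> by blast
  qed
qed

section \<open>Comparison of the parabolic solution with exponential multiples of elliptic
  ones\<close>

lemma U_caloric: "\<epsilon> > 0 \<Longrightarrow> caloric (\<lambda>x t. exp (t / \<epsilon>\<^sup>2) * U \<epsilon> x)"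
  by (rule caloric_resolvent[OF U_resolvent U_hessian])

lemma u_le_exp_U:
  assumes "\<epsilon> > 0" "x \<in> \<Omega>" "t > 0"
  shows "u x t \<le> exp (t / \<epsilon>\<^sup>2) * U \<epsilon> x"
proof -
  have "exp (t / \<epsilon>\<^sup>2) * U \<epsilon> x + (-1) * u x t \<ge> 0"
  proof (rule caloric_minimum_principle[OF caloric_add[OF U_caloric[OF assms(1)] caloric_cmult[OF u_caloric]] assms(3) _ _ assms(2,3) order_refl])
    fix y s assume y: "y \<in> frontier \<Omega>" and s: "0 < s" "s \<le> t"
    have "1 * f y \<le> exp (s / \<epsilon>\<^sup>2) * f y" using f_nonneg y s by (intro mult_right_mono) auto
    then show "0 \<le> exp (s / \<epsilon>\<^sup>2) * U \<epsilon> y + - 1 * u y s"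
      using U_boundary[OF assms(1) y] u_boundary[OF y s(1)] by simp
  next
    fix y assume "y \<in> \<Omega>"
    then show "0 \<le> exp (0 / \<epsilon>\<^sup>2) * U \<epsilon> y + - 1 * u y 0"
      using U_nonneg[OF assms(1)] u_init closure_subset by auto
  qed
  then show ?thesis by simp
qed

text \<open>An exponential Chebyshev bound: for the exit time \<open>\<tau>\<close> of the diffusion generated by the
  operator, \<open>u x t = E [f; \<tau> < t]\<close> and \<open>U \<epsilon> x = E [f exp (- \<tau> / \<epsilon>\<^sup>2)]\<close>; the
  contributions of late and of early exits to \<open>U \<epsilon>\<close> are controlled by \<open>U\<close> at a larger and
  at a smaller parameter.\<close>

lemma U_le_combination:
  assumes \<epsilon>: "0 < \<epsilon>" "\<epsilon> \<le> \<epsilon>'" "0 < \<epsilon>''" and bk: "b \<ge> 0" "k \<ge> 0"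
    and weights: "\<And>s. \<lbrakk>0 < s; s \<le> t\<rbrakk> \<Longrightarrow> exp (s / \<epsilon>\<^sup>2) \<le> exp (s / \<epsilon>'\<^sup>2) + b + k * exp (s / \<epsilon>''\<^sup>2)"
    and x: "x \<in> \<Omega>" and t: "t > 0"
  shows "exp (t / \<epsilon>\<^sup>2) * U \<epsilon> x \<le> exp (t / \<epsilon>'\<^sup>2) * U \<epsilon>' x + b * u x t + k * (exp (t / \<epsilon>''\<^sup>2) * U \<epsilon>'' x)"
proof -
  have \<epsilon>': "\<epsilon>' > 0" using \<epsilon> by simp
  have "exp (t / \<epsilon>'\<^sup>2) * U \<epsilon>' x + b * u x t + k * (exp (t / \<epsilon>''\<^sup>2) * U \<epsilon>'' x) + (-1) * (exp (t / \<epsilon>\<^sup>2) * U \<epsilon> x) \<ge> 0"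
  proof (rule caloric_minimum_principle[OF caloric_add[OF caloric_add[OF caloric_add[OF U_caloric[OF \<epsilon>'] caloric_cmult[OF u_caloric]]
          caloric_cmult[OF U_caloric[OF \<epsilon>(3)]]] caloric_cmult[OF U_caloric[OF \<epsilon>(1)]]] t _ _ x t order_refl])
    fix y s assume y: "y \<in> frontier \<Omega>" and s: "0 < s" "s \<le> t"
    have "exp (s / \<epsilon>\<^sup>2) * f y \<le> (exp (s / \<epsilon>'\<^sup>2) + b + k * exp (s / \<epsilon>''\<^sup>2)) * f y"
      using f_nonneg y weights[OF s] by (intro mult_right_mono) auto
    then show "0 \<le> exp (s / \<epsilon>'\<^sup>2) * U \<epsilon>' y + b * u y s + k * (exp (s / \<epsilon>''\<^sup>2) * U \<epsilon>'' y) + - 1 * (exp (s / \<epsilon>\<^sup>2) * U \<epsilon> y)"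
      unfolding U_boundary[OF \<epsilon>(1) y] U_boundary[OF \<epsilon>' y] U_boundary[OF \<epsilon>(3) y] u_boundary[OF y s(1)]
      by (simp add: distrib_right mult.assoc)
  next
    fix y assume y: "y \<in> \<Omega>"
    then have ycl: "y \<in> closure \<Omega>" using closure_subset by blast
    have "U \<epsilon> y \<le> U \<epsilon>' y"
      by (rule resolvent_solution_mono[OF U_resolvent[OF \<epsilon>(1)] U_resolvent[OF \<epsilon>'] \<epsilon>(1,2) _ U_nonneg[OF \<epsilon>(1)] ycl])
         (simp_all add: U_boundary \<epsilon> \<epsilon>')
    moreover have "k * U \<epsilon>'' y \<ge> 0" using bk(2) U_nonneg[OF \<epsilon>(3) ycl] by simp
    ultimately show "0 \<le> exp (0 / \<epsilon>'\<^sup>2) * U \<epsilon>' y + b * u y 0 + k * (exp (0 / \<epsilon>''\<^sup>2) * U \<epsilon>'' y) + - 1 * (exp (0 / \<epsilon>\<^sup>2) * U \<epsilon> y)"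
      using u_init[OF y] by simp
  qed
  then show ?thesis by simp
qed


text \<open>At the time \<open>\<epsilon> * y / 2\<close> the parameter \<open>\<epsilon>\<close>
  would minimise the exponent, and the solution with parameter
  \<open>\<epsilon> / (1 - \<kappa>)\<close> could not be subtracted. Lengthening the time by the
  factor \<open>1 + \<kappa>\<close> moves the minimiser towards that parameter, so its term becomes
  exponentially smaller than the one with \<open>\<epsilon>\<close>. Here \<open>y\<close> stands
  for the distance of \<open>x\<close>.\<close>

lemma u_lower_far:
  assumes x: "x \<in> \<Omega>" and \<epsilon>: "\<epsilon> > 0" and \<kappa>: "0 < \<kappa>" "\<kappa> \<le> 1/2" and y: "0 < \<delta>0" "\<delta>0 \<le> y"
    and \<eta>: "0 < \<eta>" "\<eta> \<le> \<delta>0 * \<kappa>\<^sup>2 / 16" and small: "exp (- (\<delta>0 * \<kappa>\<^sup>2 / 8) / \<epsilon>) \<le> 1/4"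
    and U0: "exp (- (y + \<eta>) / \<epsilon>) \<le> U \<epsilon> x"
    and U1: "U (\<epsilon> / (1 - \<kappa>)) x \<le> exp (- (y - \<eta>) / (\<epsilon> / (1 - \<kappa>)))"
    and U2: "U (\<epsilon> / (1 + \<kappa>)) x \<le> exp (- (y - \<eta>) / (\<epsilon> / (1 + \<kappa>)))"
  shows "u x (\<epsilon> * y * (1 + \<kappa>) / 2) \<ge> exp (- (y * (1 + \<kappa>) / 2 + \<eta>) / \<epsilon>) / 2"
proof -
  define t where "t = \<epsilon> * y * (1 + \<kappa>) / 2"
  define E where "E = (\<lambda>z. exp (z / \<epsilon>))"
  have E_add: "E (a + b) = E a * E b" for a b by (simp add: E_def add_divide_distrib exp_add)
  have E_mono: "E a \<le> E b" if "a \<le> b" for a b using that \<epsilon> by (simp add: E_def divide_right_mono)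
  have E_pos: "E a > 0" for a by (simp add: E_def)
  have y0: "y > 0" using y by simp
  have t: "t > 0" using \<epsilon> y0 \<kappa> by (simp add: t_def)
  have k1: "1 - \<kappa> > 0" "1 + \<kappa> > 0" using \<kappa> by auto
  have e0: "exp (s / \<epsilon>\<^sup>2) = E (s / \<epsilon>)" for s using \<epsilon> by (simp add: E_def power2_eq_square)
  have e1: "exp (s / (\<epsilon> / (1 - \<kappa>))\<^sup>2) = E (s / \<epsilon> * (1 - \<kappa>)\<^sup>2)" for s
    using \<epsilon> k1 by (simp add: E_def power_divide power2_eq_square)
  have e2: "exp (s / (\<epsilon> / (1 + \<kappa>))\<^sup>2) = E (s / \<epsilon> * (1 + \<kappa>)\<^sup>2)" for s
    using \<epsilon> k1 by (simp add: E_def power_divide power2_eq_square)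
  have t\<epsilon>: "t / \<epsilon> = y * (1 + \<kappa>) / 2" using \<epsilon> by (simp add: t_def)
  \<comment> \<open>Up to boundary time \<open>\<epsilon> * y * \<kappa>\<close> the constant weight
    \<open>E (y * \<kappa>)\<close> of \<open>u\<close> suffices. From then on the third term takes
    over: its prefactor makes it equal to the left side exactly at that time, because \<open>(1 +
    \<kappa>)\<^sup>2 = 1 + (2 * \<kappa> + \<kappa>\<^sup>2)\<close>. The first term is there for
    the initial data, where \<open>u\<close> vanishes.\<close>
  have comb: "exp (t / \<epsilon>\<^sup>2) * U \<epsilon> x \<le> exp (t / (\<epsilon> / (1 - \<kappa>))\<^sup>2) * U (\<epsilon> / (1 - \<kappa>)) x + E (y * \<kappa>) * u x t
      + E (- (y * \<kappa> * (2 * \<kappa> + \<kappa>\<^sup>2))) * (exp (t / (\<epsilon> / (1 + \<kappa>))\<^sup>2) * U (\<epsilon> / (1 + \<kappa>)) x)"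
  proof (rule U_le_combination[OF \<epsilon> _ _ less_imp_le[OF E_pos] less_imp_le[OF E_pos] _ x t])
    show "\<epsilon> \<le> \<epsilon> / (1 - \<kappa>)" using \<epsilon> \<kappa> by (simp add: pos_le_divide_eq)
    show "0 < \<epsilon> / (1 + \<kappa>)" using \<epsilon> \<kappa> by simp
    fix s assume s: "0 < s" "s \<le> t"
    show "exp (s / \<epsilon>\<^sup>2) \<le> exp (s / (\<epsilon> / (1 - \<kappa>))\<^sup>2) + E (y * \<kappa>) + E (- (y * \<kappa> * (2 * \<kappa> + \<kappa>\<^sup>2))) * exp (s / (\<epsilon> / (1 + \<kappa>))\<^sup>2)"
      unfolding e0 e1 e2
    proof (cases "s / \<epsilon> \<le> y * \<kappa>")
      case True
      then have "E (s / \<epsilon>) \<le> E (y * \<kappa>)" by (rule E_mono)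
      moreover have "E (s / \<epsilon> * (1 - \<kappa>)\<^sup>2) > 0" "E (- (y * \<kappa> * (2 * \<kappa> + \<kappa>\<^sup>2))) * E (s / \<epsilon> * (1 + \<kappa>)\<^sup>2) > 0"
        using E_pos by auto
      ultimately show "E (s / \<epsilon>) \<le> E (s / \<epsilon> * (1 - \<kappa>)\<^sup>2) + E (y * \<kappa>) + E (- (y * \<kappa> * (2 * \<kappa> + \<kappa>\<^sup>2))) * E (s / \<epsilon> * (1 + \<kappa>)\<^sup>2)"
        by linarith
    next
      case False
      then have "(y * \<kappa>) * (2 * \<kappa> + \<kappa>\<^sup>2) \<le> (s / \<epsilon>) * (2 * \<kappa> + \<kappa>\<^sup>2)" using \<kappa> by (intro mult_right_mono) auto
      moreover have "(s / \<epsilon>) * (1 + \<kappa>)\<^sup>2 = s / \<epsilon> + (s / \<epsilon>) * (2 * \<kappa> + \<kappa>\<^sup>2)"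
        by (simp add: power2_sum distrib_left)
      ultimately have "s / \<epsilon> \<le> - (y * \<kappa> * (2 * \<kappa> + \<kappa>\<^sup>2)) + s / \<epsilon> * (1 + \<kappa>)\<^sup>2" by linarith
      then have "E (s / \<epsilon>) \<le> E (- (y * \<kappa> * (2 * \<kappa> + \<kappa>\<^sup>2))) * E (s / \<epsilon> * (1 + \<kappa>)\<^sup>2)"
        unfolding E_add[symmetric] by (rule E_mono)
      then show "E (s / \<epsilon>) \<le> E (s / \<epsilon> * (1 - \<kappa>)\<^sup>2) + E (y * \<kappa>) + E (- (y * \<kappa> * (2 * \<kappa> + \<kappa>\<^sup>2))) * E (s / \<epsilon> * (1 + \<kappa>)\<^sup>2)"
        using E_pos[of "s / \<epsilon> * (1 - \<kappa>)\<^sup>2"] E_pos[of "y * \<kappa>"] by linarith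
    qed
  qed
  \<comment> \<open>\<open>L / \<epsilon>\<close> is the exponent guaranteed for the left side, and
    \<open>\<mu>\<close> is the gap by which the two unwanted terms fall short; each of them is at
    most a quarter of the left side, so half of it is left for \<open>u\<close>.\<close>
  define L where "L = - y * (1 - \<kappa>) / 2 - \<eta>"
  define \<mu> where "\<mu> = \<delta>0 * \<kappa>\<^sup>2 / 8"
  have V0: "E (- (y + \<eta>)) \<le> U \<epsilon> x" using U0 by (simp only: E_def)
  have V1: "U (\<epsilon> / (1 - \<kappa>)) x \<le> E (- (y - \<eta>) * (1 - \<kappa>))" using U1 by (simp add: E_def)
  have V2: "U (\<epsilon> / (1 + \<kappa>)) x \<le> E (- (y - \<eta>) * (1 + \<kappa>))" using U2 by (simp add: E_def)
  have lhs: "E L \<le> exp (t / \<epsilon>\<^sup>2) * U \<epsilon> x"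
  proof -
    have "L = t / \<epsilon> + - (y + \<eta>)" by (simp add: L_def t\<epsilon> field_simps)
    then have "E L = E (t / \<epsilon>) * E (- (y + \<eta>))" by (simp only: E_add)
    also have "\<dots> \<le> E (t / \<epsilon>) * U \<epsilon> x" by (rule mult_left_mono[OF V0 less_imp_le[OF E_pos]])
    finally show ?thesis by (simp only: e0)
  qed
  have T1: "exp (t / (\<epsilon> / (1 - \<kappa>))\<^sup>2) * U (\<epsilon> / (1 - \<kappa>)) x \<le> E (L - \<mu>)"
  proof -
    have "exp (t / (\<epsilon> / (1 - \<kappa>))\<^sup>2) * U (\<epsilon> / (1 - \<kappa>)) x \<le> E (t / \<epsilon> * (1 - \<kappa>)\<^sup>2) * E (- (y - \<eta>) * (1 - \<kappa>))"
      unfolding e1 by (rule mult_left_mono[OF V1 less_imp_le[OF E_pos]])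
    also have "\<dots> = E (y * (1 + \<kappa>) * (1 - \<kappa>)\<^sup>2 / 2 - (y - \<eta>) * (1 - \<kappa>))"
      unfolding E_add[symmetric] t\<epsilon> by (rule arg_cong[where f = E]) (simp add: algebra_simps)
    also have "\<dots> \<le> E (L - \<mu>)"
      unfolding L_def \<mu>_def by (rule E_mono[OF Chebyshev_exponents(1)[OF \<kappa> y \<eta>]])
    finally show ?thesis .
  qed
  have T3: "E (- (y * \<kappa> * (2 * \<kappa> + \<kappa>\<^sup>2))) * (exp (t / (\<epsilon> / (1 + \<kappa>))\<^sup>2) * U (\<epsilon> / (1 + \<kappa>)) x) \<le> E (L - \<mu>)"
  proof -
    have "E (- (y * \<kappa> * (2 * \<kappa> + \<kappa>\<^sup>2))) * (exp (t / (\<epsilon> / (1 + \<kappa>))\<^sup>2) * U (\<epsilon> / (1 + \<kappa>)) x)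
       \<le> E (- (y * \<kappa> * (2 * \<kappa> + \<kappa>\<^sup>2))) * (E (t / \<epsilon> * (1 + \<kappa>)\<^sup>2) * E (- (y - \<eta>) * (1 + \<kappa>)))"
      unfolding e2 by (intro mult_left_mono V2 less_imp_le[OF E_pos])
    also have "\<dots> = E (- y * \<kappa> * (2 * \<kappa> + \<kappa>\<^sup>2) + y * (1 + \<kappa>) ^ 3 / 2 - (y - \<eta>) * (1 + \<kappa>))"
      unfolding E_add[symmetric] t\<epsilon> by (rule arg_cong[where f = E]) (simp add: field_simps power2_eq_square power3_eq_cube)
    also have "\<dots> \<le> E (L - \<mu>)"
      unfolding L_def \<mu>_def by (rule E_mono[OF Chebyshev_exponents(2)[OF \<kappa> y \<eta>]])
    finally show ?thesis .
  qed
  have "E (L - \<mu>) \<le> E L * (1/4)"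
  proof -
    have "E (L - \<mu>) = E L * E (- \<mu>)" using E_add[of L "- \<mu>"] by simp
    also have "\<dots> \<le> E L * (1/4)"
      using small by (intro mult_left_mono less_imp_le[OF E_pos]) (simp only: E_def \<mu>_def)
    finally show ?thesis .
  qed
  then have "E L / 2 \<le> E (y * \<kappa>) * u x t" using lhs comb T1 T3 by linarith
  also have "E L = E (y * \<kappa>) * E (L - y * \<kappa>)" using E_add[of "y * \<kappa>" "L - y * \<kappa>"] by simp
  finally have "E (y * \<kappa>) * (E (L - y * \<kappa>) / 2) \<le> E (y * \<kappa>) * u x t" by simp
  then have "E (L - y * \<kappa>) / 2 \<le> u x t" by (rule mult_left_le_imp_le[OF _ E_pos])
  moreover have "L - y * \<kappa> = - (y * (1 + \<kappa>) / 2 + \<eta>)" by (simp add: L_def field_simps)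
  ultimately show ?thesis unfolding t_def E_def by simp
qed

text \<open>For distances below \<open>\<delta>0\<close> the ratio of \<open>t\<close> to
  \<open>\<epsilon>\<close> is fixed at \<open>8 * \<delta>0\<close>. The solution with parameter
  \<open>2 * \<epsilon>\<close> then has a time exponent four times smaller, so the crude bound
  \<open>M\<close> for it suffices: the exponents \<open>6 * \<delta>0\<close> and
  \<open>2 * \<delta>0\<close> leave a gap that absorbs \<open>2 * M\<close>. With
  \<open>k = 0\<close> the third term of the combination is a dummy.\<close>

lemma u_lower_near:
  assumes x: "x \<in> \<Omega>" and \<epsilon>: "\<epsilon> > 0" and \<delta>0: "\<delta>0 > 0"
    and small: "exp (- (4 * \<delta>0) / \<epsilon>) \<le> 1 / (2 * M)"
    and U0: "exp (- (2 * \<delta>0) / \<epsilon>) \<le> U \<epsilon> x"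
  shows "u x (8 * \<delta>0 * \<epsilon>) \<ge> exp (- (2 * \<delta>0) / \<epsilon>) / 2"
proof -
  define t where "t = 8 * \<delta>0 * \<epsilon>"
  have t: "t > 0" using \<epsilon> \<delta>0 by (simp add: t_def)
  define E where "E = (\<lambda>z. exp (z / \<epsilon>))"
  have E_add: "E (a + b) = E a * E b" for a b by (simp add: E_def add_divide_distrib exp_add)
  have E_pos: "E a > 0" for a by (simp add: E_def)
  have e0: "exp (t / \<epsilon>\<^sup>2) = E (8 * \<delta>0)" using \<epsilon> by (simp add: E_def t_def power2_eq_square)
  have e1: "exp (t / (2 * \<epsilon>)\<^sup>2) = E (2 * \<delta>0)" using \<epsilon> by (simp add: E_def t_def power2_eq_square)
  have "exp (t / \<epsilon>\<^sup>2) * U \<epsilon> x \<le> exp (t / (2 * \<epsilon>)\<^sup>2) * U (2 * \<epsilon>) x + exp (t / \<epsilon>\<^sup>2) * u x t + 0 * (exp (t / \<epsilon>\<^sup>2) * U \<epsilon> x)"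
  proof (rule U_le_combination[OF \<epsilon> _ \<epsilon> _ _ _ x t])
    fix s assume s: "0 < s" "s \<le> t"
    have "exp (s / \<epsilon>\<^sup>2) \<le> exp (t / \<epsilon>\<^sup>2)" using s(2) \<epsilon> by (simp add: divide_right_mono)
    moreover have "exp (s / (2 * \<epsilon>)\<^sup>2) > 0" by simp
    ultimately show "exp (s / \<epsilon>\<^sup>2) \<le> exp (s / (2 * \<epsilon>)\<^sup>2) + exp (t / \<epsilon>\<^sup>2) + 0 * exp (s / \<epsilon>\<^sup>2)" by linarith
  qed (use \<epsilon> in auto)
  then have comb: "E (8 * \<delta>0) * U \<epsilon> x \<le> E (2 * \<delta>0) * U (2 * \<epsilon>) x + E (8 * \<delta>0) * u x t"
    unfolding e0 e1 by simp
  have "E (8 * \<delta>0) * E (- (2 * \<delta>0)) \<le> E (8 * \<delta>0) * U \<epsilon> x"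
    using U0 by (intro mult_left_mono less_imp_le[OF E_pos]) (simp only: E_def)
  moreover have "E (2 * \<delta>0) * U (2 * \<epsilon>) x \<le> E (2 * \<delta>0) * M"
    using U_le[of "2 * \<epsilon>" x] \<epsilon> x closure_subset by (intro mult_left_mono less_imp_le[OF E_pos]) auto
  moreover have "E (2 * \<delta>0) * M \<le> E (8 * \<delta>0) * (E (- (2 * \<delta>0)) / 2)"
  proof -
    have "E (2 * \<delta>0) = E (8 * \<delta>0) * (E (- (2 * \<delta>0)) * E (- (4 * \<delta>0)))"
      unfolding E_add[symmetric] by simp
    then have "E (2 * \<delta>0) * M = E (8 * \<delta>0) * (E (- (2 * \<delta>0)) * (E (- (4 * \<delta>0)) * M))" by (simp only: mult.assoc)
    also have "\<dots> \<le> E (8 * \<delta>0) * (E (- (2 * \<delta>0)) * (1 / (2 * M) * M))"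
      using small M_pos by (intro mult_left_mono mult_right_mono less_imp_le[OF E_pos]) (simp_all only: E_def less_imp_le)
    also have "\<dots> = E (8 * \<delta>0) * (E (- (2 * \<delta>0)) / 2)" using M_pos by simp
    finally show ?thesis .
  qed
  ultimately have "E (8 * \<delta>0) * E (- (2 * \<delta>0)) \<le> E (8 * \<delta>0) * (E (- (2 * \<delta>0)) / 2) + E (8 * \<delta>0) * u x t"
    using comb by linarith
  then have "E (8 * \<delta>0) * (E (- (2 * \<delta>0)) / 2) \<le> E (8 * \<delta>0) * u x t" by simp
  then have "E (- (2 * \<delta>0)) / 2 \<le> u x t" by (rule mult_left_le_imp_le[OF _ E_pos])
  then show ?thesis by (simp only: E_def t_def)
qed

section \<open>Uniform estimates on a compact set\<close>

context
  fixes K assumes K: "compact K" "K \<subseteq> \<Omega> \<union> S"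
begin

lemma K_closure: "x \<in> K \<Longrightarrow> x \<in> closure \<Omega>"
  using K(2) S_subset frontier_eq closure_subset by blast

lemma K_d_nonneg: "x \<in> K \<Longrightarrow> d x \<ge> 0"
  using K(2) d_nonneg d_boundary by fastforce

text \<open>By compactness a local rate is enough. At an interior point it is
  \<open>d x + \<eta> / 2\<close>, which nearby is at most \<open>d y + \<eta>\<close> by
  continuity; at a point of \<open>S\<close> it is \<open>\<eta>\<close>, which is at most
  \<open>d y + \<eta>\<close> since distances are nonnegative.\<close>

lemma K_lower:
  assumes \<eta>: "\<eta> > 0"
  shows "\<exists>\<epsilon>0>0. \<forall>x\<in>K. \<forall>\<epsilon>. 0 < \<epsilon> \<longrightarrow> \<epsilon> < \<epsilon>0 \<longrightarrow> exp (- (d x + \<eta>) / \<epsilon>) \<le> U \<epsilon> x"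
proof -
  have loc: "\<exists>\<kappa>>0. \<exists>\<epsilon>0>0. \<forall>y\<in>K. norm (y - x) < \<kappa> \<longrightarrow> (\<forall>\<epsilon>. 0 < \<epsilon> \<longrightarrow> \<epsilon> < \<epsilon>0 \<longrightarrow> exp (- (d y + \<eta>) / \<epsilon>) \<le> U \<epsilon> y)"
    if x: "x \<in> K" for x
  proof -
  have mono: "exp (- a / \<epsilon>) \<le> exp (- b / \<epsilon>)" if "b \<le> a" "\<epsilon> > 0" for a b \<epsilon> :: real
    using that by (simp add: divide_right_mono)
  have "\<exists>a. lower_rate f x a \<and> (\<exists>\<kappa>>0. \<forall>y\<in>K. norm (y - x) < \<kappa> \<longrightarrow> a \<le> d y + \<eta>)"
  proof (cases "x \<in> \<Omega>")
    case True
    have ne: "path_lengths A \<Omega> S x \<noteq> {}"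
      by (rule path_lengths_nonempty[OF C11 connected S_subset S_nonempty True])
    have e2: "\<eta> / 2 > 0" using \<eta> by simp
    have "lower_rate f x (d x + \<eta> / 2)"
      by (rule lower_rate_dist[OF C11 f_continuous f_nonneg S_eq True ne e2])
    moreover obtain \<kappa> where \<kappa>: "\<kappa> > 0" "\<And>y. norm (y - x) < \<kappa> \<Longrightarrow> y \<in> \<Omega> \<and> d x \<le> d y + \<eta> / 2 \<and> d y \<le> d x + \<eta> / 2"
      using d_interior_continuous[OF True e2] by blast
    moreover have "\<forall>y\<in>K. norm (y - x) < \<kappa> \<longrightarrow> d x + \<eta> / 2 \<le> d y + \<eta>"
      using \<kappa>(2) by fastforce
    ultimately show ?thesis by blast
  next
    case False
    then have "x \<in> S" using x K(2) by blast
    then have "lower_rate f x \<eta>"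
      using S_eq by (intro lower_rate_boundary[OF C11 f_continuous f_nonneg _ _ \<eta>]) auto
    moreover have "\<forall>y\<in>K. norm (y - x) < 1 \<longrightarrow> \<eta> \<le> d y + \<eta>" using K_d_nonneg by simp
    ultimately show ?thesis using zero_less_one by blast
  qed
  then obtain a \<kappa>1 where a: "lower_rate f x a" "\<kappa>1 > 0" "\<And>y. y \<in> K \<Longrightarrow> norm (y - x) < \<kappa>1 \<Longrightarrow> a \<le> d y + \<eta>"
    by blast
  obtain \<kappa> e2 where e2: "\<kappa> > 0" "e2 > 0"
    "\<And>\<epsilon> y. \<lbrakk>0 < \<epsilon>; \<epsilon> < e2; y \<in> closure \<Omega>; norm (y - x) \<le> \<kappa>\<rbrakk> \<Longrightarrow> exp (- a / \<epsilon>) \<le> U \<epsilon> y"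
    using lower_rate_U[OF a(1)] by blast
  show ?thesis
  proof (rule exI[of _ "min \<kappa> \<kappa>1"], rule conjI[rotated], rule exI[of _ e2], intro conjI ballI allI impI)
    fix y \<epsilon> assume y: "y \<in> K" "norm (y - x) < min \<kappa> \<kappa>1" and \<epsilon>: "0 < \<epsilon>" "\<epsilon> < e2"
    have "exp (- (d y + \<eta>) / \<epsilon>) \<le> exp (- a / \<epsilon>)" using a(3)[OF y(1)] y(2) by (intro mono \<epsilon>(1)) simp
    also have "\<dots> \<le> U \<epsilon> y" using e2(3)[OF \<epsilon> K_closure[OF y(1)]] y(2) by simp
    finally show "exp (- (d y + \<eta>) / \<epsilon>) \<le> U \<epsilon> y" .
  qed (use e2 a in auto)
  qed
  show ?thesis
    by (rule compact_uniform_threshold[OF K(1), where P = "\<lambda>\<epsilon> x. exp (- (d x + \<eta>) / \<epsilon>) \<le> U \<epsilon> x"]) (rule loc)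
qed

text \<open>Near a point of \<open>S\<close> a bound follows from the rate \<open>1\<close>, which
  holds on a neighbourhood; in the interior it follows from continuity.\<close>

lemma K_d_bounded: "\<exists>D>0. \<forall>x\<in>K. d x \<le> D"
proof -
  have loc: "\<exists>\<kappa>>0. \<exists>\<epsilon>0>0. \<forall>y\<in>K. norm (y - x) < \<kappa> \<longrightarrow> (\<forall>\<epsilon>. 0 < \<epsilon> \<longrightarrow> \<epsilon> < \<epsilon>0 \<longrightarrow> d y \<le> 1 / \<epsilon>)"
    if x: "x \<in> K" for x
  proof -
    have "\<exists>a\<ge>0. \<exists>\<kappa>>0. \<forall>y\<in>K. norm (y - x) < \<kappa> \<longrightarrow> d y \<le> a"
    proof (cases "x \<in> \<Omega>")
      case True
      obtain \<kappa> where "\<kappa> > 0" "\<And>y. norm (y - x) < \<kappa> \<Longrightarrow> y \<in> \<Omega> \<and> d x \<le> d y + 1 \<and> d y \<le> d x + 1"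
        using d_interior_continuous[OF True zero_less_one] by blast
      moreover have "d x + 1 \<ge> 0" using d_nonneg[OF True] by simp
      ultimately show ?thesis by blast
    next
      case False
      then have "x \<in> S" using x K(2) by blast
      then have "lower_rate f x 1"
        using S_eq by (intro lower_rate_boundary[OF C11 f_continuous f_nonneg _ _ zero_less_one]) auto
      then obtain \<kappa> where \<kappa>: "\<kappa> > 0" "\<And>y. norm (y - x) < \<kappa> \<Longrightarrow> lower_rate f y 1"
        using lower_rate_near by blast
      have "d y \<le> 1" if "y \<in> K" "norm (y - x) < \<kappa>" for y
      proof (cases "y \<in> \<Omega>")
        case True
        then show ?thesis using d_le_lower_rate[OF \<kappa>(2)[OF that(2)] True] by simp
      next
        case False
        then have "y \<in> S" using that(1) K(2) by blast
        then show ?thesis using d_boundary by simp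
      qed
      then show ?thesis using \<kappa>(1) zero_le_one by blast
    qed
    then obtain a \<kappa> where a: "a \<ge> 0" "\<kappa> > 0" "\<And>y. y \<in> K \<Longrightarrow> norm (y - x) < \<kappa> \<Longrightarrow> d y \<le> a" by blast
    show ?thesis
    proof (rule exI[of _ \<kappa>], rule conjI[rotated], rule exI[of _ "1 / (a + 1)"], intro conjI ballI allI impI)
      fix y \<epsilon> assume y: "y \<in> K" "norm (y - x) < \<kappa>" and \<epsilon>: "0 < \<epsilon>" "\<epsilon> < 1 / (a + 1)"
      have "\<epsilon> * (a + 1) < 1" using \<epsilon>(2) a(1) by (simp add: pos_less_divide_eq)
      then have "(a + 1) < 1 / \<epsilon>" using \<epsilon>(1) by (simp add: pos_less_divide_eq mult.commute)
      then show "d y \<le> 1 / \<epsilon>" using a(3)[OF y] by linarith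
    qed (use a in auto)
  qed
  \<comment> \<open>The compactness lemma is phrased for thresholds in \<open>\<epsilon>\<close>;
    boundedness is encoded as \<open>d y \<le> 1 / \<epsilon>\<close> for all small
    \<open>\<epsilon>\<close>.\<close>
  have "\<exists>\<epsilon>0>0. \<forall>y\<in>K. \<forall>\<epsilon>. 0 < \<epsilon> \<longrightarrow> \<epsilon> < \<epsilon>0 \<longrightarrow> d y \<le> 1 / \<epsilon>"
    by (rule compact_uniform_threshold[OF K(1), where P = "\<lambda>\<epsilon> y. d y \<le> 1 / \<epsilon>"]) (rule loc)
  then obtain \<epsilon>0 where e: "\<epsilon>0 > 0" "\<forall>y\<in>K. \<forall>\<epsilon>. 0 < \<epsilon> \<longrightarrow> \<epsilon> < \<epsilon>0 \<longrightarrow> d y \<le> 1 / \<epsilon>" by blast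
  have "0 < 1 / (\<epsilon>0 / 2)" using e(1) by simp
  moreover have "0 < \<epsilon>0 / 2" "\<epsilon>0 / 2 < \<epsilon>0" using e(1) by simp_all
  then have "\<forall>x\<in>K. d x \<le> 1 / (\<epsilon>0 / 2)" using e(2) by blast
  ultimately show ?thesis by blast
qed

lemma K_upper:
  assumes \<eta>: "\<eta> > 0"
  shows "\<exists>\<epsilon>0>0. \<forall>x\<in>K. \<forall>\<epsilon>. 0 < \<epsilon> \<longrightarrow> \<epsilon> < \<epsilon>0 \<longrightarrow> U \<epsilon> x \<le> exp (- (d x - \<eta>) / \<epsilon>)"
proof -
  obtain D where D: "D > 0" "\<And>x. x \<in> K \<Longrightarrow> d x \<le> D" using K_d_bounded by blast
  \<comment> \<open>Half of \<open>\<eta>\<close> pays for the loss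
    \<open>\<delta> * (d x + 1)\<close> in the rate, uniformly for distances up to \<open>D\<close>,
    and the other half absorbs the constant \<open>M\<close>.\<close>
  define \<delta> where "\<delta> = min (1/2) (\<eta> / (2 * (D + 1)))"
  have \<delta>: "0 < \<delta>" "\<delta> < 1" "\<delta> \<le> \<eta> / (2 * (D + 1))" using D(1) \<eta> by (auto simp: \<delta>_def)
  have \<delta>D: "\<delta> * (D + 1) \<le> \<eta> / 2"
  proof -
    have "\<delta> * (D + 1) \<le> \<eta> / (2 * (D + 1)) * (D + 1)" using \<delta>(3) D(1) by (intro mult_right_mono) auto
    also have "\<dots> = \<eta> / 2"
    proof -
      have "z / (2 * q) * q = z / 2" if "q \<noteq> 0" for z q :: real using that by simp
      from this[of "D + 1"] show ?thesis using D(1) by simp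
    qed
    finally show ?thesis .
  qed
  obtain e1 where e1: "e1 > 0"
    "\<And>\<epsilon> x. \<lbrakk>0 < \<epsilon>; \<epsilon> < e1; x \<in> \<Omega>\<rbrakk> \<Longrightarrow> U \<epsilon> x \<le> M * exp (- ((1 - \<delta>) * d x - \<delta>) / \<epsilon>)"
    using U_upper[OF \<delta>(1,2)] by blast
  obtain e2 where e2: "e2 > 0" "\<And>\<epsilon>. 0 < \<epsilon> \<Longrightarrow> \<epsilon> < e2 \<Longrightarrow> exp (- (\<eta> / 2) / \<epsilon>) \<le> 1 / M"
    using exp_small[of "\<eta> / 2" "1 / M"] \<eta> M_pos by auto
  show ?thesis
  proof (intro exI[of _ "min e1 e2"] conjI ballI allI impI)
    fix x \<epsilon> assume x: "x \<in> K" and \<epsilon>: "0 < \<epsilon>" "\<epsilon> < min e1 e2"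
    have "U \<epsilon> x \<le> M * exp (- ((1 - \<delta>) * d x - \<delta>) / \<epsilon>)"
    proof (cases "x \<in> \<Omega>")
      case True
      then show ?thesis using e1(2)[of \<epsilon> x] \<epsilon> by simp
    next
      case False
      then have "d x = 0" using x K(2) d_boundary by blast
      moreover have "M * 1 \<le> M * exp (\<delta> / \<epsilon>)" using M_pos \<delta>(1) \<epsilon>(1) by (intro mult_left_mono) auto
      ultimately show ?thesis using U_le[OF \<epsilon>(1) K_closure[OF x]] by simp
    qed
    also have "\<dots> \<le> M * (exp (- (d x - \<eta>) / \<epsilon>) * exp (- (\<eta> / 2) / \<epsilon>))"
    proof -
      have "\<delta> * (d x + 1) \<le> \<delta> * (D + 1)" using D(2)[OF x] \<delta>(1) by (intro mult_left_mono) auto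
      then have "\<delta> * d x + \<delta> \<le> \<eta> / 2" using \<delta>D by (simp add: algebra_simps)
      then have "- ((1 - \<delta>) * d x - \<delta>) \<le> - (d x - \<eta>) + - (\<eta> / 2)" by (simp add: algebra_simps)
      then have "- ((1 - \<delta>) * d x - \<delta>) / \<epsilon> \<le> (- (d x - \<eta>) + - (\<eta> / 2)) / \<epsilon>"
        using \<epsilon>(1) by (intro divide_right_mono) auto
      then show ?thesis unfolding exp_add[symmetric] add_divide_distrib[symmetric] using M_pos by simp
    qed
    also have "\<dots> \<le> M * (exp (- (d x - \<eta>) / \<epsilon>) * (1 / M))"
      using e2(2)[of \<epsilon>] \<epsilon> M_pos by (intro mult_left_mono) auto
    also have "\<dots> = exp (- (d x - \<eta>) / \<epsilon>)" using M_pos by simp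
    finally show "U \<epsilon> x \<le> exp (- (d x - \<eta>) / \<epsilon>)" .
  qed (use e1 e2 in auto)
qed

lemma K_bounds:
  assumes "\<eta> > 0"
  obtains \<epsilon>0 where "\<epsilon>0 > 0"
    "\<And>\<epsilon> x. \<lbrakk>0 < \<epsilon>; \<epsilon> < \<epsilon>0; x \<in> K\<rbrakk> \<Longrightarrow> exp (- (d x + \<eta>) / \<epsilon>) \<le> U \<epsilon> x"
    "\<And>\<epsilon> x. \<lbrakk>0 < \<epsilon>; \<epsilon> < \<epsilon>0; x \<in> K\<rbrakk> \<Longrightarrow> U \<epsilon> x \<le> exp (- (d x - \<eta>) / \<epsilon>)"
proof -
  obtain e1 where e1: "e1 > 0" "\<forall>x\<in>K. \<forall>\<epsilon>. 0 < \<epsilon> \<longrightarrow> \<epsilon> < e1 \<longrightarrow> exp (- (d x + \<eta>) / \<epsilon>) \<le> U \<epsilon> x"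
    using K_lower[OF assms] by blast
  obtain e2 where e2: "e2 > 0" "\<forall>x\<in>K. \<forall>\<epsilon>. 0 < \<epsilon> \<longrightarrow> \<epsilon> < e2 \<longrightarrow> U \<epsilon> x \<le> exp (- (d x - \<eta>) / \<epsilon>)"
    using K_upper[OF assms] by blast
  show thesis by (rule that[of "min e1 e2"]) (use e1 e2 in auto)
qed

lemma elliptic_uniform_limit:
  "uniform_limit K (\<lambda>\<epsilon> x. - \<epsilon> * ln (U \<epsilon> x)) d (at_right 0)"
proof (rule uniform_limitI)
  fix e :: real assume "e > 0"
  then have e2: "e / 2 > 0" by simp
  obtain \<epsilon>0 where \<epsilon>0: "\<epsilon>0 > 0"
    "\<And>\<epsilon> x. \<lbrakk>0 < \<epsilon>; \<epsilon> < \<epsilon>0; x \<in> K\<rbrakk> \<Longrightarrow> exp (- (d x + e / 2) / \<epsilon>) \<le> U \<epsilon> x"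
    "\<And>\<epsilon> x. \<lbrakk>0 < \<epsilon>; \<epsilon> < \<epsilon>0; x \<in> K\<rbrakk> \<Longrightarrow> U \<epsilon> x \<le> exp (- (d x - e / 2) / \<epsilon>)"
    using K_bounds[OF e2] by blast
  show "\<forall>\<^sub>F \<epsilon> in at_right 0. \<forall>x\<in>K. dist (- \<epsilon> * ln (U \<epsilon> x)) (d x) < e"
  proof (rule eventually_at_rightI[of 0 \<epsilon>0])
    fix \<epsilon> assume "\<epsilon> \<in> {0<..<\<epsilon>0}"
    then have \<epsilon>: "0 < \<epsilon>" "\<epsilon> < \<epsilon>0" by auto
    show "\<forall>x\<in>K. dist (- \<epsilon> * ln (U \<epsilon> x)) (d x) < e"
    proof
      fix x assume x: "x \<in> K"
      from log_bounds[OF \<epsilon>(1) \<epsilon>0(2,3)[OF \<epsilon> x]]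
      show "dist (- \<epsilon> * ln (U \<epsilon> x)) (d x) < e" using \<open>e > 0\<close> by (simp add: dist_real_def)
    qed
  qed (rule \<epsilon>0(1))
qed

text \<open>A lower bound for \<open>u\<close>, obtained from \<open>u_lower_far\<close> at
  distances of at least \<open>\<delta>0\<close> and from \<open>u_lower_near\<close> below.
  Positivity of \<open>u\<close> is part of the conclusion since the logarithm is meaningful only
  there.\<close>

lemma K_parabolic_upper:
  assumes e: "e > 0"
  obtains t0 where "t0 > 0"
    "\<And>t x. \<lbrakk>0 < t; t < t0; x \<in> K; x \<in> \<Omega>\<rbrakk> \<Longrightarrow> u x t > 0 \<and> - 4 * t * ln (u x t) \<le> (d x)\<^sup>2 + e"
proof -
  obtain D where D: "D > 0" "\<And>x. x \<in> K \<Longrightarrow> d x \<le> D" using K_d_bounded by blast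
  \<comment> \<open>In the near case the bound is \<open>64 * (\<delta>0 * \<delta>0)\<close>, which
    is at most \<open>e / 4\<close>.\<close>
  define \<delta>0 where "\<delta>0 = min 1 (e / 256)"
  have \<delta>0: "0 < \<delta>0" "\<delta>0 \<le> 1" "256 * \<delta>0 \<le> e" using e by (auto simp: \<delta>0_def)
  \<comment> \<open>The lengthened time costs
    \<open>(d x)\<^sup>2 * (\<kappa> * (2 + \<kappa>))\<close>, which this choice keeps below
    \<open>e / 4\<close>; similarly the second bound in \<open>\<eta>\<close> keeps its contribution
    below \<open>e / 3\<close>.\<close>
  define \<kappa> where "\<kappa> = min (1/2) (e / (12 * (D\<^sup>2 + 1)))"
  have D2: "D\<^sup>2 + 1 > 0" by (simp add: add_nonneg_pos)
  have \<kappa>: "0 < \<kappa>" "\<kappa> \<le> 1/2" unfolding \<kappa>_def using e D2 min.cobounded1[of "1/2 :: real"] by (simp, blast)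
  have \<kappa>e: "\<kappa> * (12 * (D\<^sup>2 + 1)) \<le> e"
  proof -
    have "\<kappa> \<le> e / (12 * (D\<^sup>2 + 1))" by (simp add: \<kappa>_def)
    then show ?thesis using D2 by (subst (asm) pos_le_divide_eq) auto
  qed
  define \<eta> where "\<eta> = min (\<delta>0 * \<kappa>\<^sup>2 / 16) (min \<delta>0 (e / (12 * (D + 1))))"
  have \<eta>: "0 < \<eta>" "\<eta> \<le> \<delta>0 * \<kappa>\<^sup>2 / 16" "\<eta> \<le> \<delta>0"
    unfolding \<eta>_def by (simp_all only: min.cobounded1 min.cobounded2 min.coboundedI2 min_less_iff_conj)
       (use e D(1) \<delta>0(1) \<kappa>(1) in simp)
  have \<eta>e: "\<eta> * (12 * (D + 1)) \<le> e"
  proof -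
    have "\<eta> \<le> e / (12 * (D + 1))" by (simp add: \<eta>_def)
    then show ?thesis using D(1) by (subst (asm) pos_le_divide_eq) auto
  qed
  obtain e1 where e1: "e1 > 0"
    "\<And>\<epsilon> x. \<lbrakk>0 < \<epsilon>; \<epsilon> < e1; x \<in> K\<rbrakk> \<Longrightarrow> exp (- (d x + \<eta>) / \<epsilon>) \<le> U \<epsilon> x"
    "\<And>\<epsilon> x. \<lbrakk>0 < \<epsilon>; \<epsilon> < e1; x \<in> K\<rbrakk> \<Longrightarrow> U \<epsilon> x \<le> exp (- (d x - \<eta>) / \<epsilon>)"
    using K_bounds[OF \<eta>(1)] by blast
  have "\<delta>0 * \<kappa>\<^sup>2 / 8 > 0" using \<delta>0 \<kappa> by simp
  from exp_small[OF this, of "1/4"] obtain e2 where e2: "e2 > 0"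
    "\<And>\<epsilon>. 0 < \<epsilon> \<Longrightarrow> \<epsilon> < e2 \<Longrightarrow> exp (- (\<delta>0 * \<kappa>\<^sup>2 / 8) / \<epsilon>) \<le> 1/4" by auto
  have "4 * \<delta>0 > 0" using \<delta>0 by simp
  from exp_small[OF this, of "1 / (2 * M)"] M_pos obtain e3 where e3: "e3 > 0"
    "\<And>\<epsilon>. 0 < \<epsilon> \<Longrightarrow> \<epsilon> < e3 \<Longrightarrow> exp (- (4 * \<delta>0) / \<epsilon>) \<le> 1 / (2 * M)" by auto
  define \<epsilon>1 where "\<epsilon>1 = min e1 (min e2 e3)"
  have \<epsilon>1: "\<epsilon>1 > 0" "\<epsilon>1 \<le> e1" "\<epsilon>1 \<le> e2" "\<epsilon>1 \<le> e3" using e1(1) e2(1) e3(1) by (auto simp: \<epsilon>1_def)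
  \<comment> \<open>The first bound brings all parameters that occur below
    \<open>\<epsilon>1\<close>; in the far case twice \<open>\<epsilon>\<close> is below it, because
    \<open>\<epsilon> / (1 - \<kappa>)\<close> can be as large as that. The second controls the cost
    \<open>4 * t\<close> of the factor \<open>1/2\<close>.\<close>
  define t0 where "t0 = min (\<epsilon>1 * \<delta>0 / 4) (e / 16)"
  show thesis
  proof (rule that[of t0])
    show "t0 > 0" using \<epsilon>1(1) \<delta>0(1) e by (simp add: t0_def)
    fix t x assume t: "0 < t" "t < t0" and x: "x \<in> K" "x \<in> \<Omega>"
    have t4: "4 * t \<le> e / 4" and t\<epsilon>: "4 * t < \<epsilon>1 * \<delta>0" using t(2) by (auto simp: t0_def)
    have d0: "0 \<le> d x" "d x \<le> D" using d_nonneg[OF x(2)] D(2)[OF x(1)] by auto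
    show "u x t > 0 \<and> - 4 * t * ln (u x t) \<le> (d x)\<^sup>2 + e"
    proof (cases "\<delta>0 \<le> d x")
      case True
      then have dp: "d x > 0" using \<delta>0 by simp
      have k1: "1 - \<kappa> > 0" "1 + \<kappa> > 0" using \<kappa> by auto
      \<comment> \<open>Chosen so that the evaluation time of \<open>u_lower_far\<close> with
        \<open>y = d x\<close> is exactly \<open>t\<close>.\<close>
      define \<epsilon> where "\<epsilon> = 2 * t / (d x * (1 + \<kappa>))"
      have \<epsilon>: "\<epsilon> > 0" using t dp k1 by (simp add: \<epsilon>_def)
      have "\<delta>0 * 1 \<le> d x * (1 + \<kappa>)" using True \<kappa> \<delta>0 dp by (intro mult_mono) auto
      then have "\<epsilon>1 * \<delta>0 \<le> \<epsilon>1 * (d x * (1 + \<kappa>))" using \<epsilon>1(1) by (intro mult_left_mono) auto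
      then have "4 * t < \<epsilon>1 * (d x * (1 + \<kappa>))" using t\<epsilon> by linarith
      then have small: "2 * \<epsilon> < \<epsilon>1" using dp k1 by (simp add: \<epsilon>_def pos_divide_less_eq)
      have q1: "0 < \<epsilon> / (1 - \<kappa>)" "\<epsilon> / (1 - \<kappa>) < e1"
      proof -
        show "0 < \<epsilon> / (1 - \<kappa>)" using \<epsilon> k1 by simp
        have "\<epsilon> * 1 \<le> \<epsilon> * (2 * (1 - \<kappa>))" using \<epsilon> \<kappa> by (intro mult_left_mono) auto
        then have "\<epsilon> / (1 - \<kappa>) \<le> 2 * \<epsilon>" using k1 by (simp add: pos_divide_le_eq mult_ac)
        then show "\<epsilon> / (1 - \<kappa>) < e1" using small \<epsilon>1 by simp
      qed
      have q2: "0 < \<epsilon> / (1 + \<kappa>)" "\<epsilon> / (1 + \<kappa>) < e1"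
      proof -
        show "0 < \<epsilon> / (1 + \<kappa>)" using \<epsilon> k1 by simp
        have "\<epsilon> / (1 + \<kappa>) \<le> \<epsilon>" using \<epsilon> \<kappa> by (simp add: pos_divide_le_eq)
        then show "\<epsilon> / (1 + \<kappa>) < e1" using small \<epsilon>1 \<epsilon> by simp
      qed
      have tx: "\<epsilon> * d x * (1 + \<kappa>) / 2 = t" using dp k1 by (simp add: \<epsilon>_def)
      have "\<epsilon> < e1" "\<epsilon> < e2" using small \<epsilon>1 \<epsilon> by auto
      then have "exp (- (d x * (1 + \<kappa>) / 2 + \<eta>) / \<epsilon>) / 2 \<le> u x (\<epsilon> * d x * (1 + \<kappa>) / 2)"
        by (intro u_lower_far[OF x(2) \<epsilon> \<kappa> \<delta>0(1) True \<eta>(1,2)] e2(2) e1(2,3) \<epsilon> q1 q2 x(1))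
      note lb = log_lower_bound[OF t(1) this[unfolded tx]]
      have t\<epsilon>': "4 * t / \<epsilon> = 2 * (d x * (1 + \<kappa>))" using t dp k1 by (simp add: \<epsilon>_def)
      have eq: "4 * t / \<epsilon> * (d x * (1 + \<kappa>) / 2 + \<eta>) = (d x)\<^sup>2 + (d x)\<^sup>2 * (\<kappa> * (2 + \<kappa>)) + 2 * (\<eta> * (d x * (1 + \<kappa>)))"
        unfolding t\<epsilon>' by (simp add: power2_eq_square field_simps)
      have "(d x)\<^sup>2 * (\<kappa> * (2 + \<kappa>)) \<le> D\<^sup>2 * (\<kappa> * 3)"
        using d0 \<kappa> by (intro mult_mono power_mono) auto
      moreover have "\<kappa> * (12 * (D\<^sup>2 + 1)) = 4 * (D\<^sup>2 * (\<kappa> * 3)) + 12 * \<kappa>" by (simp add: algebra_simps)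
      moreover have "\<eta> * (d x * (1 + \<kappa>)) \<le> \<eta> * (D * 2)" using d0 \<kappa> \<eta> by (intro mult_left_mono mult_mono) auto
      moreover have "\<eta> * (12 * (D + 1)) = 6 * (\<eta> * (D * 2)) + 12 * \<eta>" by (simp add: algebra_simps)
      ultimately have "- 4 * t * ln (u x t) \<le> (d x)\<^sup>2 + e"
        using lb(2) eq t4 \<kappa>e \<eta>e \<kappa>(1) \<eta>(1) e by linarith
      then show ?thesis using lb(1) by blast
    next
      case False
      define \<epsilon> where "\<epsilon> = t / (8 * \<delta>0)"
      have \<epsilon>: "\<epsilon> > 0" using t \<delta>0 by (simp add: \<epsilon>_def)
      have "\<epsilon>1 * \<delta>0 > 0" using \<epsilon>1 \<delta>0 by simp
      then have "t < \<epsilon>1 * (8 * \<delta>0)" using t\<epsilon> t by linarith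
      then have small: "\<epsilon> < \<epsilon>1" using \<delta>0 by (simp add: \<epsilon>_def pos_divide_less_eq)
      have tx: "8 * \<delta>0 * \<epsilon> = t" using \<delta>0 by (simp add: \<epsilon>_def)
      have "- (2 * \<delta>0) / \<epsilon> \<le> - (d x + \<eta>) / \<epsilon>" using False \<eta>(3) \<epsilon> by (intro divide_right_mono) auto
      then have "exp (- (2 * \<delta>0) / \<epsilon>) \<le> exp (- (d x + \<eta>) / \<epsilon>)" by simp
      also have "\<dots> \<le> U \<epsilon> x" using small \<epsilon>1 \<epsilon> x by (intro e1(2)) auto
      finally have "exp (- (2 * \<delta>0) / \<epsilon>) / 2 \<le> u x (8 * \<delta>0 * \<epsilon>)"
        using small \<epsilon>1 by (intro u_lower_near[OF x(2) \<epsilon> \<delta>0(1)] e3(2) \<epsilon>) auto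
      note lb = log_lower_bound[OF t(1) this[unfolded tx]]
      have "4 * t / \<epsilon> * (2 * \<delta>0) = 64 * (\<delta>0 * \<delta>0)" using t \<delta>0 by (simp add: \<epsilon>_def)
      moreover have "\<delta>0 * \<delta>0 \<le> 1 * \<delta>0" using \<delta>0 by (intro mult_right_mono) auto
      moreover have "(d x)\<^sup>2 \<ge> 0" by simp
      ultimately have "- 4 * t * ln (u x t) \<le> (d x)\<^sup>2 + e"
        using lb(2) t4 \<delta>0(3) e by linarith
      then show ?thesis using lb(1) by blast
    qed
  qed
qed

text \<open>An upper bound for \<open>u\<close>. Where the squared distance exceeds
  \<open>e / 2\<close>, the optimal parameter tends to zero uniformly with \<open>t\<close>.
  Elsewhere it suffices that \<open>- 4 * t * ln (u x t)\<close> is not much below zero, which a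
  uniform bound on \<open>u\<close> provides.\<close>

lemma K_parabolic_lower:
  assumes e: "e > 0"
  obtains t0 where "t0 > 0"
    "\<And>t x. \<lbrakk>0 < t; t < t0; x \<in> K; x \<in> \<Omega>; u x t > 0\<rbrakk> \<Longrightarrow> (d x)\<^sup>2 - e \<le> - 4 * t * ln (u x t)"
proof -
  obtain D where D: "D > 0" "\<And>x. x \<in> K \<Longrightarrow> d x \<le> D" using K_d_bounded by blast
  define \<eta> where "\<eta> = e / (4 * (D + 1))"
  have \<eta>: "\<eta> > 0" using e D(1) by (simp add: \<eta>_def)
  have "\<eta> * (4 * (D + 1)) = e" using D(1) unfolding \<eta>_def by (intro nonzero_eq_divide_eq[THEN iffD1] refl) auto
  then have \<eta>D: "4 * (\<eta> * (D + 1)) = e" by (simp only: mult.left_commute)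
  obtain e1 where e1: "e1 > 0"
    "\<And>\<epsilon> x. \<lbrakk>0 < \<epsilon>; \<epsilon> < e1; x \<in> K\<rbrakk> \<Longrightarrow> exp (- (d x + \<eta>) / \<epsilon>) \<le> U \<epsilon> x"
    "\<And>\<epsilon> x. \<lbrakk>0 < \<epsilon>; \<epsilon> < e1; x \<in> K\<rbrakk> \<Longrightarrow> U \<epsilon> x \<le> exp (- (d x - \<eta>) / \<epsilon>)"
    using K_bounds[OF \<eta>] by blast
  have l0: "1 + \<bar>ln M\<bar> > 0" by (simp add: add_pos_nonneg)
  define t0 where "t0 = min (e1 * sqrt (e / 2) / 2) (e / (8 * (1 + \<bar>ln M\<bar>)))"
  show thesis
  proof (rule that[of t0])
    show "t0 > 0" using e1(1) e l0 by (simp add: t0_def)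
    fix t x assume t: "0 < t" "t < t0" and x: "x \<in> K" "x \<in> \<Omega>" and u0: "u x t > 0"
    show "(d x)\<^sup>2 - e \<le> - 4 * t * ln (u x t)"
    proof (cases "e / 2 < (d x)\<^sup>2")
      case True
      have d0: "0 \<le> d x" "d x \<le> D" using d_nonneg[OF x(2)] D(2)[OF x(1)] by auto
      have sq: "sqrt (e / 2) \<le> d x" by (rule real_le_lsqrt[OF d0(1) less_imp_le[OF True]])
      have "0 < sqrt (e / 2)" using e by simp
      then have dp: "d x > 0" using sq by linarith
      define \<epsilon> where "\<epsilon> = 2 * t / d x"
      have \<epsilon>: "\<epsilon> > 0" using t dp by (simp add: \<epsilon>_def)
      have "2 * t < e1 * sqrt (e / 2)" using t(2) by (simp add: t0_def)
      also have "\<dots> \<le> e1 * d x" using sq e1 by (intro mult_left_mono) auto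
      finally have \<epsilon>e: "\<epsilon> < e1" using dp by (simp add: \<epsilon>_def pos_divide_less_eq)
      have "u x t \<le> exp (t / \<epsilon>\<^sup>2) * U \<epsilon> x" by (rule u_le_exp_U[OF \<epsilon> x(2) t(1)])
      also have "\<dots> \<le> exp (t / \<epsilon>\<^sup>2) * exp (- (d x - \<eta>) / \<epsilon>)"
        by (intro mult_left_mono e1(3) \<epsilon> \<epsilon>e x) simp
      also have "\<dots> = exp (t / \<epsilon>\<^sup>2 + - (d x - \<eta>) / \<epsilon>)" by (simp only: exp_add)
      finally have "ln (u x t) \<le> t / \<epsilon>\<^sup>2 + - (d x - \<eta>) / \<epsilon>"
        using u0 by (metis ln_exp ln_mono)
      then have "(4 * t) * ln (u x t) \<le> (4 * t) * (t / \<epsilon>\<^sup>2 + - (d x - \<eta>) / \<epsilon>)"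
        using t by (intro mult_left_mono) auto
      also have "\<dots> = - (d x)\<^sup>2 + 2 * (\<eta> * d x)"
        using t dp by (simp add: \<epsilon>_def field_simps power2_eq_square)
      finally have "(d x)\<^sup>2 - 2 * (\<eta> * d x) \<le> - 4 * t * ln (u x t)" by simp
      moreover have "\<eta> * d x \<le> \<eta> * (D + 1)" using d0 \<eta> by (intro mult_left_mono) auto
      ultimately show ?thesis using \<eta>D e by linarith
    next
      case False
      \<comment> \<open>With \<open>\<epsilon> = sqrt t\<close> the exponential factor is the
        constant \<open>exp 1\<close>, so \<open>u\<close> is at most
        \<open>exp 1 * M\<close>.\<close>
      have st: "sqrt t > 0" using t by simp
      have "u x t \<le> exp (t / (sqrt t)\<^sup>2) * U (sqrt t) x" by (rule u_le_exp_U[OF st x(2) t(1)])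
      also have "\<dots> \<le> exp 1 * M"
        using t U_le[OF st] U_nonneg[OF st] x(2) closure_subset by (intro mult_mono) auto
      finally have "ln (u x t) \<le> ln (exp 1 * M)" using u0 M_pos by (subst ln_le_cancel_iff) auto
      also have "\<dots> = 1 + ln M" using M_pos by (simp add: ln_mult)
      also have "\<dots> \<le> 1 + \<bar>ln M\<bar>" by simp
      finally have "t * ln (u x t) \<le> t * (1 + \<bar>ln M\<bar>)" using t by (intro mult_left_mono) auto
      moreover have "t * (8 * (1 + \<bar>ln M\<bar>)) < e"
      proof -
        have "t < e / (8 * (1 + \<bar>ln M\<bar>))" using t(2) by (simp add: t0_def)
        then show ?thesis using l0 by (subst (asm) pos_less_divide_eq) auto
      qed
      then have "8 * (t * (1 + \<bar>ln M\<bar>)) < e" by (simp only: mult.left_commute)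
      ultimately have "4 * (t * ln (u x t)) \<le> e / 2" by linarith
      then show ?thesis using False by simp
    qed
  qed
qed

text \<open>On \<open>S\<close> the solution is \<open>f\<close> for all positive times, so only a
  uniform bound on the logarithm of \<open>f\<close> over the points of \<open>K\<close> outside the
  domain is required. The elliptic estimates at one fixed parameter give it, because
  \<open>U \<epsilon>\<close> has the same boundary values and the distance is zero there.\<close>

lemma K_parabolic_boundary:
  assumes e: "e > 0"
  obtains t0 where "t0 > 0"
    "\<And>t x. \<lbrakk>0 < t; t < t0; x \<in> K; x \<notin> \<Omega>\<rbrakk> \<Longrightarrow> \<bar>- 4 * t * ln (u x t)\<bar> \<le> e"
proof -
  obtain e1 where e1: "e1 > 0"
    "\<And>\<epsilon> x. \<lbrakk>0 < \<epsilon>; \<epsilon> < e1; x \<in> K\<rbrakk> \<Longrightarrow> exp (- (d x + 1) / \<epsilon>) \<le> U \<epsilon> x"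
    "\<And>\<epsilon> x. \<lbrakk>0 < \<epsilon>; \<epsilon> < e1; x \<in> K\<rbrakk> \<Longrightarrow> U \<epsilon> x \<le> exp (- (d x - 1) / \<epsilon>)"
    using K_bounds[OF zero_less_one] by blast
  define \<epsilon> where "\<epsilon> = e1 / 2"
  have \<epsilon>: "0 < \<epsilon>" "\<epsilon> < e1" using e1(1) by (auto simp: \<epsilon>_def)
  show thesis
  proof (rule that[of "\<epsilon> * e / 4"])
    show "\<epsilon> * e / 4 > 0" using \<epsilon> e by simp
    fix t x assume t: "0 < t" "t < \<epsilon> * e / 4" and x: "x \<in> K" "x \<notin> \<Omega>"
    then have xS: "x \<in> S" using K(2) by blast
    then have "x \<in> frontier \<Omega>" using S_subset by blast
    then have "U \<epsilon> x = u x t" using U_boundary[OF \<epsilon>(1)] u_boundary[OF _ t(1)] by simp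
    then have "\<bar>- \<epsilon> * ln (u x t) - d x\<bar> \<le> 1" using log_bounds[OF \<epsilon>(1) e1(2,3)[OF \<epsilon> x(1)]] by simp
    then have "\<bar>\<epsilon> * ln (u x t)\<bar> \<le> 1" using d_boundary[OF xS] by simp
    then have "\<epsilon> * \<bar>ln (u x t)\<bar> \<le> 1" using \<epsilon>(1) by (simp add: abs_mult)
    then have "e * (\<epsilon> * \<bar>ln (u x t)\<bar>) \<le> e * 1" using e by (intro mult_left_mono) auto
    moreover have "(4 * t) * \<bar>ln (u x t)\<bar> \<le> (\<epsilon> * e) * \<bar>ln (u x t)\<bar>" using t by (intro mult_right_mono) auto
    moreover have "\<bar>- 4 * t * ln (u x t)\<bar> = (4 * t) * \<bar>ln (u x t)\<bar>" using t by (simp add: abs_mult)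
    ultimately show "\<bar>- 4 * t * ln (u x t)\<bar> \<le> e" by (simp add: mult_ac)
  qed
qed

lemma parabolic_uniform_limit:
  "uniform_limit K (\<lambda>t x. - 4 * t * ln (u x t)) (\<lambda>x. (d x)\<^sup>2) (at_right 0)"
proof (rule uniform_limitI)
  fix e :: real assume "e > 0"
  then have e: "e / 2 > 0" by simp
  obtain t1 where t1: "t1 > 0" "\<And>t x. \<lbrakk>0 < t; t < t1; x \<in> K; x \<in> \<Omega>\<rbrakk> \<Longrightarrow>
      u x t > 0 \<and> - 4 * t * ln (u x t) \<le> (d x)\<^sup>2 + e / 2" using K_parabolic_upper[OF e] by blast
  obtain t2 where t2: "t2 > 0" "\<And>t x. \<lbrakk>0 < t; t < t2; x \<in> K; x \<in> \<Omega>; u x t > 0\<rbrakk> \<Longrightarrow>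
      (d x)\<^sup>2 - e / 2 \<le> - 4 * t * ln (u x t)" using K_parabolic_lower[OF e] by blast
  obtain t3 where t3: "t3 > 0" "\<And>t x. \<lbrakk>0 < t; t < t3; x \<in> K; x \<notin> \<Omega>\<rbrakk> \<Longrightarrow>
      \<bar>- 4 * t * ln (u x t)\<bar> \<le> e / 2" using K_parabolic_boundary[OF e] by blast
  show "\<forall>\<^sub>F t in at_right 0. \<forall>x\<in>K. dist (- 4 * t * ln (u x t)) ((d x)\<^sup>2) < e"
  proof (rule eventually_at_rightI[of 0 "min t1 (min t2 t3)"])
    fix t assume "t \<in> {0<..<min t1 (min t2 t3)}"
    then have t: "0 < t" "t < t1" "t < t2" "t < t3" by auto
    show "\<forall>x\<in>K. dist (- 4 * t * ln (u x t)) ((d x)\<^sup>2) < e"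
    proof
      fix x assume x: "x \<in> K"
      show "dist (- 4 * t * ln (u x t)) ((d x)\<^sup>2) < e"
      proof (cases "x \<in> \<Omega>")
        case True
        note a = t1(2)[OF t(1,2) x True]
        note b = t2(2)[OF t(1,3) x True conjunct1[OF a]]
        show ?thesis unfolding dist_real_def using conjunct2[OF a] b e by linarith
      next
        case False
        then have "d x = 0" using x K(2) d_boundary by blast
        then show ?thesis unfolding dist_real_def using t3(2)[OF t(1,4) x False] e by simp
      qed
    qed
  qed (use t1 t2 t3 in auto)
qed

end

end

theorem theorem1p1:
  fixes \<Omega> :: "(real^'n) set"
    and A :: "real^'n \<Rightarrow> real^'n^'n"
    and f :: "real^'n \<Rightarrow> real"
    and u :: "real^'n \<Rightarrow> real \<Rightarrow> real"
    and U :: "real \<Rightarrow> real^'n \<Rightarrow> real"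
    and S :: "(real^'n) set"
  assumes "CARD('n) \<ge> 2"
    and "bounded_domain \<Omega>"
    and "C11_boundary \<Omega>"
    and "\<And>x. transpose (A x) = A x"
    and "coefficients_locally_bounded A"
    and "uniformly_elliptic A"
    and "continuous_on (frontier \<Omega>) f"
    and "\<And>x. x \<in> frontier \<Omega> \<Longrightarrow> f x \<ge> 0"
    and "\<exists>x \<in> frontier \<Omega>. f x \<noteq> 0"
    and S_def: "S = {x \<in> frontier \<Omega>. f x > 0}"
    and "parabolic_solution A \<Omega> f u"
    and "\<And>\<epsilon>. \<epsilon> > 0 \<Longrightarrow> elliptic_solution A \<Omega> f \<epsilon> (U \<epsilon>)"
  shows "(\<forall>x \<in> \<Omega> \<union> S.
            ((\<lambda>t. - 4 * t * ln (u x t)) \<longlongrightarrow> (dist_S A \<Omega> S x)\<^sup>2) (at_right 0) \<and>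
            ((\<lambda>\<epsilon>. - \<epsilon> * ln (U \<epsilon> x)) \<longlongrightarrow> dist_S A \<Omega> S x) (at_right 0)) \<and>
         (\<forall>K. compact K \<and> K \<subseteq> \<Omega> \<union> S \<longrightarrow>
            uniform_limit K (\<lambda>t x. - 4 * t * ln (u x t)) (\<lambda>x. (dist_S A \<Omega> S x)\<^sup>2) (at_right 0) \<and>
            uniform_limit K (\<lambda>\<epsilon> x. - \<epsilon> * ln (U \<epsilon> x)) (\<lambda>x. dist_S A \<Omega> S x) (at_right 0))"
proof -
  have dom: "open \<Omega>" "connected \<Omega>" "bounded \<Omega>"
    using assms(2) unfolding bounded_domain_def by auto
  obtain c where c: "c > 0" "\<And>x \<xi>. (A x *v \<xi>) \<bullet> \<xi> \<ge> c * (norm \<xi>)\<^sup>2"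
    using assms(6) unfolding uniformly_elliptic_def by blast
  obtain r where r: "\<forall>x\<in>closure \<Omega>. norm x \<le> r"
    using bounded_closure[OF dom(3)] unfolding bounded_iff by blast
  define R where "R = r + 1"
  have R: "closure \<Omega> \<subseteq> ball 0 R" using r by (force simp: R_def)
  have Adiff: "\<forall>x. A differentiable (at x)"
    using assms(5) unfolding coefficients_locally_bounded_def by (rule conjunct1)
  have Acomp: "\<exists>L>0. \<forall>x\<in>K. norm (A x) \<le> L" if "compact K" for K
  proof -
    have "\<exists>L>0. \<forall>x\<in>K. norm (A x) \<le> L \<and> onorm (frechet_derivative A (at x)) \<le> L"
      using assms(5) that unfolding coefficients_locally_bounded_def by simp
    then show ?thesis by (elim exE conjE) (intro exI conjI ballI, assumption, simp)
  qed
  have Acont: "continuous_on UNIV A"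
    using Adiff by (intro differentiable_imp_continuous_on) (simp add: differentiable_on_def)
  obtain \<Lambda> where \<Lambda>: "\<Lambda> > 0" "\<And>x. x \<in> cball 0 R \<Longrightarrow> norm (A x) \<le> \<Lambda>"
    using Acomp[OF compact_cball] by blast
  interpret elliptic_setting \<Omega> A c \<Lambda> R
  proof
    show "transpose (A x) = A x" for x by (rule assms(4))
    show "c * (norm \<xi>)\<^sup>2 \<le> (A x *v \<xi>) \<bullet> \<xi>" for x \<xi> by (rule c(2))
    show "norm (A x) \<le> \<Lambda>" if "x \<in> cball 0 R" for x by (rule \<Lambda>(2)[OF that])
  qed (rule dom(1) R Acont c(1) \<Lambda>(1))+
  have "compact (frontier \<Omega>)" by (rule compact_frontier_bounded[OF dom(3)])
  then have "bounded (f ` frontier \<Omega>)"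
    by (intro compact_imp_bounded compact_continuous_image assms(7))
  then obtain B where B: "\<forall>z\<in>f ` frontier \<Omega>. norm z \<le> B" unfolding bounded_iff by blast
  have S: "S \<noteq> {}" using assms(8,9) unfolding S_def by force
  \<comment> \<open>The maximum with \<open>1\<close> makes the bound of the data positive, since
    logarithms and reciprocals of it are taken.\<close>
  interpret dirichlet_problem \<Omega> A c \<Lambda> R f S u U "max B 1"
  proof unfold_locales
    show "f z \<le> max B 1" if "z \<in> frontier \<Omega>" for z
      using B that by fastforce
    show "dirichlet_solution f \<epsilon> (U \<epsilon>)" "continuous_on \<Omega> (hessian (U \<epsilon>))" if "\<epsilon> > 0" for \<epsilon>
      using assms(12)[OF that] that
      unfolding elliptic_solution_def dirichlet_solution_def resolvent_solution_def C2_on_def by auto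
    show "caloric u" by (rule caloric_parabolic_solution[OF assms(11)])
    show "u x 0 = 0" if "x \<in> \<Omega>" for x using assms(11) that unfolding parabolic_solution_def by blast
    show "u x t = f x" if "x \<in> frontier \<Omega>" "t > 0" for x t
      using assms(11) that unfolding parabolic_solution_def by blast
  qed (use dom(2) S_def S in \<open>auto intro: assms(3,7,8)\<close>)
  have *: "uniform_limit K (\<lambda>t x. - 4 * t * ln (u x t)) (\<lambda>x. (dist_S A \<Omega> S x)\<^sup>2) (at_right 0)"
    "uniform_limit K (\<lambda>\<epsilon> x. - \<epsilon> * ln (U \<epsilon> x)) (\<lambda>x. dist_S A \<Omega> S x) (at_right 0)"
    if "compact K" "K \<subseteq> \<Omega> \<union> S" for K
    by (rule parabolic_uniform_limit[OF that], rule elliptic_uniform_limit[OF that])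
  show ?thesis
  proof (intro conjI ballI allI impI)
    fix x assume "x \<in> \<Omega> \<union> S"
    then have x: "compact {x}" "{x} \<subseteq> \<Omega> \<union> S" by auto
    show "((\<lambda>t. - 4 * t * ln (u x t)) \<longlongrightarrow> (dist_S A \<Omega> S x)\<^sup>2) (at_right 0)"
      by (rule tendsto_uniform_limitI[OF *(1)[OF x]]) simp
    show "((\<lambda>\<epsilon>. - \<epsilon> * ln (U \<epsilon> x)) \<longlongrightarrow> dist_S A \<Omega> S x) (at_right 0)"
      by (rule tendsto_uniform_limitI[OF *(2)[OF x]]) simp
  qed (use * in blast)+
qed

end
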